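(* For every $p\in[1,\infty]$ there exist non-negative real constants $E_1(p)$ and $E_2(p)$, depending only on $p$, such that the following holds. Let $K\subset\mathbb{R}^2$ be an arbitrary triangle with circumradius $R$, and put $$M_p:=\bigl(E_1(p)^p+E_2(p)^pR^p\bigr)^{1/p}\ \ (1\le p<\infty),\qquad M_\infty:=\max\{E_1(\infty),\,E_2(\infty)R\}.$$ Then $$\|w-I_hw\|_{1,p,K}\le M_p\,R\,|w|_{2,p,K}\qquad\text{for all } w\in W^{2,p}(K).$$
   Context: A triangle $K\subset\mathbb{R}^2$ is nondegenerate, and its circumradius is the radius of its circumscribed circle. $W^{k,p}(K)$ are the usual Sobolev spaces; $W^{2,p}(K)\subset C(\overline K)$ for every $p\in[1,\infty]$, so values of $W^{2,p}$ functions at the apexes are well defined. For $w\in W^{2,p}(K)$, $I_hw$ denotes the unique polynomial of degree at most $1$ with $(I_hw)(\mathbf{x}_i)=w(\mathbf{x}_i)$ at the three apexes $\mathbf{x}_1,\mathbf{x}_2,\mathbf{x}_3$ of $K$. Norms and semi-norms: $|u|_{0,p,K}=\|u\|_{L^p(K)}$. For $1\le p<\infty$: $|u|_{1,p,K}^p=|u_x|_{0,p,K}^p+|u_y|_{0,p,K}^p$, $\|u\|_{1,p,K}^p=|u|_{0,p,K}^p+|u|_{1,p,K}^p$, $|u|_{2,p,K}^p=|u_{xx}|_{0,p,K}^p+|u_{yy}|_{0,p,K}^p+2|u_{xy}|_{0,p,K}^p$. For $p=\infty$: $|u|_{1,\infty,K}=\max\{|u_x|_{0,\infty,K},|u_y|_{0,\infty,K}\}$,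 $\|u\|_{1,\infty,K}=\max\{|u|_{0,\infty,K},|u|_{1,\infty,K}\}$, $|u|_{2,\infty,K}=\max\{|u_{xx}|_{0,\infty,K},|u_{yy}|_{0,\infty,K},|u_{xy}|_{0,\infty,K}\}$. *)

theory Defs
  imports "HOL-Analysis.Analysis" "HOL-Probability.Essential_Supremum"
begin

definition mem_Lp :: "ennreal \<Rightarrow> (real^'n) set \<Rightarrow> (real^'n \<Rightarrow> real) \<Rightarrow> bool" where
  "mem_Lp p \<Omega> u \<longleftrightarrow> u \<in> borel_measurable (lebesgue_on \<Omega>) \<and>
     (if p = \<infinity> then \<exists>C. AE x in lebesgue_on \<Omega>. \<bar>u x\<bar> \<le> C
      else integrable (lebesgue_on \<Omega>) (\<lambda>x. \<bar>u x\<bar> powr enn2real p))"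

text \<open>The value is meaningful only for functions satisfying \<^const>\<open>mem_Lp\<close>.\<close>

definition Lp_norm :: "ennreal \<Rightarrow> (real^'n) set \<Rightarrow> (real^'n \<Rightarrow> real) \<Rightarrow> real" where
  "Lp_norm p \<Omega> u =
     (if p = \<infinity> then real_of_ereal (esssup (lebesgue_on \<Omega>) (\<lambda>x. ereal \<bar>u x\<bar>))
      else (integral\<^sup>L (lebesgue_on \<Omega>) (\<lambda>x. \<bar>u x\<bar> powr enn2real p)) powr (1 / enn2real p))"

definition partial_deriv :: "'n \<Rightarrow> (real^'n \<Rightarrow> real) \<Rightarrow> (real^'n \<Rightarrow> real)" where
  "partial_deriv i f = (\<lambda>x. frechet_derivative f (at x) (axis i 1))"

text \<open>Multi-indices are lists of coordinate directions: \<open>[i, j]\<close> stands for the second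
  derivative in the directions \<open>i\<close> and \<open>j\<close>, and the order is the length of the list.\<close>

definition partial_derivs :: "'n list \<Rightarrow> (real^'n \<Rightarrow> real) \<Rightarrow> (real^'n \<Rightarrow> real)" where
  "partial_derivs \<alpha> f = foldr partial_deriv \<alpha> f"

text \<open>Total differentiability of all iterated partial derivatives amounts to being \<open>C\<close>-infinity.\<close>

definition test_function :: "(real^'n) set \<Rightarrow> (real^'n \<Rightarrow> real) \<Rightarrow> bool" where
  "test_function \<Omega> \<phi> \<longleftrightarrow>
     (\<forall>\<alpha>. partial_derivs \<alpha> \<phi> differentiable_on UNIV) \<and>
     compact (closure {x. \<phi> x \<noteq> 0}) \<and> closure {x. \<phi> x \<noteq> 0} \<subseteq> \<Omega>"

definition locally_integrable :: "(real^'n) set \<Rightarrow> (real^'n \<Rightarrow> real) \<Rightarrow> bool" where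
  "locally_integrable \<Omega> u \<longleftrightarrow> (\<forall>C. compact C \<and> C \<subseteq> \<Omega> \<longrightarrow> integrable (lebesgue_on C) u)"

definition has_weak_deriv ::
    "(real^'n) set \<Rightarrow> 'n list \<Rightarrow> (real^'n \<Rightarrow> real) \<Rightarrow> (real^'n \<Rightarrow> real) \<Rightarrow> bool" where
  "has_weak_deriv \<Omega> \<alpha> u v \<longleftrightarrow> locally_integrable \<Omega> u \<and> locally_integrable \<Omega> v \<and>
     (\<forall>\<phi>. test_function \<Omega> \<phi> \<longrightarrow>
        integral\<^sup>L (lebesgue_on \<Omega>) (\<lambda>x. u x * partial_derivs \<alpha> \<phi> x) =
        (- 1) ^ length \<alpha> * integral\<^sup>L (lebesgue_on \<Omega>) (\<lambda>x. v x * \<phi> x))"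

text \<open>On open sets weak derivatives are unique up to null sets, so the choice of representative
  does not affect norms.\<close>

definition weak_deriv :: "(real^'n) set \<Rightarrow> 'n list \<Rightarrow> (real^'n \<Rightarrow> real) \<Rightarrow> (real^'n \<Rightarrow> real)" where
  "weak_deriv \<Omega> \<alpha> u = (SOME v. has_weak_deriv \<Omega> \<alpha> u v)"

definition sobolev :: "nat \<Rightarrow> ennreal \<Rightarrow> (real^'n) set \<Rightarrow> (real^'n \<Rightarrow> real) set" where
  "sobolev k p \<Omega> = {u. mem_Lp p \<Omega> u \<and>
     (\<forall>\<alpha>. length \<alpha> \<le> k \<longrightarrow> (\<exists>v. has_weak_deriv \<Omega> \<alpha> u v \<and> mem_Lp p \<Omega> v))}"

definition seminorm1 :: "ennreal \<Rightarrow> (real^2) set \<Rightarrow> (real^2 \<Rightarrow> real) \<Rightarrow> real" where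
  "seminorm1 p \<Omega> u =
     (let ux = Lp_norm p \<Omega> (weak_deriv \<Omega> [1] u);
          uy = Lp_norm p \<Omega> (weak_deriv \<Omega> [2] u);
          q = enn2real p
      in if p = \<infinity> then max ux uy else (ux powr q + uy powr q) powr (1 / q))"

definition norm1 :: "ennreal \<Rightarrow> (real^2) set \<Rightarrow> (real^2 \<Rightarrow> real) \<Rightarrow> real" where
  "norm1 p \<Omega> u =
     (let q = enn2real p
      in if p = \<infinity> then max (Lp_norm p \<Omega> u) (seminorm1 p \<Omega> u)
         else (Lp_norm p \<Omega> u powr q + seminorm1 p \<Omega> u powr q) powr (1 / q))"

definition seminorm2 :: "ennreal \<Rightarrow> (real^2) set \<Rightarrow> (real^2 \<Rightarrow> real) \<Rightarrow> real" where
  "seminorm2 p \<Omega> u =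
     (let uxx = Lp_norm p \<Omega> (weak_deriv \<Omega> [1, 1] u);
          uyy = Lp_norm p \<Omega> (weak_deriv \<Omega> [2, 2] u);
          uxy = Lp_norm p \<Omega> (weak_deriv \<Omega> [1, 2] u);
          q = enn2real p
      in if p = \<infinity> then max uxx (max uyy uxy)
         else (uxx powr q + uyy powr q + 2 * uxy powr q) powr (1 / q))"

definition open_triangle :: "real^2 \<Rightarrow> real^2 \<Rightarrow> real^2 \<Rightarrow> (real^2) set" where
  "open_triangle x1 x2 x3 = interior (convex hull {x1, x2, x3})"

definition circumradius :: "real^2 \<Rightarrow> real^2 \<Rightarrow> real^2 \<Rightarrow> real" where
  "circumradius x1 x2 x3 = (THE R. \<exists>c. dist c x1 = R \<and> dist c x2 = R \<and> dist c x3 = R)"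

text \<open>Elements of \<^const>\<open>sobolev\<close> are arbitrary representatives of their classes modulo null sets.
  Point values are those of the representative that is continuous up to the boundary; it
  exists in \<open>W\<^sup>2\<^sup>,\<^sup>p\<close> of a triangle by Sobolev's embedding and is unique on the closure.\<close>

definition continuous_rep :: "(real^2) set \<Rightarrow> (real^2 \<Rightarrow> real) \<Rightarrow> (real^2 \<Rightarrow> real)" where
  "continuous_rep \<Omega> w =
     (SOME v. continuous_on (closure \<Omega>) v \<and> (AE x in lebesgue_on \<Omega>. v x = w x))"

definition poly_degree_le_1 :: "(real^2 \<Rightarrow> real) \<Rightarrow> bool" where
  "poly_degree_le_1 q \<longleftrightarrow> (\<exists>a b c. \<forall>x. q x = a + b * x$1 + c * x$2)"

definition interpolant ::
    "real^2 \<Rightarrow> real^2 \<Rightarrow> real^2 \<Rightarrow> (real^2 \<Rightarrow> real) \<Rightarrow> (real^2 \<Rightarrow> real)" where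
  "interpolant x1 x2 x3 w =
     (THE q. poly_degree_le_1 q \<and>
        (\<forall>x \<in> {x1, x2, x3}. q x = continuous_rep (open_triangle x1 x2 x3) w x))"

end

theory Submission
  imports Defs "HOL-Probability.Probability_Measure"
begin

text \<open>
  The interpolation error \<open>u = w - I\<^sub>h w\<close> vanishes at the three vertices and has the same second
  derivatives as \<open>w\<close>. So the theorem bounds a function that vanishes at the vertices, and its gradient,
  by its second derivatives, and the point is that the shape of the triangle enters only through
  the circumradius.

  Along a side with direction \<open>e\<close> the derivative \<open>D\<^sub>e u\<close> has mean value zero, because \<open>u\<close> takes the same
  value at both ends. Therefore \<open>D\<^sub>e u\<close> at an arbitrary point is an average of differences of values
  of \<open>D\<^sub>e u\<close>, which are integrals of \<open>D\<^sub>v D\<^sub>e u\<close> along segments whose directions \<open>v\<close> are again sides of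
  the triangle. In affine coordinates this is a statement about one fixed reference triangle
  (\<open>edge_bound\<close>, and \<open>line_sum_power_bound\<close> for its \<open>L\<^sup>q\<close> form with a constant independent of \<open>q\<close>), and
  \<open>D\<^sub>v D\<^sub>e u\<close> is at most \<open>norm e * h\<close> times the second derivatives, where \<open>h\<close> is the longest side.

  The gradient is recovered from its components along two sides \<open>e\<close>, \<open>e'\<close> by Cramer's rule, which costs
  a factor \<open>norm e * norm e' / det\<close>. If \<open>e\<close> and \<open>e'\<close> are the two shorter sides, the total factor is
  \<open>norm e * norm e' * h / det = 2 * R\<close> (\<open>circumscribed_radius\<close>). This gives the gradient bound with a
  multiple of \<open>R\<close> (\<open>gradient_estimates\<close>). Integrating from a vertex bounds \<open>u\<close> itself by a multiple of
  \<open>h\<^sup>2\<close>, and \<open>h \<le> 2 * R\<close> (\<open>function_estimates\<close>).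

  These estimates are proved for \<open>C\<^sup>2\<close> functions. A Sobolev function is contracted towards an interior
  point and then mollified with kernels that stay inside the triangle; the resulting functions are
  smooth up to the boundary, converge together with their derivatives in \<open>L\<^sup>1\<close>, and their second
  derivatives have \<open>L\<^sup>p\<close> norms no larger than those of \<open>w\<close> (\<open>smooth_approximation_exists\<close>). Since the
  oscillation of a smooth function over the triangle is bounded by \<open>L\<^sup>1\<close> norms of its first and second
  derivatives (\<open>oscillation_bound\<close>), the approximations converge uniformly on the closed triangle. Their
  limit is the continuous representative of \<open>w\<close>, so their interpolants converge to the interpolant of \<open>w\<close>,
  and the estimates survive in the limit by Fatou's lemma or, for \<open>p = \<infinity>\<close>, pointwise
  (\<open>limit_estimates_Lq\<close>, \<open>limit_estimates_sup\<close>). The constants 1152 and 5328 serve for every \<open>p\<close>.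
\<close>

section \<open>Jensen's inequality for powers\<close>

lemma powr_above_tangent:
  fixes a y q :: real
  assumes "0 < a" "0 \<le> y" "1 \<le> q"
  shows "a powr q + q * a powr (q - 1) * (y - a) \<le> y powr q"
proof (cases "y = 0")
  case True
  have "a powr (q - 1) * a = a powr q" using assms by (simp add: powr_diff)
  then have "a powr q + q * a powr (q - 1) * (y - a) = (1 - q) * a powr q"
    using True by (simp add: algebra_simps)
  also have "\<dots> \<le> 0" using assms by (intro mult_nonpos_nonneg) auto
  finally show ?thesis using True assms by simp
next
  case False
  have "((\<lambda>x. x powr q) has_real_derivative q * a powr (q - 1)) (at a)"
    using assms by (intro has_real_derivative_powr) auto
  then have "q * a powr (q - 1) * (y - a) \<le> y powr q - a powr q"
    using convex_on_imp_above_tangent[OF powr_convex[OF assms(3)] _ _ _ has_field_derivative_at_within, of a y] assms False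
    by (auto simp: interior_open)
  then show ?thesis by simp
qed

text \<open>
  Integrate the tangent inequality at the mean value \<open>a\<close>; its linear part
  integrates to zero.
\<close>

lemma (in prob_space) nn_integral_jensen_powr:
  assumes f [measurable]: "f \<in> borel_measurable M" and f0: "\<And>x. 0 \<le> f x" and q: "1 \<le> q"
    and a: "(\<integral>\<^sup>+x. ennreal (f x) \<partial>M) = ennreal a" "0 \<le> a"
  shows "ennreal (a powr q) \<le> (\<integral>\<^sup>+x. ennreal (f x powr q) \<partial>M)"
proof (cases "a = 0 \<or> (\<integral>\<^sup>+x. ennreal (f x powr q) \<partial>M) = \<infinity>")
  case False
  then have pos: "0 < a" and fin: "(\<integral>\<^sup>+x. ennreal (f x powr q) \<partial>M) < \<infinity>" using a by (auto simp: top.not_eq_extremum)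
  have 1: "integrable M f" "(\<integral>x. f x \<partial>M) = a"
    using a f0 by (auto intro!: integrableI_nonneg simp: integral_eq_nn_integral)
  have 2: "integrable M (\<lambda>x. f x powr q)" using fin by (intro integrableI_nonneg) auto
  have "a powr q = (\<integral>x. a powr q + q * a powr (q - 1) * (f x - a) \<partial>M)"
    using 1 by (simp add: prob_space)
  also have "\<dots> \<le> (\<integral>x. f x powr q \<partial>M)"
    using 1 2 pos q f0 by (intro integral_mono powr_above_tangent) auto
  finally show ?thesis using 2 by (subst nn_integral_eq_integral) (auto intro!: ennreal_leI)
qed (use q in \<open>auto simp: top_unique\<close>)

lemma ennreal_triangle: "ennreal \<bar>x - z\<bar> \<le> ennreal \<bar>x - y\<bar> + ennreal \<bar>y - z\<bar>"
proof -
  have "ennreal \<bar>x - z\<bar> \<le> ennreal (\<bar>x - y\<bar> + \<bar>y - z\<bar>)" by (intro ennreal_leI) linarith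
  then show ?thesis by simp
qed

section \<open>Smooth bump functions\<close>

text \<open>
  The polynomial in \<open>1 / t\<close> closes the family of flat functions under
  differentiation, so that one derivative computation yields smoothness of every order.
\<close>

definition flat :: "real poly \<Rightarrow> real \<Rightarrow> real" where
  "flat P t = (if 0 < t then poly P (1 / t) * exp (- (1 / t)) else 0)"

lemma poly_times_exp_minus_tendsto_0: "((\<lambda>x. poly P x * exp (- x)) \<longlongrightarrow> 0) (at_top :: real filter)"
proof -
  have "((\<lambda>x. \<Sum>i\<le>degree P. coeff P i * (x ^ i / exp x)) \<longlongrightarrow> (\<Sum>i\<le>degree P. coeff P i * 0)) at_top"
    by (intro tendsto_sum tendsto_mult tendsto_const tendsto_power_div_exp_0)
  then show ?thesis
    by (simp add: poly_altdef sum_distrib_right exp_minus divide_inverse mult.assoc)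
qed

text \<open>
  For positive \<open>t\<close>, differentiating \<open>1 / t\<close> brings down \<open>1 /
  t\<^sup>2\<close>, which accounts for the polynomial factor \<open>X\<^sup>2\<close>. At
  \<open>0\<close> the difference quotient is the flat function of \<open>X * P\<close>, and the
  exponential beats every power of \<open>1 / t\<close>.
\<close>

lemma flat_has_derivative:
  "(flat P has_real_derivative flat ([:0, 0, 1:] * (P - pderiv P)) t) (at t)"
proof -
  consider "t < 0" | "t = 0" | "0 < t" by linarith
  then show ?thesis
  proof cases
    case 1
    have "((\<lambda>_. 0) has_real_derivative 0) (at t)" by simp
    then have "(flat P has_real_derivative 0) (at t)"
      using 1 by (elim has_field_derivative_transform_within_open[where S="{..<0}"]) (auto simp: flat_def)
    then show ?thesis using 1 by (simp add: flat_def)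
  next
    case 2
    have 0: "filterlim (\<lambda>h::real. 1 / h) at_top (at_right 0)"
      using filterlim_inverse_at_top_right by (simp add: inverse_eq_divide)
    have "((\<lambda>h. poly (pCons 0 P) (1 / h) * exp (- (1 / h))) \<longlongrightarrow> 0) (at_right 0)"
      by (rule filterlim_compose[OF poly_times_exp_minus_tendsto_0 0])
    then have "((\<lambda>h. flat P h / h) \<longlongrightarrow> 0) (at_right 0)"
      by (rule tendsto_cong[THEN iffD1, rotated])
         (auto simp: flat_def eventually_at_right_less intro!: eventually_mono[OF eventually_at_right_less])
    moreover have "((\<lambda>h. flat P h / h) \<longlongrightarrow> 0) (at_left 0)"
      by (rule tendsto_eventually) (auto simp: flat_def eventually_at_filter)
    ultimately have "((\<lambda>h. flat P h / h) \<longlongrightarrow> 0) (at 0)"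
      by (simp add: filterlim_at_split)
    then show ?thesis using 2 by (simp add: DERIV_def flat_def)
  next
    case 3
    have "((\<lambda>t. poly P (1 / t) * exp (- (1 / t))) has_real_derivative
        poly (pderiv P) (1 / t) * (- 1 / t^2) * exp (- (1 / t))
          + poly P (1 / t) * (exp (- (1 / t)) * (1 / t^2))) (at t)"
      using 3 by (auto intro!: derivative_eq_intros simp: power2_eq_square field_simps)
    then have "((\<lambda>t. poly P (1 / t) * exp (- (1 / t))) has_real_derivative
        flat ([:0, 0, 1:] * (P - pderiv P)) t) (at t)"
      using 3 by (simp add: flat_def power2_eq_square field_simps)
    then show ?thesis
      using 3 by (elim has_field_derivative_transform_within_open[where S="{0<..}"]) (auto simp: flat_def)
  qed
qed

text \<open>
  A product of flat functions of \<open>1 - t\<close> and \<open>1 + t\<close> is supported in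
  \<open>{-1..1}\<close>; sums are needed because the product rule doubles the number of terms.
\<close>

definition cutoff_sum :: "(real poly \<times> real poly) list \<Rightarrow> real \<Rightarrow> real" where
  "cutoff_sum xs t = (\<Sum>(P, Q)\<leftarrow>xs. flat P (1 - t) * flat Q (1 + t))"

lemma cutoff_sum_derivative:
  "\<exists>ys. \<forall>t. (cutoff_sum xs has_real_derivative cutoff_sum ys t) (at t)"
proof (induction xs)
  case Nil
  show ?case by (intro exI[of _ "[]"]) (simp add: cutoff_sum_def[abs_def])
next
  case (Cons a xs)
  then obtain ys where ys: "\<And>t. (cutoff_sum xs has_real_derivative cutoff_sum ys t) (at t)" by blast
  obtain P Q where a: "a = (P, Q)" by force
  let ?D = "\<lambda>P. [:0, 0, 1:] * (P - pderiv P) :: real poly"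
  have 1: "((\<lambda>t. flat P (1 - t)) has_real_derivative - flat (?D P) (1 - t)) (at t)" for t
    by (rule DERIV_chain2[where g="\<lambda>t. 1 - t" and Db="-1", OF flat_has_derivative, THEN DERIV_cong])
       (auto intro!: derivative_eq_intros)
  have 2: "((\<lambda>t. flat Q (1 + t)) has_real_derivative flat (?D Q) (1 + t)) (at t)" for t
    by (rule DERIV_chain2[where g="\<lambda>t. 1 + t" and Db="1", OF flat_has_derivative, THEN DERIV_cong])
       (auto intro!: derivative_eq_intros)
  have neg: "flat (- S) t = - flat S t" for S t by (simp add: flat_def)
  show ?case
  proof (intro exI allI)
    fix t
    have "((\<lambda>t. flat P (1 - t) * flat Q (1 + t) + cutoff_sum xs t) has_real_derivative
       cutoff_sum ((- ?D P, Q) # (P, ?D Q) # ys) t) (at t)"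
      unfolding cutoff_sum_def[of "_ # _"] list.map sum_list.Cons case_prod_conv neg
      unfolding cutoff_sum_def[of ys, symmetric]
      by (rule derivative_eq_intros 1 2 ys refl)+ (simp add: algebra_simps)
    then show "(cutoff_sum (a # xs) has_real_derivative
       cutoff_sum ((- ?D P, Q) # (P, ?D Q) # ys) t) (at t)"
      by (simp add: cutoff_sum_def[of "_ # _", abs_def] a fun_eq_iff cutoff_sum_def[of xs, symmetric, abs_def])
  qed
qed

lemma cutoff_sum_eq_0: "1 \<le> \<bar>t\<bar> \<Longrightarrow> cutoff_sum xs t = 0"
  by (induction xs) (auto simp: cutoff_sum_def flat_def abs_if split: if_splits)

text \<open>
  \<open>F n\<close> is the derivative of order \<open>n\<close> of a bump function. Carrying
  the whole sequence gives closed expressions for all mixed partial derivatives of a product of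
  two bumps.
\<close>

definition smooth_cutoff :: "(nat \<Rightarrow> real \<Rightarrow> real) \<Rightarrow> bool" where
  "smooth_cutoff F \<longleftrightarrow> (\<forall>n t. (F n has_real_derivative F (Suc n) t) (at t)) \<and>
     (\<forall>n t. 1 \<le> \<bar>t\<bar> \<longrightarrow> F n t = 0) \<and> (\<forall>t. 0 \<le> F 0 t) \<and>
     (\<integral>\<^sup>+t. ennreal (F 0 t) \<partial>lborel) = 1"

lemma smooth_cutoff_exists: "\<exists>F. smooth_cutoff F"
proof -
  obtain d where d: "\<And>xs t. (cutoff_sum xs has_real_derivative cutoff_sum (d xs) t) (at t)"
    using cutoff_sum_derivative by metis
  define G where "G n = cutoff_sum ((d ^^ n) [(1, 1)])" for n
  have G: "(G n has_real_derivative G (Suc n) t) (at t)" for n t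
    unfolding G_def using d by simp
  have G0: "G n t = 0" if "1 \<le> \<bar>t\<bar>" for n t
    unfolding G_def using that by (rule cutoff_sum_eq_0)
  have Gnn: "0 \<le> G 0 t" for t by (simp add: G_def cutoff_sum_def flat_def)
  \<comment> \<open>positivity near 0 makes the integral nonzero, so that it can be normalised; the factors are at least exp (-2) there\<close>
  have Gpos: "exp (- 4) \<le> G 0 t" if "\<bar>t\<bar> \<le> 1/2" for t
  proof -
    have "1 / (1 - t) \<le> 2" "1 / (1 + t) \<le> 2" using that by (auto simp: field_simps)
    then have "exp (- 2) \<le> exp (- (1 / (1 - t)))" "exp (-2) \<le> exp (- (1 / (1 + t)))" by auto
    then have "exp (- 2) * exp (-2) \<le> exp (- (1 / (1 - t))) * exp (- (1 / (1 + t)))"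
      by (intro mult_mono) auto
    then have "exp (- 4) \<le> exp (- (1 / (1 - t))) * exp (- (1 / (1 + t)))" by (simp flip: exp_add)
    moreover have "t < 1" "0 < 1 + t" using that by (auto simp: abs_if split: if_splits)
    ultimately show ?thesis by (simp add: G_def cutoff_sum_def flat_def)
  qed
  have Gc: "continuous_on UNIV (G n)" for n
    using G by (intro DERIV_continuous_on[where D="G (Suc n)"]) (auto intro: has_field_derivative_at_within)
  have "bounded (G 0 ` {-1..1})"
    by (intro compact_imp_bounded compact_continuous_image continuous_on_subset[OF Gc]) auto
  then obtain B where B: "\<And>t. t \<in> {-1..1} \<Longrightarrow> \<bar>G 0 t\<bar> \<le> B"
    unfolding bounded_iff by fastforce
  have [measurable]: "G n \<in> borel_measurable borel" for n
    using Gc by (rule borel_measurable_continuous_onI)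
  let ?I = "\<integral>\<^sup>+t. ennreal (G 0 t) \<partial>lborel"
  have "?I \<le> (\<integral>\<^sup>+t. ennreal B * indicator {-1..1::real} t \<partial>lborel)"
  proof (rule nn_integral_mono)
    show "ennreal (G 0 t) \<le> ennreal B * indicator {-1..1} t" for t
      using B[of t] G0[of t 0] by (cases "t \<in> {-1..1}") (auto intro!: ennreal_leI)
  qed
  also have "\<dots> < \<infinity>" by (simp add: nn_integral_cmult_indicator ennreal_mult_less_top)
  finally have fin: "?I < \<infinity>" .
  have "0 < ennreal (exp (-4)) * emeasure lborel {-(1/2)..1/2::real}" by (simp add: ennreal_zero_less_mult_iff)
  also have "\<dots> = (\<integral>\<^sup>+t. ennreal (exp (-4)) * indicator {-(1/2)..1/2::real} t \<partial>lborel)"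
    by (subst nn_integral_cmult_indicator) auto
  also have "\<dots> \<le> ?I"
    using Gpos by (intro nn_integral_mono) (auto split: split_indicator intro!: ennreal_leI simp: abs_le_iff)
  finally have pos: "0 < ?I" .
  obtain c where c: "?I = ennreal c" "0 < c" using fin pos by (cases ?I) auto
  show ?thesis
  proof (intro exI[of _ "\<lambda>n t. G n t / c"], unfold smooth_cutoff_def, intro conjI allI impI)
    show "((\<lambda>t. G n t / c) has_real_derivative G (Suc n) t / c) (at t)" for n t
      using G by (rule DERIV_cdivide)
    show "(\<integral>\<^sup>+t. ennreal (G 0 t / c) \<partial>lborel) = 1"
      using c Gnn by (simp add: divide_ennreal[symmetric] nn_integral_divide)
  qed (use G0 Gnn c in auto)
qed

definition cutoff :: "nat \<Rightarrow> real \<Rightarrow> real" where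
  "cutoff = (SOME F. smooth_cutoff F)"

lemma smooth_cutoff_cutoff: "smooth_cutoff cutoff"
  unfolding cutoff_def using smooth_cutoff_exists by (rule someI_ex)

lemma cutoff_deriv: "(cutoff n has_real_derivative cutoff (Suc n) t) (at t)"
  and cutoff_eq_0: "1 \<le> \<bar>t\<bar> \<Longrightarrow> cutoff n t = 0"
  and cutoff_nonneg: "0 \<le> cutoff 0 t"
  and nn_integral_cutoff: "(\<integral>\<^sup>+t. ennreal (cutoff 0 t) \<partial>lborel) = 1"
  using smooth_cutoff_cutoff unfolding smooth_cutoff_def by auto

lemma continuous_cutoff: "continuous_on UNIV (cutoff n)"
  using cutoff_deriv by (intro DERIV_continuous_on[where D="cutoff (Suc n)"]) (auto intro: has_field_derivative_at_within)

lemma cutoff_measurable [measurable]: "cutoff n \<in> borel_measurable borel"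
  using continuous_cutoff by (rule borel_measurable_continuous_onI)

lemma cutoff_bounded: "\<exists>B\<ge>0. \<forall>t. \<bar>cutoff n t\<bar> \<le> B"
proof -
  have "bounded (cutoff n ` {-1..1})"
    by (intro compact_imp_bounded compact_continuous_image continuous_on_subset[OF continuous_cutoff]) auto
  then obtain B where B: "\<And>t. t \<in> {-1..1} \<Longrightarrow> \<bar>cutoff n t\<bar> \<le> B"
    unfolding bounded_iff by fastforce
  have "\<bar>cutoff n t\<bar> \<le> max 0 B" for t
  proof (cases "1 \<le> \<bar>t\<bar>")
    case False
    then have "t \<in> {-1..1}" by auto
    from B[OF this] show ?thesis by simp
  qed (simp add: cutoff_eq_0)
  then show ?thesis by (intro exI[of _ "max 0 B"]) auto
qed

text \<open>
  The usual mollifier at scale \<open>\<delta>\<close> in dimension two, together with its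
  partial derivatives: \<open>i\<close> and \<open>j\<close> count the derivatives in the two
  coordinates. Being a product, it is supported in a square.
\<close>

definition kernel :: "real \<Rightarrow> nat \<Rightarrow> nat \<Rightarrow> real^2 \<Rightarrow> real" where
  "kernel \<delta> i j y = cutoff i (y$1 / \<delta>) * cutoff j (y$2 / \<delta>) / \<delta> ^ (2 + i + j)"

lemma kernel_has_derivative:
  assumes "0 < \<delta>"
  shows "(kernel \<delta> i j has_derivative
           (\<lambda>h. kernel \<delta> (Suc i) j y * h$1 + kernel \<delta> i (Suc j) y * h$2)) (at y)"
proof -
  have d: "((\<lambda>y::real^2. cutoff n (y$k / \<delta>)) has_derivative (\<lambda>h. cutoff (Suc n) (y$k / \<delta>) * (h$k / \<delta>))) (at y)" for n k
  proof -
    have "((\<lambda>y::real^2. y$k / \<delta>) has_derivative (\<lambda>h. h$k / \<delta>)) (at y)"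
      by (intro bounded_linear.has_derivative[OF bounded_linear_divide] bounded_linear_imp_has_derivative bounded_linear_vec_nth)
    from has_derivative_compose[OF this, of "cutoff n" "(*) (cutoff (Suc n) (y$k/\<delta>))"]
    show ?thesis using cutoff_deriv by (simp add: has_field_derivative_def)
  qed
  show ?thesis
    unfolding kernel_def
    apply (rule has_derivative_eq_rhs)
     apply (rule derivative_intros d)+
    using assms
    apply (auto simp: fun_eq_iff field_simps)
    done
qed

lemma kernel_eq_0:
  assumes "0 < \<delta>" "y \<notin> box (vec (-\<delta>)) (vec \<delta>)"
  shows "kernel \<delta> i j y = 0"
proof -
  have "1 \<le> \<bar>y$1 / \<delta>\<bar> \<or> 1 \<le> \<bar>y$2 / \<delta>\<bar>"
    using assms by (auto simp: mem_box_cart forall_2 abs_if field_simps not_less)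
  then show ?thesis by (auto simp: kernel_def cutoff_eq_0)
qed

lemma kernel_nonneg: "0 < \<delta> \<Longrightarrow> 0 \<le> kernel \<delta> 0 0 y"
  by (simp add: kernel_def cutoff_nonneg)

lemma kernel_measurable [measurable]: "kernel \<delta> i j \<in> borel_measurable borel"
  unfolding kernel_def by measurable

lemma kernel_bounded:
  assumes "0 < \<delta>"
  shows "\<exists>B\<ge>0. \<forall>y. \<bar>kernel \<delta> i j y\<bar> \<le> B"
proof -
  obtain A B where A: "A \<ge> 0" "\<And>t. \<bar>cutoff i t\<bar> \<le> A" and B: "B \<ge> 0" "\<And>t. \<bar>cutoff j t\<bar> \<le> B"
    using cutoff_bounded by metis
  have "\<bar>kernel \<delta> i j y\<bar> \<le> A * B / \<delta> ^ (2 + i + j)" for y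
    unfolding kernel_def abs_divide abs_mult using assms A B
    by (intro divide_mono mult_mono) auto
  then show ?thesis using A B assms by (intro exI[of _ "A * B / \<delta> ^ (2 + i + j)"]) auto
qed

lemma nn_integral_kernel:
  assumes "0 < \<delta>"
  shows "(\<integral>\<^sup>+y. ennreal (kernel \<delta> 0 0 y) \<partial>lborel) = 1"
proof -
  have 1: "(\<integral>\<^sup>+t. ennreal (cutoff 0 (t / \<delta>) / \<delta>) \<partial>lborel) = 1"
    using nn_integral_real_affine[of "\<lambda>t. ennreal (cutoff 0 (t / \<delta>) / \<delta>)" \<delta> 0] assms
    by (simp add: nn_integral_cmult[symmetric] ennreal_mult[symmetric] cutoff_nonneg nn_integral_cutoff)
  let ?f = "\<lambda>b t. ennreal (cutoff 0 (t / \<delta>) / \<delta>)"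
  have B: "(Basis :: (real^2) set) = {axis 1 1, axis 2 1}" 
    by (auto simp: Basis_vec_def UNIV_2)
  have ne: "axis 1 1 \<noteq> (axis 2 1 :: real^2)" by (simp add: axis_eq_axis)
  have "(\<integral>\<^sup>+y. ennreal (kernel \<delta> 0 0 y) \<partial>lborel) = (\<integral>\<^sup>+(y::real^2). (\<Prod>b\<in>Basis. ?f b (inner y b)) \<partial>lborel)"
    using assms ne
    by (intro nn_integral_cong)
       (simp add: B inner_axis kernel_def ennreal_mult[symmetric] cutoff_nonneg power2_eq_square)
  also have "\<dots> = (\<Prod>b\<in>(Basis :: (real^2) set). (\<integral>\<^sup>+x. ?f b x \<partial>lborel))"
    by (rule nn_integral_lborel_prod) auto
  also have "\<dots> = 1" using 1 by simp
  finally show ?thesis .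
qed

lemma shifted_kernel_has_derivative:
  assumes "0 < \<delta>"
  shows "((\<lambda>z. kernel \<delta> i j (z - y)) has_derivative
           (\<lambda>h. kernel \<delta> (Suc i) j (z - y) * h$1 + kernel \<delta> i (Suc j) (z - y) * h$2)) (at z)"
proof -
  have "((\<lambda>z. z - y) has_derivative (\<lambda>h. h)) (at z)"
    by (auto intro!: derivative_eq_intros)
  from has_derivative_compose[OF this kernel_has_derivative[OF assms]]
  show ?thesis .
qed

lemma partial_deriv_kernel:
  assumes "0 < \<delta>"
  shows "partial_deriv 1 (\<lambda>z. kernel \<delta> i j (z - y)) = (\<lambda>z. kernel \<delta> (Suc i) j (z - y))"
    and "partial_deriv 2 (\<lambda>z. kernel \<delta> i j (z - y)) = (\<lambda>z. kernel \<delta> i (Suc j) (z - y))"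
proof -
  note D = frechet_derivative_at[OF shifted_kernel_has_derivative[OF assms], symmetric]
  show "partial_deriv 1 (\<lambda>z. kernel \<delta> i j (z - y)) = (\<lambda>z. kernel \<delta> (Suc i) j (z - y))"
    and "partial_deriv 2 (\<lambda>z. kernel \<delta> i j (z - y)) = (\<lambda>z. kernel \<delta> i (Suc j) (z - y))"
    unfolding partial_deriv_def D by (auto simp: axis_def)
qed

lemma partial_derivs_kernel:
  assumes "0 < \<delta>"
  shows "partial_derivs \<alpha> (\<lambda>z. kernel \<delta> i j (z - y)) =
    (\<lambda>z. kernel \<delta> (i + count_list \<alpha> 1) (j + count_list \<alpha> 2) (z - y))"
proof (induction \<alpha>)
  case (Cons k \<alpha>)
  have "k = 1 \<or> k = 2" by (rule exhaust_2)
  then show ?case using Cons partial_deriv_kernel[OF assms]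
    by (auto simp: partial_derivs_def)
qed (simp add: partial_derivs_def)

text \<open>
  This makes the definition of weak derivatives applicable to mollifications: at points whose
  surrounding square lies in \<open>\<Omega>\<close>, mollifying means testing.
\<close>

lemma test_function_kernel:
  assumes "0 < \<delta>" "cbox (y - vec \<delta>) (y + vec \<delta>) \<subseteq> \<Omega>"
  shows "test_function \<Omega> (\<lambda>z. kernel \<delta> 0 0 (z - y))"
proof -
  have "{z. kernel \<delta> 0 0 (z - y) \<noteq> 0} \<subseteq> cbox (y - vec \<delta>) (y + vec \<delta>)"
  proof clarify
    fix z assume "kernel \<delta> 0 0 (z - y) \<noteq> 0"
    then have "z - y \<in> box (vec (-\<delta>)) (vec \<delta>)" using kernel_eq_0[OF assms(1)] by blast
    then show "z \<in> cbox (y - vec \<delta>) (y + vec \<delta>)"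
      by (auto simp: mem_box_cart forall_2)
  qed
  then have sub: "closure {z. kernel \<delta> 0 0 (z - y) \<noteq> 0} \<subseteq> cbox (y - vec \<delta>) (y + vec \<delta>)"
    by (rule closure_minimal) (rule closed_cbox)
  then have "compact (closure {z. kernel \<delta> 0 0 (z - y) \<noteq> 0})"
    by (meson bounded_cbox bounded_subset closed_closure compact_eq_bounded_closed)
  moreover have "(\<lambda>z. kernel \<delta> i j (z - y)) differentiable_on UNIV" for i j
    using shifted_kernel_has_derivative[OF assms(1)]
    unfolding differentiable_on_def differentiable_def by (blast intro: has_derivative_at_withinI)
  ultimately show ?thesis
    unfolding test_function_def using sub assms by (auto simp: partial_derivs_kernel)
qed

section \<open>Mollification\<close>

text \<open>
  The kernel is centred at \<open>y\<close> and regarded as a function of \<open>z\<close>, so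
  that for fixed \<open>y\<close> the integral tests \<open>v\<close>. In exchange, every
  derivative with respect to \<open>y\<close> changes the sign.
\<close>

definition mollify :: "real \<Rightarrow> nat \<Rightarrow> nat \<Rightarrow> (real^2 \<Rightarrow> real) \<Rightarrow> real^2 \<Rightarrow> real" where
  "mollify \<delta> i j v y = (\<integral>z. v z * kernel \<delta> i j (z - y) \<partial>lborel)"

lemma integrable_mult_kernel:
  assumes \<delta>: "0 < \<delta>" and v: "integrable lborel v"
  shows "integrable lborel (\<lambda>z. v z * kernel \<delta> i j (z - y))"
proof -
  obtain B where B: "0 \<le> B" "\<And>y. \<bar>kernel \<delta> i j y\<bar> \<le> B" using kernel_bounded[OF \<delta>] by blast
  have [measurable]: "v \<in> borel_measurable borel" using v by auto
  show ?thesis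
  proof (rule Bochner_Integration.integrable_bound)
    show "integrable lborel (\<lambda>z. B * v z)" using v by simp
    show "AE z in lborel. norm (v z * kernel \<delta> i j (z - y)) \<le> norm (B * v z)"
    proof (rule AE_I2)
      fix z
      have "\<bar>kernel \<delta> i j (z - y)\<bar> * \<bar>v z\<bar> \<le> B * \<bar>v z\<bar>" using B by (intro mult_right_mono) auto
      then show "norm (v z * kernel \<delta> i j (z - y)) \<le> norm (B * v z)"
        using B(1) by (simp add: abs_mult mult.commute)
    qed
  qed measurable
qed

lemma abs_dot_le: "\<bar>a * x + b * y\<bar> \<le> \<bar>a\<bar> * \<bar>x\<bar> + \<bar>b\<bar> * \<bar>y :: real\<bar>"
  by (rule order_trans[OF abs_triangle_ineq]) (simp add: abs_mult)

lemma kernel_mean_value: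
  assumes \<delta>: "0 < \<delta>"
  shows "\<exists>\<xi>\<in>{0..1}. kernel \<delta> i j (w - h) - kernel \<delta> i j w =
     - (kernel \<delta> (Suc i) j (w - \<xi> *\<^sub>R h) * h$1 + kernel \<delta> i (Suc j) (w - \<xi> *\<^sub>R h) * h$2)"
proof -
  have d: "((\<lambda>r. kernel \<delta> i j (w - r *\<^sub>R h)) has_real_derivative
     - (kernel \<delta> (Suc i) j (w - r *\<^sub>R h) * h$1 + kernel \<delta> i (Suc j) (w - r *\<^sub>R h) * h$2)) (at r)" for r
  proof -
    have "((\<lambda>r. w - r *\<^sub>R h) has_derivative (\<lambda>k. - (k *\<^sub>R h))) (at r)"
      by (auto intro!: derivative_eq_intros)
    from has_derivative_compose[OF this kernel_has_derivative[OF \<delta>]]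
    show ?thesis unfolding has_field_derivative_def
      by (rule has_derivative_eq_rhs) (auto simp: algebra_simps)
  qed
  from MVT2[of 0 1, OF zero_less_one d] obtain \<xi> where "0 < \<xi>" "\<xi> < 1"
    "kernel \<delta> i j (w - 1 *\<^sub>R h) - kernel \<delta> i j (w - 0 *\<^sub>R h) =
      (1 - 0) * - (kernel \<delta> (Suc i) j (w - \<xi> *\<^sub>R h) * h$1 + kernel \<delta> i (Suc j) (w - \<xi> *\<^sub>R h) * h$2)" by blast
  then show ?thesis by (intro bexI[of _ \<xi>]) auto
qed

lemma kernel_lipschitz:
  assumes \<delta>: "0 < \<delta>"
  shows "\<exists>L\<ge>0. \<forall>w h. \<bar>kernel \<delta> i j (w - h) - kernel \<delta> i j w\<bar> \<le> L * norm h"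
proof -
  obtain A B where A: "0 \<le> A" "\<And>y. \<bar>kernel \<delta> (Suc i) j y\<bar> \<le> A" and B: "0 \<le> B" "\<And>y. \<bar>kernel \<delta> i (Suc j) y\<bar> \<le> B"
    using kernel_bounded[OF \<delta>] by metis
  have "\<bar>kernel \<delta> i j (w - h) - kernel \<delta> i j w\<bar> \<le> (A + B) * norm h" for w h
  proof -
    obtain \<xi> where "kernel \<delta> i j (w - h) - kernel \<delta> i j w =
     - (kernel \<delta> (Suc i) j (w - \<xi> *\<^sub>R h) * h$1 + kernel \<delta> i (Suc j) (w - \<xi> *\<^sub>R h) * h$2)"
      using kernel_mean_value[OF \<delta>] by blast
    then have "\<bar>kernel \<delta> i j (w - h) - kernel \<delta> i j w\<bar> \<le>
       \<bar>kernel \<delta> (Suc i) j (w - \<xi> *\<^sub>R h)\<bar> * \<bar>h$1\<bar> + \<bar>kernel \<delta> i (Suc j) (w - \<xi> *\<^sub>R h)\<bar> * \<bar>h$2\<bar>"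
      by (simp only: abs_minus_cancel abs_dot_le)
    also have "\<dots> \<le> A * norm h + B * norm h"
      using A B by (intro add_mono mult_mono component_le_norm_cart) auto
    finally show ?thesis by (simp add: distrib_right)
  qed
  then show ?thesis using A B by (intro exI[of _ "A + B"]) auto
qed

text \<open>
  A quadratic remainder that is uniform in the base point: it can be integrated against any
  integrable function, which justifies differentiating under the integral.
\<close>

lemma kernel_taylor:
  assumes \<delta>: "0 < \<delta>"
  shows "\<exists>L\<ge>0. \<forall>w h. \<bar>kernel \<delta> i j (w - h) - kernel \<delta> i j w + (kernel \<delta> (Suc i) j w * h$1 + kernel \<delta> i (Suc j) w * h$2)\<bar>
       \<le> L * (norm h * norm h)"
proof -
  obtain A B where A: "0 \<le> A" "\<And>w h. \<bar>kernel \<delta> (Suc i) j (w - h) - kernel \<delta> (Suc i) j w\<bar> \<le> A * norm h"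
    and B: "0 \<le> B" "\<And>w h. \<bar>kernel \<delta> i (Suc j) (w - h) - kernel \<delta> i (Suc j) w\<bar> \<le> B * norm h"
    using kernel_lipschitz[OF \<delta>] by metis
  have "\<bar>kernel \<delta> i j (w - h) - kernel \<delta> i j w + (kernel \<delta> (Suc i) j w * h$1 + kernel \<delta> i (Suc j) w * h$2)\<bar>
       \<le> (A + B) * (norm h * norm h)" for w h
  proof -
    obtain \<xi> where \<xi>: "\<xi> \<in> {0..1}" "kernel \<delta> i j (w - h) - kernel \<delta> i j w =
     - (kernel \<delta> (Suc i) j (w - \<xi> *\<^sub>R h) * h$1 + kernel \<delta> i (Suc j) (w - \<xi> *\<^sub>R h) * h$2)"
      using kernel_mean_value[OF \<delta>] by blast
    have "norm (\<xi> *\<^sub>R h) \<le> norm h" using \<xi> by (simp add: mult_left_le_one_le)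
    then have 1: "\<bar>kernel \<delta> (Suc i) j (w - \<xi> *\<^sub>R h) - kernel \<delta> (Suc i) j w\<bar> \<le> A * norm h"
        "\<bar>kernel \<delta> i (Suc j) (w - \<xi> *\<^sub>R h) - kernel \<delta> i (Suc j) w\<bar> \<le> B * norm h"
      using A(2)[of w "\<xi> *\<^sub>R h"] B(2)[of w "\<xi> *\<^sub>R h"] by (auto intro: order_trans mult_left_mono[OF _ A(1)] mult_left_mono[OF _ B(1)])
    have "kernel \<delta> i j (w - h) - kernel \<delta> i j w + (kernel \<delta> (Suc i) j w * h$1 + kernel \<delta> i (Suc j) w * h$2)
      = - ((kernel \<delta> (Suc i) j (w - \<xi> *\<^sub>R h) - kernel \<delta> (Suc i) j w) * h$1
         + (kernel \<delta> i (Suc j) (w - \<xi> *\<^sub>R h) - kernel \<delta> i (Suc j) w) * h$2)"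
      unfolding \<xi>(2) by (simp add: algebra_simps)
    also have "\<bar>\<dots>\<bar> \<le> \<bar>kernel \<delta> (Suc i) j (w - \<xi> *\<^sub>R h) - kernel \<delta> (Suc i) j w\<bar> * \<bar>h$1\<bar>
         + \<bar>kernel \<delta> i (Suc j) (w - \<xi> *\<^sub>R h) - kernel \<delta> i (Suc j) w\<bar> * \<bar>h$2\<bar>"
      by (simp only: abs_minus_cancel abs_dot_le)
    also have "\<dots> \<le> (A * norm h) * norm h + (B * norm h) * norm h"
      using A B 1 by (intro add_mono mult_mono component_le_norm_cart) auto
    finally show ?thesis by (simp add: distrib_right mult.assoc)
  qed
  then show ?thesis using A B by (intro exI[of _ "A + B"]) auto
qed

lemma mollify_has_derivative:
  assumes \<delta>: "0 < \<delta>" and v: "integrable lborel v"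
  shows "(mollify \<delta> i j v has_derivative
     (\<lambda>h. - mollify \<delta> (Suc i) j v y * h$1 + - mollify \<delta> i (Suc j) v y * h$2)) (at y)"
proof -
  obtain L where L: "0 \<le> L" "\<And>w h. \<bar>kernel \<delta> i j (w - h) - kernel \<delta> i j w + (kernel \<delta> (Suc i) j w * h$1 + kernel \<delta> i (Suc j) w * h$2)\<bar>
       \<le> L * (norm h * norm h)" using kernel_taylor[OF \<delta>] by blast
  note int = integrable_mult_kernel[OF \<delta> v]
  let ?D = "\<lambda>h. - mollify \<delta> (Suc i) j v y * h$1 + - mollify \<delta> i (Suc j) v y * h$2"
  define C where "C = L * (\<integral>z. \<bar>v z\<bar> \<partial>lborel)"
  have bound: "\<bar>mollify \<delta> i j v (y + h) - mollify \<delta> i j v y - ?D h\<bar> \<le> C * (norm h * norm h)" for h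
  proof -
    have "mollify \<delta> i j v (y + h) - mollify \<delta> i j v y - ?D h =
      (\<integral>z. v z * kernel \<delta> i j (z - (y + h)) - v z * kernel \<delta> i j (z - y)
         + (v z * kernel \<delta> (Suc i) j (z - y) * h$1 + v z * kernel \<delta> i (Suc j) (z - y) * h$2) \<partial>lborel)"
      unfolding mollify_def by (simp add: int)
    also have "\<bar>\<dots>\<bar> \<le> (\<integral>z. \<bar>v z\<bar> * (L * (norm h * norm h)) \<partial>lborel)"
    proof (rule integral_abs_bound_integral[where f="\<lambda>z. v z * kernel \<delta> i j (z - (y + h)) - v z * kernel \<delta> i j (z - y)
         + (v z * kernel \<delta> (Suc i) j (z - y) * h$1 + v z * kernel \<delta> i (Suc j) (z - y) * h$2)"])
      fix z
      have "v z * kernel \<delta> i j (z - (y + h)) - v z * kernel \<delta> i j (z - y)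
         + (v z * kernel \<delta> (Suc i) j (z - y) * h$1 + v z * kernel \<delta> i (Suc j) (z - y) * h$2)
        = v z * (kernel \<delta> i j ((z - y) - h) - kernel \<delta> i j (z - y) + (kernel \<delta> (Suc i) j (z - y) * h$1 + kernel \<delta> i (Suc j) (z - y) * h$2))"
        by (simp add: algebra_simps)
      then show "\<bar>v z * kernel \<delta> i j (z - (y + h)) - v z * kernel \<delta> i j (z - y)
         + (v z * kernel \<delta> (Suc i) j (z - y) * h$1 + v z * kernel \<delta> i (Suc j) (z - y) * h$2)\<bar> \<le> \<bar>v z\<bar> * (L * (norm h * norm h))"
        using L(2)[of "z - y" h] by (simp only: abs_mult) (intro mult_left_mono, auto)
    qed (use int v in simp_all)
    also have "\<dots> = C * (norm h * norm h)" by (simp add: C_def)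
    finally show ?thesis .
  qed
  have bl: "bounded_linear ?D"
    by (intro bounded_linear_add bounded_linear_const_mult bounded_linear_vec_nth)
  have "(\<lambda>h. norm (mollify \<delta> i j v (y + h) - mollify \<delta> i j v y - ?D h) / norm h) \<midarrow>0\<rightarrow> 0"
  proof (rule Lim_null_comparison[where g="\<lambda>h. C * norm h"])
    show "\<forall>\<^sub>F h in at 0. norm (norm (mollify \<delta> i j v (y + h) - mollify \<delta> i j v y - ?D h) / norm h) \<le> C * norm h"
      using bound by (intro eventually_at_filter[THEN iffD2] always_eventually) (auto simp: divide_le_eq mult.assoc)
    show "(\<lambda>h. C * norm h) \<midarrow>0\<rightarrow> 0" by (auto intro!: tendsto_eq_intros)
  qed
  then show ?thesis using bl unfolding has_derivative_at by blast
qed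

lemma continuous_mollify:
  assumes "0 < \<delta>" "integrable lborel v"
  shows "continuous_on S (mollify \<delta> i j v)"
  using mollify_has_derivative[OF assms] by (meson continuous_at_imp_continuous_on has_derivative_continuous)

lemma kernel_prob_space:
  assumes "0 < \<delta>"
  shows "prob_space (density lborel (\<lambda>z. ennreal (kernel \<delta> 0 0 (z - y))))"
proof (rule prob_spaceI)
  have "(\<integral>\<^sup>+z. ennreal (kernel \<delta> 0 0 (z - y)) \<partial>lborel) = (\<integral>\<^sup>+z. ennreal (kernel \<delta> 0 0 z) \<partial>distr lborel borel ((+) (- y)))"
    by (subst nn_integral_distr) auto
  also have "\<dots> = 1" by (simp add: lborel_distr_plus nn_integral_kernel[OF assms])
  finally show "emeasure (density lborel (\<lambda>z. ennreal (kernel \<delta> 0 0 (z - y))))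
       (space (density lborel (\<lambda>z. ennreal (kernel \<delta> 0 0 (z - y))))) = 1"
    by (simp add: emeasure_density)
qed

lemma kernel_integral:
  assumes \<delta>: "0 < \<delta>"
  shows "integrable lborel (\<lambda>z. kernel \<delta> 0 0 (z - y))" "(\<integral>z. kernel \<delta> 0 0 (z - y) \<partial>lborel) = 1"
proof -
  have 1: "(\<integral>\<^sup>+z. ennreal (kernel \<delta> 0 0 (z - y)) \<partial>lborel) = 1"
    using prob_space.emeasure_space_1[OF kernel_prob_space[OF \<delta>, of y]] by (simp add: emeasure_density)
  then show "integrable lborel (\<lambda>z. kernel \<delta> 0 0 (z - y))"
    using kernel_nonneg[OF \<delta>] by (intro integrableI_nonneg) auto
  show "(\<integral>z. kernel \<delta> 0 0 (z - y) \<partial>lborel) = 1"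
    using kernel_nonneg[OF \<delta>] 1 by (subst integral_eq_nn_integral) auto
qed

text \<open>
  Jensen's inequality for the probability measure with density \<open>kernel \<delta> 0 0 (z -
  y)\<close>.
\<close>

lemma mollify_power_le:
  assumes \<delta>: "0 < \<delta>" and v: "integrable lborel v" and q: "1 \<le> q"
  shows "ennreal (\<bar>mollify \<delta> 0 0 v y\<bar> powr q) \<le> (\<integral>\<^sup>+z. ennreal (\<bar>v z\<bar> powr q) * ennreal (kernel \<delta> 0 0 (z - y)) \<partial>lborel)"
proof -
  let ?M = "density lborel (\<lambda>z. ennreal (kernel \<delta> 0 0 (z - y)))"
  interpret prob_space ?M by (rule kernel_prob_space[OF \<delta>])
  have vm [measurable]: "v \<in> borel_measurable borel" using v by auto
  define a where "a = (\<integral>z. \<bar>v z\<bar> * kernel \<delta> 0 0 (z - y) \<partial>lborel)"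
  have int: "integrable lborel (\<lambda>z. \<bar>v z\<bar> * kernel \<delta> 0 0 (z - y))"
    using v by (intro integrable_mult_kernel[OF \<delta>]) auto
  have a: "0 \<le> a" "(\<integral>\<^sup>+z. ennreal \<bar>v z\<bar> \<partial>?M) = ennreal a"
  proof -
    show "0 \<le> a" unfolding a_def using kernel_nonneg[OF \<delta>] by (intro Bochner_Integration.integral_nonneg) auto
    have "(\<integral>\<^sup>+z. ennreal \<bar>v z\<bar> \<partial>?M) = (\<integral>\<^sup>+z. ennreal (\<bar>v z\<bar> * kernel \<delta> 0 0 (z - y)) \<partial>lborel)"
      using kernel_nonneg[OF \<delta>] by (subst nn_integral_density) (auto simp: ennreal_mult mult.commute intro!: nn_integral_cong)
    also have "\<dots> = ennreal a" unfolding a_def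
      using kernel_nonneg[OF \<delta>] by (intro nn_integral_eq_integral int) auto
    finally show "(\<integral>\<^sup>+z. ennreal \<bar>v z\<bar> \<partial>?M) = ennreal a" .
  qed
  have "\<bar>mollify \<delta> 0 0 v y\<bar> \<le> (\<integral>z. \<bar>v z * kernel \<delta> 0 0 (z - y)\<bar> \<partial>lborel)"
    unfolding mollify_def by (rule integral_abs_bound)
  also have "\<dots> = a" unfolding a_def using kernel_nonneg[OF \<delta>] by (simp add: abs_mult)
  finally have "\<bar>mollify \<delta> 0 0 v y\<bar> powr q \<le> a powr q" using q by (intro powr_mono2) auto
  then have "ennreal (\<bar>mollify \<delta> 0 0 v y\<bar> powr q) \<le> ennreal (a powr q)" by (rule ennreal_leI)
  also have "\<dots> \<le> (\<integral>\<^sup>+z. ennreal (\<bar>v z\<bar> powr q) \<partial>?M)"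
    using a q by (intro nn_integral_jensen_powr) auto
  also have "\<dots> = (\<integral>\<^sup>+z. ennreal (\<bar>v z\<bar> powr q) * ennreal (kernel \<delta> 0 0 (z - y)) \<partial>lborel)"
    by (subst nn_integral_density) (auto simp: mult.commute)
  finally show ?thesis .
qed

lemma mollify_le_sup:
  assumes \<delta>: "0 < \<delta>" and v: "integrable lborel v" and S: "AE z in lborel. \<bar>v z\<bar> \<le> S"
  shows "\<bar>mollify \<delta> 0 0 v y\<bar> \<le> S"
proof -
  have i: "integrable lborel (\<lambda>z. S * kernel \<delta> 0 0 (z - y))" "(\<integral>z. kernel \<delta> 0 0 (z - y) \<partial>lborel) = 1"
    using kernel_integral[OF \<delta>, of y] by simp_all
  have "\<bar>mollify \<delta> 0 0 v y\<bar> \<le> (\<integral>z. \<bar>v z * kernel \<delta> 0 0 (z - y)\<bar> \<partial>lborel)"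
    unfolding mollify_def by (rule integral_abs_bound)
  also have "\<dots> \<le> (\<integral>z. S * kernel \<delta> 0 0 (z - y) \<partial>lborel)"
  proof (intro integral_mono_AE integrable_abs integrable_mult_kernel[OF \<delta> v] i)
    show "AE z in lborel. \<bar>v z * kernel \<delta> 0 0 (z - y)\<bar> \<le> S * kernel \<delta> 0 0 (z - y)"
      using S by eventually_elim (simp add: abs_mult kernel_nonneg[OF \<delta>] mult_right_mono)
  qed
  also have "\<dots> = S" using i by simp
  finally show ?thesis .
qed

lemma nn_integral_kernel_reflected:
  assumes \<delta>: "0 < \<delta>" and \<theta>: "0 < \<theta>"
  shows "ennreal (\<theta>^2) * (\<integral>\<^sup>+x. ennreal (kernel \<delta> 0 0 (z - (c + \<theta> *\<^sub>R x))) \<partial>lborel) = 1"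
proof -
  have "1 = (\<integral>\<^sup>+y. ennreal (kernel \<delta> 0 0 y)
      \<partial>density (distr lborel borel (\<lambda>x. (z - c) + (- \<theta>) *\<^sub>R x)) (\<lambda>_. ennreal (\<bar>-\<theta>\<bar>^DIM(real^2))))"
    using nn_integral_kernel[OF \<delta>] lborel_affine[of "-\<theta>" "z - c"] \<theta> by simp
  also have "\<dots> = ennreal (\<theta>^2) * (\<integral>\<^sup>+x. ennreal (kernel \<delta> 0 0 ((z - c) + (- \<theta>) *\<^sub>R x)) \<partial>lborel)"
    using \<theta> by (simp add: nn_integral_density nn_integral_distr nn_integral_cmult)
  finally show ?thesis by (simp add: algebra_simps)
qed

text \<open>
  By Jensen and Fubini, mollification does not increase the \<open>L\<^sup>q\<close> norm. The
  similarity \<open>x \<mapsto> c + \<theta> x\<close>, with Jacobian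
  \<open>\<theta>\<^sup>2\<close>, is built in because the mollification will be evaluated on a
  contracted triangle.
\<close>

lemma nn_integral_mollify_power_le:
  assumes \<delta>: "0 < \<delta>" and \<theta>: "0 < \<theta>" and v: "integrable lborel v" and q: "1 \<le> q"
  shows "ennreal (\<theta>^2) * (\<integral>\<^sup>+x. ennreal (\<bar>mollify \<delta> 0 0 v (c + \<theta> *\<^sub>R x)\<bar> powr q) \<partial>lborel)
          \<le> (\<integral>\<^sup>+z. ennreal (\<bar>v z\<bar> powr q) \<partial>lborel)"
proof -
  have vm [measurable]: "v \<in> borel_measurable borel" using v by auto
  have "(\<integral>\<^sup>+x. ennreal (\<bar>mollify \<delta> 0 0 v (c + \<theta> *\<^sub>R x)\<bar> powr q) \<partial>lborel)
     \<le> (\<integral>\<^sup>+x. \<integral>\<^sup>+z. ennreal (\<bar>v z\<bar> powr q) * ennreal (kernel \<delta> 0 0 (z - (c + \<theta> *\<^sub>R x))) \<partial>lborel \<partial>lborel)"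
    by (intro nn_integral_mono mollify_power_le \<delta> v q)
  also have "\<dots> = (\<integral>\<^sup>+z. \<integral>\<^sup>+x. ennreal (\<bar>v z\<bar> powr q) * ennreal (kernel \<delta> 0 0 (z - (c + \<theta> *\<^sub>R x))) \<partial>lborel \<partial>lborel)"
    by (rule lborel_pair.Fubini') measurable
  also have "\<dots> = (\<integral>\<^sup>+z. ennreal (\<bar>v z\<bar> powr q) * (\<integral>\<^sup>+x. ennreal (kernel \<delta> 0 0 (z - (c + \<theta> *\<^sub>R x))) \<partial>lborel) \<partial>lborel)"
    by (intro nn_integral_cong nn_integral_cmult) measurable
  finally have "ennreal (\<theta>^2) * (\<integral>\<^sup>+x. ennreal (\<bar>mollify \<delta> 0 0 v (c + \<theta> *\<^sub>R x)\<bar> powr q) \<partial>lborel)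
    \<le> ennreal (\<theta>^2) * (\<integral>\<^sup>+z. ennreal (\<bar>v z\<bar> powr q) * (\<integral>\<^sup>+x. ennreal (kernel \<delta> 0 0 (z - (c + \<theta> *\<^sub>R x))) \<partial>lborel) \<partial>lborel)"
    by (intro mult_left_mono) auto
  also have "\<dots> = (\<integral>\<^sup>+z. ennreal (\<theta>^2) * (ennreal (\<bar>v z\<bar> powr q) * (\<integral>\<^sup>+x. ennreal (kernel \<delta> 0 0 (z - (c + \<theta> *\<^sub>R x))) \<partial>lborel)) \<partial>lborel)"
    by (intro nn_integral_cmult[symmetric]) measurable
  also have "\<dots> = (\<integral>\<^sup>+z. ennreal (\<bar>v z\<bar> powr q) \<partial>lborel)"
  proof (intro nn_integral_cong)
    fix z
    show "ennreal (\<theta>^2) * (ennreal (\<bar>v z\<bar> powr q) * (\<integral>\<^sup>+x. ennreal (kernel \<delta> 0 0 (z - (c + \<theta> *\<^sub>R x))) \<partial>lborel)) = ennreal (\<bar>v z\<bar> powr q)"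
      by (subst mult.left_commute) (simp only: nn_integral_kernel_reflected[OF \<delta> \<theta>] mult_1_right)
  qed
  finally show ?thesis .
qed

text \<open>
  Sums and dominated limits preserve approximability, so only the indicator of a set
  \<open>A\<close> matters. Regularity of the measure encloses \<open>A\<close> between a
  compact \<open>K\<close> and an open \<open>U\<close> of almost the same measure; a function
  of the distance to \<open>K\<close> that vanishes off \<open>U\<close> is the required
  approximation.
\<close>

lemma continuous_L1_dense:
  fixes v :: "'a::euclidean_space \<Rightarrow> real"
  assumes "integrable lborel v" "0 < \<epsilon>"
  shows "\<exists>g. uniformly_continuous_on UNIV g \<and> integrable lborel g \<and> (\<integral>\<^sup>+x. ennreal \<bar>v x - g x\<bar> \<partial>lborel) \<le> ennreal \<epsilon>"
  using assms
proof (induction arbitrary: \<epsilon>)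
  case (base A c)
  then have A [measurable]: "A \<in> sets borel" by simp
  define e where "e = \<epsilon> / (2 * (\<bar>c\<bar> + 1))"
  have e: "0 < e" using base by (simp add: e_def)
  let ?M = "density lborel (indicator A)"
  have M: "emeasure ?M B = emeasure lborel (A \<inter> B)" if "B \<in> sets borel" for B
    using that by (simp add: emeasure_density nn_integral_indicator flip: indicator_inter_arith)
  have "emeasure ?M A = (SUP K\<in>{K. K \<subseteq> A \<and> compact K}. emeasure ?M K)"
    using base by (intro inner_regular) (auto simp: M)
  then have "emeasure lborel A = (SUP K\<in>{K. K \<subseteq> A \<and> compact K}. emeasure ?M K)"
    by (simp add: M)
  also have "\<dots> = (SUP K\<in>{K. K \<subseteq> A \<and> compact K}. emeasure lborel K)"
    by (intro SUP_cong) (auto simp: M compact_imp_closed Int_absorb1)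
  finally have sup: "emeasure lborel A = (SUP K\<in>{K. K \<subseteq> A \<and> compact K}. emeasure lborel K)" .
  have "\<exists>K\<in>{K. K \<subseteq> A \<and> compact K}. emeasure lborel A < emeasure lborel K + ennreal e"
    using base(2) by (intro SUP_approx_ennreal[OF e _ sup]) auto
  then obtain K where K: "K \<subseteq> A" "compact K" "emeasure lborel A < emeasure lborel K + ennreal e" by auto
  have Km [measurable]: "K \<in> sets borel" using K by (simp add: compact_imp_closed)
  have Kfin: "emeasure lborel K < \<infinity>" using emeasure_bounded_finite[OF compact_imp_bounded[OF K(2)]] by simp
  have AK: "emeasure lborel (A - K) \<le> ennreal e"
    using K Kfin by (subst emeasure_Diff) (auto simp: ennreal_minus_le_iff less_imp_le top_unique)
  obtain U where U: "open U" "A \<subseteq> U" "emeasure lborel (U - A) < ennreal e"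
    using outer_regular_lborel[OF A e] by blast
  have Um [measurable]: "U \<in> sets borel" using U by simp
  have UA: "emeasure lborel (U - K) \<le> ennreal (2 * e)"
  proof -
    have "emeasure lborel (U - K) \<le> emeasure lborel ((U - A) \<union> (A - K))" by (intro emeasure_mono) auto
    also have "\<dots> \<le> emeasure lborel (U - A) + emeasure lborel (A - K)" by (intro emeasure_subadditive) auto
    also have "\<dots> \<le> ennreal e + ennreal e" using U AK by (intro add_mono) auto
    finally show ?thesis using e by (simp flip: ennreal_plus)
  qed
  have Ufin: "emeasure lborel U < \<infinity>"
  proof -
    have "emeasure lborel U \<le> emeasure lborel ((U - K) \<union> K)" by (intro emeasure_mono) auto
    also have "\<dots> \<le> emeasure lborel (U - K) + emeasure lborel K" by (intro emeasure_subadditive) auto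
    also have "\<dots> < \<infinity>" using UA Kfin by (auto simp: top.not_eq_extremum intro: order.strict_trans1)
    finally show ?thesis .
  qed
  obtain d where d: "0 < d" "(\<Union>x\<in>K. ball x d) \<subseteq> U"
    using compact_subset_open_imp_ball_epsilon_subset[of K U] K U by blast
  \<comment> \<open>the case distinction is there because the distance to the empty set is 0 by convention\<close>
  define g where "g x = (if K = {} then 0 else c * max 0 (1 - infdist x K / d))" for x
  have lip: "\<bar>g x - g y\<bar> \<le> \<bar>c\<bar> / d * dist x y" for x y
  proof (cases "K = {}")
    case False
    have "\<bar>max 0 (1 - infdist x K / d) - max 0 (1 - infdist y K / d)\<bar> \<le> \<bar>infdist x K / d - infdist y K / d\<bar>" by linarith
    also have "\<dots> = \<bar>infdist x K - infdist y K\<bar> / d" using d by (simp flip: diff_divide_distrib)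
    also have "\<dots> \<le> dist x y / d" using infdist_triangle_abs d by (intro divide_right_mono) auto
    finally have "\<bar>c\<bar> * \<bar>max 0 (1 - infdist x K / d) - max 0 (1 - infdist y K / d)\<bar> \<le> \<bar>c\<bar> * (dist x y / d)"
      by (intro mult_left_mono) auto
    then show ?thesis using False by (simp add: g_def flip: abs_mult right_diff_distrib)
  qed (use d in \<open>simp add: g_def\<close>)
  have uc: "uniformly_continuous_on UNIV g"
    unfolding uniformly_continuous_on_def
  proof safe
    fix \<eta> :: real assume \<eta>: "0 < \<eta>"
    have "dist (g x) (g y) < \<eta>" if "dist x y < \<eta> * d / (\<bar>c\<bar> + 1)" for x y
    proof -
      have "dist (g x) (g y) \<le> \<bar>c\<bar> / d * dist x y" using lip by (simp add: dist_real_def)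
      also have "\<dots> \<le> (\<bar>c\<bar> + 1) / d * dist x y" using d by (intro mult_right_mono divide_right_mono) auto
      also have "\<dots> < \<eta>" using that d by (simp add: field_simps)
      finally show ?thesis .
    qed
    then show "\<exists>r>0. \<forall>x\<in>UNIV. \<forall>x'\<in>UNIV. dist x' x < r \<longrightarrow> dist (g x') (g x) < \<eta>"
      using \<eta> d by (intro exI[of _ "\<eta> * d / (\<bar>c\<bar> + 1)"]) auto
  qed
  have gm [measurable]: "g \<in> borel_measurable borel"
    using uc by (intro borel_measurable_continuous_onI uniformly_continuous_imp_continuous)
  have gK: "g x = c" if "x \<in> K" for x using that by (auto simp: g_def)
  have gU: "g x = 0" if "x \<notin> U" for x
  proof (cases "K = {}")
    case False
    obtain a where a: "a \<in> K" "infdist x K = dist x a"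
      using infdist_attains_inf[of K x] False K by (auto simp: compact_imp_closed)
    have "d \<le> dist x a" using that d a by (force simp: dist_commute)
    then show ?thesis using a d by (simp add: g_def)
  qed (simp add: g_def)
  have gc: "\<bar>g x\<bar> \<le> \<bar>c\<bar>" "\<bar>c - g x\<bar> \<le> \<bar>c\<bar>" for x
  proof -
    define m where "m = max 0 (1 - infdist x K / d)"
    have m: "0 \<le> m" "m \<le> 1" using infdist_nonneg[of x K] d by (auto simp: m_def)
    have 1: "\<bar>c * m\<bar> \<le> \<bar>c\<bar>" using m by (simp add: abs_mult mult_left_le)
    have "\<bar>c - c * m\<bar> = \<bar>c\<bar> * (1 - m)" using m by (simp add: abs_mult flip: right_diff_distrib[of c 1, simplified])
    also have "\<dots> \<le> \<bar>c\<bar>" using m by (simp add: mult_left_le)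
    finally show "\<bar>g x\<bar> \<le> \<bar>c\<bar>" "\<bar>c - g x\<bar> \<le> \<bar>c\<bar>" using 1 by (auto simp: g_def m_def)
  qed
  have gi: "integrable lborel g"
  proof (rule Bochner_Integration.integrable_bound)
    show "integrable lborel (\<lambda>x. c * indicator U x)" using Ufin by simp
    show "AE x in lborel. norm (g x) \<le> norm (c * indicator U x)"
      using gc gU by (intro AE_I2) (auto split: split_indicator)
  qed measurable
  have "(\<integral>\<^sup>+x. ennreal \<bar>indicator A x *\<^sub>R c - g x\<bar> \<partial>lborel) \<le> (\<integral>\<^sup>+x. ennreal \<bar>c\<bar> * indicator (U - K) x \<partial>lborel)"
  proof (intro nn_integral_mono)
    fix x
    have "\<bar>indicator A x *\<^sub>R c - g x\<bar> \<le> \<bar>c\<bar> * indicator (U - K) x"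
      using gK[of x] gU[of x] gc[of x] K(1) U(2) by (auto split: split_indicator)
    then have "ennreal \<bar>indicator A x *\<^sub>R c - g x\<bar> \<le> ennreal (\<bar>c\<bar> * indicator (U - K) x)" by (rule ennreal_leI)
    then show "ennreal \<bar>indicator A x *\<^sub>R c - g x\<bar> \<le> ennreal \<bar>c\<bar> * indicator (U - K) x"
      by (simp add: ennreal_mult ennreal_indicator)
  qed
  also have "\<dots> = ennreal \<bar>c\<bar> * emeasure lborel (U - K)" by (subst nn_integral_cmult_indicator) auto
  also have "\<dots> \<le> ennreal \<bar>c\<bar> * ennreal (2 * e)" by (intro mult_left_mono UA) auto
  also have "\<dots> = ennreal (\<bar>c\<bar> * (2 * e))" using e by (simp add: ennreal_mult)
  also have "\<dots> \<le> ennreal \<epsilon>" using base(3) by (intro ennreal_leI) (simp add: e_def field_simps)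
  finally show ?case using uc gi by blast
next
  case (add f1 f2)
  have e2: "0 < \<epsilon> / 2" using add by simp
  obtain g1 where g1: "uniformly_continuous_on UNIV g1" "integrable lborel g1" "(\<integral>\<^sup>+x. ennreal \<bar>f1 x - g1 x\<bar> \<partial>lborel) \<le> ennreal (\<epsilon> / 2)"
    using add.IH(1)[OF e2] by blast
  obtain g2 where g2: "uniformly_continuous_on UNIV g2" "integrable lborel g2" "(\<integral>\<^sup>+x. ennreal \<bar>f2 x - g2 x\<bar> \<partial>lborel) \<le> ennreal (\<epsilon> / 2)"
    using add.IH(2)[OF e2] by blast
  have [measurable]: "f1 \<in> borel_measurable borel" "f2 \<in> borel_measurable borel" "g1 \<in> borel_measurable borel" "g2 \<in> borel_measurable borel"
    using add g1 g2 by auto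
  have "(\<integral>\<^sup>+x. ennreal \<bar>(f1 x + f2 x) - (g1 x + g2 x)\<bar> \<partial>lborel) \<le> (\<integral>\<^sup>+x. ennreal \<bar>f1 x - g1 x\<bar> + ennreal \<bar>f2 x - g2 x\<bar> \<partial>lborel)"
  proof (intro nn_integral_mono)
    fix x
    have "ennreal \<bar>(f1 x + f2 x) - (g1 x + g2 x)\<bar> \<le> ennreal (\<bar>f1 x - g1 x\<bar> + \<bar>f2 x - g2 x\<bar>)" by (intro ennreal_leI) linarith
    then show "ennreal \<bar>(f1 x + f2 x) - (g1 x + g2 x)\<bar> \<le> ennreal \<bar>f1 x - g1 x\<bar> + ennreal \<bar>f2 x - g2 x\<bar>" by simp
  qed
  also have "\<dots> = (\<integral>\<^sup>+x. ennreal \<bar>f1 x - g1 x\<bar> \<partial>lborel) + (\<integral>\<^sup>+x. ennreal \<bar>f2 x - g2 x\<bar> \<partial>lborel)"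
    by (rule nn_integral_add) auto
  also have "\<dots> \<le> ennreal (\<epsilon> / 2) + ennreal (\<epsilon> / 2)" by (intro add_mono g1 g2)
  also have "\<dots> = ennreal \<epsilon>" using add by (simp flip: ennreal_plus)
  finally show ?case using g1 g2
    by (intro exI[of _ "\<lambda>x. g1 x + g2 x"] conjI uniformly_continuous_on_add) auto
next
  case (lim f s)
  have e2: "0 < \<epsilon> / 2" using lim by simp
  have [measurable]: "f \<in> borel_measurable borel" "s i \<in> borel_measurable borel" for i
    using lim by auto
  have "(\<lambda>i. \<integral>\<^sup>+x. ennreal (norm (f x - s i x)) \<partial>lborel) \<longlonglongrightarrow> 0"
    using lim by (intro nn_integral_dominated_convergence_norm[where w="\<lambda>x. 2 * norm (f x)"])
      (auto simp: nn_integral_cmult ennreal_mult integrable_iff_bounded ennreal_mult_less_top)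
  then have "\<forall>\<^sub>F i in sequentially. (\<integral>\<^sup>+x. ennreal (norm (f x - s i x)) \<partial>lborel) < ennreal (\<epsilon> / 2)"
    using e2 by (intro order_tendstoD) auto
  then obtain i where i: "(\<integral>\<^sup>+x. ennreal \<bar>f x - s i x\<bar> \<partial>lborel) < ennreal (\<epsilon> / 2)"
    by (auto simp: eventually_sequentially)
  obtain g where g: "uniformly_continuous_on UNIV g" "integrable lborel g" "(\<integral>\<^sup>+x. ennreal \<bar>s i x - g x\<bar> \<partial>lborel) \<le> ennreal (\<epsilon> / 2)"
    using lim.IH[OF e2] by blast
  have [measurable]: "g \<in> borel_measurable borel" using g by auto
  have "(\<integral>\<^sup>+x. ennreal \<bar>f x - g x\<bar> \<partial>lborel) \<le> (\<integral>\<^sup>+x. ennreal \<bar>f x - s i x\<bar> + ennreal \<bar>s i x - g x\<bar> \<partial>lborel)"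
    by (intro nn_integral_mono ennreal_triangle)
  also have "\<dots> = (\<integral>\<^sup>+x. ennreal \<bar>f x - s i x\<bar> \<partial>lborel) + (\<integral>\<^sup>+x. ennreal \<bar>s i x - g x\<bar> \<partial>lborel)"
    by (rule nn_integral_add) auto
  also have "\<dots> \<le> ennreal (\<epsilon> / 2) + ennreal (\<epsilon> / 2)" using i g by (intro add_mono) auto
  also have "\<dots> = ennreal \<epsilon>" using lim by (simp flip: ennreal_plus)
  finally show ?case using g by blast
qed

lemma mollify_close:
  assumes \<delta>: "0 < \<delta>" and g: "integrable lborel g"
    and close: "\<And>z. z - y \<in> box (vec (-\<delta>)) (vec \<delta>) \<Longrightarrow> \<bar>g z - a\<bar> \<le> \<eta>"
  shows "\<bar>mollify \<delta> 0 0 g y - a\<bar> \<le> \<eta>"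
proof -
  note k = kernel_integral[OF \<delta>, of y]
  have "mollify \<delta> 0 0 g y - a = (\<integral>z. g z * kernel \<delta> 0 0 (z - y) - a * kernel \<delta> 0 0 (z - y) \<partial>lborel)"
    unfolding mollify_def using k integrable_mult_kernel[OF \<delta> g] by simp
  also have "\<bar>\<dots>\<bar> \<le> (\<integral>z. \<eta> * kernel \<delta> 0 0 (z - y) \<partial>lborel)"
  proof (rule integral_abs_bound_integral)
    fix z
    show "\<bar>g z * kernel \<delta> 0 0 (z - y) - a * kernel \<delta> 0 0 (z - y)\<bar> \<le> \<eta> * kernel \<delta> 0 0 (z - y)"
    proof (cases "z - y \<in> box (vec (-\<delta>)) (vec \<delta>)")
      case True
      have "\<bar>g z * kernel \<delta> 0 0 (z - y) - a * kernel \<delta> 0 0 (z - y)\<bar> = \<bar>g z - a\<bar> * kernel \<delta> 0 0 (z - y)"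
        using kernel_nonneg[OF \<delta>] by (simp add: abs_mult flip: left_diff_distrib)
      also have "\<dots> \<le> \<eta> * kernel \<delta> 0 0 (z - y)"
        using close[OF True] kernel_nonneg[OF \<delta>] by (rule mult_right_mono)
      finally show ?thesis .
    qed (simp add: kernel_eq_0[OF \<delta>])
  qed (use k integrable_mult_kernel[OF \<delta> g] in simp_all)
  also have "\<dots> = \<eta>" using k by simp
  finally show ?thesis .
qed

lemma mollify_diff:
  assumes "0 < \<delta>" "integrable lborel u" "integrable lborel v"
  shows "mollify \<delta> i j (\<lambda>x. u x - v x) y = mollify \<delta> i j u y - mollify \<delta> i j v y"
  unfolding mollify_def using integrable_mult_kernel[OF assms(1)] assms(2,3) by (simp add: left_diff_distrib)

lemma norm_le_box:
  assumes "z \<in> box (vec (-\<delta>)) (vec \<delta> :: real^2)"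
  shows "norm z \<le> 2 * \<delta>"
proof -
  have "norm z \<le> (\<Sum>i\<in>UNIV. \<bar>z$i\<bar>)" by (rule norm_le_l1_cart)
  also have "\<dots> \<le> \<delta> + \<delta>" using assms
    by (auto simp: UNIV_2 mem_box_cart forall_2 intro!: add_mono)
  finally show ?thesis by simp
qed

lemma mollify_measurable [measurable]:
  assumes "0 < \<delta>" "integrable lborel v"
  shows "mollify \<delta> i j v \<in> borel_measurable borel"
  by (rule borel_measurable_continuous_onI[OF continuous_mollify[OF assms]])

text \<open>
  For a uniformly continuous \<open>g\<close> near \<open>v\<close> in \<open>L\<^sup>1\<close>
  the mollified values are uniformly close to \<open>g x\<close>, since the kernel sits near
  \<open>x\<close>; the mollification of \<open>v - g\<close> has \<open>L\<^sup>1\<close> norm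
  at most \<open>\<theta>\<^sup>-\<^sup>2 \<le> 4\<close> times that of \<open>v - g\<close>.
\<close>

lemma mollify_tendsto_L1:
  fixes c :: "nat \<Rightarrow> real^2"
  assumes v: "integrable lborel v" and B [measurable]: "B \<in> sets borel" and bnd: "bounded B"
    and c: "c \<longlonglongrightarrow> 0" and \<theta>: "\<theta> \<longlonglongrightarrow> 1" and \<delta>: "\<delta> \<longlonglongrightarrow> 0"
    and \<delta>0: "\<And>n. 0 < \<delta> n" and \<theta>2: "\<And>n. 1/2 \<le> \<theta> n"
  shows "(\<lambda>n. \<integral>\<^sup>+x. ennreal \<bar>mollify (\<delta> n) 0 0 v (c n + \<theta> n *\<^sub>R x) - v x\<bar> * indicator B x \<partial>lborel) \<longlonglongrightarrow> 0"
    (is "?F \<longlonglongrightarrow> 0")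
proof (rule order_tendstoI)
  fix a :: ennreal assume "0 < a"
  then obtain b where b: "0 < b" "b < a" using dense by blast
  then obtain \<epsilon> where \<epsilon>: "0 < \<epsilon>" "ennreal \<epsilon> < a" by (cases b) auto
  have [measurable]: "v \<in> borel_measurable borel" using v by auto
  define m where "m = measure lborel B"
  have Bfin: "emeasure lborel B = ennreal m" unfolding m_def
    using emeasure_bounded_finite[OF bnd] by (intro emeasure_eq_ennreal_measure) auto
  have m: "0 \<le> m" by (simp add: m_def)
  obtain M where M: "\<And>x. x \<in> B \<Longrightarrow> norm x \<le> M" using bnd by (auto simp: bounded_iff)
  \<comment> \<open>error budget: 4 * (\<epsilon> / 12) for the mollification of v - g, \<epsilon> / 4 for the oscillation of g on B, \<epsilon> / 12 for v - g\<close>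
  define \<eta> where "\<eta> = \<epsilon> / (4 * (m + 1))"
  have \<eta>: "0 < \<eta>" "\<eta> * m \<le> \<epsilon> / 4" using \<epsilon> m by (auto simp: \<eta>_def field_simps)
  have "0 < \<epsilon> / 12" using \<epsilon> by simp
  then obtain g where g: "uniformly_continuous_on UNIV g" "integrable lborel g"
      "(\<integral>\<^sup>+x. ennreal \<bar>v x - g x\<bar> \<partial>lborel) \<le> ennreal (\<epsilon> / 12)"
    using continuous_L1_dense[OF v] by blast
  have gm [measurable]: "g \<in> borel_measurable borel" using g by auto
  obtain r where r: "0 < r" "\<And>x z. dist z x < r \<Longrightarrow> dist (g z) (g x) < \<eta>"
    using g(1) \<eta> unfolding uniformly_continuous_on_def by auto
  have "(\<lambda>n. norm (c n) + \<bar>\<theta> n - 1\<bar> * M + 2 * \<delta> n) \<longlonglongrightarrow> norm (0 :: real^2) + \<bar>1 - 1\<bar> * M + 2 * 0"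
    by (intro tendsto_intros c \<theta> \<delta>)
  then have "\<forall>\<^sub>F n in sequentially. norm (c n) + \<bar>\<theta> n - 1\<bar> * M + 2 * \<delta> n < r"
    using r by (intro order_tendstoD) auto
  then show "\<forall>\<^sub>F n in sequentially. ?F n < a"
  proof eventually_elim
    case (elim n)
    let ?y = "\<lambda>x. c n + \<theta> n *\<^sub>R x"
    note d = \<delta>0[of n]
    have vg: "integrable lborel (\<lambda>x. v x - g x)" using v g by simp
    have [measurable]: "mollify (\<delta> n) 0 0 (\<lambda>x. v x - g x) \<in> borel_measurable borel"
      using mollify_measurable[OF d vg] .
    have pt: "\<bar>mollify (\<delta> n) 0 0 g (?y x) - g x\<bar> \<le> \<eta>" if x: "x \<in> B" for x
    proof (rule mollify_close[OF d g(2)])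
      fix z assume "z - ?y x \<in> box (vec (- \<delta> n)) (vec (\<delta> n))"
      then have 1: "norm (z - ?y x) \<le> 2 * \<delta> n" by (rule norm_le_box)
      have "z - x = (z - ?y x) + c n + (\<theta> n - 1) *\<^sub>R x" by (simp add: algebra_simps)
      then have "norm (z - x) \<le> norm (z - ?y x) + norm (c n) + norm ((\<theta> n - 1) *\<^sub>R x)"
        by (metis norm_triangle_le norm_triangle_ineq add_right_mono)
      also have "\<dots> \<le> 2 * \<delta> n + norm (c n) + \<bar>\<theta> n - 1\<bar> * M"
        using 1 M[OF x] by (auto intro!: add_mono mult_left_mono)
      finally have "dist z x < r" using elim by (simp add: dist_norm)
      then show "\<bar>g z - g x\<bar> \<le> \<eta>" using r(2) by (force simp: dist_real_def)
    qed
    have "?F n \<le> (\<integral>\<^sup>+x. ennreal \<bar>mollify (\<delta> n) 0 0 (\<lambda>x. v x - g x) (?y x)\<bar> + (ennreal \<eta> * indicator B x + ennreal \<bar>v x - g x\<bar>) \<partial>lborel)"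
    proof (intro nn_integral_mono)
      fix x
      have "ennreal \<bar>mollify (\<delta> n) 0 0 v (?y x) - v x\<bar> \<le> ennreal (\<bar>mollify (\<delta> n) 0 0 (\<lambda>x. v x - g x) (?y x)\<bar> + (\<eta> + \<bar>v x - g x\<bar>))" if "x \<in> B"
        using pt[OF that] unfolding mollify_diff[OF d v g(2)] by (intro ennreal_leI) linarith
      then show "ennreal \<bar>mollify (\<delta> n) 0 0 v (?y x) - v x\<bar> * indicator B x
         \<le> ennreal \<bar>mollify (\<delta> n) 0 0 (\<lambda>x. v x - g x) (?y x)\<bar> + (ennreal \<eta> * indicator B x + ennreal \<bar>v x - g x\<bar>)"
        using \<eta> by (auto split: split_indicator simp: ennreal_plus[symmetric] simp del: ennreal_plus)
    qed
    also have "\<dots> = (\<integral>\<^sup>+x. ennreal \<bar>mollify (\<delta> n) 0 0 (\<lambda>x. v x - g x) (?y x)\<bar> \<partial>lborel) + (ennreal \<eta> * emeasure lborel B + (\<integral>\<^sup>+x. ennreal \<bar>v x - g x\<bar> \<partial>lborel))"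
      by (simp add: nn_integral_add nn_integral_cmult_indicator)
    also have "\<dots> \<le> ennreal (4 * (\<epsilon> / 12)) + (ennreal (\<epsilon> / 4) + ennreal (\<epsilon> / 12))"
    proof (intro add_mono g)
      let ?I = "\<integral>\<^sup>+x. ennreal \<bar>mollify (\<delta> n) 0 0 (\<lambda>x. v x - g x) (?y x)\<bar> \<partial>lborel"
      have \<theta>n: "0 < \<theta> n" using \<theta>2[of n] by simp
      have "(1/2)^2 \<le> (\<theta> n)^2" using \<theta>2[of n] by (intro power_mono) auto
      then have "1 \<le> 4 * (\<theta> n)^2" by (simp add: power2_eq_square)
      then have "1 * ?I \<le> ennreal (4 * (\<theta> n)^2) * ?I" by (intro mult_right_mono) auto
      also have "\<dots> = 4 * (ennreal ((\<theta> n)^2) * ?I)" by (simp add: ennreal_mult mult.assoc)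
      also have "\<dots> \<le> 4 * (\<integral>\<^sup>+x. ennreal \<bar>v x - g x\<bar> \<partial>lborel)"
        using nn_integral_mollify_power_le[OF d \<theta>n vg, of 1 "c n"] by (intro mult_left_mono) auto
      also have "\<dots> \<le> 4 * ennreal (\<epsilon> / 12)" by (intro mult_left_mono g) auto
      also have "\<dots> = ennreal (4 * (\<epsilon> / 12))" using \<epsilon> by (subst ennreal_mult) auto
      finally show "?I \<le> ennreal (4 * (\<epsilon> / 12))" by simp
      show "ennreal \<eta> * emeasure lborel B \<le> ennreal (\<epsilon> / 4)"
        unfolding Bfin using \<eta> m by (simp flip: ennreal_mult add: ennreal_leI)
    qed
    also have "\<dots> = ennreal (4 * (\<epsilon> / 12) + (\<epsilon> / 4 + \<epsilon> / 12))" using \<epsilon> by (simp flip: ennreal_plus)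
    also have "\<dots> < a" using \<epsilon> by (intro le_less_trans[OF ennreal_leI \<epsilon>(2)]) auto
    finally show ?case .
  qed
qed simp

text \<open>
  Membership in \<open>L\<^sup>p\<close> is a matter of the Lebesgue completion on
  \<open>C\<close>, whereas Fubini and substitution are applied to Borel functions on the whole
  plane. Extension by zero and a change on a null set link the two.
\<close>

lemma borel_representative:
  fixes u :: "real^2 \<Rightarrow> real"
  assumes C: "C \<in> sets borel" and u: "u \<in> borel_measurable (lebesgue_on C)"
  shows "\<exists>u'\<in>borel_measurable borel. (\<forall>x. x \<notin> C \<longrightarrow> u' x = 0) \<and> (AE x in lebesgue. indicator C x * u x = u' x)"
proof -
  have "(\<lambda>x. indicator C x *\<^sub>R u x) \<in> borel_measurable lebesgue"
    using u C by (subst borel_measurable_restrict_space_iff[symmetric]) auto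
  then obtain u' where u': "u' \<in> borel_measurable lborel" "AE x in lborel. indicator C x *\<^sub>R u x = u' x"
    using completion_ex_borel_measurable_real by blast
  have "AE x in lebesgue. indicator C x * u x = indicator C x * u' x"
    using AE_completion[OF u'(2)] by eventually_elim (auto split: split_indicator)
  then show ?thesis using u' C by (intro bexI[of _ "\<lambda>x. indicator C x * u' x"]) auto
qed

lemma integral_lebesgue_on_eq_lborel:
  fixes f h g :: "real^2 \<Rightarrow> real"
  assumes \<Omega>: "\<Omega> \<in> sets borel" and fh: "\<And>x. indicator \<Omega> x * f x = h x"
    and hg: "AE x in lebesgue. h x = g x" and g: "g \<in> borel_measurable borel"
    and h: "h \<in> borel_measurable lebesgue"
  shows "integral\<^sup>L (lebesgue_on \<Omega>) f = integral\<^sup>L lborel g"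
proof -
  have gl: "g \<in> borel_measurable lebesgue" using g by (intro measurable_completion) simp
  have "integral\<^sup>L (lebesgue_on \<Omega>) f = integral\<^sup>L lebesgue h"
    using \<Omega> fh by (subst integral_restrict_space) auto
  also have "\<dots> = integral\<^sup>L lebesgue g"
    using h gl hg by (intro integral_cong_AE) auto
  also have "\<dots> = integral\<^sup>L lborel g"
    using g by (intro integral_completion) simp
  finally show ?thesis .
qed

section \<open>Weak derivatives\<close>

lemma integral_translation:
  fixes \<psi> :: "'a::euclidean_space \<Rightarrow> real"
  assumes [measurable]: "\<psi> \<in> borel_measurable borel"
  shows "(\<integral>x. \<psi> (x + c) \<partial>lborel) = (\<integral>x. \<psi> x \<partial>lborel)"
proof -
  have "(\<integral>x. \<psi> x \<partial>lborel) = (\<integral>x. \<psi> x \<partial>distr lborel borel ((+) c))" by (simp add: lborel_distr_plus)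
  also have "\<dots> = (\<integral>x. \<psi> (c + x) \<partial>lborel)" by (rule integral_distr) auto
  finally show ?thesis by (simp add: add.commute)
qed

lemma bounded_support_integrable:
  fixes f :: "'a::euclidean_space \<Rightarrow> real"
  assumes "continuous_on UNIV f" "\<And>x. x \<notin> cball 0 M \<Longrightarrow> f x = 0"
  shows "integrable lborel f"
proof -
  have "integrable lborel (\<lambda>x. indicator (cball 0 M) x *\<^sub>R f x)"
    using assms(1) by (intro borel_integrable_compact) (auto intro: continuous_on_subset)
  moreover have "(\<lambda>x. indicator (cball 0 M) x *\<^sub>R f x) = f" using assms(2) by (auto simp: fun_eq_iff split: split_indicator)
  ultimately show ?thesis by simp
qed

text \<open>
  Difference quotients of a compactly supported function integrate to zero by translation
  invariance of Lebesgue measure, and dominated convergence passes to the derivative. Applied to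
  products, this is integration by parts.
\<close>

lemma integral_directional_derivative_eq_0:
  fixes \<psi> \<psi>' :: "'a::euclidean_space \<Rightarrow> real"
  assumes d: "\<And>x r. ((\<lambda>r. \<psi> (x + r *\<^sub>R e)) has_real_derivative \<psi>' (x + r *\<^sub>R e)) (at r)"
    and c: "continuous_on UNIV \<psi>" and c': "continuous_on UNIV \<psi>'"
    and supp: "\<And>x. x \<notin> cball 0 M \<Longrightarrow> \<psi> x = 0" and e: "norm e \<le> 1"
  shows "(\<integral>x. \<psi>' x \<partial>lborel) = 0"
proof -
  have [measurable]: "\<psi> \<in> borel_measurable borel" "\<psi>' \<in> borel_measurable borel"
    using c c' by (auto intro!: borel_measurable_continuous_onI)
  have "bounded (\<psi>' ` cball 0 (M + 2))"
    by (intro compact_imp_bounded compact_continuous_image continuous_on_subset[OF c']) auto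
  then obtain B where B: "\<And>x. x \<in> cball 0 (M + 2) \<Longrightarrow> \<bar>\<psi>' x\<bar> \<le> B" unfolding bounded_iff by fastforce
  \<comment> \<open>steps of length at most 1 keep all shifted supports in the ball of radius M + 1\<close>
  define h where "h n = 1 / real (Suc n)" for n
  have h: "0 < h n" "h n \<le> 1" for n by (auto simp: h_def)
  have h0: "h \<longlonglongrightarrow> 0" unfolding h_def by (rule LIMSEQ_Suc[OF lim_1_over_n])
  define s where "s n x = (\<psi> (x + h n *\<^sub>R e) - \<psi> x) / h n" for n x
  have int: "integrable lborel \<psi>" using c supp by (rule bounded_support_integrable)
  have int2: "integrable lborel (\<lambda>x. \<psi> (x + a))" for a
  proof -
    have "integrable (distr lborel borel ((+) a)) \<psi>" using int by (simp add: lborel_distr_plus)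
    then show ?thesis by (subst (asm) integrable_distr_eq) (auto simp: add.commute)
  qed
  have s0: "(\<integral>x. s n x \<partial>lborel) = 0" for n
    unfolding s_def using int int2 by (simp add: integral_translation)
  have "(\<lambda>n. \<integral>x. s n x \<partial>lborel) \<longlonglongrightarrow> (\<integral>x. \<psi>' x \<partial>lborel)"
  proof (rule integral_dominated_convergence[where w="\<lambda>x. indicator (cball 0 (M + 1)) x * B"])
    show "\<psi>' \<in> borel_measurable lborel" by simp
    show "s n \<in> borel_measurable lborel" for n unfolding s_def by measurable
    show "integrable lborel (\<lambda>x. indicator (cball 0 (M + 1)) x * B)"
      using emeasure_bounded_finite[of "cball 0 (M + 1)"] by (intro integrable_mult_left) (auto)
    show "AE x in lborel. (\<lambda>n. s n x) \<longlonglongrightarrow> \<psi>' x"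
    proof (rule AE_I2)
      fix x
      have "((\<lambda>r. (\<psi> (x + (0 + r) *\<^sub>R e) - \<psi> (x + 0 *\<^sub>R e)) / r) \<longlongrightarrow> \<psi>' (x + 0 *\<^sub>R e)) (at 0)"
        using d[of x 0] unfolding DERIV_def .
      then have "((\<lambda>r. (\<psi> (x + r *\<^sub>R e) - \<psi> x) / r) \<longlongrightarrow> \<psi>' x) (at 0)" by simp
      moreover have "filterlim h (at 0) sequentially"
        using h0 h by (auto simp: filterlim_at less_imp_neq[OF h(1), symmetric])
      ultimately show "(\<lambda>n. s n x) \<longlonglongrightarrow> \<psi>' x" unfolding s_def by (rule filterlim_compose)
    qed
    show "AE x in lborel. norm (s n x) \<le> indicator (cball 0 (M + 1)) x * B" for n
    proof (rule AE_I2)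
      fix x
      have he: "norm (r *\<^sub>R e) \<le> 1" if "0 \<le> r" "r \<le> h n" for r
        using e that h[of n] by (simp add: mult_le_one)
      show "norm (s n x) \<le> indicator (cball 0 (M + 1)) x * B"
      proof (cases "x \<in> cball 0 (M + 1)")
        case True
        obtain z where z: "0 < z" "z < h n" "\<psi> (x + h n *\<^sub>R e) - \<psi> (x + 0 *\<^sub>R e) = (h n - 0) * \<psi>' (x + z *\<^sub>R e)"
          using MVT2[of 0 "h n", OF h(1) d] by blast
        have "norm (x + z *\<^sub>R e) \<le> M + 2" using norm_triangle_ineq[of x "z *\<^sub>R e"] he[of z] z True by auto
        then show ?thesis using True z(3) h[of n] B[of "x + z *\<^sub>R e"] by (simp add: s_def)
      next
        case False
        have "norm x - 1 \<le> norm (x + h n *\<^sub>R e)" using norm_diff_ineq[of x "h n *\<^sub>R e"] he[of "h n"] h[of n] by simp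
        then have "\<psi> (x + h n *\<^sub>R e) = 0" "\<psi> x = 0" using False by (auto intro!: supp)
        then show ?thesis using False by (simp add: s_def)
      qed
    qed
  qed
  then show ?thesis unfolding s0 using LIMSEQ_const_iff by metis
qed

context
  fixes \<Omega> :: "(real^2) set" and \<phi> :: "real^2 \<Rightarrow> real"
  assumes t: "test_function \<Omega> \<phi>"
begin

lemma test_function_diff:
  "\<phi> differentiable (at x)" "partial_deriv i \<phi> differentiable (at x)"
  using t[unfolded test_function_def, THEN conjunct1, rule_format, of "[]"]
    t[unfolded test_function_def, THEN conjunct1, rule_format, of "[i]"]
  by (auto simp: partial_derivs_def differentiable_on_def)

lemma test_function_continuous: "continuous_on UNIV \<phi>" "continuous_on UNIV (partial_deriv i \<phi>)"
  using test_function_diff differentiable_imp_continuous_within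
  by (simp_all add: continuous_on_eq_continuous_within) blast+

lemma test_function_line:
  "((\<lambda>r. \<phi> (x + r *\<^sub>R axis i 1)) has_real_derivative partial_deriv i \<phi> (x + r *\<^sub>R axis i 1)) (at r)"
proof -
  have 1: "((\<lambda>r. x + r *\<^sub>R axis i 1) has_derivative (\<lambda>k. k *\<^sub>R axis i 1)) (at r)"
    by (auto intro!: derivative_eq_intros)
  have 2: "(\<phi> has_derivative frechet_derivative \<phi> (at y)) (at y)" for y
    using test_function_diff(1) by (simp add: frechet_derivative_works)
  have "linear (frechet_derivative \<phi> (at y))" for y
    using 2 has_derivative_linear by blast
  then show ?thesis using has_derivative_compose[OF 1 2]
    unfolding has_field_derivative_def partial_deriv_def
    by (elim has_derivative_eq_rhs) (auto simp: linear_cmul mult.commute)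
qed

lemma test_function_eq_0:
  assumes "x \<notin> \<Omega>" shows "\<phi> x = 0" "partial_deriv i \<phi> x = 0"
proof -
  let ?S = "closure {x. \<phi> x \<noteq> 0}"
  have S: "?S \<subseteq> \<Omega>" using t by (simp add: test_function_def)
  have S0: "\<phi> y = 0" if "y \<notin> ?S" for y
    using that subsetD[OF closure_subset, of y "{x. \<phi> x \<noteq> 0}"] by blast
  show "\<phi> x = 0" using assms S S0 by blast
  have "((\<lambda>_. 0) has_derivative (\<lambda>_. 0)) (at x)" by simp
  then have "(\<phi> has_derivative (\<lambda>_. 0)) (at x)"
  proof (rule has_derivative_transform_within_open[where s="- ?S"])
    show "x \<in> - ?S" using assms S by blast
    show "0 = \<phi> y" if "y \<in> - ?S" for y by (rule S0[symmetric]) (use that in blast)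
  qed (intro open_Compl closed_closure)
  then show "partial_deriv i \<phi> x = 0"
    unfolding partial_deriv_def by (metis frechet_derivative_at)
qed

end

lemma test_function_support:
  fixes \<phi> :: "real^2 \<Rightarrow> real"
  assumes t: "test_function \<Omega> \<phi>"
  shows "\<exists>M. \<forall>x. x \<notin> cball 0 M \<longrightarrow> \<phi> x = 0 \<and> partial_deriv i \<phi> x = 0"
proof -
  let ?S = "closure {x. \<phi> x \<noteq> 0}"
  have "bounded ?S" using t by (simp add: test_function_def compact_imp_bounded)
  then obtain M where M: "?S \<subseteq> cball 0 M" unfolding bounded_iff by fastforce
  have "test_function (cball 0 M) \<phi>" using t M by (simp add: test_function_def)
  then show ?thesis using test_function_eq_0 by (intro exI[of _ M]) blast
qed

lemma test_function_bounded:
  fixes \<phi> :: "real^2 \<Rightarrow> real"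
  assumes t: "test_function \<Omega> \<phi>"
  shows "\<exists>C. \<forall>x. \<bar>\<phi> x\<bar> \<le> C \<and> \<bar>partial_deriv i \<phi> x\<bar> \<le> C"
proof -
  obtain M where M: "\<And>x. x \<notin> cball 0 M \<Longrightarrow> \<phi> x = 0 \<and> partial_deriv i \<phi> x = 0"
    using test_function_support[OF t] by blast
  have *: "\<exists>C. \<forall>x. \<bar>f x\<bar> \<le> C" if f: "continuous_on UNIV f" "\<And>x. x \<notin> cball 0 M \<Longrightarrow> f x = 0" for f :: "real^2 \<Rightarrow> real"
  proof -
    have "bounded (f ` cball 0 M)"
      by (intro compact_imp_bounded compact_continuous_image continuous_on_subset[OF f(1)]) auto
    then obtain B where B: "\<And>x. x \<in> cball 0 M \<Longrightarrow> \<bar>f x\<bar> \<le> B" unfolding bounded_iff by fastforce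
    have "\<bar>f x\<bar> \<le> max 0 B" for x
      using B[of x] f(2)[of x] by (cases "x \<in> cball 0 M") (simp_all add: max.coboundedI2)
    then show ?thesis by blast
  qed
  obtain C1 where C1: "\<And>x. \<bar>\<phi> x\<bar> \<le> C1" using *[OF test_function_continuous(1)[OF t]] M by blast
  obtain C2 where C2: "\<And>x. \<bar>partial_deriv i \<phi> x\<bar> \<le> C2" using *[OF test_function_continuous(2)[OF t]] M by blast
  show ?thesis using C1 C2 by (intro exI[of _ "max C1 C2"]) (simp add: max.coboundedI1 max.coboundedI2)
qed

lemma integrable_mult_bounded:
  fixes u g :: "'a \<Rightarrow> real"
  assumes u: "integrable M u" and g: "g \<in> borel_measurable M" "\<And>x. \<bar>g x\<bar> \<le> C"
  shows "integrable M (\<lambda>x. u x * g x)"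
proof (rule Bochner_Integration.integrable_bound)
  show "integrable M (\<lambda>x. C * u x)" using u by simp
  have "0 \<le> C" using g(2) by (meson abs_ge_zero order_trans)
  then show "AE x in M. norm (u x * g x) \<le> norm (C * u x)"
    using mult_right_mono[OF g(2) abs_ge_zero]
    by (intro AE_I2) (simp only: real_norm_def abs_mult mult.commute[of "\<bar>u _\<bar>"] abs_of_nonneg)
qed (use u g in auto)

lemma continuous_measurable_lebesgue_on:
  fixes f :: "real^2 \<Rightarrow> real"
  assumes "continuous_on UNIV f" shows "f \<in> borel_measurable (lebesgue_on S)"
proof -
  have "f \<in> borel_measurable lborel" using borel_measurable_continuous_onI[OF assms] by simp
  then show ?thesis by (rule measurable_restrict_space1[OF measurable_completion])
qed

text \<open>
  The integrand is the derivative of the affine function times \<open>\<phi>\<close> in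
  direction \<open>i\<close>.
\<close>

lemma integral_affine_by_parts:
  fixes a :: real and b :: "2 \<Rightarrow> real"
  assumes t: "test_function \<Omega> \<phi>" and \<Omega>: "\<Omega> \<in> sets borel"
  shows "integral\<^sup>L (lebesgue_on \<Omega>)
    (\<lambda>x. (a + b 1 * x$1 + b 2 * x$2) * partial_deriv i \<phi> x + b i * \<phi> x) = 0"
proof -
  define L where "L = (\<lambda>x::real^2. a + b 1 * x$1 + b 2 * x$2)"
  have cL: "continuous_on UNIV L" unfolding L_def by (intro continuous_intros)
  note c = test_function_continuous[OF t]
  let ?\<psi>' = "\<lambda>x. L x * partial_deriv i \<phi> x + b i * \<phi> x"
  have c': "continuous_on UNIV ?\<psi>'" by (intro continuous_intros cL c)
  then have m: "?\<psi>' \<in> borel_measurable borel" by (rule borel_measurable_continuous_onI)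
  obtain M where M: "\<And>x. x \<notin> cball 0 M \<Longrightarrow> \<phi> x = 0" using test_function_support[OF t] by blast
  have "integral\<^sup>L (lebesgue_on \<Omega>) ?\<psi>' = integral\<^sup>L lborel ?\<psi>'"
  proof (rule integral_lebesgue_on_eq_lborel[OF \<Omega> _ _ m])
    show "indicator \<Omega> x * ?\<psi>' x = ?\<psi>' x" for x
      using test_function_eq_0(1)[OF t, of x] test_function_eq_0(2)[OF t, of x i] by (auto split: split_indicator)
    show "?\<psi>' \<in> borel_measurable lebesgue" using m by (intro measurable_completion) simp
  qed simp
  also have "\<dots> = 0"
  proof (rule integral_directional_derivative_eq_0[where \<psi>="\<lambda>x. L x * \<phi> x" and e="axis i 1" and M=M])
    fix x r
    have i: "i = 1 \<or> i = 2" by (rule exhaust_2)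
    have "((\<lambda>r. L (x + r *\<^sub>R axis i 1)) has_real_derivative b i) (at r)"
      using i unfolding L_def by (auto simp: axis_def intro!: derivative_eq_intros)
    from DERIV_mult[OF this test_function_line[OF t]]
    show "((\<lambda>r. L (x + r *\<^sub>R axis i 1) * \<phi> (x + r *\<^sub>R axis i 1)) has_real_derivative
       L (x + r *\<^sub>R axis i 1) * partial_deriv i \<phi> (x + r *\<^sub>R axis i 1) + b i * \<phi> (x + r *\<^sub>R axis i 1)) (at r)"
      by (simp add: algebra_simps)
  qed (use M c' in \<open>auto intro!: continuous_intros cL c\<close>)
  finally show ?thesis unfolding L_def .
qed

lemma continuous_integrable_lebesgue_on:
  fixes f :: "real^2 \<Rightarrow> real"
  assumes "bounded C" "C \<in> sets borel" "continuous_on UNIV f"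
  shows "integrable (lebesgue_on C) f"
proof -
  have "bounded (f ` closure C)"
    by (rule compact_imp_bounded[OF compact_continuous_image[OF continuous_on_subset[OF assms(3) subset_UNIV] compact_closure[THEN iffD2, OF assms(1)]]])
  then obtain B where B: "\<And>x. x \<in> closure C \<Longrightarrow> \<bar>f x\<bar> \<le> B" unfolding bounded_iff by fastforce
  have "C \<in> lmeasurable" using assms by (simp add: bounded_set_imp_lmeasurable)
  then interpret finite_measure "lebesgue_on C" by (rule finite_measure_lebesgue_on)
  have "norm (f x) \<le> B" if "x \<in> space (lebesgue_on C)" for x
    using that B[of x] closure_subset[of C] by auto
  then show ?thesis
    by (intro integrable_const_bound[of _ B] continuous_measurable_lebesgue_on[OF assms(3)] AE_I2)
qed

text \<open>
  The weak gradient of the interpolation error is the weak gradient of the function minus the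
  constant gradient of the interpolant.
\<close>

lemma has_weak_deriv_minus_affine:
  fixes w wi :: "real^2 \<Rightarrow> real" and a :: real and b :: "2 \<Rightarrow> real"
  assumes \<Omega>: "open \<Omega>" "bounded \<Omega>"
    and w: "integrable (lebesgue_on \<Omega>) w" and wi: "integrable (lebesgue_on \<Omega>) wi"
    and wd: "has_weak_deriv \<Omega> [i] w wi"
  shows "has_weak_deriv \<Omega> [i] (\<lambda>x. w x - (a + b 1 * x$1 + b 2 * x$2)) (\<lambda>x. wi x - b i)"
  unfolding has_weak_deriv_def
proof (intro conjI allI impI)
  let ?L = "\<lambda>x::real^2. a + b 1 * x$1 + b 2 * x$2"
  have cL: "continuous_on UNIV ?L"
    by (intro continuous_on_add continuous_on_mult continuous_on_const continuous_on_component continuous_on_id)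
  show "locally_integrable \<Omega> (\<lambda>x. w x - ?L x)" "locally_integrable \<Omega> (\<lambda>x. wi x - b i)"
    unfolding locally_integrable_def
  proof safe
    fix C assume C: "compact C" "C \<subseteq> \<Omega>"
    then have C': "bounded C" "C \<in> sets borel" by (auto simp: compact_imp_bounded compact_imp_closed)
    have "integrable (lebesgue_on C) w" "integrable (lebesgue_on C) wi"
      using C wd by (auto simp: has_weak_deriv_def locally_integrable_def)
    then show "integrable (lebesgue_on C) (\<lambda>x. w x - ?L x)" "integrable (lebesgue_on C) (\<lambda>x. wi x - b i)"
      using continuous_integrable_lebesgue_on[OF C' cL] continuous_integrable_lebesgue_on[OF C' continuous_on_const[of UNIV "b i"]]
      by (auto intro: Bochner_Integration.integrable_diff)
  qed
  fix \<phi> assume t: "test_function \<Omega> \<phi>"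
  obtain C where C: "\<And>x. \<bar>\<phi> x\<bar> \<le> C" "\<And>x. \<bar>partial_deriv i \<phi> x\<bar> \<le> C" using test_function_bounded[OF t] by blast
  have m: "\<phi> \<in> borel_measurable (lebesgue_on \<Omega>)" "partial_deriv i \<phi> \<in> borel_measurable (lebesgue_on \<Omega>)"
    by (intro continuous_measurable_lebesgue_on test_function_continuous[OF t])+
  have \<Omega>b: "\<Omega> \<in> sets borel" using \<Omega> by simp
  have I: "integrable (lebesgue_on \<Omega>) (\<lambda>x. w x * partial_deriv i \<phi> x)" "integrable (lebesgue_on \<Omega>) (\<lambda>x. wi x * \<phi> x)"
    "integrable (lebesgue_on \<Omega>) (\<lambda>x. ?L x * partial_deriv i \<phi> x)" "integrable (lebesgue_on \<Omega>) (\<lambda>x. b i * \<phi> x)"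
    by (rule integrable_mult_bounded[OF w m(2) C(2)] integrable_mult_bounded[OF wi m(1) C(1)]
        integrable_mult_bounded[OF continuous_integrable_lebesgue_on[OF \<Omega>(2) \<Omega>b cL] m(2) C(2)]
        integrable_mult_bounded[OF continuous_integrable_lebesgue_on[OF \<Omega>(2) \<Omega>b continuous_on_const] m(1) C(1)])+
  have "integral\<^sup>L (lebesgue_on \<Omega>) (\<lambda>x. w x * partial_deriv i \<phi> x) = - integral\<^sup>L (lebesgue_on \<Omega>) (\<lambda>x. wi x * \<phi> x)"
    using wd t unfolding has_weak_deriv_def by (auto simp: partial_derivs_def)
  moreover have "integral\<^sup>L (lebesgue_on \<Omega>) (\<lambda>x. ?L x * partial_deriv i \<phi> x) + integral\<^sup>L (lebesgue_on \<Omega>) (\<lambda>x. b i * \<phi> x) = 0"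
    using integral_affine_by_parts[OF t \<Omega>b, where a=a and b=b and i=i] I by simp
  ultimately show "integral\<^sup>L (lebesgue_on \<Omega>) (\<lambda>x. (w x - ?L x) * partial_derivs [i] \<phi> x) =
     (- 1) ^ length [i] * integral\<^sup>L (lebesgue_on \<Omega>) (\<lambda>x. (wi x - b i) * \<phi> x)"
    using I by (simp add: partial_derivs_def left_diff_distrib)
qed

lemma AE_lebesgue_negligible: "AE x in lebesgue. P x \<Longrightarrow> negligible {x::'a::euclidean_space. \<not> P x}"
  by (auto simp: eventually_ae_filter negligible_iff_null_sets[symmetric] intro: negligible_subset)

lemma negligible_AE_lebesgue: "negligible N \<Longrightarrow> AE x in lebesgue. x \<notin> N"
  by (rule AE_not_in) (simp add: negligible_iff_null_sets)

lemma borel_representative_integrable: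
  fixes u :: "real^2 \<Rightarrow> real"
  assumes C: "C \<in> sets borel" and u: "integrable (lebesgue_on C) u"
  obtains u' where "u' \<in> borel_measurable borel" "integrable lborel u'" "\<And>x. x \<notin> C \<Longrightarrow> u' x = 0"
    "AE x in lebesgue. indicator C x * u x = u' x" "(\<lambda>x. indicator C x * u x) \<in> borel_measurable lebesgue"
proof -
  obtain u' where u': "u' \<in> borel_measurable borel" "\<And>x. x \<notin> C \<Longrightarrow> u' x = 0" "AE x in lebesgue. indicator C x * u x = u' x"
    using borel_representative[OF C borel_measurable_integrable[OF u]] by blast
  have i: "integrable lebesgue (\<lambda>x. indicator C x * u x)"
    using u C by (subst (asm) integrable_restrict_space) auto
  have u'l: "u' \<in> borel_measurable lborel" using u'(1) by simp
  have "integrable lebesgue u'"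
    using i u'(3) measurable_completion[OF u'l] by (subst integrable_cong_AE[symmetric]) auto
  then have "integrable lborel u'" using u'l by (simp add: integrable_completion)
  then show ?thesis using that u' i by blast
qed

text \<open>
  The fundamental lemma of the calculus of variations. Near each point the mollifications of
  \<open>v\<close> with narrow kernels are integrals against test functions, hence zero, and
  they converge to \<open>v\<close> in \<open>L\<^sup>1\<close>.
\<close>

lemma weakly_zero_imp_negligible:
  fixes v :: "real^2 \<Rightarrow> real"
  assumes \<Omega>: "open \<Omega>" and v: "locally_integrable \<Omega> v"
    and z: "\<And>\<phi>. test_function \<Omega> \<phi> \<Longrightarrow> integral\<^sup>L (lebesgue_on \<Omega>) (\<lambda>x. v x * \<phi> x) = 0"
  shows "negligible {x \<in> \<Omega>. v x \<noteq> 0}"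
proof (rule locally_negligible_alt[THEN iffD2, OF ballI])
  let ?N = "{x \<in> \<Omega>. v x \<noteq> 0}"
  fix x0 assume "x0 \<in> ?N"
  then have "x0 \<in> \<Omega>" by simp
  then obtain e where e: "0 < e" "ball x0 e \<subseteq> \<Omega>" using \<Omega> unfolding open_contains_ball by blast
  \<comment> \<open>squares of half-width r and 2 * r: kernels of width at most r centred in the small one stay in the large one\<close>
  define r where "r = e / 8"
  have r: "0 < r" using e by (simp add: r_def)
  define C where "C = cbox (x0 - vec (2 * r)) (x0 + vec (2 * r))"
  define B where "B = box (x0 - vec r) (x0 + vec r)"
  have C\<Omega>: "C \<subseteq> \<Omega>"
  proof
    fix z assume "z \<in> C"
    then have "x0$i - 2 * r \<le> z$i \<and> z$i \<le> x0$i + 2 * r" for i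
      by (simp add: C_def mem_box_cart)
    then have "\<bar>(z - x0)$i\<bar> \<le> 2 * r" for i
      by (simp add: abs_le_iff) (smt (verit))
    then have "\<bar>(z - x0)$1\<bar> + \<bar>(z - x0)$2\<bar> \<le> 2 * r + 2 * r" by (intro add_mono)
    then have "norm (z - x0) \<le> 2 * r + 2 * r"
      by (intro order_trans[OF norm_le_l1_cart]) (simp only: sum_2)
    then have "z \<in> ball x0 e" using e by (simp add: r_def dist_norm norm_minus_commute)
    then show "z \<in> \<Omega>" using e by blast
  qed
  have Cb: "C \<in> sets borel" "compact C" by (auto simp: C_def)
  have "integrable (lebesgue_on C) v" using v Cb C\<Omega> by (auto simp: locally_integrable_def)
  from borel_representative_integrable[OF Cb(1) this]
  obtain v' where v': "v' \<in> borel_measurable borel" "integrable lborel v'" "\<And>x. x \<notin> C \<Longrightarrow> v' x = 0"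
    "AE x in lebesgue. indicator C x * v x = v' x" "(\<lambda>x. indicator C x * v x) \<in> borel_measurable lebesgue"
    by blast
  define \<delta> where "\<delta> n = r / real (Suc n)" for n
  have \<delta>: "0 < \<delta> n" "\<delta> n \<le> r" for n using r by (auto simp: \<delta>_def field_simps)
  have \<delta>0: "\<delta> \<longlonglongrightarrow> 0" unfolding \<delta>_def
    using tendsto_mult_right_zero[OF LIMSEQ_Suc[OF lim_1_over_n], of r] by simp
  have mollify0: "mollify (\<delta> n) 0 0 v' y = 0" if y: "y \<in> B" for n y
  proof -
    let ?k = "\<lambda>z. kernel (\<delta> n) 0 0 (z - y)"
    have sub: "cbox (y - vec (\<delta> n)) (y + vec (\<delta> n)) \<subseteq> C"
    proof
      fix z assume z: "z \<in> cbox (y - vec (\<delta> n)) (y + vec (\<delta> n))"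
      have "x0$i - 2 * r \<le> z$i \<and> z$i \<le> x0$i + 2 * r" for i
      proof -
        have "y$i - \<delta> n \<le> z$i" "z$i \<le> y$i + \<delta> n" using z by (simp_all add: mem_box_cart)
        moreover have "x0$i - r < y$i" "y$i < x0$i + r" using y by (simp_all add: B_def mem_box_cart)
        ultimately show ?thesis using \<delta>(2)[of n] by linarith
      qed
      then show "z \<in> C" by (simp add: C_def mem_box_cart)
    qed
    have t: "test_function \<Omega> ?k"
      using sub C\<Omega> by (intro test_function_kernel \<delta>) auto
    have k0: "?k z = 0" if "z \<notin> C" for z
      using test_function_eq_0(1)[OF test_function_kernel[OF \<delta>(1) sub] that] .
    have kb: "?k \<in> borel_measurable borel" by measurable
    have "integral\<^sup>L (lebesgue_on \<Omega>) (\<lambda>z. v z * ?k z) = integral\<^sup>L lborel (\<lambda>z. v' z * ?k z)"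
    proof (rule integral_lebesgue_on_eq_lborel[where h="\<lambda>z. (indicator C z * v z) * ?k z"])
      show "indicator \<Omega> x * (v x * ?k x) = (indicator C x * v x) * ?k x" for x
        using C\<Omega> k0[of x] by (auto split: split_indicator)
      show "AE x in lebesgue. (indicator C x * v x) * ?k x = v' x * ?k x"
        using v'(4) by eventually_elim simp
      have "?k \<in> borel_measurable lebesgue" using kb by (intro measurable_completion) simp
      then show "(\<lambda>z. (indicator C z * v z) * ?k z) \<in> borel_measurable lebesgue"
        using v'(5) by (rule borel_measurable_times[rotated])
    qed (use \<Omega> v' kb in auto)
    then show ?thesis using z[OF t] by (simp add: mollify_def)
  qed
  have Bb: "B \<in> sets borel" "bounded B" by (auto simp: B_def)
  have "(\<lambda>n. \<integral>\<^sup>+x. ennreal \<bar>mollify (\<delta> n) 0 0 v' (0 + 1 *\<^sub>R x) - v' x\<bar> * indicator B x \<partial>lborel) \<longlonglongrightarrow> 0"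
    by (rule mollify_tendsto_L1[OF v'(2) Bb tendsto_const tendsto_const \<delta>0 \<delta>(1)]) simp
  moreover have "(\<integral>\<^sup>+x. ennreal \<bar>mollify (\<delta> n) 0 0 v' (0 + 1 *\<^sub>R x) - v' x\<bar> * indicator B x \<partial>lborel)
      = (\<integral>\<^sup>+x. ennreal \<bar>v' x\<bar> * indicator B x \<partial>lborel)" for n
    using mollify0 by (intro nn_integral_cong) (auto split: split_indicator)
  ultimately have "(\<integral>\<^sup>+x. ennreal \<bar>v' x\<bar> * indicator B x \<partial>lborel) = 0"
    using LIMSEQ_unique tendsto_const by fastforce
  then have "AE x in lborel. ennreal \<bar>v' x\<bar> * indicator B x = 0"
    using v' Bb by (subst (asm) nn_integral_0_iff_AE) auto
  then have "AE x in lebesgue. ennreal \<bar>v' x\<bar> * indicator B x = 0" by (rule AE_completion)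
  then have "AE x in lebesgue. x \<in> B \<longrightarrow> v x = 0"
    using v'(4)
  proof eventually_elim
    case (elim x)
    have "B \<subseteq> C"
    proof
      fix z assume "z \<in> B"
      then have "x0$i - r < z$i \<and> z$i < x0$i + r" for i by (simp add: B_def mem_box_cart)
      then have "x0$i - 2 * r \<le> z$i \<and> z$i \<le> x0$i + 2 * r" for i using r by (smt (verit))
      then show "z \<in> C" by (simp add: C_def mem_box_cart)
    qed
    then show ?case using elim by (auto split: split_indicator_asm)
  qed
  then have "negligible {x. \<not> (x \<in> B \<longrightarrow> v x = 0)}" by (rule AE_lebesgue_negligible)
  then have "negligible (?N \<inter> B)" by (rule negligible_subset) auto
  moreover have "x0 \<in> B" using r by (simp add: B_def mem_box_cart)
  moreover have "openin (top_of_set ?N) (?N \<inter> B)"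
    by (intro openin_open_Int) (simp add: B_def open_box)
  ultimately show "\<exists>U. openin (top_of_set ?N) U \<and> x0 \<in> U \<and> negligible U"
    using \<open>x0 \<in> ?N\<close> by blast
qed

lemma integrable_mult_test_function:
  fixes v :: "real^2 \<Rightarrow> real"
  assumes \<Omega>: "open \<Omega>" and v: "locally_integrable \<Omega> v" and t: "test_function \<Omega> \<phi>"
  shows "integrable (lebesgue_on \<Omega>) (\<lambda>x. v x * \<phi> x)"
proof -
  define S where "S = closure {x. \<phi> x \<noteq> 0}"
  have S: "compact S" "S \<subseteq> \<Omega>" using t by (auto simp: S_def test_function_def)
  have S0: "\<phi> y = 0" if "y \<notin> S" for y
    using that subsetD[OF closure_subset, of y "{x. \<phi> x \<noteq> 0}"] unfolding S_def by blast
  obtain C where C: "\<And>x. \<bar>\<phi> x\<bar> \<le> C" using test_function_bounded[OF t] by blast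
  have "integrable (lebesgue_on S) (\<lambda>x. v x * \<phi> x)"
    using v S by (intro integrable_mult_bounded[OF _ _ C] continuous_measurable_lebesgue_on test_function_continuous[OF t])
      (auto simp: locally_integrable_def)
  then have "integrable lebesgue (\<lambda>x. indicator S x *\<^sub>R (v x * \<phi> x))"
    using S by (subst (asm) integrable_restrict_space) (auto simp: compact_imp_closed)
  moreover have "(\<lambda>x. indicator S x *\<^sub>R (v x * \<phi> x)) = (\<lambda>x. indicator \<Omega> x *\<^sub>R (v x * \<phi> x))"
    using S S0 by (auto simp: fun_eq_iff split: split_indicator)
  ultimately show ?thesis using \<Omega> by (subst integrable_restrict_space) auto
qed

lemma has_weak_deriv_unique:
  fixes w :: "real^2 \<Rightarrow> real"
  assumes \<Omega>: "open \<Omega>" and 1: "has_weak_deriv \<Omega> \<alpha> w v1" and 2: "has_weak_deriv \<Omega> \<alpha> w v2"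
  shows "AE x in lebesgue_on \<Omega>. v1 x = v2 x"
proof -
  have l: "locally_integrable \<Omega> v1" "locally_integrable \<Omega> v2" using 1 2 by (auto simp: has_weak_deriv_def)
  have "negligible {x \<in> \<Omega>. v1 x - v2 x \<noteq> 0}"
  proof (rule weakly_zero_imp_negligible[OF \<Omega>])
    show "locally_integrable \<Omega> (\<lambda>x. v1 x - v2 x)" using l by (auto simp: locally_integrable_def)
    fix \<phi> assume t: "test_function \<Omega> \<phi>"
    have "integral\<^sup>L (lebesgue_on \<Omega>) (\<lambda>x. v1 x * \<phi> x) = integral\<^sup>L (lebesgue_on \<Omega>) (\<lambda>x. v2 x * \<phi> x)"
    proof -
      have "(- 1) ^ length \<alpha> * integral\<^sup>L (lebesgue_on \<Omega>) (\<lambda>x. v1 x * \<phi> x)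
        = (- 1) ^ length \<alpha> * integral\<^sup>L (lebesgue_on \<Omega>) (\<lambda>x. v2 x * \<phi> x)"
        using 1 2 t unfolding has_weak_deriv_def by simp
      then show ?thesis by simp
    qed
    then show "integral\<^sup>L (lebesgue_on \<Omega>) (\<lambda>x. (v1 x - v2 x) * \<phi> x) = 0"
      using integrable_mult_test_function[OF \<Omega> _ t] l by (simp add: left_diff_distrib)
  qed
  from negligible_AE_lebesgue[OF this] have "AE x in lebesgue. x \<in> \<Omega> \<longrightarrow> v1 x = v2 x"
    by eventually_elim auto
  then show ?thesis using \<Omega> by (subst AE_restrict_space_iff) auto
qed

lemma AE_weak_deriv:
  fixes w :: "real^2 \<Rightarrow> real"
  assumes "open \<Omega>" "has_weak_deriv \<Omega> \<alpha> w v"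
  shows "AE x in lebesgue_on \<Omega>. weak_deriv \<Omega> \<alpha> w x = v x"
  using has_weak_deriv_unique[OF assms(1) _ assms(2)] someI[of "has_weak_deriv \<Omega> \<alpha> w", OF assms(2)]
  unfolding weak_deriv_def by blast

section \<open>Line integrals in the reference triangle\<close>

definition reftri :: "(real \<times> real) set" where
  "reftri = {(s, t). 0 \<le> s \<and> 0 \<le> t \<and> s + t \<le> 1}"

text \<open>
  Integrals over the sections of the reference triangle by lines parallel to its three sides:
  horizontal, vertical, and the lines of constant \<open>s + t\<close>. The values are extended
  nonnegative reals so that Fubini's theorem applies directly: integrating any of the three over
  its parameter gives the integral over the triangle.
\<close>

definition hline :: "(real \<times> real \<Rightarrow> real) \<Rightarrow> real \<Rightarrow> ennreal" where
  "hline Z t = (\<integral>\<^sup>+s. ennreal (Z (s, t)) * indicator reftri (s, t) \<partial>lborel)"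

definition vline :: "(real \<times> real \<Rightarrow> real) \<Rightarrow> real \<Rightarrow> ennreal" where
  "vline Z s = (\<integral>\<^sup>+t. ennreal (Z (s, t)) * indicator reftri (s, t) \<partial>lborel)"

definition dline :: "(real \<times> real \<Rightarrow> real) \<Rightarrow> real \<Rightarrow> ennreal" where
  "dline Z \<sigma> = (\<integral>\<^sup>+r. ennreal (Z (\<sigma> - r, r)) * indicator reftri (\<sigma> - r, r) \<partial>lborel)"

definition triint :: "(real \<times> real \<Rightarrow> real) \<Rightarrow> ennreal" where
  "triint Z = (\<integral>\<^sup>+p. ennreal (Z p) * indicator reftri p \<partial>lborel)"

lemma closed_reftri: "closed reftri"
proof -
  have "reftri = {p. 0 \<le> fst p} \<inter> {p. 0 \<le> snd p} \<inter> {p. fst p + snd p \<le> 1}"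
    by (auto simp: reftri_def)
  also have "closed \<dots>"
    by (intro closed_Int closed_Collect_le continuous_intros)
  finally show ?thesis .
qed

lemma reftri_measurable [measurable]: "reftri \<in> sets borel" "reftri \<in> sets (borel \<Otimes>\<^sub>M borel)"
proof -
  show "reftri \<in> sets borel" using closed_reftri by (rule borel_closed)
  then show "reftri \<in> sets (borel \<Otimes>\<^sub>M borel)" unfolding borel_prod .
qed

lemma nn_integral_lborel_pair:
  assumes "f \<in> borel_measurable (borel :: (real \<times> real) measure)"
  shows "(\<integral>\<^sup>+p. f p \<partial>lborel) = (\<integral>\<^sup>+t. \<integral>\<^sup>+s. f (s, t) \<partial>lborel \<partial>lborel)"
    and "(\<integral>\<^sup>+p. f p \<partial>lborel) = (\<integral>\<^sup>+s. \<integral>\<^sup>+t. f (s, t) \<partial>lborel \<partial>lborel)"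
proof -
  have f: "f \<in> borel_measurable (lborel \<Otimes>\<^sub>M lborel)" using assms by (simp add: lborel_prod)
  show "(\<integral>\<^sup>+p. f p \<partial>lborel) = (\<integral>\<^sup>+t. \<integral>\<^sup>+s. f (s, t) \<partial>lborel \<partial>lborel)"
    using lborel_pair.nn_integral_snd[OF f] by (simp add: lborel_prod)
  show "(\<integral>\<^sup>+p. f p \<partial>lborel) = (\<integral>\<^sup>+s. \<integral>\<^sup>+t. f (s, t) \<partial>lborel \<partial>lborel)"
    using lborel.nn_integral_fst[OF f] by (simp add: lborel_prod)
qed

context
  fixes Z :: "real \<times> real \<Rightarrow> real"
  assumes Z [measurable]: "Z \<in> borel_measurable borel"
begin

lemma Z_pair_measurable [measurable]: "Z \<in> borel_measurable (borel \<Otimes>\<^sub>M borel)"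
  unfolding borel_prod by (rule Z)

lemma hline_measurable [measurable]: "hline Z \<in> borel_measurable borel"
  unfolding hline_def by measurable

lemma vline_measurable [measurable]: "vline Z \<in> borel_measurable borel"
  unfolding vline_def by measurable

lemma nn_integral_hline: "(\<integral>\<^sup>+t. hline Z t \<partial>lborel) = triint Z"
  unfolding hline_def triint_def by (subst nn_integral_lborel_pair(1)) auto

lemma nn_integral_vline: "(\<integral>\<^sup>+s. vline Z s \<partial>lborel) = triint Z"
  unfolding vline_def triint_def by (subst nn_integral_lborel_pair(2)) auto

lemma dline_measurable [measurable]: "dline Z \<in> borel_measurable borel"
  unfolding dline_def by measurable

lemma section_measurable:
  "(\<lambda>s. ennreal (Z (s, t)) * indicator reftri (s, t)) \<in> borel_measurable borel"
  "(\<lambda>t. ennreal (Z (s, t)) * indicator reftri (s, t)) \<in> borel_measurable borel"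
  by measurable

text \<open>
  The shear \<open>(\<sigma>, r) \<mapsto> (\<sigma> - r, r)\<close> preserves area.
\<close>

lemma nn_integral_dline: "(\<integral>\<^sup>+\<sigma>. dline Z \<sigma> \<partial>lborel) = triint Z"
proof -
  have "(\<integral>\<^sup>+\<sigma>. dline Z \<sigma> \<partial>lborel)
      = (\<integral>\<^sup>+r. \<integral>\<^sup>+\<sigma>. ennreal (Z (\<sigma> - r, r)) * indicator reftri (\<sigma> - r, r) \<partial>lborel \<partial>lborel)"
    unfolding dline_def by (rule lborel_pair.Fubini') measurable
  also have "\<dots> = (\<integral>\<^sup>+r. hline Z r \<partial>lborel)"
  proof (rule nn_integral_cong)
    fix r
    show "(\<integral>\<^sup>+\<sigma>. ennreal (Z (\<sigma> - r, r)) * indicator reftri (\<sigma> - r, r) \<partial>lborel) = hline Z r"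
      unfolding hline_def
      using nn_integral_real_affine[of "\<lambda>s. ennreal (Z (s, r)) * indicator reftri (s, r)" 1 "-r"]
      by simp
  qed
  finally show ?thesis by (simp add: nn_integral_hline)
qed

end

\<comment> \<open>outside the context this rule has a premise about an arbitrary function and would be tried on every goal\<close>
declare Z_pair_measurable [measurable del]

lemma ftc_bound:
  fixes \<phi> \<phi>' :: "real \<Rightarrow> real" and z :: "real \<Rightarrow> ennreal"
  assumes der: "\<And>r. r \<in> closed_segment x y \<Longrightarrow> (\<phi> has_real_derivative \<phi>' r) (at r)"
    and cont: "continuous_on (closed_segment x y) \<phi>'"
    and bound: "\<And>r. r \<in> closed_segment x y \<Longrightarrow> ennreal \<bar>\<phi>' r\<bar> \<le> z r"
  shows "ennreal \<bar>\<phi> x - \<phi> y\<bar> \<le> (\<integral>\<^sup>+r. z r \<partial>lborel)"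
proof -
  have *: "ennreal \<bar>\<phi> b - \<phi> a\<bar> \<le> (\<integral>\<^sup>+r. z r \<partial>lborel)"
    if "a \<le> b" and seg: "closed_segment x y = {a..b}" for a b
  proof -
    have h: "has_bochner_integral lborel (\<lambda>r. indicator {a..b} r *\<^sub>R \<phi>' r) (\<phi> b - \<phi> a)"
      using that der cont unfolding seg
      by (intro has_bochner_integral_FTC_Icc)
         (auto simp: has_real_derivative_iff_has_vector_derivative[symmetric] intro: has_field_derivative_at_within)
    have "ennreal (norm (\<phi> b - \<phi> a)) \<le> (\<integral>\<^sup>+r. norm (indicator {a..b} r *\<^sub>R \<phi>' r) \<partial>lborel)"
      using h integral_norm_bound_ennreal[of lborel "\<lambda>r. indicator {a..b} r *\<^sub>R \<phi>' r"]
      unfolding has_bochner_integral_iff by metis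
    also have "\<dots> \<le> (\<integral>\<^sup>+r. z r \<partial>lborel)"
      using bound unfolding seg by (intro nn_integral_mono) (auto split: split_indicator)
    finally show ?thesis by simp
  qed
  show ?thesis
    using *[of x y] *[of y x] by (cases "x \<le> y") (auto simp: closed_segment_eq_real_ivl abs_minus_commute)
qed

text \<open>
  Continuous differentiability in affine coordinates; functions on the plane will be transported
  here by a chart of the triangle.
\<close>

definition C1_pair :: "(real \<times> real \<Rightarrow> real) \<Rightarrow> (real \<times> real \<Rightarrow> real) \<Rightarrow> (real \<times> real \<Rightarrow> real) \<Rightarrow> bool" where
  "C1_pair G G1 G2 \<longleftrightarrow> (\<forall>p. (G has_derivative (\<lambda>h. G1 p * fst h + G2 p * snd h)) (at p)) \<and>
     continuous_on UNIV G1 \<and> continuous_on UNIV G2"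

lemma C1_pair_line:
  assumes "C1_pair G G1 G2"
  shows "((\<lambda>r. G (s + r * a, t + r * b)) has_real_derivative
           (G1 (s + r * a, t + r * b) * a + G2 (s + r * a, t + r * b) * b)) (at r)"
proof -
  have "((\<lambda>r. (s + r * a, t + r * b)) has_derivative (\<lambda>h. (h * a, h * b))) (at r)"
    by (auto intro!: derivative_eq_intros)
  from has_derivative_compose[OF this, of G] assms
  have "((\<lambda>r. G (s + r * a, t + r * b)) has_derivative
     (\<lambda>h. G1 (s + r * a, t + r * b) * (h * a) + G2 (s + r * a, t + r * b) * (h * b))) (at r)"
    unfolding C1_pair_def by fastforce
  then show ?thesis
    unfolding has_field_derivative_def by (rule has_derivative_eq_rhs) (auto simp: algebra_simps)
qed

lemma C1_pair_continuous_on: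
  assumes "C1_pair G G1 G2" "continuous_on S f"
  shows "continuous_on S (\<lambda>x. G1 (f x))" "continuous_on S (\<lambda>x. G2 (f x))"
  using assms unfolding C1_pair_def by (blast intro: continuous_on_compose2)+

lemma C1_pair_swap: "C1_pair G G1 G2 \<Longrightarrow> C1_pair (\<lambda>(s, t). G (t, s)) (\<lambda>(s, t). G2 (t, s)) (\<lambda>(s, t). G1 (t, s))"
proof -
  assume C: "C1_pair G G1 G2"
  have "((\<lambda>p. G (snd p, fst p)) has_derivative (\<lambda>h. G2 (snd p, fst p) * fst h + G1 (snd p, fst p) * snd h)) (at p)" for p
  proof -
    have "((\<lambda>p::real\<times>real. (snd p, fst p)) has_derivative (\<lambda>h. (snd h, fst h))) (at p)"
      by (auto intro!: derivative_eq_intros)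
    from has_derivative_compose[OF this, of G] C
    have "((\<lambda>p. G (snd p, fst p)) has_derivative (\<lambda>h. G1 (snd p, fst p) * snd h + G2 (snd p, fst p) * fst h)) (at p)"
      unfolding C1_pair_def by fastforce
    then show ?thesis by (simp add: add.commute)
  qed
  moreover have "continuous_on UNIV (\<lambda>p. G1 (snd p, fst p))" "continuous_on UNIV (\<lambda>p. G2 (snd p, fst p))"
    by (intro C1_pair_continuous_on[OF C] continuous_intros)+
  ultimately show ?thesis unfolding C1_pair_def by (simp add: case_prod_unfold)
qed

lemma C1_pair_horizontal:
  assumes C: "C1_pair G G1 G2" and Z: "\<And>p. p \<in> reftri \<Longrightarrow> \<bar>G1 p\<bar> \<le> Z p"
    and "(s, t) \<in> reftri" "(s', t) \<in> reftri"
  shows "ennreal \<bar>G (s, t) - G (s', t)\<bar> \<le> hline Z t"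
  unfolding hline_def
proof (rule ftc_bound[where \<phi>="\<lambda>r. G (r, t)" and \<phi>'="\<lambda>r. G1 (r, t)"])
  show "((\<lambda>r. G (r, t)) has_real_derivative G1 (r, t)) (at r)" for r
    using C1_pair_line[OF C, of 0 1 t 0] by simp
  show "continuous_on (closed_segment s s') (\<lambda>r. G1 (r, t))"
    by (intro C1_pair_continuous_on[OF C] continuous_intros)
  show "ennreal \<bar>G1 (r, t)\<bar> \<le> ennreal (Z (r, t)) * indicator reftri (r, t)" if "r \<in> closed_segment s s'" for r
  proof -
    have "(r, t) \<in> reftri" using assms(3,4) that
      by (auto simp: reftri_def closed_segment_eq_real_ivl split: if_splits)
    then show ?thesis using Z by (auto intro!: ennreal_leI)
  qed
qed

lemma C1_pair_vertical:
  assumes C: "C1_pair G G1 G2" and Z: "\<And>p. p \<in> reftri \<Longrightarrow> \<bar>G2 p\<bar> \<le> Z p"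
    and "(s, t) \<in> reftri" "(s, t') \<in> reftri"
  shows "ennreal \<bar>G (s, t) - G (s, t')\<bar> \<le> vline Z s"
  unfolding vline_def
proof (rule ftc_bound[where \<phi>="\<lambda>r. G (s, r)" and \<phi>'="\<lambda>r. G2 (s, r)"])
  show "((\<lambda>r. G (s, r)) has_real_derivative G2 (s, r)) (at r)" for r
    using C1_pair_line[OF C, of s 0 0 1] by simp
  show "continuous_on (closed_segment t t') (\<lambda>r. G2 (s, r))"
    by (intro C1_pair_continuous_on[OF C] continuous_intros)
  show "ennreal \<bar>G2 (s, r)\<bar> \<le> ennreal (Z (s, r)) * indicator reftri (s, r)" if "r \<in> closed_segment t t'" for r
  proof -
    have "(s, r) \<in> reftri" using assms(3,4) that
      by (auto simp: reftri_def closed_segment_eq_real_ivl split: if_splits)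
    then show ?thesis using Z by (auto intro!: ennreal_leI)
  qed
qed

lemma C1_pair_diagonal:
  assumes C: "C1_pair G G1 G2" and Z: "\<And>p. p \<in> reftri \<Longrightarrow> \<bar>G2 p - G1 p\<bar> \<le> Z p"
    and t: "0 \<le> t" "t \<le> \<sigma>" "\<sigma> \<le> 1"
  shows "ennreal \<bar>G (\<sigma> - t, t) - G (\<sigma>, 0)\<bar>
          \<le> dline Z \<sigma>"
proof -
  have "ennreal \<bar>(\<lambda>r. G (\<sigma> - r, r)) t - (\<lambda>r. G (\<sigma> - r, r)) 0\<bar>
          \<le> dline Z \<sigma>"
    unfolding dline_def
  proof (rule ftc_bound[where \<phi>="\<lambda>r. G (\<sigma> - r, r)" and x=t and y=0 and \<phi>'="\<lambda>r. G2 (\<sigma> - r, r) - G1 (\<sigma> - r, r)"])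
    show "((\<lambda>r. G (\<sigma> - r, r)) has_real_derivative G2 (\<sigma> - r, r) - G1 (\<sigma> - r, r)) (at r)" for r
      using C1_pair_line[OF C, of \<sigma> "-1" 0 1] by simp
    show "continuous_on (closed_segment t 0) (\<lambda>r. G2 (\<sigma> - r, r) - G1 (\<sigma> - r, r))"
      by (intro C1_pair_continuous_on[OF C] continuous_intros)
    show "ennreal \<bar>G2 (\<sigma> - r, r) - G1 (\<sigma> - r, r)\<bar> \<le> ennreal (Z (\<sigma> - r, r)) * indicator reftri (\<sigma> - r, r)"
      if "r \<in> closed_segment t 0" for r
    proof -
      have "(\<sigma> - r, r) \<in> reftri" using t that
        by (auto simp: reftri_def closed_segment_eq_real_ivl split: if_splits)
      then show ?thesis using Z by (auto intro!: ennreal_leI)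
    qed
  qed
  then show ?thesis by simp
qed

text \<open>
  This is how a free parameter of a path is averaged out: a bound by \<open>h r\<close> for all
  \<open>r\<close> in an interval of length \<open>1 / 2\<close> becomes a bound by twice the
  integral of \<open>h\<close>.
\<close>

lemma average_half:
  fixes a b :: ennreal
  assumes le: "\<And>r. r \<in> {0..1/2::real} \<Longrightarrow> a \<le> b + h r" and [measurable]: "h \<in> borel_measurable borel"
  shows "a \<le> b + 2 * (\<integral>\<^sup>+r. h r \<partial>lborel)"
proof -
  have half: "emeasure lborel {0..1/2::real} = ennreal (1/2)" by simp
  have "a * emeasure lborel {0..1/2::real} = (\<integral>\<^sup>+r. a * indicator {0..1/2::real} r \<partial>lborel)"
    by (simp add: nn_integral_cmult_indicator)
  also have "\<dots> \<le> (\<integral>\<^sup>+r. b * indicator {0..1/2::real} r + h r \<partial>lborel)"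
    using le by (intro nn_integral_mono) (auto split: split_indicator)
  also have "\<dots> = b * emeasure lborel {0..1/2::real} + (\<integral>\<^sup>+r. h r \<partial>lborel)"
    by (subst nn_integral_add) (auto simp: nn_integral_cmult_indicator)
  finally have "2 * (a * ennreal (1/2)) \<le> 2 * (b * ennreal (1/2) + (\<integral>\<^sup>+r. h r \<partial>lborel))"
    unfolding half by (intro mult_left_mono) auto
  moreover have "2 * (x * ennreal (1/2)) = x" for x :: ennreal
  proof -
    have "2 * ennreal (1/2) = ennreal 2 * ennreal (1/2)" by simp
    also have "\<dots> = 1" by (subst ennreal_mult[symmetric]) auto
    finally show ?thesis by (metis mult.left_commute mult.right_neutral)
  qed
  ultimately show ?thesis by (simp only: distrib_left)
qed

text \<open>
  Since \<open>F\<close> takes the same value at both ends of the side \<open>t = 0\<close>, its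
  derivative \<open>F1\<close> has mean zero on that side. Hence \<open>F1 (s, t)\<close> is the
  mean over \<open>\<sigma>\<close> of the differences \<open>F1 (s, t) - F1 (\<sigma>,
  0)\<close>. Each difference is integrated along a path with two pieces parallel to sides:
  first horizontally, then vertically down to \<open>(\<sigma>, 0)\<close> if \<open>\<sigma>
  \<le> 1 / 2\<close>, and diagonally if \<open>\<sigma> > 1 / 2\<close>. For \<open>t \<le> 1 /
  2\<close> these paths stay inside the triangle. Averaging over \<open>\<sigma>\<close> turns
  the second pieces into integrals over the triangle, so that only the line through the given
  point remains. A point with \<open>t > 1 / 2\<close> is first moved vertically to a height in
  \<open>{0..1/2}\<close>, and that height is averaged as well.
\<close>

lemma edge_bound:
  assumes F: "C1_pair F F1 F2" and F1: "C1_pair F1 F11 F12"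
    and edge: "F (0, 0) = F (1, 0)"
    and Z [measurable]: "Z \<in> borel_measurable borel"
    and Zb: "\<And>p. p \<in> reftri \<Longrightarrow> \<bar>F11 p\<bar> \<le> Z p" "\<And>p. p \<in> reftri \<Longrightarrow> \<bar>F12 p\<bar> \<le> Z p"
      "\<And>p. p \<in> reftri \<Longrightarrow> \<bar>F12 p - F11 p\<bar> \<le> Z p"
    and st: "(s, t) \<in> reftri"
  shows "ennreal \<bar>F1 (s, t)\<bar> \<le> hline Z t + vline Z s + 4 * triint Z"
proof -
  have low: "ennreal \<bar>F1 (s, t)\<bar> \<le> hline Z t + 2 * triint Z" if st: "(s, t) \<in> reftri" and t: "t \<le> 1/2" for s t
  proof -
    have *: "ennreal \<bar>F1 (s, t) - F1 (\<sigma>, 0)\<bar> \<le> hline Z t + (vline Z \<sigma> + dline Z \<sigma>)" if "\<sigma> \<in> {0..1}" for \<sigma>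
    proof (cases "\<sigma> \<le> 1/2")
      case True
      then have 1: "(\<sigma>, t) \<in> reftri" "(\<sigma>, 0) \<in> reftri" using st t that by (auto simp: reftri_def)
      have "ennreal \<bar>F1 (s, t) - F1 (\<sigma>, 0)\<bar> \<le> hline Z t + vline Z \<sigma>"
        by (rule order_trans[OF ennreal_triangle
              add_mono[OF C1_pair_horizontal[OF F1 Zb(1) st 1(1)] C1_pair_vertical[OF F1 Zb(2) 1]]])
      also have "\<dots> \<le> hline Z t + (vline Z \<sigma> + dline Z \<sigma>)" by (intro add_left_mono) simp
      finally show ?thesis .
    next
      case False
      then have 1: "(\<sigma> - t, t) \<in> reftri" using st t that by (auto simp: reftri_def)
      have "ennreal \<bar>F1 (\<sigma> - t, t) - F1 (\<sigma>, 0)\<bar> \<le> dline Z \<sigma>"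
        using that False st t
        by (intro C1_pair_diagonal[OF F1 Zb(3)]) (auto simp: reftri_def)
      then have "ennreal \<bar>F1 (s, t) - F1 (\<sigma>, 0)\<bar> \<le> hline Z t + dline Z \<sigma>"
        by (intro order_trans[OF ennreal_triangle add_mono[OF C1_pair_horizontal[OF F1 Zb(1) st 1]]])
      also have "\<dots> \<le> hline Z t + (vline Z \<sigma> + dline Z \<sigma>)" by (intro add_left_mono) simp
      finally show ?thesis .
    qed
    \<comment> \<open>this primitive of F1 (s, t) - F1 (\<sigma>, 0) changes by exactly F1 (s, t) over the side, because the values of F at the ends cancel\<close>
    have "ennreal \<bar>(\<lambda>\<sigma>. F1 (s, t) * \<sigma> - F (\<sigma>, 0)) 0 - (\<lambda>\<sigma>. F1 (s, t) * \<sigma> - F (\<sigma>, 0)) 1\<bar>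
        \<le> (\<integral>\<^sup>+\<sigma>. hline Z t * indicator {0..1} \<sigma> + (vline Z \<sigma> + dline Z \<sigma>) \<partial>lborel)"
    proof (rule ftc_bound[where \<phi>="\<lambda>\<sigma>. F1 (s, t) * \<sigma> - F (\<sigma>, 0)" and x=0 and y=1 and \<phi>'="\<lambda>\<sigma>. F1 (s, t) - F1 (\<sigma>, 0)"])
      have "((\<lambda>r. F (r, 0)) has_real_derivative F1 (r, 0)) (at r)" for r
        using C1_pair_line[OF F, of 0 1 0 0] by simp
      then show "((\<lambda>\<sigma>. F1 (s, t) * \<sigma> - F (\<sigma>, 0)) has_real_derivative F1 (s, t) - F1 (\<sigma>, 0)) (at \<sigma>)" for \<sigma>
        by (auto intro!: derivative_eq_intros)
      show "continuous_on (closed_segment 0 1) (\<lambda>\<sigma>. F1 (s, t) - F1 (\<sigma>, 0))"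
        by (intro C1_pair_continuous_on[OF F] continuous_intros)
    qed (use * in \<open>auto simp: closed_segment_eq_real_ivl\<close>)
    also have "\<dots> = hline Z t + (triint Z + triint Z)"
      by (simp add: nn_integral_add nn_integral_cmult_indicator nn_integral_vline[OF Z] nn_integral_dline[OF Z]
          hline_measurable[OF Z] vline_measurable[OF Z] dline_measurable[OF Z])
    finally show ?thesis using edge by (simp add: mult_2)
  qed
  show ?thesis
  proof (cases "t \<le> 1/2")
    case True
    have "hline Z t + 2 * triint Z \<le> hline Z t + vline Z s + 4 * triint Z"
      by (intro add_mono mult_right_mono) (auto simp: add_increasing2)
    then show ?thesis using low[OF st True] by (rule order_trans[rotated])
  next
    case False
    have "ennreal \<bar>F1 (s, t)\<bar> \<le> (vline Z s + 2 * triint Z) + 2 * (\<integral>\<^sup>+t'. hline Z t' \<partial>lborel)"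
    proof (rule average_half)
      fix t' :: real assume t': "t' \<in> {0..1/2}"
      then have st': "(s, t') \<in> reftri" using st False by (auto simp: reftri_def)
      have "ennreal \<bar>F1 (s, t) - 0\<bar> \<le> vline Z s + (hline Z t' + 2 * triint Z)"
        using low[OF st'] t'
        by (intro order_trans[OF ennreal_triangle add_mono[OF C1_pair_vertical[OF F1 Zb(2) st st']]]) auto
      then show "ennreal \<bar>F1 (s, t)\<bar> \<le> (vline Z s + 2 * triint Z) + hline Z t'" by (simp add: ac_simps)
    qed (rule hline_measurable[OF Z])
    also have "\<dots> = vline Z s + 4 * triint Z"
      by (simp add: nn_integral_hline[OF Z] add.assoc distrib_right[symmetric])
    also have "\<dots> \<le> hline Z t + vline Z s + 4 * triint Z" by (simp add: add_right_mono add_increasing)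
    finally show ?thesis .
  qed
qed

text \<open>
  The increment of \<open>F\<close> is integrated along the path from \<open>(0, 0)\<close> over
  \<open>(s, 0)\<close> to \<open>(s, t)\<close>. At each point of the path the derivative is
  compared, at the cost of \<open>F12\<close>, with its values at the points whose other
  coordinate ranges over \<open>{0..1/2}\<close>, and these values are averaged. Coordinates up
  to \<open>1 / 2\<close> keep all these segments inside the triangle.
\<close>

lemma corner_bound:
  assumes F: "C1_pair F F1 F2" and F1: "C1_pair F1 F11 F12" and F2: "C1_pair F2 F12 F22"
    and st: "0 \<le> s" "s \<le> 1/2" "0 \<le> t" "t \<le> 1/2"
  shows "ennreal \<bar>F (s, t) - F (0, 0)\<bar>
    \<le> 2 * triint (\<lambda>p. \<bar>F1 p\<bar>) + 2 * triint (\<lambda>p. \<bar>F2 p\<bar>) + 2 * triint (\<lambda>p. \<bar>F12 p\<bar>)"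
proof -
  let ?a = "\<lambda>f p. \<bar>f p :: real\<bar>"
  have c: "continuous_on UNIV F1" "continuous_on UNIV F2" "continuous_on UNIV F12"
    using F F1 unfolding C1_pair_def by blast+
  have m: "?a F1 \<in> borel_measurable borel" "?a F2 \<in> borel_measurable borel" "?a F12 \<in> borel_measurable borel"
    by (intro borel_measurable_continuous_onI continuous_on_rabs c)+
  have 1: "ennreal \<bar>F (s, 0) - F (0, 0)\<bar> \<le> (\<integral>\<^sup>+\<sigma>. vline (?a F12) \<sigma> + 2 * vline (?a F1) \<sigma> \<partial>lborel)"
  proof (rule ftc_bound[where \<phi>="\<lambda>r. F (r, 0)" and \<phi>'="\<lambda>r. F1 (r, 0)"])
    show "((\<lambda>r. F (r, 0)) has_real_derivative F1 (r, 0)) (at r)" for r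
      using C1_pair_line[OF F, of 0 1 0 0] by simp
    show "continuous_on (closed_segment s 0) (\<lambda>r. F1 (r, 0))"
      by (intro C1_pair_continuous_on[OF F] continuous_intros)
    fix r assume "r \<in> closed_segment s 0"
    then have r: "0 \<le> r" "r \<le> 1/2" using st by (auto simp: closed_segment_eq_real_ivl split: if_splits)
    show "ennreal \<bar>F1 (r, 0)\<bar> \<le> vline (?a F12) r + 2 * vline (?a F1) r"
      unfolding vline_def[of "?a F1"]
    proof (rule average_half)
      fix t' :: real assume t': "t' \<in> {0..1/2}"
      then have st': "(r, t') \<in> reftri" "(r, 0) \<in> reftri" using r by (auto simp: reftri_def)
      have "ennreal \<bar>F1 (r, 0) - 0\<bar> \<le> vline (?a F12) r + ennreal \<bar>F1 (r, t')\<bar>"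
        by (intro order_trans[OF ennreal_triangle add_mono[OF C1_pair_vertical[OF F1 _ st'(2,1)]]]) auto
      then show "ennreal \<bar>F1 (r, 0)\<bar> \<le> vline (?a F12) r + ennreal \<bar>F1 (r, t')\<bar> * indicator reftri (r, t')"
        using st' by simp
    qed (rule section_measurable(2)[OF m(1)])
  qed
  have 2: "ennreal \<bar>F (s, t) - F (s, 0)\<bar> \<le> (\<integral>\<^sup>+\<tau>. hline (?a F12) \<tau> + 2 * hline (?a F2) \<tau> \<partial>lborel)"
  proof (rule ftc_bound[where \<phi>="\<lambda>r. F (s, r)" and \<phi>'="\<lambda>r. F2 (s, r)"])
    show "((\<lambda>r. F (s, r)) has_real_derivative F2 (s, r)) (at r)" for r
      using C1_pair_line[OF F, of s 0 0 1] by simp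
    show "continuous_on (closed_segment t 0) (\<lambda>r. F2 (s, r))"
      by (intro C1_pair_continuous_on[OF F] continuous_intros)
    fix r assume "r \<in> closed_segment t 0"
    then have r: "0 \<le> r" "r \<le> 1/2" using st by (auto simp: closed_segment_eq_real_ivl split: if_splits)
    show "ennreal \<bar>F2 (s, r)\<bar> \<le> hline (?a F12) r + 2 * hline (?a F2) r"
      unfolding hline_def[of "?a F2"]
    proof (rule average_half)
      fix t' :: real assume t': "t' \<in> {0..1/2}"
      then have st': "(t', r) \<in> reftri" "(s, r) \<in> reftri" using r st by (auto simp: reftri_def)
      have "ennreal \<bar>F2 (s, r) - 0\<bar> \<le> hline (?a F12) r + ennreal \<bar>F2 (t', r)\<bar>"
        by (intro order_trans[OF ennreal_triangle add_mono[OF C1_pair_horizontal[OF F2 _ st'(2,1)]]]) auto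
      then show "ennreal \<bar>F2 (s, r)\<bar> \<le> hline (?a F12) r + ennreal \<bar>F2 (t', r)\<bar> * indicator reftri (t', r)"
        using st' by simp
    qed (rule section_measurable(1)[OF m(2)])
  qed
  have I: "(\<integral>\<^sup>+\<sigma>. vline (?a F12) \<sigma> + 2 * vline (?a F1) \<sigma> \<partial>lborel) = triint (?a F12) + 2 * triint (?a F1)"
    "(\<integral>\<^sup>+\<tau>. hline (?a F12) \<tau> + 2 * hline (?a F2) \<tau> \<partial>lborel) = triint (?a F12) + 2 * triint (?a F2)"
    using hline_measurable[OF m(3)] hline_measurable[OF m(2)] vline_measurable[OF m(3)] vline_measurable[OF m(1)]
    by (simp_all add: nn_integral_add nn_integral_cmult nn_integral_hline[OF m(3)] nn_integral_hline[OF m(2)]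
         nn_integral_vline[OF m(3)] nn_integral_vline[OF m(1)])
  have "ennreal \<bar>F (s, t) - F (0, 0)\<bar> \<le> (triint (?a F12) + 2 * triint (?a F2)) + (triint (?a F12) + 2 * triint (?a F1))"
    by (rule order_trans[OF ennreal_triangle add_mono[OF 2[unfolded I] 1[unfolded I]]])
  also have "\<dots> = 2 * triint (?a F1) + 2 * triint (?a F2) + 2 * triint (?a F12)"
    by (simp add: mult_2 ac_simps)
  finally show ?thesis .
qed

lemma edge_bound_swap:
  assumes F: "C1_pair F F1 F2" and F2: "C1_pair F2 F12 F22"
    and edge: "F (0, 0) = F (0, 1)"
    and Z [measurable]: "Z \<in> borel_measurable borel"
    and Zb: "\<And>p. p \<in> reftri \<Longrightarrow> \<bar>F22 p\<bar> \<le> Z p" "\<And>p. p \<in> reftri \<Longrightarrow> \<bar>F12 p\<bar> \<le> Z p"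
      "\<And>p. p \<in> reftri \<Longrightarrow> \<bar>F12 p - F22 p\<bar> \<le> Z p"
    and st: "(s, t) \<in> reftri"
  shows "ennreal \<bar>F2 (s, t)\<bar> \<le> hline Z t + vline Z s + 4 * triint Z"
proof -
  let ?sw = "\<lambda>(s, t). (t, s) :: real \<times> real"
  have sw: "p \<in> reftri \<Longrightarrow> ?sw p \<in> reftri" for p by (auto simp: reftri_def)
  have ind: "indicator reftri (s, t) = (indicator reftri (t, s) :: ennreal)" for s t
    by (auto simp: reftri_def indicator_def)
  have m: "(\<lambda>(s, t). Z (t, s)) \<in> borel_measurable borel"
  proof -
    have "(\<lambda>p::real\<times>real. (snd p, fst p)) \<in> borel_measurable borel"
      by (intro borel_measurable_continuous_onI continuous_intros)
    from measurable_compose[OF this Z] show ?thesis by (simp add: case_prod_unfold)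
  qed
  have h: "hline (\<lambda>(s, t). Z (t, s)) r = vline Z r" "vline (\<lambda>(s, t). Z (t, s)) r = hline Z r" for r
    unfolding hline_def vline_def case_prod_conv by (subst ind, rule refl)+
  have t: "triint (\<lambda>(s, t). Z (t, s)) = triint Z"
    using nn_integral_hline[OF m] nn_integral_vline[OF Z] by (simp add: h)
  have "ennreal \<bar>(\<lambda>(s, t). F2 (t, s)) (t, s)\<bar> \<le> hline (\<lambda>(s, t). Z (t, s)) s + vline (\<lambda>(s, t). Z (t, s)) t
      + 4 * triint (\<lambda>(s, t). Z (t, s))"
  proof (rule edge_bound[OF C1_pair_swap[OF F] C1_pair_swap[OF F2] _ m])
    show "(t, s) \<in> reftri" using sw[OF st] by simp
  qed (use edge Zb sw in \<open>auto\<close>)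
  then show ?thesis by (simp add: h t add.commute add.left_commute)
qed

lemma jensen_unit_interval:
  fixes f :: "real \<Rightarrow> real"
  assumes f [measurable]: "f \<in> borel_measurable borel" and f0: "\<And>x. 0 \<le> f x"
    and supp: "\<And>x. x \<notin> {0..1} \<Longrightarrow> f x = 0" and q: "1 \<le> q"
    and fin: "(\<integral>\<^sup>+x. ennreal (f x) \<partial>lborel) < \<infinity>"
  shows "ennreal (enn2real (\<integral>\<^sup>+x. ennreal (f x) \<partial>lborel) powr q) \<le> (\<integral>\<^sup>+x. ennreal (f x powr q) \<partial>lborel)"
proof -
  interpret prob_space "uniform_measure lborel {0..1::real}"
    by (rule prob_space_uniform_measure) auto
  have u: "(\<integral>\<^sup>+x. ennreal (g x) \<partial>uniform_measure lborel {0..1}) = (\<integral>\<^sup>+x. ennreal (g x) \<partial>lborel)"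
    if [measurable]: "g \<in> borel_measurable borel" and "\<And>x. x \<notin> {0..1} \<Longrightarrow> g x = 0" for g :: "real \<Rightarrow> real"
    using that(2) by (subst nn_integral_uniform_measure)
      (auto intro!: nn_integral_cong simp: divide_ennreal_def split: split_indicator)
  have "ennreal (enn2real (\<integral>\<^sup>+x. ennreal (f x) \<partial>lborel) powr q) \<le> (\<integral>\<^sup>+x. ennreal (f x powr q) \<partial>uniform_measure lborel {0..1})"
    using f0 q fin u[OF f supp] by (intro nn_integral_jensen_powr) auto
  then show ?thesis using u[of "\<lambda>x. f x powr q"] supp by simp
qed

context
  fixes Z :: "real \<times> real \<Rightarrow> real" and B :: real
  assumes Z: "Z \<in> borel_measurable borel" and Z0: "\<And>p. 0 \<le> Z p" and ZB: "\<And>p. p \<in> reftri \<Longrightarrow> Z p \<le> B"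
begin

lemma B_nonneg: "0 \<le> B"
  using ZB[of "(0, 0)"] Z0[of "(0, 0)"] by (simp add: reftri_def)

lemma line_le: "hline Z t \<le> ennreal B * indicator {0..1} t" "vline Z t \<le> ennreal B * indicator {0..1} t"
proof -
  have *: "(\<integral>\<^sup>+s. ennreal B * indicator {0..1} t * indicator {0..1::real} s \<partial>lborel) = ennreal B * indicator {0..1::real} t"
    by (subst nn_integral_cmult_indicator) auto
  have "hline Z t \<le> (\<integral>\<^sup>+s. ennreal B * indicator {0..1} t * indicator {0..1::real} s \<partial>lborel)"
    unfolding hline_def using ZB by (intro nn_integral_mono)
      (auto split: split_indicator intro!: ennreal_leI simp: reftri_def)
  then show "hline Z t \<le> ennreal B * indicator {0..1} t" using * by simp
  have "vline Z t \<le> (\<integral>\<^sup>+s. ennreal B * indicator {0..1} t * indicator {0..1::real} s \<partial>lborel)"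
    unfolding vline_def using ZB by (intro nn_integral_mono)
      (auto split: split_indicator intro!: ennreal_leI simp: reftri_def)
  then show "vline Z t \<le> ennreal B * indicator {0..1} t" using * by simp
qed

lemma triint_le: "triint Z \<le> ennreal B"
proof -
  have "triint Z \<le> (\<integral>\<^sup>+t. ennreal B * indicator {0..1::real} t \<partial>lborel)"
    unfolding nn_integral_hline[OF Z, symmetric] by (intro nn_integral_mono line_le)
  then show ?thesis by (simp add: nn_integral_cmult_indicator)
qed

lemma line_sum_le: "hline Z t + vline Z s + 4 * triint Z \<le> ennreal (6 * B)"
proof -
  have "hline Z t \<le> ennreal B" "vline Z s \<le> ennreal B"
    by (rule order_trans[OF line_le(1)] order_trans[OF line_le(2)]; simp split: split_indicator)+
  then have "hline Z t + vline Z s + 4 * triint Z \<le> ennreal B + ennreal B + 4 * ennreal B"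
    by (intro add_mono mult_left_mono triint_le) auto
  also have "\<dots> = ennreal (6 * B)"
    using B_nonneg by (simp add: ennreal_mult flip: distrib_right ennreal_plus)
  finally show ?thesis .
qed

text \<open>
  Each of the three terms, raised to the power \<open>q\<close> and integrated over the unit
  square, is at most the integral of \<open>Z\<^sup>q\<close>, by Jensen's inequality on unit
  intervals. Together they give \<open>3 * 6\<^sup>q \<le> 18\<^sup>q\<close>, where \<open>6 =
  1 + 1 + 4\<close> is the sum of the coefficients.
\<close>

lemma line_sum_power_bound:
  assumes q: "1 \<le> q"
    and g: "\<And>s t. (s, t) \<in> reftri \<Longrightarrow> ennreal \<bar>g (s, t)\<bar> \<le> hline Z t + vline Z s + 4 * triint Z"
  shows "triint (\<lambda>p. \<bar>g p\<bar> powr q) \<le> ennreal (18 powr q) * triint (\<lambda>p. Z p powr q)"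
proof -
  let ?W = "triint (\<lambda>p. Z p powr q)"
  define H where "H t = enn2real (hline Z t)" for t
  define V where "V t = enn2real (vline Z t)" for t
  define I where "I = enn2real (triint Z)"
  have fin: "hline Z t < \<infinity>" "vline Z t < \<infinity>" for t
    using line_le[of t] by (auto intro: order.strict_trans1 simp: ennreal_mult_less_top split: split_indicator_asm)
  have H: "hline Z t = ennreal (H t)" "vline Z t = ennreal (V t)" "0 \<le> H t" "0 \<le> V t" for t
    using fin[of t] by (auto simp: H_def V_def)
  have finI: "triint Z < \<infinity>" using triint_le by (auto intro: order.strict_trans1)
  have I: "triint Z = ennreal I" "0 \<le> I" using finI by (auto simp: I_def)
  have m: "(\<lambda>p. Z p powr q) \<in> borel_measurable borel" using Z by measurable
  have [measurable]: "H \<in> borel_measurable borel" "V \<in> borel_measurable borel"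
    unfolding H_def V_def using hline_measurable[OF Z] vline_measurable[OF Z] by measurable
  note sm = Z_pair_measurable[OF Z]
  have real_section: "(\<lambda>s. Z (s, t) * indicator reftri (s, t)) \<in> borel_measurable borel"
    "(\<lambda>s. Z (t, s) * indicator reftri (t, s)) \<in> borel_measurable borel" for t
    using sm by measurable
  have ind: "ennreal (x * indicator A y) = ennreal x * indicator A y"
     "(x * indicator A y) powr q = x powr q * indicator A y" for x :: real and A y
    using q by (auto split: split_indicator)
  have supp: "Z (s, t) * indicator reftri (s, t) = 0" if "s \<notin> {0..1} \<or> t \<notin> {0..1}" for s t
    using that by (auto simp: reftri_def indicator_def)
  have HW: "ennreal (H t powr q) \<le> hline (\<lambda>p. Z p powr q) t" for t
    using jensen_unit_interval[OF real_section(1)[of t] _ supp q] Z0 fin(1)[of t]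
    by (simp add: ind H_def hline_def)
  have VW: "ennreal (V t powr q) \<le> vline (\<lambda>p. Z p powr q) t" for t
    using jensen_unit_interval[OF real_section(2)[of t] _ supp q] Z0 fin(2)[of t]
    by (simp add: ind V_def vline_def)
  have HI: "(\<integral>\<^sup>+t. ennreal (H t powr q) \<partial>lborel) \<le> ?W"
    unfolding nn_integral_hline[OF m, symmetric] by (intro nn_integral_mono HW)
  have VI: "(\<integral>\<^sup>+t. ennreal (V t powr q) \<partial>lborel) \<le> ?W"
    unfolding nn_integral_vline[OF m, symmetric] by (intro nn_integral_mono VW)
  have HV0: "H t = 0" "V t = 0" if "t \<notin> {0..1}" for t
    using line_le[of t] that by (auto simp: H_def V_def)
  have eqI: "(\<integral>\<^sup>+t. ennreal (H t) \<partial>lborel) = ennreal I"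
    unfolding I(1)[symmetric] nn_integral_hline[OF Z, symmetric] by (intro nn_integral_cong) (simp add: H(1))
  have "ennreal (I powr q) \<le> (\<integral>\<^sup>+t. ennreal (H t powr q) \<partial>lborel)"
    using jensen_unit_interval[of H q] HV0 H q by (auto simp: eqI I)
  then have II: "ennreal (I powr q) \<le> ?W" using HI by (rule order_trans)
  have pt: "\<bar>g (s, t)\<bar> powr q \<le> 6 powr q * (H t powr q + V s powr q + I powr q)" if st: "(s, t) \<in> reftri" for s t
  proof -
    have "ennreal \<bar>g (s, t)\<bar> \<le> ennreal (H t + V s + 4 * I)"
      using g[OF st] H I by (simp add: ennreal_mult)
    moreover have "0 \<le> H t + V s + 4 * I" using H I by simp
    ultimately have 1: "\<bar>g (s, t)\<bar> \<le> H t + V s + 4 * I" by (simp only: ennreal_le_iff)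
    define x where "x = max (H t) (max (V s) I)"
    have x: "\<bar>g (s, t)\<bar> \<le> 6 * x" "0 \<le> x" using 1 H[of t] I unfolding x_def by linarith+
    have "x \<in> {H t, V s, I}" by (auto simp: x_def max_def)
    then have "x powr q \<le> H t powr q + V s powr q + I powr q" by auto
    then have "6 powr q * x powr q \<le> 6 powr q * (H t powr q + V s powr q + I powr q)" by (intro mult_left_mono) auto
    moreover have "\<bar>g (s, t)\<bar> powr q \<le> (6 * x) powr q" using x q by (intro powr_mono2) auto
    moreover have "(6 * x) powr q = 6 powr q * x powr q" using x by (simp add: powr_mult)
    ultimately show ?thesis by linarith
  qed
  let ?h = "\<lambda>s t. ennreal (6 powr q) * (ennreal (H t powr q) * indicator {0..1} s + ennreal (V s powr q) * indicator {0..1} t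
             + ennreal (I powr q) * (indicator {0..1} s * indicator {0..1} t))"
  have "triint (\<lambda>p. \<bar>g p\<bar> powr q) \<le> (\<integral>\<^sup>+p. ?h (fst p) (snd p) \<partial>lborel)"
    unfolding triint_def
  proof (intro nn_integral_mono)
    fix p show "ennreal (\<bar>g p\<bar> powr q) * indicator reftri p \<le> ?h (fst p) (snd p)"
    proof (cases "p \<in> reftri")
      case True
      obtain s t where p: "p = (s, t)" by force
      have st: "s \<in> {0..1}" "t \<in> {0..1}" using True by (auto simp: p reftri_def)
      have "ennreal (\<bar>g p\<bar> powr q) \<le> ennreal (6 powr q * (H t powr q + V s powr q + I powr q))"
        using pt[of s t] True by (intro ennreal_leI) (simp add: p)
      then show ?thesis using True st by (simp add: p ennreal_mult)
    qed simp
  qed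
  also have "\<dots> = (\<integral>\<^sup>+t. \<integral>\<^sup>+s. ?h s t \<partial>lborel \<partial>lborel)"
    by (subst nn_integral_lborel_pair(1)) (auto simp: borel_prod[symmetric])
  also have "\<dots> = ennreal (6 powr q) * ((\<integral>\<^sup>+t. ennreal (H t powr q) \<partial>lborel) + (\<integral>\<^sup>+s. ennreal (V s powr q) \<partial>lborel) + ennreal (I powr q))"
    by (simp add: nn_integral_cmult nn_integral_add nn_integral_multc)
  also have "\<dots> \<le> ennreal (6 powr q) * (?W + ?W + ?W)"
    by (intro mult_left_mono add_mono HI VI II) auto
  also have "\<dots> = ennreal (6 powr q) * 3 * ?W"
  proof -
    have "x + x + x = (1 + 1 + 1) * x" for x :: ennreal by (simp only: distrib_right mult_1)
    then show ?thesis by (simp add: mult.assoc)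
  qed
  also have "\<dots> \<le> ennreal (18 powr q) * ?W"
  proof (intro mult_right_mono)
    have "ennreal (6 powr q) * 3 = ennreal (6 powr q * 3)" by (simp add: ennreal_mult)
    also have "\<dots> \<le> ennreal (6 powr q * 3 powr q)"
      using powr_mono[of 1 q 3] q by (intro ennreal_leI mult_left_mono) auto
    also have "6 powr q * 3 powr q = (18::real) powr q" by (simp flip: powr_mult)
    finally show "ennreal (6 powr q) * 3 \<le> ennreal (18 powr q)" .
  qed auto
  finally show ?thesis .
qed

end

section \<open>Affine coordinates on a triangle and its circumradius\<close>

definition det2 :: "real^2 \<Rightarrow> real^2 \<Rightarrow> real" where
  "det2 u v = u$1 * v$2 - u$2 * v$1"

definition chart :: "real^2 \<Rightarrow> real^2 \<Rightarrow> real^2 \<Rightarrow> real \<times> real \<Rightarrow> real^2" where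
  "chart a b c p = a + fst p *\<^sub>R (b - a) + snd p *\<^sub>R (c - a)"

definition vec2 :: "real \<times> real \<Rightarrow> real^2" where
  "vec2 p = (\<chi> i. if i = 1 then fst p else snd p)"

lemma vec2_nth [simp]: "vec2 p $ 1 = fst p" "vec2 p $ 2 = snd p"
  by (auto simp: vec2_def)

lemma continuous_vec2: "continuous_on UNIV vec2"
proof -
  have "continuous_on UNIV (\<lambda>p::real \<times> real. if i = (1::2) then fst p else snd p)" for i
    by (cases "i = 1") (simp_all add: continuous_on_fst continuous_on_snd continuous_on_id)
  then show ?thesis unfolding vec2_def by (rule continuous_on_vec_lambda)
qed

lemma vec2_measurable [measurable]: "vec2 \<in> borel_measurable borel"
  by (rule borel_measurable_continuous_onI[OF continuous_vec2])

text \<open>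
  Both measures agree on boxes; Fubini's theorem on pairs thereby becomes available on
  \<open>real^2\<close>.
\<close>

lemma lborel_vec2: "lborel = distr lborel borel vec2"
proof (rule lborel_eqI)
  fix l u :: "real^2" assume le: "\<And>b. b \<in> Basis \<Longrightarrow> inner l b \<le> inner u b"
  have le': "l$1 \<le> u$1" "l$2 \<le> u$2" using le[of "axis 1 1"] le[of "axis 2 1"] by (auto simp: inner_axis)
  have "vec2 -` box l u = box (l$1, l$2) (u$1, u$2)"
    by (auto simp: mem_box_cart forall_2 mem_box Basis_prod_def)
  then have "emeasure (distr lborel borel vec2) (box l u) = emeasure lborel (box (l$1, l$2) (u$1, u$2))"
    by (simp add: emeasure_distr)
  also have "\<dots> = ennreal ((u$1 - l$1) * (u$2 - l$2))"
    using le' by (subst emeasure_lborel_box) (auto simp: Basis_prod_def)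
  also have "(u$1 - l$1) * (u$2 - l$2) = (\<Prod>b\<in>Basis. inner (u - l) b)"
  proof -
    have B: "(Basis :: (real^2) set) = {axis 1 1, axis 2 1}"
      by (auto simp: Basis_vec_def UNIV_2)
    have "axis 1 1 \<noteq> (axis 2 1 :: real^2)" by (simp add: axis_eq_axis)
    then show ?thesis by (simp add: B inner_axis)
  qed
  finally show "emeasure (distr lborel borel vec2) (box l u) = ennreal (\<Prod>b\<in>Basis. inner (u - l) b)" .
qed simp

lemma nn_integral_plane:
  assumes [measurable]: "h \<in> borel_measurable borel"
  shows "(\<integral>\<^sup>+x. h x \<partial>lborel) = (\<integral>\<^sup>+s. \<integral>\<^sup>+t. h (vec2 (s, t)) \<partial>lborel \<partial>lborel)"
proof -
  have "(\<integral>\<^sup>+x. h x \<partial>lborel) = (\<integral>\<^sup>+p. h (vec2 p) \<partial>lborel)"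
    by (subst lborel_vec2) (simp add: nn_integral_distr)
  also have "\<dots> = (\<integral>\<^sup>+s. \<integral>\<^sup>+t. h (vec2 (s, t)) \<partial>lborel \<partial>lborel)"
    by (rule nn_integral_lborel_pair(2)) measurable
  finally show ?thesis .
qed

lemma continuous_chart: "continuous_on UNIV (chart a b c)"
  unfolding chart_def by (intro continuous_intros)

lemma chart_measurable [measurable]: "chart a b c \<in> borel_measurable borel"
  by (rule borel_measurable_continuous_onI[OF continuous_chart])

lemma chart_swap: "chart a b c (s, t) = chart a c b (t, s)"
  by (simp add: chart_def)

lemma det2_swap: "det2 v u = - det2 u v"
  by (simp add: det2_def)

text \<open>
  Two one-dimensional substitutions: \<open>s\<close> is replaced by the first coordinate for
  fixed \<open>t\<close>, and then \<open>t\<close> by the second coordinate for fixed first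
  coordinate. The first step divides by the first component of \<open>b - a\<close>; if it is
  zero, the roles of \<open>b\<close> and \<open>c\<close> are exchanged.
\<close>

lemma nn_integral_chart:
  assumes h [measurable]: "h \<in> borel_measurable borel" and det: "det2 (b - a) (c - a) \<noteq> 0"
  shows "ennreal \<bar>det2 (b - a) (c - a)\<bar> * (\<integral>\<^sup>+p. h (chart a b c p) \<partial>lborel) = (\<integral>\<^sup>+x. h x \<partial>lborel)"
proof -
  have [measurable]: "(\<lambda>x. h (vec2 x)) \<in> borel_measurable (borel \<Otimes>\<^sub>M borel)" 
    unfolding borel_prod by measurable
  have mc [measurable]: "(\<lambda>p. h (chart a b c p)) \<in> borel_measurable (borel \<Otimes>\<^sub>M borel)" for b c
    unfolding borel_prod by measurable
  have main: "ennreal \<bar>det2 (b - a) (c - a)\<bar> * (\<integral>\<^sup>+p. h (chart a b c p) \<partial>lborel) = (\<integral>\<^sup>+x. h x \<partial>lborel)"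
    if det: "det2 (b - a) (c - a) \<noteq> 0" and e1: "(b - a)$1 \<noteq> 0" for b c
  proof -
    define e e' where "e = b - a" and "e' = c - a"
    define d where "d = det2 e e'"
    have d0: "d \<noteq> 0" and e10: "e$1 \<noteq> 0" using det e1 by (auto simp: d_def e_def e'_def)
    define \<kappa> where "\<kappa> = d / e$1"
    have \<kappa>: "\<kappa> \<noteq> 0" using d0 e10 by (simp add: \<kappa>_def)
    define y where "y x1 t = vec2 (x1, (a$2 + (e$2 / e$1) * (x1 - a$1)) + \<kappa> * t)" for x1 t
    have pt: "chart a b c (s, t) = y (a$1 + t * e'$1 + e$1 * s) t" for s t
    proof -
      have "chart a b c (s, t) $ 1 = y (a$1 + t * e'$1 + e$1 * s) t $ 1"
        by (simp add: y_def chart_def e_def e'_def)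
      moreover have "chart a b c (s, t) $ 2 = y (a$1 + t * e'$1 + e$1 * s) t $ 2"
        using e10 by (simp add: y_def chart_def \<kappa>_def d_def det2_def flip: e_def e'_def) (simp add: field_simps)
      ultimately show ?thesis by (simp add: vec_eq_iff forall_2)
    qed
    have my: "(\<lambda>p. h (y (fst p) (snd p))) \<in> borel_measurable (borel \<Otimes>\<^sub>M borel)"
      unfolding y_def by measurable
    have my1: "(\<lambda>x1. h (y x1 t)) \<in> borel_measurable borel" for t
      unfolding y_def by measurable
    have "(\<integral>\<^sup>+p. h (chart a b c p) \<partial>lborel) = (\<integral>\<^sup>+t. \<integral>\<^sup>+s. h (chart a b c (s, t)) \<partial>lborel \<partial>lborel)"
      by (rule nn_integral_lborel_pair(1)) measurable
    then have "ennreal \<bar>e$1\<bar> * (\<integral>\<^sup>+p. h (chart a b c p) \<partial>lborel)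
        = (\<integral>\<^sup>+t. ennreal \<bar>e$1\<bar> * (\<integral>\<^sup>+s. h (chart a b c (s, t)) \<partial>lborel) \<partial>lborel)"
      by (simp add: nn_integral_cmult)
    also have "\<dots> = (\<integral>\<^sup>+t. \<integral>\<^sup>+x1. h (y x1 t) \<partial>lborel \<partial>lborel)"
      unfolding pt by (intro nn_integral_cong nn_integral_real_affine[OF my1 e10, symmetric])
    also have "\<dots> = (\<integral>\<^sup>+x1. \<integral>\<^sup>+t. h (y x1 t) \<partial>lborel \<partial>lborel)"
      using lborel_pair.Fubini'[of "\<lambda>x t. h (y x t)"] my by (simp add: case_prod_unfold)
    finally have 1: "ennreal \<bar>e$1\<bar> * (\<integral>\<^sup>+p. h (chart a b c p) \<partial>lborel) = (\<integral>\<^sup>+x1. \<integral>\<^sup>+t. h (y x1 t) \<partial>lborel \<partial>lborel)" .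
    have 2: "ennreal \<bar>\<kappa>\<bar> * (\<integral>\<^sup>+t. h (y x1 t) \<partial>lborel) = (\<integral>\<^sup>+x2. h (vec2 (x1, x2)) \<partial>lborel)" for x1
      unfolding y_def by (rule nn_integral_real_affine[OF _ \<kappa>, symmetric]) measurable
    have "d = \<kappa> * e$1" using e10 by (simp add: \<kappa>_def)
    then have "\<bar>d\<bar> = \<bar>\<kappa>\<bar> * \<bar>e$1\<bar>" by (simp add: abs_mult)
    then have "ennreal \<bar>d\<bar> * (\<integral>\<^sup>+p. h (chart a b c p) \<partial>lborel)
       = ennreal \<bar>\<kappa>\<bar> * (ennreal \<bar>e$1\<bar> * (\<integral>\<^sup>+p. h (chart a b c p) \<partial>lborel))"
      by (simp add: ennreal_mult mult.assoc)
    also have "\<dots> = (\<integral>\<^sup>+x1. ennreal \<bar>\<kappa>\<bar> * (\<integral>\<^sup>+t. h (y x1 t) \<partial>lborel) \<partial>lborel)"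
      unfolding 1 using my by (intro nn_integral_cmult[symmetric]) (simp add: case_prod_unfold lborel.borel_measurable_nn_integral_fst[of "\<lambda>p. h (y (fst p) (snd p))" borel, simplified])
    also have "\<dots> = (\<integral>\<^sup>+x. h x \<partial>lborel)" unfolding 2 by (rule nn_integral_plane[OF h, symmetric])
    finally show ?thesis by (simp add: d_def e_def e'_def)
  qed
  show ?thesis
  proof (cases "(b - a)$1 = 0")
    case True
    then have "(c - a)$1 \<noteq> 0" using det by (auto simp: det2_def)
    moreover have "det2 (c - a) (b - a) \<noteq> 0" using det by (simp add: det2_swap[of "c - a"])
    ultimately have "ennreal \<bar>det2 (c - a) (b - a)\<bar> * (\<integral>\<^sup>+p. h (chart a c b p) \<partial>lborel) = (\<integral>\<^sup>+x. h x \<partial>lborel)"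
      using main by blast
    moreover have "(\<integral>\<^sup>+p. h (chart a c b p) \<partial>lborel) = (\<integral>\<^sup>+p. h (chart a b c p) \<partial>lborel)"
    proof -
      have "(\<integral>\<^sup>+p. h (chart a c b p) \<partial>lborel) = (\<integral>\<^sup>+t. \<integral>\<^sup>+s. h (chart a c b (s, t)) \<partial>lborel \<partial>lborel)"
        by (rule nn_integral_lborel_pair(1)) measurable
      also have "\<dots> = (\<integral>\<^sup>+t. \<integral>\<^sup>+s. h (chart a b c (t, s)) \<partial>lborel \<partial>lborel)"
        unfolding chart_swap[of a c b] ..
      also have "\<dots> = (\<integral>\<^sup>+p. h (chart a b c p) \<partial>lborel)"
        by (rule nn_integral_lborel_pair(2)[symmetric]) measurable
      finally show ?thesis .
    qed
    ultimately show ?thesis by (simp add: det2_swap[of "c - a"])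
  qed (use main det in blast)
qed

lemma chart_in_hull:
  assumes det: "det2 (b - a) (c - a) \<noteq> 0"
  shows "chart a b c p \<in> convex hull {a, b, c} \<longleftrightarrow> p \<in> reftri"
proof
  assume "p \<in> reftri"
  then obtain s t where p: "p = (s, t)" "0 \<le> s" "0 \<le> t" "s + t \<le> 1" by (auto simp: reftri_def)
  then show "chart a b c p \<in> convex hull {a, b, c}"
    unfolding convex_hull_3_alt by (auto simp: chart_def)
next
  assume "chart a b c p \<in> convex hull {a, b, c}"
  then obtain v w where uvw: "0 \<le> v" "0 \<le> w" "v + w \<le> 1" "chart a b c p = a + v *\<^sub>R (b - a) + w *\<^sub>R (c - a)"
    unfolding convex_hull_3_alt by auto
  have "a + fst p *\<^sub>R (b - a) + snd p *\<^sub>R (c - a) = a + v *\<^sub>R (b - a) + w *\<^sub>R (c - a)"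
    using uvw(4) unfolding chart_def .
  then have 0: "(fst p - v) *\<^sub>R (b - a) + (snd p - w) *\<^sub>R (c - a) = 0"
    by (simp add: algebra_simps)
  define x y where "x = fst p - v" and "y = snd p - w"
  have 1: "x * (b - a)$1 + y * (c - a)$1 = 0" "x * (b - a)$2 + y * (c - a)$2 = 0"
    using arg_cong[OF 0, of "\<lambda>z. z$1"] arg_cong[OF 0, of "\<lambda>z. z$2"] by (simp_all add: x_def y_def)
  have "x * det2 (b - a) (c - a) = (x * (b - a)$1 + y * (c - a)$1) * (c - a)$2 - (x * (b - a)$2 + y * (c - a)$2) * (c - a)$1"
    "y * det2 (b - a) (c - a) = (x * (b - a)$2 + y * (c - a)$2) * (b - a)$1 - (x * (b - a)$1 + y * (c - a)$1) * (b - a)$2"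
    unfolding det2_def by algebra+
  then have "x = 0" "y = 0" using 1 det by auto
  then show "p \<in> reftri" using uvw by (cases p) (auto simp: x_def y_def reftri_def)
qed

lemma hull_eq_chart_image: "convex hull {a, b, c} = chart a b c ` reftri"
  unfolding convex_hull_3_alt by (force simp: chart_def reftri_def)

lemma compact_triangle: "compact (convex hull {a, b, c :: real^2})"
  by (intro compact_convex_hull finite_imp_compact) auto

lemma AE_open_triangle: "AE x in lborel. (x \<in> open_triangle a b c) = (x \<in> convex hull {a, b, c})"
proof -
  have "negligible (frontier (convex hull {a, b, c}))" by (rule negligible_convex_frontier) (rule convex_convex_hull)
  then have "AE x in lebesgue. x \<notin> frontier (convex hull {a, b, c})" by (rule negligible_AE_lebesgue)
  then have "AE x in lborel. x \<notin> frontier (convex hull {a, b, c})" by (simp add: AE_completion_iff)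
  then show ?thesis
  proof eventually_elim
    case (elim x)
    have "closed (convex hull {a, b, c})" by (rule compact_imp_closed[OF compact_triangle])
    then show ?case using elim interior_subset[of "convex hull {a, b, c}"]
      by (auto simp: frontier_def open_triangle_def)
  qed
qed

lemma nn_integral_open_triangle:
  assumes h [measurable]: "h \<in> borel_measurable borel" and det: "det2 (b - a) (c - a) \<noteq> 0"
  shows "(\<integral>\<^sup>+x. h x * indicator (open_triangle a b c) x \<partial>lborel)
     = ennreal \<bar>det2 (b - a) (c - a)\<bar> * (\<integral>\<^sup>+p. h (chart a b c p) * indicator reftri p \<partial>lborel)"
proof -
  have [measurable]: "convex hull {a, b, c} \<in> sets borel"
    using compact_imp_closed[OF compact_triangle] by (rule borel_closed)
  have "(\<integral>\<^sup>+x. h x * indicator (open_triangle a b c) x \<partial>lborel) = (\<integral>\<^sup>+x. h x * indicator (convex hull {a, b, c}) x \<partial>lborel)"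
  proof (rule nn_integral_cong_AE)
    show "AE x in lborel. h x * indicator (open_triangle a b c) x = h x * indicator (convex hull {a, b, c}) x"
      using AE_open_triangle[of a b c] by eventually_elim (simp add: indicator_def)
  qed
  also have "\<dots> = ennreal \<bar>det2 (b - a) (c - a)\<bar> * (\<integral>\<^sup>+p. h (chart a b c p) * indicator (convex hull {a, b, c}) (chart a b c p) \<partial>lborel)"
    by (rule nn_integral_chart[OF _ det, symmetric]) measurable
  also have "(\<integral>\<^sup>+p. h (chart a b c p) * indicator (convex hull {a, b, c}) (chart a b c p) \<partial>lborel)
     = (\<integral>\<^sup>+p. h (chart a b c p) * indicator reftri p \<partial>lborel)"
    using chart_in_hull[OF det] by (intro nn_integral_cong) (auto simp: indicator_def)
  finally show ?thesis .
qed

lemma collinear_iff_det2: "collinear {a, b, c} \<longleftrightarrow> det2 (b - a) (c - a) = 0"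
proof
  assume "collinear {a, b, c}"
  then obtain u where u: "\<forall>x\<in>{a, b, c}. \<forall>y\<in>{a, b, c}. \<exists>k. x - y = k *\<^sub>R u" unfolding collinear_def by blast
  obtain k l where "b - a = k *\<^sub>R u" "c - a = l *\<^sub>R u" using u by blast
  then show "det2 (b - a) (c - a) = 0" by (simp add: det2_def)
next
  assume 0: "det2 (b - a) (c - a) = 0"
  show "collinear {a, b, c}"
  proof (cases "b = a")
    case False
    define e where "e = b - a"
    define e' where "e' = c - a"
    have 1: "e$1 * e'$2 = e$2 * e'$1" using 0 by (simp add: det2_def e_def e'_def)
    have ne: "e$1 \<noteq> 0 \<or> e$2 \<noteq> 0" using False by (auto simp: e_def vec_eq_iff forall_2)
    have "\<exists>k. e' = k *\<^sub>R e"
    proof (cases "e$1 = 0")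
      case True
      then show ?thesis using 1 ne by (intro exI[of _ "e'$2 / e$2"]) (auto simp: vec_eq_iff forall_2)
    next
      case F: False
      then show ?thesis using 1 by (intro exI[of _ "e'$1 / e$1"]) (auto simp: vec_eq_iff forall_2 field_simps)
    qed
    then obtain k where k: "c - a = k *\<^sub>R (b - a)" by (auto simp: e_def e'_def)
    then have "c = a + k *\<^sub>R (b - a)" by (simp add: algebra_simps)
    moreover have "b = a + 1 *\<^sub>R (b - a)" by simp
    moreover have "a = a + 0 *\<^sub>R (b - a)" by simp
    ultimately have "\<exists>u v. \<forall>x\<in>{a,b,c}. \<exists>r. x = u + r *\<^sub>R v" by blast
    then show ?thesis by (simp only: collinear_alt)
  qed simp
qed

lemma norm_sq_2: "norm (v :: real^2) ^ 2 = v$1 * v$1 + v$2 * v$2"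
  by (simp only: power2_norm_eq_inner inner_vec_def sum_2 inner_real_def)

text \<open>
  The classical relation between the product of the sides, the circumradius and the area.
  Relative to \<open>a\<close>, equidistance of the centre \<open>q\<close> from
  \<open>a\<close> and \<open>b\<close> says that twice its inner product with \<open>b -
  a\<close> is the square of that side, and likewise for \<open>c\<close>; the squared relation
  is a polynomial consequence of these two equations.
\<close>

lemma circumscribed_radius:
  fixes a b c q :: "real^2"
  assumes R: "dist q a = R" "dist q b = R" "dist q c = R"
  shows "norm (b - a) * norm (c - a) * norm (c - b) = 2 * R * \<bar>det2 (b - a) (c - a)\<bar>"
proof -
  define o1 o2 where "o1 = (q - a)$1" and "o2 = (q - a)$2"
  define x y where "x = (b - a)$1" and "y = (b - a)$2"
  define x' y' where "x' = (c - a)$1" and "y' = (c - a)$2"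
  have R0: "0 \<le> R" using R(1) zero_le_dist by metis
  have 0: "o1 * o1 + o2 * o2 = R^2"
    using R(1) norm_sq_2[of "q - a"] by (simp add: dist_norm o1_def o2_def)
  have b: "(o1 - x) * (o1 - x) + (o2 - y) * (o2 - y) = R^2"
    using R(2) norm_sq_2[of "q - b"] by (simp add: dist_norm o1_def o2_def x_def y_def)
  have c: "(o1 - x') * (o1 - x') + (o2 - y') * (o2 - y') = R^2"
    using R(3) norm_sq_2[of "q - c"] by (simp add: dist_norm o1_def o2_def x'_def y'_def)
  have e: "2 * (o1 * x + o2 * y) = x * x + y * y" using 0 b by algebra
  have e': "2 * (o1 * x' + o2 * y') = x' * x' + y' * y'" using 0 c by algebra
  have "4 * R^2 * (x * y' - y * x')^2 = (x * x + y * y) * (x' * x' + y' * y') * ((x' - x) * (x' - x) + (y' - y) * (y' - y))"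
    unfolding 0[symmetric] using e e' by algebra
  moreover have "norm (b - a)^2 = x * x + y * y" "norm (c - a)^2 = x' * x' + y' * y'"
     "norm (c - b)^2 = (x' - x) * (x' - x) + (y' - y) * (y' - y)"
    using norm_sq_2[of "b - a"] norm_sq_2[of "c - a"] norm_sq_2[of "c - b"]
    by (auto simp: x_def y_def x'_def y'_def)
  ultimately have "(norm (b - a) * norm (c - a) * norm (c - b))^2 = (2 * R * \<bar>det2 (b - a) (c - a)\<bar>)^2"
    by (simp add: power_mult_distrib det2_def x_def y_def x'_def y'_def)
  then show ?thesis using R0 by (simp add: power2_eq_iff_nonneg)
qed

lemma circumcenter_exists:
  assumes det: "det2 (b - a) (c - a) \<noteq> 0"
  shows "\<exists>q. dist q a = dist q b \<and> dist q c = dist q b"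
proof -
  define x y where "x = (b - a)$1" and "y = (b - a)$2"
  define x' y' where "x' = (c - a)$1" and "y' = (c - a)$2"
  define d where "d = 2 * (x * y' - y * x')"
  have d: "d \<noteq> 0" using det by (simp add: d_def det2_def x_def y_def x'_def y'_def)
  define o1 where "o1 = ((x * x + y * y) * y' - (x' * x' + y' * y') * y) / d"
  define o2 where "o2 = (x * (x' * x' + y' * y') - x' * (x * x + y * y)) / d"
  have do: "d * o1 = (x * x + y * y) * y' - (x' * x' + y' * y') * y" "d * o2 = x * (x' * x' + y' * y') - x' * (x * x + y * y)"
    using d by (auto simp: o1_def o2_def)
  have "d * (2 * (o1 * x + o2 * y)) = d * (x * x + y * y)" "d * (2 * (o1 * x' + o2 * y')) = d * (x' * x' + y' * y')"
    using do unfolding d_def by algebra+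
  then have e: "2 * (o1 * x + o2 * y) = x * x + y * y" "2 * (o1 * x' + o2 * y') = x' * x' + y' * y'"
    using d by auto
  define q where "q = a + vec2 (o1, o2)"
  have "norm (q - a)^2 = norm (q - b)^2" "norm (q - c)^2 = norm (q - b)^2"
    using e unfolding norm_sq_2 by (simp_all add: q_def x_def y_def x'_def y'_def algebra_simps)
  then show ?thesis by (intro exI[of _ q]) (simp add: dist_norm power2_eq_iff_nonneg)
qed

lemma circumradius_works:
  assumes det: "det2 (b - a) (c - a) \<noteq> 0"
  shows "\<exists>q. dist q a = circumradius a b c \<and> dist q b = circumradius a b c \<and> dist q c = circumradius a b c"
proof -
  obtain q where q: "dist q a = dist q b" "dist q c = dist q b" using circumcenter_exists[OF det] by blast
  have "\<exists>!R. \<exists>q. dist q a = R \<and> dist q b = R \<and> dist q c = R"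
  proof (rule ex1I[of _ "dist q b"])
    show "\<exists>q'. dist q' a = dist q b \<and> dist q' b = dist q b \<and> dist q' c = dist q b" using q by blast
    fix R assume "\<exists>q. dist q a = R \<and> dist q b = R \<and> dist q c = R"
    then have "2 * R * \<bar>det2 (b - a) (c - a)\<bar> = 2 * dist q b * \<bar>det2 (b - a) (c - a)\<bar>"
      using circumscribed_radius q by metis
    then show "R = dist q b" using det by simp
  qed
  then show ?thesis unfolding circumradius_def by (rule theI')
qed

text \<open>
  The sides are chords of the circumscribed circle and so at most its diameter.
\<close>

lemma circumradius_sides:
  assumes det: "det2 (b - a) (c - a) \<noteq> 0"
  defines "R \<equiv> circumradius a b c"
  shows "norm (b - a) * norm (c - a) * norm (c - b) = 2 * R * \<bar>det2 (b - a) (c - a)\<bar>"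
    and "norm (b - a) \<le> 2 * R" "norm (c - a) \<le> 2 * R" "norm (c - b) \<le> 2 * R" "0 < R"
proof -
  obtain q where q: "dist q a = R" "dist q b = R" "dist q c = R"
    using circumradius_works[OF det] unfolding R_def by blast
  show "norm (b - a) * norm (c - a) * norm (c - b) = 2 * R * \<bar>det2 (b - a) (c - a)\<bar>"
    using q by (rule circumscribed_radius)
  show 1: "norm (b - a) \<le> 2 * R" and "norm (c - a) \<le> 2 * R" "norm (c - b) \<le> 2 * R"
    using q dist_triangle3[of b a q] dist_triangle3[of c a q] dist_triangle3[of c b q] by (auto simp: dist_norm)
  have "b \<noteq> a" using det by (auto simp: det2_def)
  then show "0 < R" using 1 by (smt (verit) zero_less_norm_iff right_minus_eq)
qed

section \<open>The gradient of a function vanishing at the vertices\<close>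

definition C1_plane :: "(real^2 \<Rightarrow> real) \<Rightarrow> (real^2 \<Rightarrow> real) \<Rightarrow> (real^2 \<Rightarrow> real) \<Rightarrow> bool" where
  "C1_plane f f1 f2 \<longleftrightarrow> (\<forall>x. (f has_derivative (\<lambda>h. f1 x * h$1 + f2 x * h$2)) (at x)) \<and>
     continuous_on UNIV f1 \<and> continuous_on UNIV f2"

lemma C1_plane_continuous: "C1_plane f f1 f2 \<Longrightarrow> continuous_on UNIV f"
  unfolding C1_plane_def by (meson continuous_at_imp_continuous_on has_derivative_continuous)

lemma C1_plane_chart:
  assumes "C1_plane f f1 f2"
  shows "C1_pair (\<lambda>p. f (chart a b c p))
    (\<lambda>p. (b - a)$1 * f1 (chart a b c p) + (b - a)$2 * f2 (chart a b c p))
    (\<lambda>p. (c - a)$1 * f1 (chart a b c p) + (c - a)$2 * f2 (chart a b c p))"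
  unfolding C1_pair_def
proof (intro conjI allI)
  fix p
  have 1: "(chart a b c has_derivative (\<lambda>h. fst h *\<^sub>R (b - a) + snd h *\<^sub>R (c - a))) (at p)"
    unfolding chart_def by (auto intro!: derivative_eq_intros)
  have 2: "(f has_derivative (\<lambda>h. f1 x * h$1 + f2 x * h$2)) (at x)" for x
    using assms by (simp add: C1_plane_def)
  show "((\<lambda>p. f (chart a b c p)) has_derivative (\<lambda>h. ((b - a)$1 * f1 (chart a b c p) + (b - a)$2 * f2 (chart a b c p)) * fst h +
     ((c - a)$1 * f1 (chart a b c p) + (c - a)$2 * f2 (chart a b c p)) * snd h)) (at p)"
    by (rule has_derivative_eq_rhs[OF has_derivative_compose[OF 1 2]]) (auto simp: algebra_simps)
next
  have c: "continuous_on UNIV (\<lambda>p. f1 (chart a b c p))" "continuous_on UNIV (\<lambda>p. f2 (chart a b c p))"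
    using assms continuous_on_compose2[OF _ continuous_chart, of UNIV] unfolding C1_plane_def by auto
  show "continuous_on UNIV (\<lambda>p. (b - a)$1 * f1 (chart a b c p) + (b - a)$2 * f2 (chart a b c p))"
    "continuous_on UNIV (\<lambda>p. (c - a)$1 * f1 (chart a b c p) + (c - a)$2 * f2 (chart a b c p))"
    by (intro continuous_on_add continuous_on_mult continuous_on_const c)+
qed

text \<open>
  The derivatives are named explicitly; one function \<open>u12\<close> serves for both mixed
  derivatives.
\<close>

definition C2_plane where
  "C2_plane u u1 u2 u11 u12 u22 \<longleftrightarrow> C1_plane u u1 u2 \<and> C1_plane u1 u11 u12 \<and> C1_plane u2 u12 u22"

lemma C1_plane_linear:
  assumes "C1_plane f f1 f2" "C1_plane g g1 g2"
  shows "C1_plane (\<lambda>x. \<alpha> * f x + \<beta> * g x) (\<lambda>x. \<alpha> * f1 x + \<beta> * g1 x) (\<lambda>x. \<alpha> * f2 x + \<beta> * g2 x)"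
  unfolding C1_plane_def
proof (intro conjI allI)
  fix x
  have "(f has_derivative (\<lambda>h. f1 x * h$1 + f2 x * h$2)) (at x)" "(g has_derivative (\<lambda>h. g1 x * h$1 + g2 x * h$2)) (at x)"
    using assms by (auto simp: C1_plane_def)
  then have "((\<lambda>x. \<alpha> * f x + \<beta> * g x) has_derivative
     (\<lambda>h. \<alpha> * (f1 x * h$1 + f2 x * h$2) + \<beta> * (g1 x * h$1 + g2 x * h$2))) (at x)"
    by (intro has_derivative_add has_derivative_mult_right)
  then show "((\<lambda>x. \<alpha> * f x + \<beta> * g x) has_derivative
     (\<lambda>h. (\<alpha> * f1 x + \<beta> * g1 x) * h$1 + (\<alpha> * f2 x + \<beta> * g2 x) * h$2)) (at x)"
    by (rule has_derivative_eq_rhs) (auto simp: algebra_simps)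
qed (use assms in \<open>auto simp: C1_plane_def intro!: continuous_on_add continuous_on_mult continuous_on_const\<close>)

lemma open_triangle_rotate: "open_triangle b c a = open_triangle a b c"
proof -
  have "{b, c, a} = {a, b, c}" by auto
  then show ?thesis by (simp add: open_triangle_def)
qed

lemma det2_rotate: "det2 (c - b) (a - b) = det2 (b - a) (c - a)"
  by (simp add: det2_def algebra_simps)

lemma triint_cmult:
  assumes "0 \<le> k" and [measurable]: "f \<in> borel_measurable borel" and "\<And>p. 0 \<le> f p"
  shows "triint (\<lambda>p. k * f p) = ennreal k * triint f"
  unfolding triint_def
proof (subst nn_integral_cmult[symmetric])
  show "(\<lambda>p. ennreal (f p) * indicator reftri p) \<in> borel_measurable lborel" by measurable
  show "(\<integral>\<^sup>+p. ennreal (k * f p) * indicator reftri p \<partial>lborel) = (\<integral>\<^sup>+p. ennreal k * (ennreal (f p) * indicator reftri p) \<partial>lborel)"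
    using assms by (simp add: ennreal_mult mult.assoc)
qed

lemma triint_mono: "(\<And>p. p \<in> reftri \<Longrightarrow> f p \<le> g p) \<Longrightarrow> triint f \<le> triint g"
  unfolding triint_def by (intro nn_integral_mono) (auto split: split_indicator intro!: ennreal_leI)

lemma triint_add:
  assumes [measurable]: "f \<in> borel_measurable borel" "g \<in> borel_measurable borel" and "\<And>p. 0 \<le> f p" "\<And>p. 0 \<le> g p"
  shows "triint (\<lambda>p. f p + g p) = triint f + triint g"
  unfolding triint_def
proof (subst nn_integral_add[symmetric])
  show "(\<integral>\<^sup>+p. ennreal (f p + g p) * indicator reftri p \<partial>lborel) =
     (\<integral>\<^sup>+p. ennreal (f p) * indicator reftri p + ennreal (g p) * indicator reftri p \<partial>lborel)"
    using assms by (simp add: distrib_right)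
qed measurable

context
  fixes u u1 u2 u11 u12 u22 :: "real^2 \<Rightarrow> real"
  assumes C2: "C2_plane u u1 u2 u11 u12 u22"
begin

definition dir_deriv :: "real^2 \<Rightarrow> real^2 \<Rightarrow> real" where
  "dir_deriv e x = e$1 * u1 x + e$2 * u2 x"

definition dir_deriv2 :: "real^2 \<Rightarrow> real^2 \<Rightarrow> real^2 \<Rightarrow> real" where
  "dir_deriv2 e e' x = e'$1 * (e$1 * u11 x + e$2 * u12 x) + e'$2 * (e$1 * u12 x + e$2 * u22 x)"

text \<open>
  The mixed derivative is counted twice, as in the Hessian matrix, so that this is a bound for
  all second derivatives in directions of unit length.
\<close>

definition hess :: "real^2 \<Rightarrow> real" where
  "hess x = \<bar>u11 x\<bar> + 2 * \<bar>u12 x\<bar> + \<bar>u22 x\<bar>"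

lemma hess_nonneg: "0 \<le> hess x"
  by (simp add: hess_def)

lemma C2_continuous: "continuous_on UNIV u" "continuous_on UNIV u1" "continuous_on UNIV u2"
    "continuous_on UNIV u11" "continuous_on UNIV u12" "continuous_on UNIV u22"
  using C2 C1_plane_continuous unfolding C2_plane_def C1_plane_def by blast+

lemma continuous_hess: "continuous_on UNIV hess"
  unfolding hess_def
  by (intro continuous_on_add continuous_on_mult continuous_on_const continuous_on_rabs C2_continuous)

lemma continuous_dir_deriv: "continuous_on UNIV (dir_deriv e)"
  unfolding dir_deriv_def by (intro continuous_on_add continuous_on_mult continuous_on_const C2_continuous)

lemma continuous_dir_deriv2: "continuous_on UNIV (dir_deriv2 e e')"
  unfolding dir_deriv2_def by (intro continuous_on_add continuous_on_mult continuous_on_const C2_continuous)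

lemma dir_deriv2_commute: "dir_deriv2 e e' x = dir_deriv2 e' e x"
  by (simp add: dir_deriv2_def algebra_simps)

lemma dir_deriv2_diff: "dir_deriv2 e (e' - e'') x = dir_deriv2 e e' x - dir_deriv2 e e'' x"
  by (simp add: dir_deriv2_def algebra_simps)

lemma dir_deriv2_le: "\<bar>dir_deriv2 e e' x\<bar> \<le> norm e * norm e' * hess x"
proof -
  have n: "\<bar>e$i * e'$j\<bar> \<le> norm e * norm e'" for i j
    unfolding abs_mult by (intro mult_mono component_le_norm_cart) auto
  have "dir_deriv2 e e' x = e$1 * e'$1 * u11 x + e$2 * e'$1 * u12 x + e$1 * e'$2 * u12 x + e$2 * e'$2 * u22 x"
    by (simp add: dir_deriv2_def algebra_simps)
  also have "\<bar>\<dots>\<bar> \<le> \<bar>e$1 * e'$1\<bar> * \<bar>u11 x\<bar> + \<bar>e$2 * e'$1\<bar> * \<bar>u12 x\<bar> + \<bar>e$1 * e'$2\<bar> * \<bar>u12 x\<bar> + \<bar>e$2 * e'$2\<bar> * \<bar>u22 x\<bar>"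
    unfolding abs_mult[symmetric] by linarith
  also have "\<dots> \<le> norm e * norm e' * \<bar>u11 x\<bar> + norm e * norm e' * \<bar>u12 x\<bar> + norm e * norm e' * \<bar>u12 x\<bar> + norm e * norm e' * \<bar>u22 x\<bar>"
    by (intro add_mono mult_right_mono n) auto
  also have "\<dots> = norm e * norm e' * hess x" by (simp add: hess_def algebra_simps)
  finally show ?thesis .
qed

lemma C1_pair_u: "C1_pair (\<lambda>p. u (chart a b c p)) (\<lambda>p. dir_deriv (b - a) (chart a b c p)) (\<lambda>p. dir_deriv (c - a) (chart a b c p))"
  unfolding dir_deriv_def using C2 by (intro C1_plane_chart) (simp add: C2_plane_def)

lemma C1_pair_dir_deriv: "C1_pair (\<lambda>p. dir_deriv e (chart a b c p)) (\<lambda>p. dir_deriv2 e (b - a) (chart a b c p)) (\<lambda>p. dir_deriv2 e (c - a) (chart a b c p))"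
  unfolding dir_deriv_def dir_deriv2_def using C2 by (intro C1_plane_chart C1_plane_linear) (simp_all add: C2_plane_def)

lemma chart_continuous_measurable:
  fixes f :: "real^2 \<Rightarrow> real"
  assumes "continuous_on UNIV f"
  shows "(\<lambda>p. f (chart a b c p)) \<in> borel_measurable borel"
  by (intro borel_measurable_continuous_onI continuous_on_compose2[OF assms continuous_chart]) auto

lemma hess_bounded: "\<exists>B. \<forall>p\<in>reftri. hess (chart a b c p) \<le> B"
proof -
  have "bounded (hess ` (convex hull {a, b, c}))"
    by (intro compact_imp_bounded compact_continuous_image continuous_on_subset[OF continuous_hess] compact_triangle) simp
  then show ?thesis unfolding bounded_iff hull_eq_chart_image by (metis abs_le_D1 imageI real_norm_def)
qed

context
  fixes a b c :: "real^2" and h :: real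
  assumes sides: "norm (b - a) \<le> h" "norm (c - a) \<le> h" "norm (c - b) \<le> h"
    and vanish: "u a = 0" "u b = 0" "u c = 0"
begin

definition scaled_hess :: "real \<Rightarrow> real \<times> real \<Rightarrow> real" where
  "scaled_hess k p = k * hess (chart a b c p)"

lemma scaled_hess_measurable: "scaled_hess k \<in> borel_measurable borel"
  unfolding scaled_hess_def using chart_continuous_measurable[OF continuous_hess] by measurable

text \<open>
  For the derivative along a side \<open>e\<close> from \<open>a\<close>, the second derivatives
  occurring in the edge bound are those in the directions \<open>e\<close> and \<open>v\<close>,
  with \<open>v\<close> running through the sides. Each is at most \<open>norm e * h\<close>
  times the Hessian.
\<close>

lemma edge_derivative_bound:
  assumes "(s, t) \<in> reftri"
  shows "ennreal \<bar>dir_deriv (b - a) (chart a b c (s, t))\<bar> \<le> hline (scaled_hess (norm (b - a) * h)) t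
      + vline (scaled_hess (norm (b - a) * h)) s + 4 * triint (scaled_hess (norm (b - a) * h))"
    and "ennreal \<bar>dir_deriv (c - a) (chart a b c (s, t))\<bar> \<le> hline (scaled_hess (norm (c - a) * h)) t
      + vline (scaled_hess (norm (c - a) * h)) s + 4 * triint (scaled_hess (norm (c - a) * h))"
proof -
  have le: "\<bar>dir_deriv2 e e' x\<bar> \<le> norm e * h * hess x" if "norm e' \<le> h" for e e' x
    using dir_deriv2_le[of e e' x] mult_right_mono[OF mult_left_mono[OF that norm_ge_zero[of e]] hess_nonneg[of x]] by linarith
  have cba: "(c - a) - (b - a) = c - b" "(b - a) - (c - a) = b - c" by simp_all
  have bc: "norm (b - c) \<le> h" using sides(3) by (simp add: norm_minus_commute)
  show "ennreal \<bar>dir_deriv (b - a) (chart a b c (s, t))\<bar> \<le> hline (scaled_hess (norm (b - a) * h)) t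
      + vline (scaled_hess (norm (b - a) * h)) s + 4 * triint (scaled_hess (norm (b - a) * h))"
  proof (rule edge_bound[OF C1_pair_u C1_pair_dir_deriv _ scaled_hess_measurable _ _ _ assms])
    show "u (chart a b c (0, 0)) = u (chart a b c (1, 0))" using vanish by (simp add: chart_def)
    fix p
    show "\<bar>dir_deriv2 (b - a) (b - a) (chart a b c p)\<bar> \<le> scaled_hess (norm (b - a) * h) p"
      "\<bar>dir_deriv2 (b - a) (c - a) (chart a b c p)\<bar> \<le> scaled_hess (norm (b - a) * h) p"
      unfolding scaled_hess_def by (intro le sides)+
    show "\<bar>dir_deriv2 (b - a) (c - a) (chart a b c p) - dir_deriv2 (b - a) (b - a) (chart a b c p)\<bar> \<le> scaled_hess (norm (b - a) * h) p"
      unfolding scaled_hess_def dir_deriv2_diff[symmetric] cba by (intro le sides)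
  qed
  show "ennreal \<bar>dir_deriv (c - a) (chart a b c (s, t))\<bar> \<le> hline (scaled_hess (norm (c - a) * h)) t
      + vline (scaled_hess (norm (c - a) * h)) s + 4 * triint (scaled_hess (norm (c - a) * h))"
  proof (rule edge_bound_swap[OF C1_pair_u C1_pair_dir_deriv _ scaled_hess_measurable _ _ _ assms])
    show "u (chart a b c (0, 0)) = u (chart a b c (0, 1))" using vanish by (simp add: chart_def)
    fix p
    show "\<bar>dir_deriv2 (c - a) (c - a) (chart a b c p)\<bar> \<le> scaled_hess (norm (c - a) * h) p"
      "\<bar>dir_deriv2 (c - a) (b - a) (chart a b c p)\<bar> \<le> scaled_hess (norm (c - a) * h) p"
      unfolding scaled_hess_def by (intro le sides)+
    show "\<bar>dir_deriv2 (c - a) (b - a) (chart a b c p) - dir_deriv2 (c - a) (c - a) (chart a b c p)\<bar> \<le> scaled_hess (norm (c - a) * h) p"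
      unfolding scaled_hess_def dir_deriv2_diff[symmetric] cba by (intro le bc)
  qed
qed

lemma h_nonneg: "0 \<le> h"
  using sides(1) norm_ge_zero order_trans by blast

lemma edge_derivative_Lq:
  assumes q: "1 \<le> q" and e: "e = b - a \<or> e = c - a"
  shows "triint (\<lambda>p. \<bar>dir_deriv e (chart a b c p)\<bar> powr q)
     \<le> ennreal ((18 * (norm e * h)) powr q) * triint (\<lambda>p. hess (chart a b c p) powr q)"
proof -
  obtain B where B: "\<And>p. p \<in> reftri \<Longrightarrow> hess (chart a b c p) \<le> B" using hess_bounded by blast
  have k: "0 \<le> norm e * h" using h_nonneg by simp
  have m: "(\<lambda>p. hess (chart a b c p) powr q) \<in> borel_measurable borel"
    using chart_continuous_measurable[OF continuous_hess] by measurable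
  have "triint (\<lambda>p. \<bar>dir_deriv e (chart a b c p)\<bar> powr q) \<le> ennreal (18 powr q) * triint (\<lambda>p. scaled_hess (norm e * h) p powr q)"
  proof (rule line_sum_power_bound[OF scaled_hess_measurable _ _ q])
    show "0 \<le> scaled_hess (norm e * h) p" for p using k hess_nonneg by (simp add: scaled_hess_def)
    show "scaled_hess (norm e * h) p \<le> norm e * h * B" if "p \<in> reftri" for p
      unfolding scaled_hess_def using k B[OF that] by (rule mult_left_mono[rotated])
  qed (use e edge_derivative_bound in auto)
  also have "triint (\<lambda>p. scaled_hess (norm e * h) p powr q) = ennreal ((norm e * h) powr q) * triint (\<lambda>p. hess (chart a b c p) powr q)"
    unfolding scaled_hess_def using k hess_nonneg m by (simp add: powr_mult triint_cmult)
  also have "ennreal (18 powr q) * (ennreal ((norm e * h) powr q) * triint (\<lambda>p. hess (chart a b c p) powr q))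
     = ennreal ((18 * (norm e * h)) powr q) * triint (\<lambda>p. hess (chart a b c p) powr q)"
    using k by (simp add: powr_mult ennreal_mult mult.assoc)
  finally show ?thesis .
qed

lemma edge_derivative_sup:
  assumes B: "\<And>x. x \<in> convex hull {a, b, c} \<Longrightarrow> hess x \<le> B" and e: "e = b - a \<or> e = c - a" and p: "p \<in> reftri"
  shows "\<bar>dir_deriv e (chart a b c p)\<bar> \<le> 6 * (norm e * h * B)"
proof -
  have k: "0 \<le> norm e * h" using h_nonneg by simp
  obtain s t where st: "p = (s, t)" by force
  have B': "scaled_hess (norm e * h) p \<le> norm e * h * B" if "p \<in> reftri" for p
    unfolding scaled_hess_def using k B that unfolding hull_eq_chart_image by (intro mult_left_mono) auto
  have nn: "0 \<le> scaled_hess (norm e * h) p" for p using k hess_nonneg by (simp add: scaled_hess_def)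
  have "ennreal \<bar>dir_deriv e (chart a b c p)\<bar> \<le> hline (scaled_hess (norm e * h)) t + vline (scaled_hess (norm e * h)) s + 4 * triint (scaled_hess (norm e * h))"
    using e p edge_derivative_bound unfolding st by auto
  also have "\<dots> \<le> ennreal (6 * (norm e * h * B))"
    by (rule line_sum_le[OF scaled_hess_measurable nn B'])
  finally show ?thesis
    using order_trans[OF nn[of p] B'[OF p]] by (subst (asm) ennreal_le_iff) auto
qed

text \<open>
  Cramer's rule.
\<close>

lemma gradient_from_edges:
  "\<bar>u1 x\<bar> * \<bar>det2 (b - a) (c - a)\<bar> \<le> \<bar>dir_deriv (b - a) x\<bar> * norm (c - a) + \<bar>dir_deriv (c - a) x\<bar> * norm (b - a)"
  "\<bar>u2 x\<bar> * \<bar>det2 (b - a) (c - a)\<bar> \<le> \<bar>dir_deriv (b - a) x\<bar> * norm (c - a) + \<bar>dir_deriv (c - a) x\<bar> * norm (b - a)"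
proof -
  have "u1 x * det2 (b - a) (c - a) = dir_deriv (b - a) x * (c - a)$2 + dir_deriv (c - a) x * (- (b - a)$2)"
    "u2 x * det2 (b - a) (c - a) = dir_deriv (b - a) x * (- (c - a)$1) + dir_deriv (c - a) x * (b - a)$1"
    unfolding det2_def dir_deriv_def by algebra+
  then have "\<bar>u1 x\<bar> * \<bar>det2 (b - a) (c - a)\<bar> \<le> \<bar>dir_deriv (b - a) x\<bar> * \<bar>(c - a)$2\<bar> + \<bar>dir_deriv (c - a) x\<bar> * \<bar>- (b - a)$2\<bar>"
    "\<bar>u2 x\<bar> * \<bar>det2 (b - a) (c - a)\<bar> \<le> \<bar>dir_deriv (b - a) x\<bar> * \<bar>- (c - a)$1\<bar> + \<bar>dir_deriv (c - a) x\<bar> * \<bar>(b - a)$1\<bar>"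
    unfolding abs_mult[symmetric] by (simp_all only: abs_mult abs_dot_le)
  moreover have "\<bar>dir_deriv (b - a) x\<bar> * \<bar>(c - a)$i\<bar> + \<bar>dir_deriv (c - a) x\<bar> * \<bar>(b - a)$i\<bar> \<le> \<bar>dir_deriv (b - a) x\<bar> * norm (c - a) + \<bar>dir_deriv (c - a) x\<bar> * norm (b - a)" for i
    by (intro add_mono mult_left_mono component_le_norm_cart) auto
  ultimately show "\<bar>u1 x\<bar> * \<bar>det2 (b - a) (c - a)\<bar> \<le> \<bar>dir_deriv (b - a) x\<bar> * norm (c - a) + \<bar>dir_deriv (c - a) x\<bar> * norm (b - a)"
    "\<bar>u2 x\<bar> * \<bar>det2 (b - a) (c - a)\<bar> \<le> \<bar>dir_deriv (b - a) x\<bar> * norm (c - a) + \<bar>dir_deriv (c - a) x\<bar> * norm (b - a)"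
    unfolding abs_minus_cancel by (blast intro: order_trans)+
qed

context
  fixes R :: real
  assumes det: "det2 (b - a) (c - a) \<noteq> 0"
    and R: "norm (b - a) * norm (c - a) * h = 2 * R * \<bar>det2 (b - a) (c - a)\<bar>"
begin

text \<open>
  For a triangle with circumradius \<open>R\<close> the hypothesis on \<open>R\<close> says that
  \<open>h\<close>, a bound for all sides, is attained by the side opposite to \<open>a\<close>.
  It is precisely the factor produced by Cramer's rule and the edge estimates, which is how the
  circumradius arises. The constant is \<open>2 * 6 * 2\<close>: two sides, the edge estimate,
  and \<open>2 * R\<close>.
\<close>

lemma gradient_sup_opposite_longest:
  assumes B: "\<And>x. x \<in> convex hull {a, b, c} \<Longrightarrow> hess x \<le> B" and g: "g = u1 \<or> g = u2" and x: "x \<in> convex hull {a, b, c}"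
  shows "\<bar>g x\<bar> \<le> 24 * R * B"
proof -
  let ?d = "\<bar>det2 (b - a) (c - a)\<bar>"
  obtain p where p: "p \<in> reftri" "x = chart a b c p" using x unfolding hull_eq_chart_image by blast
  have "\<bar>g x\<bar> * ?d \<le> \<bar>dir_deriv (b - a) x\<bar> * norm (c - a) + \<bar>dir_deriv (c - a) x\<bar> * norm (b - a)"
    using g gradient_from_edges by auto
  also have "\<dots> \<le> 6 * (norm (b - a) * h * B) * norm (c - a) + 6 * (norm (c - a) * h * B) * norm (b - a)"
    unfolding p(2) by (intro add_mono mult_right_mono edge_derivative_sup[OF B _ p(1)]) auto
  also have "\<dots> = 12 * B * (norm (b - a) * norm (c - a) * h)" by (simp add: algebra_simps)
  also have "\<dots> = 24 * R * B * ?d" unfolding R by (simp add: algebra_simps)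
  finally show ?thesis using det by simp
qed

text \<open>
  Each of the two terms of Cramer's rule contributes \<open>18 * 2 * R = 36 * R\<close>. Adding
  two terms costs \<open>2\<^sup>q * 2 \<le> 4\<^sup>q\<close>, which gives \<open>144 *
  R\<close>.
\<close>

lemma gradient_Lq_opposite_longest:
  assumes q: "1 \<le> q" and g: "g = u1 \<or> g = u2"
  shows "triint (\<lambda>p. \<bar>g (chart a b c p)\<bar> powr q) \<le> ennreal ((144 * R) powr q) * triint (\<lambda>p. hess (chart a b c p) powr q)"
proof -
  let ?d = "\<bar>det2 (b - a) (c - a)\<bar>"
  let ?W = "triint (\<lambda>p. hess (chart a b c p) powr q)"
  define \<alpha> where "\<alpha> p = (norm (c - a) / ?d) powr q * \<bar>dir_deriv (b - a) (chart a b c p)\<bar> powr q" for p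
  define \<beta> where "\<beta> p = (norm (b - a) / ?d) powr q * \<bar>dir_deriv (c - a) (chart a b c p)\<bar> powr q" for p
  have d: "0 < ?d" using det by simp
  have m [measurable]: "(\<lambda>p. dir_deriv e (chart a b c p)) \<in> borel_measurable borel" for e
    by (rule chart_continuous_measurable[OF continuous_dir_deriv])
  have mq: "(\<lambda>p. \<bar>dir_deriv e (chart a b c p)\<bar> powr q) \<in> borel_measurable borel" for e by measurable
  have [measurable]: "\<alpha> \<in> borel_measurable borel" "\<beta> \<in> borel_measurable borel"
    unfolding \<alpha>_def \<beta>_def by measurable
  have pt: "\<bar>g (chart a b c p)\<bar> powr q \<le> 2 powr q * (\<alpha> p + \<beta> p)" for p
  proof -
    let ?x = "chart a b c p"
    define x y where "x = \<bar>dir_deriv (b - a) ?x\<bar> * (norm (c - a) / ?d)" and "y = \<bar>dir_deriv (c - a) ?x\<bar> * (norm (b - a) / ?d)"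
    have xy: "x powr q = \<alpha> p" "y powr q = \<beta> p"
      by (simp_all only: x_def y_def \<alpha>_def \<beta>_def powr_mult abs_ge_zero divide_nonneg_nonneg norm_ge_zero mult.commute)
    define m where "m = max x y"
    have "0 \<le> x" by (simp add: x_def)
    then have m0: "0 \<le> m" by (simp add: m_def max.coboundedI1)
    have "\<bar>g ?x\<bar> \<le> x + y"
      using g gradient_from_edges[of ?x] d by (auto simp: field_simps x_def y_def)
    also have "\<dots> \<le> 2 * m" by (simp add: m_def)
    finally have "\<bar>g ?x\<bar> powr q \<le> (2 * m) powr q" using q by (intro powr_mono2) auto
    also have "\<dots> = 2 powr q * m powr q" using m0 by (simp add: powr_mult)
    also have "m powr q \<le> x powr q + y powr q"
      by (auto simp: m_def max_def)
    also have "\<dots> = \<alpha> p + \<beta> p" unfolding xy ..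
    finally show ?thesis by simp
  qed
  have part: "ennreal ((norm e' / ?d) powr q) * triint (\<lambda>p. \<bar>dir_deriv e (chart a b c p)\<bar> powr q) \<le> ennreal ((36 * R) powr q) * ?W"
    if e: "e = b - a \<and> e' = c - a \<or> e = c - a \<and> e' = b - a" for e e'
  proof -
    have "ennreal ((norm e' / ?d) powr q) * triint (\<lambda>p. \<bar>dir_deriv e (chart a b c p)\<bar> powr q)
       \<le> ennreal ((norm e' / ?d) powr q) * (ennreal ((18 * (norm e * h)) powr q) * ?W)"
      using e by (intro mult_left_mono edge_derivative_Lq[OF q]) auto
    also have "\<dots> = ennreal ((norm e' / ?d) powr q * (18 * (norm e * h)) powr q) * ?W"
      by (simp add: ennreal_mult mult.assoc)
    also have "(norm e' / ?d) powr q * (18 * (norm e * h)) powr q = (norm e' / ?d * (18 * (norm e * h))) powr q"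
      using h_nonneg by (intro powr_mult[symmetric])
    also have "norm e' / ?d * (18 * (norm e * h)) = 18 * (norm (b - a) * norm (c - a) * h) / ?d"
      using e by (auto simp: algebra_simps)
    also have "\<dots> = 36 * R" unfolding R using d by simp
    finally show ?thesis .
  qed
  have "triint (\<lambda>p. \<bar>g (chart a b c p)\<bar> powr q) \<le> triint (\<lambda>p. 2 powr q * (\<alpha> p + \<beta> p))"
    by (intro triint_mono pt)
  also have "\<dots> = ennreal (2 powr q) * (triint \<alpha> + triint \<beta>)"
    by (subst triint_cmult, simp, measurable, simp add: \<alpha>_def \<beta>_def, subst triint_add) (auto simp: \<alpha>_def \<beta>_def)
  also have "triint \<alpha> = ennreal ((norm (c - a) / ?d) powr q) * triint (\<lambda>p. \<bar>dir_deriv (b - a) (chart a b c p)\<bar> powr q)"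
    unfolding \<alpha>_def by (rule triint_cmult) (auto intro: mq)
  also have "triint \<beta> = ennreal ((norm (b - a) / ?d) powr q) * triint (\<lambda>p. \<bar>dir_deriv (c - a) (chart a b c p)\<bar> powr q)"
    unfolding \<beta>_def by (rule triint_cmult) (auto intro: mq)
  also have "ennreal (2 powr q) * (ennreal ((norm (c - a) / ?d) powr q) * triint (\<lambda>p. \<bar>dir_deriv (b - a) (chart a b c p)\<bar> powr q)
      + ennreal ((norm (b - a) / ?d) powr q) * triint (\<lambda>p. \<bar>dir_deriv (c - a) (chart a b c p)\<bar> powr q))
     \<le> ennreal (2 powr q) * (ennreal ((36 * R) powr q) * ?W + ennreal ((36 * R) powr q) * ?W)"
    by (intro mult_left_mono add_mono part) auto
  also have "\<dots> = ennreal (2 powr q * 2 * (36 * R) powr q) * ?W"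
  proof -
    have "ennreal (2 * (36 * R) powr q) = ennreal ((36 * R) powr q) + ennreal ((36 * R) powr q)"
      by (subst ennreal_plus[symmetric]) auto
    then have "ennreal ((36 * R) powr q) * ?W + ennreal ((36 * R) powr q) * ?W = ennreal (2 * (36 * R) powr q) * ?W"
      by (simp only: distrib_right)
    moreover have "ennreal (2 powr q * 2 * (36 * R) powr q) = ennreal (2 powr q) * ennreal (2 * (36 * R) powr q)"
      by (subst ennreal_mult[symmetric]) (auto simp: mult.assoc)
    ultimately show ?thesis by (simp only: mult.assoc)
  qed
  also have "\<dots> \<le> ennreal ((144 * R) powr q) * ?W"
  proof (intro mult_right_mono ennreal_leI)
    have "2 \<le> (2::real) powr q" using powr_mono[OF q, of 2] by simp
    then have "2 powr q * 2 * (36 * R) powr q \<le> 2 powr q * 2 powr q * (36 * R) powr q"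
      by (intro mult_right_mono mult_left_mono) auto
    also have "\<dots> = (2 * 2 * (36 * R)) powr q" by (simp only: powr_mult mult.assoc)
    finally show "2 powr q * 2 * (36 * R) powr q \<le> (144 * R) powr q" by simp
  qed auto
  finally show ?thesis .
qed

end

end

end

section \<open>Pointwise bounds for the function itself\<close>

definition triangle_integral :: "real^2 \<Rightarrow> real^2 \<Rightarrow> real^2 \<Rightarrow> (real^2 \<Rightarrow> real) \<Rightarrow> ennreal" where
  "triangle_integral a b c f = (\<integral>\<^sup>+x. ennreal (f x) * indicator (open_triangle a b c) x \<partial>lborel)"

lemma triangle_integral_rotate: "triangle_integral b c a = triangle_integral a b c"
  by (simp add: triangle_integral_def[abs_def] open_triangle_rotate)

lemma triangle_integral_chart:
  assumes "f \<in> borel_measurable borel" "det2 (b - a) (c - a) \<noteq> 0"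
  shows "triangle_integral a b c f = ennreal \<bar>det2 (b - a) (c - a)\<bar> * triint (\<lambda>p. f (chart a b c p))"
  unfolding triangle_integral_def triint_def using assms by (intro nn_integral_open_triangle) auto

lemma open_triangle_sets [measurable]: "open_triangle a b c \<in> sets borel"
  by (simp add: open_triangle_def)

lemma triangle_integral_cmult:
  assumes "0 \<le> k" and [measurable]: "f \<in> borel_measurable borel" and "\<And>x. 0 \<le> f x"
  shows "triangle_integral a b c (\<lambda>x. k * f x) = ennreal k * triangle_integral a b c f"
  unfolding triangle_integral_def
proof (subst nn_integral_cmult[symmetric])
  show "(\<lambda>x. ennreal (f x) * indicator (open_triangle a b c) x) \<in> borel_measurable lborel" by measurable
  show "(\<integral>\<^sup>+x. ennreal (k * f x) * indicator (open_triangle a b c) x \<partial>lborel)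
    = (\<integral>\<^sup>+x. ennreal k * (ennreal (f x) * indicator (open_triangle a b c) x) \<partial>lborel)"
    using assms by (simp add: ennreal_mult mult.assoc)
qed

lemma triangle_integral_mono:
  "(\<And>x. x \<in> open_triangle a b c \<Longrightarrow> f x \<le> g x) \<Longrightarrow> triangle_integral a b c f \<le> triangle_integral a b c g"
  unfolding triangle_integral_def by (intro nn_integral_mono) (auto split: split_indicator intro!: ennreal_leI)

lemma triangle_integral_add:
  assumes [measurable]: "f \<in> borel_measurable borel" "g \<in> borel_measurable borel" and "\<And>x. 0 \<le> f x" "\<And>x. 0 \<le> g x"
  shows "triangle_integral a b c (\<lambda>x. f x + g x) = triangle_integral a b c f + triangle_integral a b c g"
  unfolding triangle_integral_def
proof (subst nn_integral_add[symmetric])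
  show "(\<integral>\<^sup>+x. ennreal (f x + g x) * indicator (open_triangle a b c) x \<partial>lborel) =
     (\<integral>\<^sup>+x. ennreal (f x) * indicator (open_triangle a b c) x + ennreal (g x) * indicator (open_triangle a b c) x \<partial>lborel)"
    using assms by (simp add: distrib_right)
qed measurable

text \<open>
  Start from the vertex with the largest barycentric coordinate; the other two coordinates are
  at most \<open>1 / 2\<close>.
\<close>

lemma hull_corner_cases:
  assumes "x \<in> convex hull {a, b, c :: real^2}"
  obtains s t where "0 \<le> s" "s \<le> 1/2" "0 \<le> t" "t \<le> 1/2"
    "x = chart a b c (s, t) \<or> x = chart b c a (s, t) \<or> x = chart c a b (s, t)"
proof -
  obtain v w where vw: "0 \<le> v" "0 \<le> w" "v + w \<le> 1" "x = a + v *\<^sub>R (b - a) + w *\<^sub>R (c - a)"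
    using assms unfolding convex_hull_3_alt by auto
  have "x = chart a b c (v, w)" "x = chart b c a (w, 1 - v - w)" "x = chart c a b (1 - v - w, v)"
    unfolding vw(4) chart_def by (simp_all add: vec_eq_iff algebra_simps)
  then show thesis
    using that[of v w] that[of w "1 - v - w"] that[of "1 - v - w" v] vw by (smt (verit) field_sum_of_halves)
qed

context
  fixes u u1 u2 u11 u12 u22 :: "real^2 \<Rightarrow> real"
  assumes C2: "C2_plane u u1 u2 u11 u12 u22"
begin

abbreviation "H \<equiv> hess u11 u12 u22"

lemma C2_plane_measurable: "H \<in> borel_measurable borel" "u \<in> borel_measurable borel" "u1 \<in> borel_measurable borel" "u2 \<in> borel_measurable borel"
    "dir_deriv u1 u2 e \<in> borel_measurable borel" "dir_deriv2 u11 u12 u22 e e' \<in> borel_measurable borel"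
  by (intro borel_measurable_continuous_onI continuous_hess[OF C2] C2_continuous[OF C2] continuous_dir_deriv[OF C2] continuous_dir_deriv2[OF C2])+

lemma corner_bound_plane:
  assumes det: "det2 (b - a) (c - a) \<noteq> 0" and st: "0 \<le> s" "s \<le> 1/2" "0 \<le> t" "t \<le> 1/2"
  shows "ennreal (\<bar>u (chart a b c (s, t)) - u a\<bar> * \<bar>det2 (b - a) (c - a)\<bar>)
    \<le> 2 * triangle_integral a b c (\<lambda>x. \<bar>dir_deriv u1 u2 (b - a) x\<bar>) + 2 * triangle_integral a b c (\<lambda>x. \<bar>dir_deriv u1 u2 (c - a) x\<bar>)
      + 2 * triangle_integral a b c (\<lambda>x. \<bar>dir_deriv2 u11 u12 u22 (b - a) (c - a) x\<bar>)"
proof -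
  let ?d = "\<bar>det2 (b - a) (c - a)\<bar>"
  have 2: "C1_pair (\<lambda>p. dir_deriv u1 u2 (c - a) (chart a b c p)) (\<lambda>p. dir_deriv2 u11 u12 u22 (b - a) (c - a) (chart a b c p))
     (\<lambda>p. dir_deriv2 u11 u12 u22 (c - a) (c - a) (chart a b c p))"
    using C1_pair_dir_deriv[OF C2, of "c - a" a b c] unfolding dir_deriv2_commute[OF C2, of "c - a" "b - a"] .
  have "ennreal ?d * ennreal \<bar>u (chart a b c (s, t)) - u (chart a b c (0, 0))\<bar>
    \<le> ennreal ?d * (2 * triint (\<lambda>p. \<bar>dir_deriv u1 u2 (b - a) (chart a b c p)\<bar>) + 2 * triint (\<lambda>p. \<bar>dir_deriv u1 u2 (c - a) (chart a b c p)\<bar>)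
     + 2 * triint (\<lambda>p. \<bar>dir_deriv2 u11 u12 u22 (b - a) (c - a) (chart a b c p)\<bar>))"
    by (intro mult_left_mono corner_bound[OF C1_pair_u[OF C2] C1_pair_dir_deriv[OF C2] 2 st]) auto
  also have "\<dots> = 2 * triangle_integral a b c (\<lambda>x. \<bar>dir_deriv u1 u2 (b - a) x\<bar>) + 2 * triangle_integral a b c (\<lambda>x. \<bar>dir_deriv u1 u2 (c - a) x\<bar>)
      + 2 * triangle_integral a b c (\<lambda>x. \<bar>dir_deriv2 u11 u12 u22 (b - a) (c - a) x\<bar>)"
    using C2_plane_measurable det by (simp add: triangle_integral_chart distrib_left mult.left_commute)
  finally show ?thesis by (simp add: chart_def ennreal_mult mult.commute)
qed

context
  fixes a b c :: "real^2" and h :: real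
  assumes sides: "norm (b - a) \<le> h" "norm (c - a) \<le> h" "norm (c - b) \<le> h"
    and det: "det2 (b - a) (c - a) \<noteq> 0"
begin

lemma side_bound_nonneg: "0 \<le> h" using sides(1) norm_ge_zero order_trans by blast

lemma triangle_integral_dir_deriv2: "triangle_integral a b c (\<lambda>x. \<bar>dir_deriv2 u11 u12 u22 (b - a) (c - a) x\<bar>) \<le> ennreal (h^2) * triangle_integral a b c H"
proof -
  have "\<bar>dir_deriv2 u11 u12 u22 (b - a) (c - a) x\<bar> \<le> h^2 * H x" for x
  proof -
    have "norm (b - a) * norm (c - a) * H x \<le> h^2 * H x"
      unfolding power2_eq_square using sides side_bound_nonneg hess_nonneg[OF C2] by (intro mult_right_mono mult_mono) auto
    then show ?thesis using dir_deriv2_le[OF C2, of "b - a" "c - a" x] by linarith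
  qed
  then have "triangle_integral a b c (\<lambda>x. \<bar>dir_deriv2 u11 u12 u22 (b - a) (c - a) x\<bar>) \<le> triangle_integral a b c (\<lambda>x. h^2 * H x)"
    by (intro triangle_integral_mono)
  also have "\<dots> = ennreal (h^2) * triangle_integral a b c H"
    using C2_plane_measurable hess_nonneg[OF C2] by (intro triangle_integral_cmult) auto
  finally show ?thesis .
qed

text \<open>
  The bound involves first derivatives but no condition at the vertices. It will be applied to
  differences of smooth approximations, whose values at the vertices are not controlled
  beforehand.
\<close>

lemma corner_osc:
  assumes st: "0 \<le> s" "s \<le> 1/2" "0 \<le> t" "t \<le> 1/2"
  shows "ennreal (\<bar>u (chart a b c (s, t)) - u a\<bar> * \<bar>det2 (b - a) (c - a)\<bar>)
    \<le> triangle_integral a b c (\<lambda>x. 4 * h * (\<bar>u1 x\<bar> + \<bar>u2 x\<bar>) + 2 * h^2 * H x)"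
proof -
  let ?T = "triangle_integral a b c"
  have m1: "(\<lambda>x. \<bar>u1 x\<bar> + \<bar>u2 x\<bar>) \<in> borel_measurable borel" using C2_plane_measurable by measurable
  have le: "?T (\<lambda>x. \<bar>dir_deriv u1 u2 e x\<bar>) \<le> ennreal h * ?T (\<lambda>x. \<bar>u1 x\<bar> + \<bar>u2 x\<bar>)" if "norm e \<le> h" for e
  proof -
    have "\<bar>dir_deriv u1 u2 e x\<bar> \<le> h * (\<bar>u1 x\<bar> + \<bar>u2 x\<bar>)" for x
    proof -
      have "\<bar>dir_deriv u1 u2 e x\<bar> \<le> \<bar>e$1\<bar> * \<bar>u1 x\<bar> + \<bar>e$2\<bar> * \<bar>u2 x\<bar>"
        unfolding dir_deriv_def[OF C2] by (rule abs_dot_le)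
      also have "\<dots> \<le> h * \<bar>u1 x\<bar> + h * \<bar>u2 x\<bar>"
        using that by (intro add_mono mult_right_mono order_trans[OF component_le_norm_cart]) auto
      finally show ?thesis by (simp add: distrib_left)
    qed
    then have "?T (\<lambda>x. \<bar>dir_deriv u1 u2 e x\<bar>) \<le> ?T (\<lambda>x. h * (\<bar>u1 x\<bar> + \<bar>u2 x\<bar>))" by (intro triangle_integral_mono)
    also have "\<dots> = ennreal h * ?T (\<lambda>x. \<bar>u1 x\<bar> + \<bar>u2 x\<bar>)"
      by (rule triangle_integral_cmult[OF side_bound_nonneg m1]) simp
    finally show ?thesis .
  qed
  have "ennreal (\<bar>u (chart a b c (s, t)) - u a\<bar> * \<bar>det2 (b - a) (c - a)\<bar>)
    \<le> 2 * (ennreal h * ?T (\<lambda>x. \<bar>u1 x\<bar> + \<bar>u2 x\<bar>)) + 2 * (ennreal h * ?T (\<lambda>x. \<bar>u1 x\<bar> + \<bar>u2 x\<bar>)) + 2 * (ennreal (h^2) * ?T H)"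
    by (rule order_trans[OF corner_bound_plane[OF det st]])
       (intro add_mono mult_left_mono le sides triangle_integral_dir_deriv2; simp)
  also have "\<dots> = ennreal (4 * h) * ?T (\<lambda>x. \<bar>u1 x\<bar> + \<bar>u2 x\<bar>) + ennreal (2 * h^2) * ?T H"
    using side_bound_nonneg by (simp add: ennreal_mult mult.assoc flip: distrib_right)
  also have "\<dots> = ?T (\<lambda>x. 4 * h * (\<bar>u1 x\<bar> + \<bar>u2 x\<bar>)) + ?T (\<lambda>x. 2 * h^2 * H x)"
    using side_bound_nonneg m1 C2_plane_measurable(1) hess_nonneg[OF C2]
    by (simp add: triangle_integral_cmult[of "4 * h"] triangle_integral_cmult[of "2 * h^2"])
  also have "\<dots> = ?T (\<lambda>x. 4 * h * (\<bar>u1 x\<bar> + \<bar>u2 x\<bar>) + 2 * h^2 * H x)"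
    using side_bound_nonneg m1 C2_plane_measurable(1) hess_nonneg[OF C2] by (intro triangle_integral_add[symmetric]) auto
  finally show ?thesis .
qed

text \<open>
  The first derivatives in the corner bound are themselves controlled by the edge estimate for
  \<open>q = 1\<close>. The constant is \<open>2 * 18 + 2 * 18 + 2\<close>.
\<close>

lemma corner_sup:
  assumes st: "0 \<le> s" "s \<le> 1/2" "0 \<le> t" "t \<le> 1/2" and vanish: "u a = 0" "u b = 0" "u c = 0"
  shows "ennreal (\<bar>u (chart a b c (s, t))\<bar> * \<bar>det2 (b - a) (c - a)\<bar>) \<le> ennreal (74 * h^2) * triangle_integral a b c H"
proof -
  let ?T = "triangle_integral a b c"
  have le: "?T (\<lambda>x. \<bar>dir_deriv u1 u2 e x\<bar>) \<le> ennreal (18 * h^2) * ?T H" if e: "e = b - a \<or> e = c - a" for e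
  proof -
    have p1: "x powr 1 = x" if "0 \<le> x" for x :: real using that by simp
    have "triint (\<lambda>p. \<bar>dir_deriv u1 u2 e (chart a b c p)\<bar>) \<le> ennreal (18 * (norm e * h)) * triint (\<lambda>p. H (chart a b c p))"
      using edge_derivative_Lq[OF C2 sides vanish order_refl e] hess_nonneg[OF C2] side_bound_nonneg by (simp add: p1)
    also have "\<dots> \<le> ennreal (18 * h^2) * triint (\<lambda>p. H (chart a b c p))"
      using e sides side_bound_nonneg by (intro mult_right_mono ennreal_leI) (auto simp: power2_eq_square intro: mult_right_mono)
    finally have "ennreal \<bar>det2 (b - a) (c - a)\<bar> * triint (\<lambda>p. \<bar>dir_deriv u1 u2 e (chart a b c p)\<bar>)
      \<le> ennreal \<bar>det2 (b - a) (c - a)\<bar> * (ennreal (18 * h^2) * triint (\<lambda>p. H (chart a b c p)))"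
      by (intro mult_left_mono) auto
    then show ?thesis using C2_plane_measurable det by (simp add: triangle_integral_chart mult.left_commute)
  qed
  have "ennreal (\<bar>u (chart a b c (s, t)) - u a\<bar> * \<bar>det2 (b - a) (c - a)\<bar>)
    \<le> 2 * (ennreal (18 * h^2) * ?T H) + 2 * (ennreal (18 * h^2) * ?T H) + 2 * (ennreal (h^2) * ?T H)"
    by (rule order_trans[OF corner_bound_plane[OF det st]])
       (intro add_mono mult_left_mono le triangle_integral_dir_deriv2; simp)
  also have "\<dots> = ennreal (74 * h^2) * ?T H"
  proof -
    have "ennreal (18 * h^2) = 18 * ennreal (h^2)" "ennreal (74 * h^2) = 74 * ennreal (h^2)" by (simp_all add: ennreal_mult)
    then show ?thesis by (simp add: mult.assoc flip: distrib_right)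
  qed
  finally show ?thesis using vanish by simp
qed

end

end

section \<open>Estimates independent of the labelling of the vertices\<close>

lemma rotate_sides:
  assumes "norm (b - a) * norm (c - a) * norm (c - b) = 2 * R * \<bar>det2 (b - a) (c - a)\<bar>"
  shows "norm (c - b) * norm (a - b) * norm (a - c) = 2 * R * \<bar>det2 (c - b) (a - b)\<bar>"
  using assms by (simp only: det2_rotate norm_minus_commute[of a] mult.commute mult.left_commute)

context
  fixes u u1 u2 u11 u12 u22 :: "real^2 \<Rightarrow> real"
  assumes C2: "C2_plane u u1 u2 u11 u12 u22"
begin

lemma gradient_longest:
  assumes det: "det2 (b - a) (c - a) \<noteq> 0"
    and R: "norm (b - a) * norm (c - a) * norm (c - b) = 2 * R * \<bar>det2 (b - a) (c - a)\<bar>"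
    and vanish: "u a = 0" "u b = 0" "u c = 0"
    and longest: "norm (b - a) \<le> norm (c - b)" "norm (c - a) \<le> norm (c - b)"
    and g: "g = u1 \<or> g = u2"
  shows "1 \<le> q \<Longrightarrow> triangle_integral a b c (\<lambda>x. \<bar>g x\<bar> powr q)
      \<le> ennreal ((144 * R) powr q) * triangle_integral a b c (\<lambda>x. hess u11 u12 u22 x powr q)"
    and "\<lbrakk>\<And>x. x \<in> convex hull {a, b, c} \<Longrightarrow> hess u11 u12 u22 x \<le> B; x \<in> convex hull {a, b, c}\<rbrakk>
      \<Longrightarrow> \<bar>g x\<bar> \<le> 24 * R * B"
proof -
  let ?d = "\<bar>det2 (b - a) (c - a)\<bar>"
  assume q: "1 \<le> q"
  have m: "(\<lambda>x. \<bar>g x\<bar> powr q) \<in> borel_measurable borel" "(\<lambda>x. hess u11 u12 u22 x powr q) \<in> borel_measurable borel"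
  proof -
    have [measurable]: "g \<in> borel_measurable borel" "hess u11 u12 u22 \<in> borel_measurable borel"
      using g C2_plane_measurable[OF C2] by auto
    show "(\<lambda>x. \<bar>g x\<bar> powr q) \<in> borel_measurable borel" "(\<lambda>x. hess u11 u12 u22 x powr q) \<in> borel_measurable borel"
      by measurable
  qed
  have "ennreal ?d * triint (\<lambda>p. \<bar>g (chart a b c p)\<bar> powr q)
     \<le> ennreal ?d * (ennreal ((144 * R) powr q) * triint (\<lambda>p. hess u11 u12 u22 (chart a b c p) powr q))"
    by (intro mult_left_mono gradient_Lq_opposite_longest[OF C2 longest order_refl vanish det R q g]) auto
  then show "triangle_integral a b c (\<lambda>x. \<bar>g x\<bar> powr q)
      \<le> ennreal ((144 * R) powr q) * triangle_integral a b c (\<lambda>x. hess u11 u12 u22 x powr q)"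
    using m det by (simp add: triangle_integral_chart mult.left_commute)
qed (rule gradient_sup_opposite_longest[OF C2 longest order_refl vanish det R _ g])

text \<open>
  After a rotation of the labels the longest side is opposite to the first vertex.
\<close>

lemma gradient_estimates:
  assumes det: "det2 (b - a) (c - a) \<noteq> 0"
    and R: "norm (b - a) * norm (c - a) * norm (c - b) = 2 * R * \<bar>det2 (b - a) (c - a)\<bar>"
    and vanish: "u a = 0" "u b = 0" "u c = 0"
    and g: "g = u1 \<or> g = u2"
  shows "1 \<le> q \<Longrightarrow> triangle_integral a b c (\<lambda>x. \<bar>g x\<bar> powr q)
      \<le> ennreal ((144 * R) powr q) * triangle_integral a b c (\<lambda>x. hess u11 u12 u22 x powr q)"
    and "\<lbrakk>\<And>x. x \<in> convex hull {a, b, c} \<Longrightarrow> hess u11 u12 u22 x \<le> B; x \<in> convex hull {a, b, c}\<rbrakk>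
      \<Longrightarrow> \<bar>g x\<bar> \<le> 24 * R * B"
proof -
  have det1: "det2 (c - b) (a - b) \<noteq> 0" using det by (simp only: det2_rotate not_False_eq_True)
  have det2: "det2 (a - c) (b - c) \<noteq> 0" using det1 by (simp only: det2_rotate not_False_eq_True)
  have T: "triangle_integral b c a = triangle_integral a b c" "triangle_integral c a b = triangle_integral a b c"
    by (metis triangle_integral_rotate)+
  note R1 = rotate_sides[OF R]
  note R2 = rotate_sides[OF R1]
  have cases: "norm (b - a) \<le> norm (c - b) \<and> norm (c - a) \<le> norm (c - b) \<or>
     norm (c - b) \<le> norm (a - c) \<and> norm (a - b) \<le> norm (a - c) \<or>
     norm (a - c) \<le> norm (b - a) \<and> norm (b - c) \<le> norm (b - a)"
    using norm_minus_commute[of a b] norm_minus_commute[of a c] norm_minus_commute[of b c] by linarith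
  {
    assume q: "1 \<le> q"
    show "triangle_integral a b c (\<lambda>x. \<bar>g x\<bar> powr q)
      \<le> ennreal ((144 * R) powr q) * triangle_integral a b c (\<lambda>x. hess u11 u12 u22 x powr q)"
      using cases gradient_longest(1)[OF det R vanish _ _ g q] gradient_longest(1)[OF det1 R1 vanish(2,3,1) _ _ g q]
        gradient_longest(1)[OF det2 R2 vanish(3,1,2) _ _ g q]
      unfolding T by blast
  next
    assume B: "\<And>x. x \<in> convex hull {a, b, c} \<Longrightarrow> hess u11 u12 u22 x \<le> B" and x: "x \<in> convex hull {a, b, c}"
    have 1: "{b, c, a} = {a, b, c}" "{c, a, b} = {a, b, c}" by auto
    show "\<bar>g x\<bar> \<le> 24 * R * B"
      using cases gradient_longest(2)[OF det R vanish _ _ g B x]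
        gradient_longest(2)[OF det1 R1 vanish(2,3,1) _ _ g, unfolded 1, OF _ _ B x]
        gradient_longest(2)[OF det2 R2 vanish(3,1,2) _ _ g, unfolded 1, OF _ _ B x] by blast
  }
qed

lemma sup_by_hessian_integral:
  assumes det: "det2 (b - a) (c - a) \<noteq> 0"
    and sides: "norm (b - a) \<le> h" "norm (c - a) \<le> h" "norm (c - b) \<le> h"
    and vanish: "u a = 0" "u b = 0" "u c = 0"
    and x: "x \<in> convex hull {a, b, c}"
  shows "ennreal (\<bar>u x\<bar> * \<bar>det2 (b - a) (c - a)\<bar>) \<le> ennreal (74 * h^2) * triangle_integral a b c (hess u11 u12 u22)"
proof -
  have det1: "det2 (c - b) (a - b) \<noteq> 0" using det by (simp only: det2_rotate not_False_eq_True)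
  have det2: "det2 (a - c) (b - c) \<noteq> 0" using det1 by (simp only: det2_rotate not_False_eq_True)
  have d: "det2 (c - b) (a - b) = det2 (b - a) (c - a)" "det2 (a - c) (b - c) = det2 (b - a) (c - a)"
    by (simp_all only: det2_rotate)
  have s: "norm (a - b) \<le> h" "norm (a - c) \<le> h" "norm (b - c) \<le> h" using sides by (simp_all add: norm_minus_commute)
  have T: "triangle_integral b c a = triangle_integral a b c" "triangle_integral c a b = triangle_integral a b c"
    by (metis triangle_integral_rotate)+
  obtain s t where st: "0 \<le> s" "s \<le> 1/2" "0 \<le> t" "t \<le> 1/2"
    "x = chart a b c (s, t) \<or> x = chart b c a (s, t) \<or> x = chart c a b (s, t)"
    using hull_corner_cases[OF x] by blast
  show ?thesis
    using st(5) corner_sup[OF C2 sides det st(1-4) vanish] corner_sup[OF C2 sides(3) s(1) s(2) det1 st(1-4) vanish(2,3,1)]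
      corner_sup[OF C2 s(2) s(3) sides(1) det2 st(1-4) vanish(3,1,2)]
    unfolding T d by blast
qed

text \<open>
  The pointwise bound by the integral of the Hessian is a special case, without line terms, of
  the hypothesis on sums of line integrals, if the Hessian is scaled by \<open>74 * h\<^sup>2 /
  4\<close>. This gives the constants \<open>18 * 74 / 4 = 333\<close> and \<open>6 * 74 / 4 =
  111\<close>.
\<close>

lemma function_estimates:
  assumes det: "det2 (b - a) (c - a) \<noteq> 0"
    and sides: "norm (b - a) \<le> h" "norm (c - a) \<le> h" "norm (c - b) \<le> h"
    and vanish: "u a = 0" "u b = 0" "u c = 0"
  shows "1 \<le> q \<Longrightarrow> triangle_integral a b c (\<lambda>x. \<bar>u x\<bar> powr q)
      \<le> ennreal ((333 * h^2) powr q) * triangle_integral a b c (\<lambda>x. hess u11 u12 u22 x powr q)"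
    and "\<lbrakk>\<And>x. x \<in> convex hull {a, b, c} \<Longrightarrow> hess u11 u12 u22 x \<le> B; x \<in> convex hull {a, b, c}\<rbrakk>
      \<Longrightarrow> \<bar>u x\<bar> \<le> 111 * h^2 * B"
proof -
  let ?d = "\<bar>det2 (b - a) (c - a)\<bar>"
  define k where "k = 74 * h^2 / 4"
  define Z where "Z p = k * hess u11 u12 u22 (chart a b c p)" for p
  have k0: "0 \<le> k" by (simp add: k_def)
  have Zm: "Z \<in> borel_measurable borel"
    unfolding Z_def using chart_continuous_measurable[OF C2 continuous_hess[OF C2]] by measurable
  have Z0: "0 \<le> Z p" for p using k0 hess_nonneg[OF C2] by (simp add: Z_def)
  have m: "(\<lambda>p. hess u11 u12 u22 (chart a b c p)) \<in> borel_measurable borel"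
    by (rule chart_continuous_measurable[OF C2 continuous_hess[OF C2]])
  have le: "ennreal \<bar>u (chart a b c p)\<bar> \<le> 4 * triint Z" if p: "p \<in> reftri" for p
  proof -
    have "chart a b c p \<in> convex hull {a, b, c}" using p unfolding hull_eq_chart_image by blast
    from sup_by_hessian_integral[OF det sides vanish this]
    have "ennreal ?d * ennreal \<bar>u (chart a b c p)\<bar> \<le> ennreal (74 * h^2) * (ennreal ?d * triint (\<lambda>p. hess u11 u12 u22 (chart a b c p)))"
      using C2_plane_measurable(1)[OF C2] det by (simp add: triangle_integral_chart ennreal_mult mult.commute)
    also have "74 * h^2 = 4 * k" by (simp add: k_def)
    also have "ennreal (4 * k) * (ennreal ?d * triint (\<lambda>p. hess u11 u12 u22 (chart a b c p))) = ennreal ?d * (4 * triint Z)"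
      unfolding Z_def using k0 m hess_nonneg[OF C2] by (simp add: triint_cmult ennreal_mult ac_simps)
    finally show ?thesis using det by (simp add: ennreal_mult_le_mult_iff)
  qed
  have le2: "ennreal \<bar>u (chart a b c (s, t))\<bar> \<le> hline Z t + vline Z s + 4 * triint Z" if "(s, t) \<in> reftri" for s t
    using le[OF that] by (rule order_trans) simp
  {
    assume q: "1 \<le> q"
    have mq: "(\<lambda>x. \<bar>u x\<bar> powr q) \<in> borel_measurable borel" "(\<lambda>x. hess u11 u12 u22 x powr q) \<in> borel_measurable borel"
      "(\<lambda>p. hess u11 u12 u22 (chart a b c p) powr q) \<in> borel_measurable borel"
      using C2_plane_measurable[OF C2] m by measurable
    obtain B where B: "\<And>p. p \<in> reftri \<Longrightarrow> hess u11 u12 u22 (chart a b c p) \<le> B" using hess_bounded[OF C2] by blast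
    have ZB: "Z p \<le> k * B" if "p \<in> reftri" for p unfolding Z_def using B[OF that] k0 by (rule mult_left_mono)
    have "triint (\<lambda>p. \<bar>u (chart a b c p)\<bar> powr q) \<le> ennreal (18 powr q) * triint (\<lambda>p. Z p powr q)"
      by (rule line_sum_power_bound[OF Zm Z0 ZB q le2])
    also have "triint (\<lambda>p. Z p powr q) = ennreal (k powr q) * triint (\<lambda>p. hess u11 u12 u22 (chart a b c p) powr q)"
      unfolding Z_def powr_mult using mq by (intro triint_cmult) auto
    also have "ennreal (18 powr q) * (ennreal (k powr q) * triint (\<lambda>p. hess u11 u12 u22 (chart a b c p) powr q))
      = ennreal ((18 * k) powr q) * triint (\<lambda>p. hess u11 u12 u22 (chart a b c p) powr q)"
      by (simp add: powr_mult ennreal_mult mult.assoc)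
    also have "18 * k = 333 * h^2" by (simp add: k_def)
    finally have "ennreal ?d * triint (\<lambda>p. \<bar>u (chart a b c p)\<bar> powr q)
      \<le> ennreal ?d * (ennreal ((333 * h^2) powr q) * triint (\<lambda>p. hess u11 u12 u22 (chart a b c p) powr q))"
      by (intro mult_left_mono) auto
    then show "triangle_integral a b c (\<lambda>x. \<bar>u x\<bar> powr q)
      \<le> ennreal ((333 * h^2) powr q) * triangle_integral a b c (\<lambda>x. hess u11 u12 u22 x powr q)"
      using mq det by (simp add: triangle_integral_chart mult.left_commute)
  next
    assume B: "\<And>x. x \<in> convex hull {a, b, c} \<Longrightarrow> hess u11 u12 u22 x \<le> B" and x: "x \<in> convex hull {a, b, c}"
    obtain s t where st: "(s, t) \<in> reftri" "x = chart a b c (s, t)" using x unfolding hull_eq_chart_image by auto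
    have ZB: "Z p \<le> k * B" if "p \<in> reftri" for p
      unfolding Z_def using B[of "chart a b c p"] that k0 unfolding hull_eq_chart_image by (intro mult_left_mono) auto
    have "ennreal \<bar>u x\<bar> \<le> ennreal (6 * (k * B))"
      unfolding st(2) by (rule order_trans[OF le2[OF st(1)] line_sum_le[OF Zm Z0 ZB]])
    moreover have "0 \<le> 6 * (k * B)" using order_trans[OF Z0 ZB[OF st(1)]] by simp
    moreover have "6 * (k * B) = 111 * h^2 * B" by (simp add: k_def)
    ultimately show "\<bar>u x\<bar> \<le> 111 * h^2 * B" by (simp only: ennreal_le_iff)
  }
qed

text \<open>
  The three corner parallelograms cover the triangle and all contain the centroid. Each of the
  two points is compared with the centroid through a vertex, so four corner bounds are added.
\<close>

lemma oscillation_bound: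
  assumes det: "det2 (b - a) (c - a) \<noteq> 0"
    and sides: "norm (b - a) \<le> h" "norm (c - a) \<le> h" "norm (c - b) \<le> h"
    and x: "x \<in> convex hull {a, b, c}" and y: "y \<in> convex hull {a, b, c}"
  shows "ennreal (\<bar>u x - u y\<bar> * \<bar>det2 (b - a) (c - a)\<bar>)
    \<le> 4 * triangle_integral a b c (\<lambda>x. 4 * h * (\<bar>u1 x\<bar> + \<bar>u2 x\<bar>) + 2 * h^2 * hess u11 u12 u22 x)" (is "_ \<le> 4 * ?N")
proof -
  let ?d = "\<bar>det2 (b - a) (c - a)\<bar>"
  have det1: "det2 (c - b) (a - b) \<noteq> 0" using det by (simp only: det2_rotate not_False_eq_True)
  have det2: "det2 (a - c) (b - c) \<noteq> 0" using det1 by (simp only: det2_rotate not_False_eq_True)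
  have d: "det2 (c - b) (a - b) = det2 (b - a) (c - a)" "det2 (a - c) (b - c) = det2 (b - a) (c - a)"
    by (simp_all only: det2_rotate)
  have s: "norm (a - b) \<le> h" "norm (a - c) \<le> h" "norm (b - c) \<le> h" using sides by (simp_all add: norm_minus_commute)
  have T: "triangle_integral b c a = triangle_integral a b c" "triangle_integral c a b = triangle_integral a b c"
    by (metis triangle_integral_rotate)+
  have third: "0 \<le> (1/3::real)" "(1/3::real) \<le> 1/2" by auto
  define z where "z = chart a b c (1/3, 1/3)"
  have z: "z = chart b c a (1/3, 1/3)" "z = chart c a b (1/3, 1/3)"
    by (simp_all add: z_def chart_def vec_eq_iff algebra_simps)
  have triangle: "ennreal (\<bar>p - r\<bar> * ?d) \<le> ennreal (\<bar>p - q\<bar> * ?d) + ennreal (\<bar>r - q\<bar> * ?d)" for p q r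
  proof -
    have "\<bar>p - r\<bar> * ?d \<le> (\<bar>p - q\<bar> + \<bar>r - q\<bar>) * ?d" by (intro mult_right_mono) auto
    then show ?thesis by (simp add: distrib_right ennreal_plus[symmetric] ennreal_leI del: ennreal_plus)
  qed
  have main: "ennreal (\<bar>u x - u z\<bar> * ?d) \<le> 2 * ?N" if x: "x \<in> convex hull {a, b, c}" for x
  proof -
    obtain s' t where st: "0 \<le> s'" "s' \<le> 1/2" "0 \<le> t" "t \<le> 1/2"
      "x = chart a b c (s', t) \<or> x = chart b c a (s', t) \<or> x = chart c a b (s', t)"
      using hull_corner_cases[OF x] by blast
    have "\<exists>v. ennreal (\<bar>u x - u v\<bar> * ?d) \<le> ?N \<and> ennreal (\<bar>u z - u v\<bar> * ?d) \<le> ?N"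
      using st(5)
        corner_osc[OF C2 sides det st(1-4)] corner_osc[OF C2 sides det third third, folded z_def]
        corner_osc[OF C2 sides(3) s(1) s(2) det1 st(1-4)] corner_osc[OF C2 sides(3) s(1) s(2) det1 third third, folded z(1)]
        corner_osc[OF C2 s(2) s(3) sides(1) det2 st(1-4)] corner_osc[OF C2 s(2) s(3) sides(1) det2 third third, folded z(2)]
      unfolding T d by blast
    then obtain v where "ennreal (\<bar>u x - u v\<bar> * ?d) \<le> ?N" "ennreal (\<bar>u z - u v\<bar> * ?d) \<le> ?N" by blast
    then show ?thesis using triangle[of "u x" "u z" "u v"] add_mono unfolding mult_2 by (blast intro: order_trans)
  qed
  have "ennreal (\<bar>u x - u y\<bar> * ?d) \<le> 2 * ?N + 2 * ?N"
    using triangle[of "u x" "u y" "u z"] add_mono[OF main[OF x] main[OF y]] by (rule order_trans)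
  also have "\<dots> = 4 * ?N" by (simp flip: distrib_right)
  finally show ?thesis .
qed

end

section \<open>Mollification inside a convex set\<close>

text \<open>
  Wherever the kernel is a test function in \<open>\<Omega>\<close>, its derivatives can be
  thrown onto \<open>w\<close> by the definition of the weak derivative.
\<close>

lemma mollify_weak_deriv:
  assumes \<Omega>: "open \<Omega>" and wd: "has_weak_deriv \<Omega> \<alpha> w w'"
    and v: "v \<in> borel_measurable borel" "AE x in lebesgue. indicator \<Omega> x * w x = v x" "(\<lambda>x. indicator \<Omega> x * w x) \<in> borel_measurable lebesgue"
    and v': "v' \<in> borel_measurable borel" "AE x in lebesgue. indicator \<Omega> x * w' x = v' x" "(\<lambda>x. indicator \<Omega> x * w' x) \<in> borel_measurable lebesgue"
    and \<delta>: "0 < \<delta>" and sub: "cbox (y - vec \<delta>) (y + vec \<delta>) \<subseteq> \<Omega>"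
  shows "mollify \<delta> (count_list \<alpha> 1) (count_list \<alpha> 2) v y = (- 1) ^ length \<alpha> * mollify \<delta> 0 0 v' y"
proof -
  have \<Omega>b: "\<Omega> \<in> sets borel" using \<Omega> by simp
  have eq: "integral\<^sup>L (lebesgue_on \<Omega>) (\<lambda>z. g z * kernel \<delta> i j (z - y)) = mollify \<delta> i j g' y"
    if g: "g' \<in> borel_measurable borel" "AE x in lebesgue. indicator \<Omega> x * g x = g' x" "(\<lambda>x. indicator \<Omega> x * g x) \<in> borel_measurable lebesgue"
    for g g' i j
    unfolding mollify_def
  proof (rule integral_lebesgue_on_eq_lborel[OF \<Omega>b, where h="\<lambda>z. (indicator \<Omega> z * g z) * kernel \<delta> i j (z - y)"])
    have kb: "(\<lambda>z. kernel \<delta> i j (z - y)) \<in> borel_measurable borel" by measurable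
    show "AE x in lebesgue. (indicator \<Omega> x * g x) * kernel \<delta> i j (x - y) = g' x * kernel \<delta> i j (x - y)"
      using g(2) by eventually_elim simp
    show "(\<lambda>z. g' z * kernel \<delta> i j (z - y)) \<in> borel_measurable borel" using g(1) kb by (rule borel_measurable_times)
    have "(\<lambda>z. kernel \<delta> i j (z - y)) \<in> borel_measurable lebesgue" using kb by (intro measurable_completion) simp
    then show "(\<lambda>z. (indicator \<Omega> z * g z) * kernel \<delta> i j (z - y)) \<in> borel_measurable lebesgue"
      using g(3) by (rule borel_measurable_times[rotated])
  qed simp
  have "integral\<^sup>L (lebesgue_on \<Omega>) (\<lambda>z. w z * partial_derivs \<alpha> (\<lambda>z. kernel \<delta> 0 0 (z - y)) z) =
        (- 1) ^ length \<alpha> * integral\<^sup>L (lebesgue_on \<Omega>) (\<lambda>z. w' z * kernel \<delta> 0 0 (z - y))"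
    using wd test_function_kernel[OF \<delta> sub] unfolding has_weak_deriv_def by blast
  then show ?thesis unfolding partial_derivs_kernel[OF \<delta>] using eq[OF v] eq[OF v'] by simp
qed

lemma mollify_affine_derivative:
  assumes \<delta>: "0 < \<delta>" and v: "integrable lborel v"
  shows "C1_plane (\<lambda>x. k * mollify \<delta> i j v (c + \<theta> *\<^sub>R x))
     (\<lambda>x. - \<theta> * k * mollify \<delta> (Suc i) j v (c + \<theta> *\<^sub>R x)) (\<lambda>x. - \<theta> * k * mollify \<delta> i (Suc j) v (c + \<theta> *\<^sub>R x))"
  unfolding C1_plane_def
proof (intro conjI allI)
  fix x
  have 1: "((\<lambda>x. c + \<theta> *\<^sub>R x) has_derivative (\<lambda>h. \<theta> *\<^sub>R h)) (at x)"
    by (auto intro!: derivative_eq_intros)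
  from has_derivative_mult_right[OF has_derivative_compose[OF 1 mollify_has_derivative[OF \<delta> v]], of k]
  show "((\<lambda>x. k * mollify \<delta> i j v (c + \<theta> *\<^sub>R x)) has_derivative
     (\<lambda>h. - \<theta> * k * mollify \<delta> (Suc i) j v (c + \<theta> *\<^sub>R x) * h$1 + - \<theta> * k * mollify \<delta> i (Suc j) v (c + \<theta> *\<^sub>R x) * h$2)) (at x)"
    by (rule has_derivative_eq_rhs) (auto simp: algebra_simps)
next
  have "continuous_on UNIV (\<lambda>x::real^2. c + \<theta> *\<^sub>R x)" by (intro continuous_intros)
  then have cc: "continuous_on UNIV (\<lambda>x. mollify \<delta> i j v (c + \<theta> *\<^sub>R x))" for i j
    by (rule continuous_on_compose2[OF continuous_mollify[OF \<delta> v, of UNIV]]) simp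
  show "continuous_on UNIV (\<lambda>x. - \<theta> * k * mollify \<delta> (Suc i) j v (c + \<theta> *\<^sub>R x))"
    "continuous_on UNIV (\<lambda>x. - \<theta> * k * mollify \<delta> i (Suc j) v (c + \<theta> *\<^sub>R x))"
    by (intro continuous_on_mult continuous_on_const cc)+
qed

lemma mollify_C2_plane:
  assumes \<delta>: "0 < \<delta>" and v: "integrable lborel v"
  shows "C2_plane (\<lambda>x. mollify \<delta> 0 0 v (c + \<theta> *\<^sub>R x))
     (\<lambda>x. - \<theta> * mollify \<delta> 1 0 v (c + \<theta> *\<^sub>R x)) (\<lambda>x. - \<theta> * mollify \<delta> 0 1 v (c + \<theta> *\<^sub>R x))
     (\<lambda>x. \<theta>^2 * mollify \<delta> 2 0 v (c + \<theta> *\<^sub>R x)) (\<lambda>x. \<theta>^2 * mollify \<delta> 1 1 v (c + \<theta> *\<^sub>R x)) (\<lambda>x. \<theta>^2 * mollify \<delta> 0 2 v (c + \<theta> *\<^sub>R x))"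
  unfolding C2_plane_def
  using mollify_affine_derivative[OF \<delta> v, of 1 0 0 c \<theta>] mollify_affine_derivative[OF \<delta> v, of "-\<theta>" 1 0 c \<theta>]
    mollify_affine_derivative[OF \<delta> v, of "-\<theta>" 0 1 c \<theta>]
  by (simp add: power2_eq_square numeral_2_eq_2)

text \<open>
  A point of the small square has the form \<open>\<theta> x + (1 - \<theta>) q\<close> with
  \<open>q\<close> in the given square around \<open>z\<close>. As \<open>q\<close> is interior
  and \<open>x\<close> is in the closure of a convex set, such a point is interior. So kernels
  of width \<open>r * (1 - \<theta>)\<close> fit around the contracted image of every
  \<open>x\<close>, even on the boundary.
\<close>

lemma shrink_into_interior:
  fixes K :: "(real^2) set"
  assumes K: "convex K" and r: "cbox (z - vec r) (z + vec r) \<subseteq> interior K"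
    and x: "x \<in> closure K" and \<theta>: "0 \<le> \<theta>" "\<theta> < 1"
  shows "cbox ((1 - \<theta>) *\<^sub>R z + \<theta> *\<^sub>R x - vec (r * (1 - \<theta>))) ((1 - \<theta>) *\<^sub>R z + \<theta> *\<^sub>R x + vec (r * (1 - \<theta>))) \<subseteq> interior K"
proof
  fix y assume y: "y \<in> cbox ((1 - \<theta>) *\<^sub>R z + \<theta> *\<^sub>R x - vec (r * (1 - \<theta>))) ((1 - \<theta>) *\<^sub>R z + \<theta> *\<^sub>R x + vec (r * (1 - \<theta>)))"
  define q where "q = (1 / (1 - \<theta>)) *\<^sub>R (y - \<theta> *\<^sub>R x)"
  have "(1 - \<theta>) *\<^sub>R q = y - \<theta> *\<^sub>R x" using \<theta> by (simp add: q_def)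
  moreover have "x - (1 - \<theta>) *\<^sub>R (x - q) = \<theta> *\<^sub>R x + (1 - \<theta>) *\<^sub>R q" by (simp add: algebra_simps)
  ultimately have y_eq: "y = x - (1 - \<theta>) *\<^sub>R (x - q)" by simp
  have "z$i - r \<le> q$i \<and> q$i \<le> z$i + r" for i
  proof -
    have 1: "(1 - \<theta>) * z$i + \<theta> * x$i - r * (1 - \<theta>) \<le> y$i" "y$i \<le> (1 - \<theta>) * z$i + \<theta> * x$i + r * (1 - \<theta>)"
      using y by (simp_all add: mem_box_cart)
    have "q$i = (y$i - \<theta> * x$i) / (1 - \<theta>)" by (simp add: q_def)
    moreover have "(z$i - r) * (1 - \<theta>) \<le> y$i - \<theta> * x$i" "y$i - \<theta> * x$i \<le> (z$i + r) * (1 - \<theta>)"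
      using 1 by (simp_all add: algebra_simps)
    ultimately show ?thesis using \<theta> by (simp add: le_divide_eq divide_le_eq)
  qed
  then have "q \<in> interior K" using r by (auto simp: mem_box_cart)
  then show "y \<in> interior K" unfolding y_eq
    using mem_interior_closure_convex_shrink[OF K _ x, of q "1 - \<theta>"] \<theta> by simp
qed

lemma cbox_inside_open:
  fixes S :: "(real^2) set"
  assumes "open S" "S \<noteq> {}"
  shows "\<exists>z r. 0 < r \<and> cbox (z - vec r) (z + vec r) \<subseteq> S"
proof -
  obtain z e where e: "0 < e" "ball z e \<subseteq> S" using assms unfolding open_contains_ball by blast
  have "cbox (z - vec (e/4)) (z + vec (e/4)) \<subseteq> ball z e"
  proof
    fix y assume "y \<in> cbox (z - vec (e/4)) (z + vec (e/4))"
    then have y: "z$i - e/4 \<le> y$i \<and> y$i \<le> z$i + e/4" for i by (simp add: mem_box_cart)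
    have "\<bar>(y - z)$i\<bar> \<le> e/4" for i
      using y[of i] unfolding abs_le_iff vector_minus_component by linarith
    then have "\<bar>(y - z)$1\<bar> + \<bar>(y - z)$2\<bar> \<le> e/4 + e/4" by (intro add_mono)
    then have "norm (y - z) \<le> e/4 + e/4" by (intro order_trans[OF norm_le_l1_cart]) (simp only: sum_2)
    then show "y \<in> ball z e" using e by (simp add: dist_norm norm_minus_commute)
  qed
  then show ?thesis using e by (intro exI[of _ z] exI[of _ "e/4"]) auto
qed

section \<open>Limits of smooth approximations\<close>

lemma nn_integral_le_of_AE_limit:
  fixes F :: "nat \<Rightarrow> 'a \<Rightarrow> ennreal"
  assumes [measurable]: "\<And>n. F n \<in> borel_measurable M" and le: "\<And>n. (\<integral>\<^sup>+x. F n x \<partial>M) \<le> W"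
    and lim: "AE x in M. (\<lambda>n. F n x) \<longlonglongrightarrow> G x"
  shows "(\<integral>\<^sup>+x. G x \<partial>M) \<le> W"
proof -
  have "(\<integral>\<^sup>+x. G x \<partial>M) = (\<integral>\<^sup>+x. liminf (\<lambda>n. F n x) \<partial>M)"
  proof (rule nn_integral_cong_AE)
    show "AE x in M. G x = liminf (\<lambda>n. F n x)"
      using lim by eventually_elim (simp add: lim_imp_Liminf)
  qed
  also have "\<dots> \<le> liminf (\<lambda>n. \<integral>\<^sup>+x. F n x \<partial>M)" by (rule nn_integral_liminf) simp
  also have "\<dots> \<le> W" using le by (intro Liminf_le) (auto intro: always_eventually)
  finally show ?thesis .
qed

lemma triangle_integral_triangle:
  assumes [measurable]: "f \<in> borel_measurable borel" "g \<in> borel_measurable borel" "v \<in> borel_measurable borel"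
  shows "triangle_integral a b c (\<lambda>x. \<bar>f x - g x\<bar>) \<le> triangle_integral a b c (\<lambda>x. \<bar>f x - v x\<bar>) + triangle_integral a b c (\<lambda>x. \<bar>g x - v x\<bar>)"
  by (subst triangle_integral_add[symmetric]) (auto intro!: triangle_integral_mono)

lemma triangle_integral_AE_subseq:
  assumes [measurable]: "\<And>n. f n \<in> borel_measurable borel" "v \<in> borel_measurable borel"
    and lim: "(\<lambda>n. triangle_integral a b c (\<lambda>x. \<bar>f n x - v x\<bar>)) \<longlonglongrightarrow> 0"
    and fin: "\<And>n. triangle_integral a b c (\<lambda>x. \<bar>f n x - v x\<bar>) < \<infinity>"
  shows "\<exists>\<rho>. strict_mono \<rho> \<and> (AE x in lborel. x \<in> open_triangle a b c \<longrightarrow> (\<lambda>n. f (\<rho> n) x) \<longlonglongrightarrow> v x)"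
proof -
  let ?K = "open_triangle a b c"
  define s where "s n x = (f n x - v x) * indicator ?K x" for n x
  have [measurable]: "s n \<in> borel_measurable borel" for n unfolding s_def by measurable
  have eq: "(\<integral>\<^sup>+x. ennreal \<bar>s n x\<bar> \<partial>lborel) = triangle_integral a b c (\<lambda>x. \<bar>f n x - v x\<bar>)" for n
    unfolding triangle_integral_def s_def by (intro nn_integral_cong) (auto split: split_indicator)
  have int: "integrable lborel (s n)" for n
    using fin[of n] by (intro integrableI_bounded) (simp_all add: eq)
  have "(\<lambda>n. \<integral>x. \<bar>s n x\<bar> \<partial>lborel) \<longlonglongrightarrow> 0"
  proof -
    have "(\<integral>x. \<bar>s n x\<bar> \<partial>lborel) = enn2real (triangle_integral a b c (\<lambda>x. \<bar>f n x - v x\<bar>))" for n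
      unfolding eq[symmetric] by (rule integral_eq_nn_integral) auto
    moreover have "(\<lambda>n. enn2real (triangle_integral a b c (\<lambda>x. \<bar>f n x - v x\<bar>))) \<longlonglongrightarrow> enn2real 0"
      using lim by (intro tendsto_enn2real) auto
    ultimately show ?thesis by simp
  qed
  then have "(\<lambda>n. \<integral>x. norm (s n x) \<partial>lborel) \<longlonglongrightarrow> 0" by simp
  from tendsto_L1_AE_subseq[of lborel s, OF int this] obtain \<rho> where
    \<rho>: "strict_mono \<rho>" "AE x in lborel. (\<lambda>n. s (\<rho> n) x) \<longlonglongrightarrow> 0" by blast
  have "AE x in lborel. x \<in> ?K \<longrightarrow> (\<lambda>n. f (\<rho> n) x) \<longlonglongrightarrow> v x"
    using \<rho>(2) by eventually_elim (auto simp: s_def LIM_zero_iff)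
  then show ?thesis using \<rho>(1) by blast
qed

lemma C2_plane_diff:
  assumes "C2_plane f f1 f2 f11 f12 f22" "C2_plane g g1 g2 g11 g12 g22"
  shows "C2_plane (\<lambda>x. f x - g x) (\<lambda>x. f1 x - g1 x) (\<lambda>x. f2 x - g2 x) (\<lambda>x. f11 x - g11 x) (\<lambda>x. f12 x - g12 x) (\<lambda>x. f22 x - g22 x)"
proof -
  have "C1_plane (\<lambda>x. f x - g x) (\<lambda>x. f1 x - g1 x) (\<lambda>x. f2 x - g2 x)" if "C1_plane f f1 f2" "C1_plane g g1 g2" for f f1 f2 g g1 g2
    using C1_plane_linear[OF that, of 1 "-1"] by simp
  then show ?thesis using assms unfolding C2_plane_def by blast
qed

lemma C2_plane_affine: "C2_plane (\<lambda>x. \<alpha> + \<beta>1 * x$1 + \<beta>2 * x$2) (\<lambda>_. \<beta>1) (\<lambda>_. \<beta>2) (\<lambda>_. 0) (\<lambda>_. 0) (\<lambda>_. 0)"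
proof -
  have "((\<lambda>x::real^2. \<alpha> + \<beta>1 * x$1 + \<beta>2 * x$2) has_derivative (\<lambda>h. \<beta>1 * h$1 + \<beta>2 * h$2)) (at x)" for x
    by ((rule has_derivative_eq_rhs, (rule has_derivative_add has_derivative_const has_derivative_mult_right
          bounded_linear_imp_has_derivative[OF bounded_linear_vec_nth])+), auto)
  then show ?thesis unfolding C2_plane_def C1_plane_def by (simp add: continuous_on_const)
qed

lemma emeasure_open_triangle:
  assumes det: "det2 (b - a) (c - a) \<noteq> 0"
  obtains k where "0 < k" "emeasure lborel (open_triangle a b c) = ennreal k"
proof -
  have bnd: "bounded (open_triangle a b c)"
    unfolding open_triangle_def by (rule bounded_subset[OF compact_imp_bounded[OF compact_triangle] interior_subset])
  have "interior reftri \<noteq> {}"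
  proof -
    have "box (0, 0) (1/2 :: real, 1/2 :: real) \<subseteq> reftri" by (auto simp: reftri_def mem_box Basis_prod_def)
    then have "box (0, 0) (1/2 :: real, 1/2 :: real) \<subseteq> interior reftri" by (intro interior_maximal) auto
    moreover have "(1/4, 1/4) \<in> box (0, 0) (1/2 :: real, 1/2 :: real)" by (auto simp: mem_box Basis_prod_def)
    ultimately show ?thesis by blast
  qed
  have "emeasure lborel (box (0, 0) (1/2 :: real, 1/2 :: real)) = ennreal (1/4)"
    by (subst emeasure_lborel_box) (auto simp: Basis_prod_def)
  moreover have "emeasure lborel (box (0, 0) (1/2 :: real, 1/2 :: real)) \<le> emeasure lborel reftri"
  proof (rule emeasure_mono)
    show "box (0, 0) (1/2 :: real, 1/2 :: real) \<subseteq> reftri" by (auto simp: reftri_def mem_box Basis_prod_def)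
  qed (simp add: reftri_measurable)
  ultimately have "ennreal (1/4) \<le> emeasure lborel reftri" by simp
  then have "0 < emeasure lborel reftri" by (rule less_le_trans[rotated]) simp
  moreover have "emeasure lborel (open_triangle a b c) = ennreal \<bar>det2 (b - a) (c - a)\<bar> * emeasure lborel reftri"
    using nn_integral_open_triangle[of "\<lambda>_. 1", OF _ det] by (simp add: open_triangle_sets)
  ultimately have "0 < emeasure lborel (open_triangle a b c)" using det by (simp add: ennreal_zero_less_mult_iff)
  moreover have "emeasure lborel (open_triangle a b c) < \<infinity>" by (rule emeasure_bounded_finite[OF bnd])
  ultimately show thesis using that by (cases "emeasure lborel (open_triangle a b c)") auto
qed

text \<open>
  Convergence is required in \<open>L\<^sup>1\<close> only, for every exponent; the
  \<open>L\<^sup>p\<close> bounds on the second derivatives of the approximations enter later as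
  separate hypotheses. The limits \<open>v\<close>, \<open>v1\<close>, \<dots> stand for Borel
  representatives of a Sobolev function and its weak derivatives.
\<close>

locale smooth_approximation =
  fixes a b c :: "real^2" and f f1 f2 f11 f12 f22 :: "nat \<Rightarrow> real^2 \<Rightarrow> real" and v v1 v2 v11 v12 v22 :: "real^2 \<Rightarrow> real"
  assumes det: "det2 (b - a) (c - a) \<noteq> 0"
    and C2: "\<And>n. C2_plane (f n) (f1 n) (f2 n) (f11 n) (f12 n) (f22 n)"
    and limits_measurable: "v \<in> borel_measurable borel" "v1 \<in> borel_measurable borel" "v2 \<in> borel_measurable borel"
      "v11 \<in> borel_measurable borel" "v12 \<in> borel_measurable borel" "v22 \<in> borel_measurable borel"
    and lim: "(\<lambda>n. triangle_integral a b c (\<lambda>x. \<bar>f n x - v x\<bar>)) \<longlonglongrightarrow> 0"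
      "(\<lambda>n. triangle_integral a b c (\<lambda>x. \<bar>f1 n x - v1 x\<bar>)) \<longlonglongrightarrow> 0"
      "(\<lambda>n. triangle_integral a b c (\<lambda>x. \<bar>f2 n x - v2 x\<bar>)) \<longlonglongrightarrow> 0"
      "(\<lambda>n. triangle_integral a b c (\<lambda>x. \<bar>f11 n x - v11 x\<bar>)) \<longlonglongrightarrow> 0"
      "(\<lambda>n. triangle_integral a b c (\<lambda>x. \<bar>f12 n x - v12 x\<bar>)) \<longlonglongrightarrow> 0"
      "(\<lambda>n. triangle_integral a b c (\<lambda>x. \<bar>f22 n x - v22 x\<bar>)) \<longlonglongrightarrow> 0"
    and fin: "\<And>n. triangle_integral a b c (\<lambda>x. \<bar>f n x - v x\<bar>) < \<infinity>"
      "\<And>n. triangle_integral a b c (\<lambda>x. \<bar>f1 n x - v1 x\<bar>) < \<infinity>"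
      "\<And>n. triangle_integral a b c (\<lambda>x. \<bar>f2 n x - v2 x\<bar>) < \<infinity>"
begin

abbreviation "tri \<equiv> convex hull {a, b, c}"
abbreviation "T \<equiv> triangle_integral a b c"

lemma approximants_measurable: "f n \<in> borel_measurable borel" "f1 n \<in> borel_measurable borel" "f2 n \<in> borel_measurable borel"
    "f11 n \<in> borel_measurable borel" "f12 n \<in> borel_measurable borel" "f22 n \<in> borel_measurable borel"
  using C2_continuous[OF C2[of n]] by (auto intro: borel_measurable_continuous_onI)

text \<open>
  A value of the difference \<open>u\<close> of two approximations is at most its mean over the
  triangle plus its oscillation. Both are bounded by \<open>L\<^sup>1\<close> norms of
  \<open>u\<close> and its derivatives, which are at most \<open>2 * \<eta>\<close>.
\<close>

lemma difference_bound:
  assumes \<eta>: "0 < \<eta>"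
    and small: "\<And>k. k = n \<or> k = m \<Longrightarrow> T (\<lambda>x. \<bar>f k x - v x\<bar>) < ennreal \<eta> \<and> T (\<lambda>x. \<bar>f1 k x - v1 x\<bar>) < ennreal \<eta> \<and>
      T (\<lambda>x. \<bar>f2 k x - v2 x\<bar>) < ennreal \<eta> \<and> T (\<lambda>x. \<bar>f11 k x - v11 x\<bar>) < ennreal \<eta> \<and>
      T (\<lambda>x. \<bar>f12 k x - v12 x\<bar>) < ennreal \<eta> \<and> T (\<lambda>x. \<bar>f22 k x - v22 x\<bar>) < ennreal \<eta>"
    and h: "0 \<le> h" "norm (b - a) \<le> h" "norm (c - a) \<le> h" "norm (c - b) \<le> h"
    and k: "0 < k" "emeasure lborel (open_triangle a b c) = ennreal k"
    and x: "x \<in> tri"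
  shows "\<bar>f n x - f m x\<bar> \<le> (2 / k + 64 * (h + h^2) / \<bar>det2 (b - a) (c - a)\<bar>) * \<eta>"
proof -
  let ?d = "\<bar>det2 (b - a) (c - a)\<bar>"
  define u where "u x = f n x - f m x" for x
  define u1 where "u1 x = f1 n x - f1 m x" for x
  define u2 where "u2 x = f2 n x - f2 m x" for x
  define u11 where "u11 x = f11 n x - f11 m x" for x
  define u12 where "u12 x = f12 n x - f12 m x" for x
  define u22 where "u22 x = f22 n x - f22 m x" for x
  have Cu: "C2_plane u u1 u2 u11 u12 u22"
    unfolding u_def[abs_def] u1_def[abs_def] u2_def[abs_def] u11_def[abs_def] u12_def[abs_def] u22_def[abs_def]
    by (rule C2_plane_diff[OF C2 C2])
  have um [measurable]: "u \<in> borel_measurable borel" "u1 \<in> borel_measurable borel" "u2 \<in> borel_measurable borel"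
    "u11 \<in> borel_measurable borel" "u12 \<in> borel_measurable borel" "u22 \<in> borel_measurable borel"
    using C2_continuous[OF Cu] by (auto intro: borel_measurable_continuous_onI)
  have two: "T (\<lambda>x. \<bar>g n x - g m x\<bar>) \<le> ennreal (2 * \<eta>)"
    if "\<And>k. g k \<in> borel_measurable borel" "z \<in> borel_measurable borel" "T (\<lambda>x. \<bar>g n x - z x\<bar>) < ennreal \<eta>" "T (\<lambda>x. \<bar>g m x - z x\<bar>) < ennreal \<eta>"
    for g :: "nat \<Rightarrow> real^2 \<Rightarrow> real" and z
  proof -
    have "T (\<lambda>x. \<bar>g n x - g m x\<bar>) \<le> ennreal \<eta> + ennreal \<eta>"
      using that by (intro order_trans[OF triangle_integral_triangle add_mono]) auto
    then show ?thesis using \<eta> by (simp flip: ennreal_plus)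
  qed
  have b: "T (\<lambda>x. \<bar>u x\<bar>) \<le> ennreal (2 * \<eta>)" "T (\<lambda>x. \<bar>u1 x\<bar>) \<le> ennreal (2 * \<eta>)" "T (\<lambda>x. \<bar>u2 x\<bar>) \<le> ennreal (2 * \<eta>)"
    "T (\<lambda>x. \<bar>u11 x\<bar>) \<le> ennreal (2 * \<eta>)" "T (\<lambda>x. \<bar>u12 x\<bar>) \<le> ennreal (2 * \<eta>)" "T (\<lambda>x. \<bar>u22 x\<bar>) \<le> ennreal (2 * \<eta>)"
    unfolding u_def u1_def u2_def u11_def u12_def u22_def
    by (rule two[OF approximants_measurable(1) limits_measurable(1)] two[OF approximants_measurable(2) limits_measurable(2)] two[OF approximants_measurable(3) limits_measurable(3)] two[OF approximants_measurable(4) limits_measurable(4)] two[OF approximants_measurable(5) limits_measurable(5)] two[OF approximants_measurable(6) limits_measurable(6)]; use small[OF disjI1[OF refl]] small[OF disjI2[OF refl]] in blast)+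
  \<comment> \<open>the terms with h contribute 4 * h * (2 * \<eta> + 2 * \<eta>), those with h^2 contribute 2 * h^2 * (8 * \<eta>); the oscillation bound multiplies their sum by 4\<close>
  define N where "N = T (\<lambda>x. 4 * h * (\<bar>u1 x\<bar> + \<bar>u2 x\<bar>) + 2 * h^2 * hess u11 u12 u22 x)"
  have hm: "hess u11 u12 u22 \<in> borel_measurable borel" by (rule C2_plane_measurable(1)[OF Cu])
  have "N = T (\<lambda>x. 4 * h * (\<bar>u1 x\<bar> + \<bar>u2 x\<bar>)) + T (\<lambda>x. 2 * h^2 * hess u11 u12 u22 x)"
    unfolding N_def using h hm hess_nonneg[OF Cu] by (intro triangle_integral_add) auto
  also have "T (\<lambda>x. 4 * h * (\<bar>u1 x\<bar> + \<bar>u2 x\<bar>)) = ennreal (4 * h) * (T (\<lambda>x. \<bar>u1 x\<bar>) + T (\<lambda>x. \<bar>u2 x\<bar>))"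
    using h by (subst triangle_integral_cmult, simp, measurable, simp, subst triangle_integral_add) auto
  also have "T (\<lambda>x. 2 * h^2 * hess u11 u12 u22 x) = ennreal (2 * h^2) * T (hess u11 u12 u22)"
    using h hm hess_nonneg[OF Cu] by (intro triangle_integral_cmult) auto
  also have "T (hess u11 u12 u22) = T (\<lambda>x. \<bar>u11 x\<bar>) + 2 * T (\<lambda>x. \<bar>u12 x\<bar>) + T (\<lambda>x. \<bar>u22 x\<bar>)"
  proof -
    have "T (hess u11 u12 u22) = T (\<lambda>x. (\<bar>u11 x\<bar> + 2 * \<bar>u12 x\<bar>) + \<bar>u22 x\<bar>)"
      unfolding hess_def[OF Cu] ..
    also have "\<dots> = T (\<lambda>x. \<bar>u11 x\<bar> + 2 * \<bar>u12 x\<bar>) + T (\<lambda>x. \<bar>u22 x\<bar>)" by (rule triangle_integral_add) auto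
    also have "T (\<lambda>x. \<bar>u11 x\<bar> + 2 * \<bar>u12 x\<bar>) = T (\<lambda>x. \<bar>u11 x\<bar>) + T (\<lambda>x. 2 * \<bar>u12 x\<bar>)" by (rule triangle_integral_add) auto
    also have "T (\<lambda>x. 2 * \<bar>u12 x\<bar>) = ennreal 2 * T (\<lambda>x. \<bar>u12 x\<bar>)" by (rule triangle_integral_cmult) auto
    finally show ?thesis by simp
  qed
  also have "ennreal (4 * h) * (T (\<lambda>x. \<bar>u1 x\<bar>) + T (\<lambda>x. \<bar>u2 x\<bar>)) + ennreal (2 * h^2) * (T (\<lambda>x. \<bar>u11 x\<bar>) + 2 * T (\<lambda>x. \<bar>u12 x\<bar>) + T (\<lambda>x. \<bar>u22 x\<bar>))
     \<le> ennreal (4 * h) * (ennreal (2 * \<eta>) + ennreal (2 * \<eta>)) + ennreal (2 * h^2) * (ennreal (2 * \<eta>) + 2 * ennreal (2 * \<eta>) + ennreal (2 * \<eta>))"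
    by (intro add_mono mult_left_mono b) auto
  also have "\<dots> = ennreal (16 * (h + h^2) * \<eta>)"
  proof -
    have "ennreal (2 * \<eta>) + 2 * ennreal (2 * \<eta>) + ennreal (2 * \<eta>) = ennreal (8 * \<eta>)"
    proof -
      have "2 * ennreal (2 * \<eta>) = ennreal (4 * \<eta>)" using \<eta> by (simp add: ennreal_mult flip: mult.assoc)
      then show ?thesis using \<eta> by (simp flip: ennreal_plus)
    qed
    moreover have "ennreal (2 * \<eta>) + ennreal (2 * \<eta>) = ennreal (4 * \<eta>)" using \<eta> by (simp flip: ennreal_plus)
    ultimately show ?thesis using h \<eta> by (simp add: algebra_simps flip: ennreal_mult ennreal_plus)
  qed
  finally have N: "N \<le> ennreal (16 * (h + h^2) * \<eta>)" .
  have osc: "\<bar>u x - u y\<bar> \<le> 64 * (h + h^2) * \<eta> / ?d" if y: "y \<in> tri" for y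
  proof -
    have "ennreal (\<bar>u x - u y\<bar> * ?d) \<le> 4 * N"
      unfolding N_def by (rule oscillation_bound[OF Cu det h(2-4) x y])
    also have "\<dots> \<le> 4 * ennreal (16 * (h + h^2) * \<eta>)" by (intro mult_left_mono N) auto
    also have "\<dots> = ennreal (64 * (h + h^2) * \<eta>)"
    proof -
      have "4 * ennreal (16 * (h + h^2) * \<eta>) = ennreal 4 * ennreal (16 * (h + h^2) * \<eta>)" by simp
      also have "\<dots> = ennreal (4 * (16 * (h + h^2) * \<eta>))" using h \<eta> by (intro ennreal_mult[symmetric]) auto
      finally show ?thesis by (simp add: algebra_simps)
    qed
    finally have "\<bar>u x - u y\<bar> * ?d \<le> 64 * (h + h^2) * \<eta>" using h \<eta> by (subst (asm) ennreal_le_iff) auto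
    then show ?thesis using det by (simp add: le_divide_eq)
  qed
  define D where "D = 64 * (h + h^2) * \<eta> / ?d"
  have D0: "0 \<le> D" using h \<eta> by (simp add: D_def)
  have "ennreal \<bar>u x\<bar> * ennreal k = T (\<lambda>y. \<bar>u x\<bar>)"
    unfolding triangle_integral_def k(2)[symmetric] by (subst nn_integral_cmult_indicator) auto
  also have "\<dots> \<le> T (\<lambda>y. \<bar>u y\<bar> + D)"
  proof (rule triangle_integral_mono)
    fix y assume "y \<in> open_triangle a b c"
    then have "y \<in> tri" using interior_subset unfolding open_triangle_def by blast
    from osc[OF this] show "\<bar>u x\<bar> \<le> \<bar>u y\<bar> + D" unfolding D_def by linarith
  qed
  also have "\<dots> = T (\<lambda>y. \<bar>u y\<bar>) + T (\<lambda>y. D)" using D0 by (intro triangle_integral_add) auto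
  also have "T (\<lambda>y. D) = ennreal D * ennreal k"
    unfolding triangle_integral_def k(2)[symmetric] by (subst nn_integral_cmult_indicator) auto
  also have "T (\<lambda>y. \<bar>u y\<bar>) + ennreal D * ennreal k \<le> ennreal (2 * \<eta>) + ennreal D * ennreal k" by (intro add_right_mono b)
  also have "\<dots> = ennreal (2 * \<eta> + D * k)" using D0 k \<eta> by (simp add: ennreal_mult)
  finally have "ennreal (\<bar>u x\<bar> * k) \<le> ennreal (2 * \<eta> + D * k)" using k by (simp add: ennreal_mult)
  then have "\<bar>u x\<bar> * k \<le> 2 * \<eta> + D * k" using D0 k \<eta> by (subst (asm) ennreal_le_iff) auto
  then have "\<bar>u x\<bar> \<le> (2 * \<eta> + D * k) / k" using k by (simp add: le_divide_eq)
  also have "\<dots> = (2 / k + 64 * (h + h^2) / ?d) * \<eta>" using k by (simp add: D_def field_simps)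
  finally show ?thesis by (simp add: u_def)
qed

lemma uniform_limit_exists: "\<exists>V. uniform_limit tri f V sequentially"
proof -
  define h where "h = norm (b - a) + norm (c - a) + norm (c - b)"
  have h: "0 \<le> h" "norm (b - a) \<le> h" "norm (c - a) \<le> h" "norm (c - b) \<le> h" by (auto simp: h_def)
  obtain k where k: "0 < k" "emeasure lborel (open_triangle a b c) = ennreal k" using emeasure_open_triangle[OF det] by blast
  define C where "C = 2 / k + 64 * (h + h^2) / \<bar>det2 (b - a) (c - a)\<bar>"
  have C: "0 < C" using k h by (auto simp: C_def intro!: add_pos_nonneg divide_nonneg_nonneg)
  have "uniformly_Cauchy_on tri f"
    unfolding uniformly_Cauchy_on_def
  proof safe
    fix e :: real assume e: "0 < e"
    define \<eta> where "\<eta> = e / (2 * C)"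
    have \<eta>: "0 < \<eta>" "C * \<eta> < e" using e C by (auto simp: \<eta>_def)
    have "0 < ennreal \<eta>" using \<eta> by simp
    note ev = order_tendstoD(2)[OF lim(1) this] order_tendstoD(2)[OF lim(2) this] order_tendstoD(2)[OF lim(3) this]
      order_tendstoD(2)[OF lim(4) this] order_tendstoD(2)[OF lim(5) this] order_tendstoD(2)[OF lim(6) this]
    have "\<forall>\<^sub>F k in sequentially. T (\<lambda>x. \<bar>f k x - v x\<bar>) < ennreal \<eta> \<and> T (\<lambda>x. \<bar>f1 k x - v1 x\<bar>) < ennreal \<eta> \<and>
      T (\<lambda>x. \<bar>f2 k x - v2 x\<bar>) < ennreal \<eta> \<and> T (\<lambda>x. \<bar>f11 k x - v11 x\<bar>) < ennreal \<eta> \<and>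
      T (\<lambda>x. \<bar>f12 k x - v12 x\<bar>) < ennreal \<eta> \<and> T (\<lambda>x. \<bar>f22 k x - v22 x\<bar>) < ennreal \<eta>"
      by (intro eventually_conj ev)
    then obtain M where M: "\<And>k. M \<le> k \<Longrightarrow> T (\<lambda>x. \<bar>f k x - v x\<bar>) < ennreal \<eta> \<and> T (\<lambda>x. \<bar>f1 k x - v1 x\<bar>) < ennreal \<eta> \<and>
      T (\<lambda>x. \<bar>f2 k x - v2 x\<bar>) < ennreal \<eta> \<and> T (\<lambda>x. \<bar>f11 k x - v11 x\<bar>) < ennreal \<eta> \<and>
      T (\<lambda>x. \<bar>f12 k x - v12 x\<bar>) < ennreal \<eta> \<and> T (\<lambda>x. \<bar>f22 k x - v22 x\<bar>) < ennreal \<eta>"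
      unfolding eventually_sequentially by blast
    have "dist (f m x) (f n x) < e" if "x \<in> tri" "M \<le> m" "M \<le> n" for x m n
    proof -
      have "\<bar>f m x - f n x\<bar> \<le> C * \<eta>"
        unfolding C_def using that(2,3) M by (intro difference_bound[OF \<eta>(1) _ h k that(1)]) blast
      then show ?thesis using \<eta> by (simp add: dist_real_def)
    qed
    then show "\<exists>M. \<forall>x\<in>tri. \<forall>m\<ge>M. \<forall>n\<ge>M. dist (f m x) (f n x) < e" by blast
  qed
  then show ?thesis using Cauchy_uniformly_convergent uniformly_convergent_on_def by blast
qed

lemma vertices_in: "a \<in> tri" "b \<in> tri" "c \<in> tri"
  by (auto intro: hull_inc)

lemma open_subset_tri: "open_triangle a b c \<subseteq> tri"
  unfolding open_triangle_def by (rule interior_subset)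

end

text \<open>
  The gradient of the affine function with prescribed values at the vertices, by Cramer's rule.
  The explicit formula makes its continuous dependence on the values evident.
\<close>

definition slope :: "2 \<Rightarrow> real^2 \<Rightarrow> real^2 \<Rightarrow> real^2 \<Rightarrow> real \<Rightarrow> real \<Rightarrow> real \<Rightarrow> real" where
  "slope i a b c ya yb yc = (if i = 1 then (yb - ya) * (c - a)$2 - (yc - ya) * (b - a)$2
     else (yc - ya) * (b - a)$1 - (yb - ya) * (c - a)$1) / det2 (b - a) (c - a)"

definition intercept :: "real^2 \<Rightarrow> real^2 \<Rightarrow> real^2 \<Rightarrow> real \<Rightarrow> real \<Rightarrow> real \<Rightarrow> real" where
  "intercept a b c ya yb yc = ya - slope 1 a b c ya yb yc * a$1 - slope 2 a b c ya yb yc * a$2"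

definition affine_interp :: "real^2 \<Rightarrow> real^2 \<Rightarrow> real^2 \<Rightarrow> real \<Rightarrow> real \<Rightarrow> real \<Rightarrow> real^2 \<Rightarrow> real" where
  "affine_interp a b c ya yb yc x = intercept a b c ya yb yc + slope 1 a b c ya yb yc * x$1 + slope 2 a b c ya yb yc * x$2"

lemma affine_interp_vertices:
  assumes det: "det2 (b - a) (c - a) \<noteq> 0"
  shows "affine_interp a b c ya yb yc a = ya" "affine_interp a b c ya yb yc b = yb" "affine_interp a b c ya yb yc c = yc"
proof -
  define d where "d = det2 (b - a) (c - a)"
  define s1 s2 where "s1 = slope 1 a b c ya yb yc" and "s2 = slope 2 a b c ya yb yc"
  have d: "d \<noteq> 0" "d = (b - a)$1 * (c - a)$2 - (b - a)$2 * (c - a)$1" using det by (auto simp: d_def det2_def)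
  have s: "d * s1 = (yb - ya) * (c - a)$2 - (yc - ya) * (b - a)$2" "d * s2 = (yc - ya) * (b - a)$1 - (yb - ya) * (c - a)$1"
    using det by (auto simp: s1_def s2_def slope_def d_def)
  have "d * (s1 * (b - a)$1 + s2 * (b - a)$2) = d * (yb - ya)" "d * (s1 * (c - a)$1 + s2 * (c - a)$2) = d * (yc - ya)"
    using s d(2) by algebra+
  then have "s1 * (b - a)$1 + s2 * (b - a)$2 = yb - ya" "s1 * (c - a)$1 + s2 * (c - a)$2 = yc - ya"
    using d by auto
  then show "affine_interp a b c ya yb yc a = ya" "affine_interp a b c ya yb yc b = yb" "affine_interp a b c ya yb yc c = yc"
    unfolding affine_interp_def intercept_def s1_def[symmetric] s2_def[symmetric] by (simp_all add: algebra_simps)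
qed

lemma affine_interp_unique:
  assumes det: "det2 (b - a) (c - a) \<noteq> 0" and q: "poly_degree_le_1 q" and "q a = ya" "q b = yb" "q c = yc"
  shows "q = affine_interp a b c ya yb yc"
proof -
  obtain k l m where klm: "\<And>x. q x = k + l * x$1 + m * x$2" using q by (auto simp: poly_degree_le_1_def)
  define d where "d = det2 (b - a) (c - a)"
  define x y where "x = (b - a)$1" and "y = (b - a)$2"
  define x' y' where "x' = (c - a)$1" and "y' = (c - a)$2"
  have dnz: "d \<noteq> 0" "d = x * y' - y * x'" using det by (auto simp: d_def det2_def x_def y_def x'_def y'_def)
  have "yb - ya = l * x + m * y" "yc - ya = l * x' + m * y'"
    using assms(3-5) unfolding klm by (auto simp: x_def y_def x'_def y'_def algebra_simps)
  then have "(yb - ya) * y' - (yc - ya) * y = d * l" "(yc - ya) * x - (yb - ya) * x' = d * m"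
    unfolding dnz(2) by algebra+
  then have "slope 1 a b c ya yb yc = l" "slope 2 a b c ya yb yc = m"
    using dnz by (auto simp: slope_def d_def[symmetric] x_def y_def x'_def y'_def)
  moreover have "k = ya - l * a$1 - m * a$2" using assms(3) klm[of a] by simp
  ultimately show ?thesis by (auto simp: fun_eq_iff klm affine_interp_def intercept_def)
qed

lemma poly_degree_affine_interp: "poly_degree_le_1 (affine_interp a b c ya yb yc)"
  unfolding poly_degree_le_1_def affine_interp_def by blast

context smooth_approximation
begin

context
  fixes V :: "real^2 \<Rightarrow> real"
  assumes V: "uniform_limit tri f V sequentially"
begin

lemma limit_continuous: "continuous_on tri V"
proof (rule uniform_limit_theorem[OF _ V])
  show "\<forall>\<^sub>F n in sequentially. continuous_on tri (f n)"
    by (intro always_eventually allI continuous_on_subset[OF C2_continuous(1)[OF C2] subset_UNIV])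
qed simp

lemma limit_pointwise: "x \<in> tri \<Longrightarrow> (\<lambda>n. f n x) \<longlonglongrightarrow> V x"
  using V by (rule tendsto_uniform_limitI)

lemma AE_limit_eq: "AE x in lborel. x \<in> open_triangle a b c \<longrightarrow> V x = v x"
proof -
  obtain \<rho> where \<rho>: "strict_mono \<rho>" "AE x in lborel. x \<in> open_triangle a b c \<longrightarrow> (\<lambda>n. f (\<rho> n) x) \<longlonglongrightarrow> v x"
    using triangle_integral_AE_subseq[OF approximants_measurable(1) limits_measurable(1) lim(1) fin(1)] by blast
  from \<rho>(2) show ?thesis
  proof eventually_elim
    case (elim x)
    show ?case
    proof
      assume x: "x \<in> open_triangle a b c"
      then have "(\<lambda>n. f (\<rho> n) x) \<longlonglongrightarrow> V x"
        using LIMSEQ_subseq_LIMSEQ[OF limit_pointwise \<rho>(1)] open_subset_tri by (auto simp: o_def)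
      then show "V x = v x" using elim x LIMSEQ_unique by blast
    qed
  qed
qed

definition interp_slope where "interp_slope i n = slope i a b c (f n a) (f n b) (f n c)"
definition interp_slope_lim where "interp_slope_lim i = slope i a b c (V a) (V b) (V c)"
definition interp where "interp n = affine_interp a b c (f n a) (f n b) (f n c)"
definition interp_lim where "interp_lim = affine_interp a b c (V a) (V b) (V c)"

lemma interp_slope_tendsto: "interp_slope i \<longlonglongrightarrow> interp_slope_lim i"
  unfolding interp_slope_def[abs_def] interp_slope_lim_def slope_def using det
  by (cases "i = 1") (auto intro!: tendsto_intros limit_pointwise vertices_in)

lemma interp_tendsto: "(\<lambda>n. interp n x) \<longlonglongrightarrow> interp_lim x"
  using interp_slope_tendsto[of 1] interp_slope_tendsto[of 2] unfolding interp_def interp_lim_def affine_interp_def intercept_def interp_slope_def[symmetric] interp_slope_lim_def[symmetric]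
  by (intro tendsto_intros limit_pointwise vertices_in)

lemma C2_error: "C2_plane (\<lambda>x. f n x - interp n x) (\<lambda>x. f1 n x - interp_slope 1 n) (\<lambda>x. f2 n x - interp_slope 2 n) (f11 n) (f12 n) (f22 n)"
  using C2_plane_diff[OF C2 C2_plane_affine, of n "intercept a b c (f n a) (f n b) (f n c)" "interp_slope 1 n" "interp_slope 2 n"]
  by (simp add: interp_def affine_interp_def interp_slope_def)

lemma error_vanishes: "f n a - interp n a = 0" "f n b - interp n b = 0" "f n c - interp n c = 0"
  by (simp_all add: interp_def affine_interp_vertices[OF det])

lemma error_measurable: "(\<lambda>x. f n x - interp n x) \<in> borel_measurable borel" "(\<lambda>x. f1 n x - interp_slope 1 n) \<in> borel_measurable borel"
   "(\<lambda>x. f2 n x - interp_slope 2 n) \<in> borel_measurable borel"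
  by (rule C2_plane_measurable(2,3,4)[OF C2_error])+

lemma fatou_power:
  assumes gm: "\<And>n. g n \<in> borel_measurable borel"
    and lim: "AE x in lborel. x \<in> open_triangle a b c \<longrightarrow> (\<lambda>n. g n x) \<longlonglongrightarrow> g' x"
    and le: "\<And>n. T (\<lambda>x. \<bar>g n x\<bar> powr q) \<le> W" and q: "1 \<le> q"
  shows "T (\<lambda>x. \<bar>g' x\<bar> powr q) \<le> W"
  unfolding triangle_integral_def
proof (rule nn_integral_le_of_AE_limit)
  note [measurable] = gm
  show "(\<lambda>x. ennreal (\<bar>g n x\<bar> powr q) * indicator (open_triangle a b c) x) \<in> borel_measurable lborel" for n
    by measurable
  show "(\<integral>\<^sup>+x. ennreal (\<bar>g n x\<bar> powr q) * indicator (open_triangle a b c) x \<partial>lborel) \<le> W" for n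
    using le unfolding triangle_integral_def .
  show "AE x in lborel. (\<lambda>n. ennreal (\<bar>g n x\<bar> powr q) * indicator (open_triangle a b c) x)
     \<longlonglongrightarrow> ennreal (\<bar>g' x\<bar> powr q) * indicator (open_triangle a b c) x"
    using lim
  proof eventually_elim
    case (elim x)
    show ?case
    proof (cases "x \<in> open_triangle a b c")
      case True
      then have "(\<lambda>n. \<bar>g n x\<bar> powr q) \<longlonglongrightarrow> \<bar>g' x\<bar> powr q"
        using elim q by (intro tendsto_powr' tendsto_rabs tendsto_const) auto
      then show ?thesis using True by (simp add: tendsto_ennrealI)
    qed simp
  qed
qed

lemma error_limit: "AE x in lborel. x \<in> open_triangle a b c \<longrightarrow> (\<lambda>n. f n x - interp n x) \<longlonglongrightarrow> v x - interp_lim x"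
  using AE_limit_eq
proof eventually_elim
  case (elim x)
  then show ?case using limit_pointwise[of x] open_subset_tri interp_tendsto by (auto intro!: tendsto_diff)
qed

text \<open>
  Convergence in \<open>L\<^sup>1\<close> yields convergence almost everywhere along a
  subsequence, as needed for Fatou's lemma.
\<close>

lemma gradient_limit:
  "\<exists>\<rho>. strict_mono \<rho> \<and> (AE x in lborel. x \<in> open_triangle a b c \<longrightarrow> (\<lambda>n. f1 (\<rho> n) x - interp_slope 1 (\<rho> n)) \<longlonglongrightarrow> v1 x - interp_slope_lim 1)"
  "\<exists>\<rho>. strict_mono \<rho> \<and> (AE x in lborel. x \<in> open_triangle a b c \<longrightarrow> (\<lambda>n. f2 (\<rho> n) x - interp_slope 2 (\<rho> n)) \<longlonglongrightarrow> v2 x - interp_slope_lim 2)"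
proof -
  have *: "\<exists>\<rho>. strict_mono \<rho> \<and> (AE x in lborel. x \<in> open_triangle a b c \<longrightarrow> (\<lambda>n. g (\<rho> n) x - interp_slope i (\<rho> n)) \<longlonglongrightarrow> v' x - interp_slope_lim i)"
    if ex: "\<exists>\<rho>. strict_mono \<rho> \<and> (AE x in lborel. x \<in> open_triangle a b c \<longrightarrow> (\<lambda>n. g (\<rho> n) x) \<longlonglongrightarrow> v' x)" for g :: "nat \<Rightarrow> real^2 \<Rightarrow> real" and v' i
  proof -
    obtain \<rho> :: "nat \<Rightarrow> nat" where \<rho>: "strict_mono \<rho>" "AE x in lborel. x \<in> open_triangle a b c \<longrightarrow> (\<lambda>n. g (\<rho> n) x) \<longlonglongrightarrow> v' x"
      using ex by blast
    have "(\<lambda>n. interp_slope i (\<rho> n)) \<longlonglongrightarrow> interp_slope_lim i" using LIMSEQ_subseq_LIMSEQ[OF interp_slope_tendsto \<rho>(1)] by (simp add: o_def)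
    with \<rho>(2) have "AE x in lborel. x \<in> open_triangle a b c \<longrightarrow> (\<lambda>n. g (\<rho> n) x - interp_slope i (\<rho> n)) \<longlonglongrightarrow> v' x - interp_slope_lim i"
      by (auto elim!: eventually_mono intro!: tendsto_diff)
    then show ?thesis using \<rho>(1) by blast
  qed
  show "\<exists>\<rho>. strict_mono \<rho> \<and> (AE x in lborel. x \<in> open_triangle a b c \<longrightarrow> (\<lambda>n. f1 (\<rho> n) x - interp_slope 1 (\<rho> n)) \<longlonglongrightarrow> v1 x - interp_slope_lim 1)"
    by (rule *[OF triangle_integral_AE_subseq[OF approximants_measurable(2) limits_measurable(2) lim(2) fin(2)]])
  show "\<exists>\<rho>. strict_mono \<rho> \<and> (AE x in lborel. x \<in> open_triangle a b c \<longrightarrow> (\<lambda>n. f2 (\<rho> n) x - interp_slope 2 (\<rho> n)) \<longlonglongrightarrow> v2 x - interp_slope_lim 2)"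
    by (rule *[OF triangle_integral_AE_subseq[OF approximants_measurable(3) limits_measurable(3) lim(3) fin(3)]])
qed

text \<open>
  The estimates for smooth functions are applied to the approximations minus their own
  interpolants, and Fatou's lemma passes to the limit. For the function itself the longest side
  is replaced by \<open>2 * R\<close>, whence \<open>333 * (2 * R)\<^sup>2 = 1332 *
  R\<^sup>2\<close>.
\<close>

lemma limit_estimates_Lq:
  assumes q: "1 \<le> q" and W: "\<And>n. T (\<lambda>x. hess (f11 n) (f12 n) (f22 n) x powr q) \<le> W"
    and R: "R = circumradius a b c"
  shows "T (\<lambda>x. \<bar>v1 x - interp_slope_lim 1\<bar> powr q) \<le> ennreal ((144 * R) powr q) * W"
    "T (\<lambda>x. \<bar>v2 x - interp_slope_lim 2\<bar> powr q) \<le> ennreal ((144 * R) powr q) * W"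
    "T (\<lambda>x. \<bar>v x - interp_lim x\<bar> powr q) \<le> ennreal ((1332 * R^2) powr q) * W"
proof -
  note S = circumradius_sides[OF det, folded R]
  have le: "ennreal k * T (\<lambda>x. hess (f11 n) (f12 n) (f22 n) x powr q) \<le> ennreal k * W" for k n
    by (intro mult_left_mono W) simp
  obtain \<rho> where \<rho>: "strict_mono \<rho>" "AE x in lborel. x \<in> open_triangle a b c \<longrightarrow> (\<lambda>n. f1 (\<rho> n) x - interp_slope 1 (\<rho> n)) \<longlonglongrightarrow> v1 x - interp_slope_lim 1"
    using gradient_limit(1) by blast
  show "T (\<lambda>x. \<bar>v1 x - interp_slope_lim 1\<bar> powr q) \<le> ennreal ((144 * R) powr q) * W"
    by (rule fatou_power[OF error_measurable(2) \<rho>(2) _ q], rule order_trans[OF gradient_estimates(1)[OF C2_error det S(1) error_vanishes disjI1[OF refl] q] le])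
  obtain \<rho>' where \<rho>': "strict_mono \<rho>'" "AE x in lborel. x \<in> open_triangle a b c \<longrightarrow> (\<lambda>n. f2 (\<rho>' n) x - interp_slope 2 (\<rho>' n)) \<longlonglongrightarrow> v2 x - interp_slope_lim 2"
    using gradient_limit(2) by blast
  show "T (\<lambda>x. \<bar>v2 x - interp_slope_lim 2\<bar> powr q) \<le> ennreal ((144 * R) powr q) * W"
    by (rule fatou_power[OF error_measurable(3) \<rho>'(2) _ q], rule order_trans[OF gradient_estimates(1)[OF C2_error det S(1) error_vanishes disjI2[OF refl] q] le])
  have "T (\<lambda>x. \<bar>v x - interp_lim x\<bar> powr q) \<le> ennreal ((333 * (2 * R)^2) powr q) * W"
    by (rule fatou_power[OF error_measurable(1) error_limit _ q], rule order_trans[OF function_estimates(1)[OF C2_error det S(2-4) error_vanishes q] le])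
  then show "T (\<lambda>x. \<bar>v x - interp_lim x\<bar> powr q) \<le> ennreal ((1332 * R^2) powr q) * W"
    by (simp add: power_mult_distrib)
qed

lemma AE_le_of_limit:
  assumes lim: "AE x in lborel. x \<in> open_triangle a b c \<longrightarrow> (\<lambda>n. g n x) \<longlonglongrightarrow> g' x"
    and le: "\<And>n x. x \<in> tri \<Longrightarrow> \<bar>g n x\<bar> \<le> (k::real)"
  shows "AE x in lborel. x \<in> open_triangle a b c \<longrightarrow> \<bar>g' x\<bar> \<le> k"
  using lim
proof eventually_elim
  case (elim x)
  show ?case
  proof
    assume x: "x \<in> open_triangle a b c"
    then have "(\<lambda>n. \<bar>g n x\<bar>) \<longlonglongrightarrow> \<bar>g' x\<bar>" using elim by (intro tendsto_rabs) auto
    then show "\<bar>g' x\<bar> \<le> k" using le x open_subset_tri by (intro LIMSEQ_le_const2) blast+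
  qed
qed

lemma limit_estimates_sup:
  assumes B: "\<And>n x. x \<in> tri \<Longrightarrow> hess (f11 n) (f12 n) (f22 n) x \<le> B" and R: "R = circumradius a b c"
  shows "AE x in lborel. x \<in> open_triangle a b c \<longrightarrow> \<bar>v1 x - interp_slope_lim 1\<bar> \<le> 24 * R * B"
    "AE x in lborel. x \<in> open_triangle a b c \<longrightarrow> \<bar>v2 x - interp_slope_lim 2\<bar> \<le> 24 * R * B"
    "AE x in lborel. x \<in> open_triangle a b c \<longrightarrow> \<bar>v x - interp_lim x\<bar> \<le> 444 * R^2 * B"
proof -
  note S = circumradius_sides[OF det, folded R]
  obtain \<rho> where \<rho>: "strict_mono \<rho>" "AE x in lborel. x \<in> open_triangle a b c \<longrightarrow> (\<lambda>n. f1 (\<rho> n) x - interp_slope 1 (\<rho> n)) \<longlonglongrightarrow> v1 x - interp_slope_lim 1"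
    using gradient_limit(1) by blast
  show "AE x in lborel. x \<in> open_triangle a b c \<longrightarrow> \<bar>v1 x - interp_slope_lim 1\<bar> \<le> 24 * R * B"
    by (rule AE_le_of_limit[OF \<rho>(2)], rule gradient_estimates(2)[OF C2_error det S(1) error_vanishes disjI1[OF refl] B])
  obtain \<rho>' where \<rho>': "strict_mono \<rho>'" "AE x in lborel. x \<in> open_triangle a b c \<longrightarrow> (\<lambda>n. f2 (\<rho>' n) x - interp_slope 2 (\<rho>' n)) \<longlonglongrightarrow> v2 x - interp_slope_lim 2"
    using gradient_limit(2) by blast
  show "AE x in lborel. x \<in> open_triangle a b c \<longrightarrow> \<bar>v2 x - interp_slope_lim 2\<bar> \<le> 24 * R * B"
    by (rule AE_le_of_limit[OF \<rho>'(2)], rule gradient_estimates(2)[OF C2_error det S(1) error_vanishes disjI2[OF refl] B])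
  have "AE x in lborel. x \<in> open_triangle a b c \<longrightarrow> \<bar>v x - interp_lim x\<bar> \<le> 111 * (2 * R)^2 * B"
    by (rule AE_le_of_limit[OF error_limit], rule function_estimates(2)[OF C2_error det S(2-4) error_vanishes B])
  then show "AE x in lborel. x \<in> open_triangle a b c \<longrightarrow> \<bar>v x - interp_lim x\<bar> \<le> 444 * R^2 * B"
    by (simp add: power_mult_distrib)
qed

end

end

section \<open>Existence of smooth approximations\<close>

text \<open>
  The factor \<open>\<kappa>\<close> stands for the powers of \<open>\<theta>\<close> that the
  chain rule for the contraction puts in front of derivatives.
\<close>

lemma scaled_mollify_tendsto:
  fixes c :: "nat \<Rightarrow> real^2" and v :: "real^2 \<Rightarrow> real"
  assumes v: "integrable lborel v" and K: "bounded (open_triangle x1 x2 x3)"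
    and c: "c \<longlonglongrightarrow> 0" and \<theta>: "\<theta> \<longlonglongrightarrow> 1" and \<delta>: "\<delta> \<longlonglongrightarrow> 0"
    and \<delta>0: "\<And>n. 0 < \<delta> n" and \<theta>2: "\<And>n. 1/2 \<le> \<theta> n"
    and \<kappa>: "\<kappa> \<longlonglongrightarrow> 1" "\<And>n. 0 \<le> \<kappa> n" "\<And>n. \<kappa> n \<le> 1"
    and g: "\<And>n x. x \<in> open_triangle x1 x2 x3 \<Longrightarrow> g n x = \<kappa> n * mollify (\<delta> n) 0 0 v (c n + \<theta> n *\<^sub>R x)"
  shows "(\<lambda>n. triangle_integral x1 x2 x3 (\<lambda>x. \<bar>g n x - v x\<bar>)) \<longlonglongrightarrow> 0"
    and "triangle_integral x1 x2 x3 (\<lambda>x. \<bar>g n x - v x\<bar>) < \<infinity>"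
proof -
  let ?K = "open_triangle x1 x2 x3"
  let ?T = "triangle_integral x1 x2 x3"
  let ?F = "\<lambda>n x. mollify (\<delta> n) 0 0 v (c n + \<theta> n *\<^sub>R x)"
  have [measurable]: "v \<in> borel_measurable borel" using v by auto
  have [measurable]: "mollify (\<delta> n) 0 0 v \<in> borel_measurable borel" for n by (rule mollify_measurable[OF \<delta>0 v])
  have fin: "(\<integral>\<^sup>+x. ennreal \<bar>v x\<bar> \<partial>lborel) < \<infinity>" using v by (simp add: integrable_iff_bounded)
  define m where "m = enn2real (\<integral>\<^sup>+x. ennreal \<bar>v x\<bar> \<partial>lborel)"
  have m: "(\<integral>\<^sup>+x. ennreal \<bar>v x\<bar> \<partial>lborel) = ennreal m" "0 \<le> m" using fin by (auto simp: m_def)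
  have Tv: "?T (\<lambda>x. \<bar>v x\<bar>) \<le> ennreal m"
    unfolding m(1)[symmetric] triangle_integral_def by (intro nn_integral_mono) (auto split: split_indicator)
  define G where "G n = (\<integral>\<^sup>+x. ennreal \<bar>?F n x - v x\<bar> * indicator ?K x \<partial>lborel)" for n
  have G0: "G \<longlonglongrightarrow> 0" unfolding G_def by (rule mollify_tendsto_L1[OF v open_triangle_sets K c \<theta> \<delta> \<delta>0 \<theta>2])
  have le: "?T (\<lambda>x. \<bar>g n x - v x\<bar>) \<le> G n + ennreal ((1 - \<kappa> n) * m)" for n
  proof -
    have "?T (\<lambda>x. \<bar>g n x - v x\<bar>) \<le> ?T (\<lambda>x. \<bar>?F n x - v x\<bar> + (1 - \<kappa> n) * \<bar>v x\<bar>)"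
    proof (rule triangle_integral_mono)
      fix x assume x: "x \<in> ?K"
      have "g n x - v x = \<kappa> n * (?F n x - v x) + (1 - \<kappa> n) * (- v x)" unfolding g[OF x] by (simp add: algebra_simps)
      also have "\<bar>\<dots>\<bar> \<le> \<bar>\<kappa> n\<bar> * \<bar>?F n x - v x\<bar> + \<bar>1 - \<kappa> n\<bar> * \<bar>- v x\<bar>" by (rule abs_dot_le)
      also have "\<dots> \<le> \<bar>?F n x - v x\<bar> + (1 - \<kappa> n) * \<bar>v x\<bar>"
        using \<kappa>(2,3)[of n] mult_right_mono[of "\<kappa> n" 1 "\<bar>?F n x - v x\<bar>"] by simp
      finally show "\<bar>g n x - v x\<bar> \<le> \<bar>?F n x - v x\<bar> + (1 - \<kappa> n) * \<bar>v x\<bar>" .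
    qed
    also have "\<dots> = ?T (\<lambda>x. \<bar>?F n x - v x\<bar>) + ?T (\<lambda>x. (1 - \<kappa> n) * \<bar>v x\<bar>)"
      using \<kappa>(3)[of n] by (intro triangle_integral_add) auto
    also have "?T (\<lambda>x. (1 - \<kappa> n) * \<bar>v x\<bar>) = ennreal (1 - \<kappa> n) * ?T (\<lambda>x. \<bar>v x\<bar>)"
      using \<kappa>(3)[of n] by (intro triangle_integral_cmult) auto
    also have "?T (\<lambda>x. \<bar>?F n x - v x\<bar>) + ennreal (1 - \<kappa> n) * ?T (\<lambda>x. \<bar>v x\<bar>) \<le> G n + ennreal (1 - \<kappa> n) * ennreal m"
      unfolding G_def triangle_integral_def[of _ _ _ "\<lambda>x. \<bar>?F n x - v x\<bar>"] by (intro add_left_mono mult_left_mono Tv) simp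
    also have "\<dots> = G n + ennreal ((1 - \<kappa> n) * m)" using \<kappa>(3)[of n] m by (simp add: ennreal_mult)
    finally show ?thesis .
  qed
  have "(\<lambda>n. G n + ennreal ((1 - \<kappa> n) * m)) \<longlonglongrightarrow> 0 + ennreal ((1 - 1) * m)"
    by (intro tendsto_add G0 tendsto_ennrealI tendsto_mult tendsto_diff tendsto_const \<kappa>)
  then have "(\<lambda>n. G n + ennreal ((1 - \<kappa> n) * m)) \<longlonglongrightarrow> 0" by simp
  then show "(\<lambda>n. ?T (\<lambda>x. \<bar>g n x - v x\<bar>)) \<longlonglongrightarrow> 0"
    by (rule tendsto_sandwich[OF _ _ tendsto_const, rotated 2]) (auto intro: always_eventually le)
  have "G n < \<infinity>"
  proof -
    have \<theta>n: "0 < \<theta> n" using \<theta>2[of n] by simp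
    have "ennreal ((\<theta> n)^2) * (\<integral>\<^sup>+x. ennreal \<bar>?F n x\<bar> \<partial>lborel) \<le> ennreal m"
      using nn_integral_mollify_power_le[OF \<delta>0 \<theta>n v order_refl, of n "c n"] m by simp
    then have "ennreal ((\<theta> n)^2) * (\<integral>\<^sup>+x. ennreal \<bar>?F n x\<bar> \<partial>lborel) < \<infinity>" by (rule order.strict_trans1) simp
    then have F: "(\<integral>\<^sup>+x. ennreal \<bar>?F n x\<bar> \<partial>lborel) < \<infinity>" using \<theta>n by (auto simp: ennreal_mult_less_top)
    have "G n \<le> (\<integral>\<^sup>+x. ennreal \<bar>?F n x\<bar> + ennreal \<bar>v x\<bar> \<partial>lborel)"
      unfolding G_def
    proof (rule nn_integral_mono)
      fix x
      have "ennreal \<bar>?F n x - v x\<bar> \<le> ennreal (\<bar>?F n x\<bar> + \<bar>v x\<bar>)" by (intro ennreal_leI) simp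
      then show "ennreal \<bar>?F n x - v x\<bar> * indicator ?K x \<le> ennreal \<bar>?F n x\<bar> + ennreal \<bar>v x\<bar>"
        by (auto split: split_indicator)
    qed
    also have "\<dots> = (\<integral>\<^sup>+x. ennreal \<bar>?F n x\<bar> \<partial>lborel) + (\<integral>\<^sup>+x. ennreal \<bar>v x\<bar> \<partial>lborel)"
      by (rule nn_integral_add) auto
    also have "\<dots> < \<infinity>" using F fin by simp
    finally show ?thesis .
  qed
  then have "G n + ennreal ((1 - \<kappa> n) * m) < \<infinity>" by simp
  then show "?T (\<lambda>x. \<bar>g n x - v x\<bar>) < \<infinity>" using le[of n] by (rule order.strict_trans1[rotated])
qed

text \<open>
  Undoing the contraction in the integral costs \<open>\<theta>\<^sup>-\<^sup>2\<close>. The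
  factor \<open>\<theta>\<^sup>2\<close> in front of second derivatives compensates this, since
  \<open>\<theta>\<^sup>2\<^sup>q \<le> \<theta>\<^sup>2\<close>.
\<close>

lemma scaled_mollify_power_le:
  assumes v: "integrable lborel v" and \<delta>: "0 < \<delta>" and \<theta>: "0 < \<theta>" "\<theta> \<le> 1" and q: "1 \<le> q"
    and g: "\<And>x. x \<in> open_triangle x1 x2 x3 \<Longrightarrow> g x = \<theta>^2 * mollify \<delta> 0 0 v (c + \<theta> *\<^sub>R x)"
  shows "triangle_integral x1 x2 x3 (\<lambda>x. \<bar>g x\<bar> powr q) \<le> (\<integral>\<^sup>+x. ennreal (\<bar>v x\<bar> powr q) \<partial>lborel)"
proof -
  let ?F = "\<lambda>x. mollify \<delta> 0 0 v (c + \<theta> *\<^sub>R x)"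
  have [measurable]: "mollify \<delta> 0 0 v \<in> borel_measurable borel" by (rule mollify_measurable[OF \<delta> v])
  have "\<theta>^2 \<le> 1" using \<theta> by (simp add: power_le_one)
  then have \<theta>q: "(\<theta>^2) powr q \<le> \<theta>^2" using powr_mono'[OF q, of "\<theta>^2"] \<theta> by simp
  have "triangle_integral x1 x2 x3 (\<lambda>x. \<bar>g x\<bar> powr q) \<le> (\<integral>\<^sup>+x. ennreal (\<theta>^2) * ennreal (\<bar>?F x\<bar> powr q) \<partial>lborel)"
    unfolding triangle_integral_def
  proof (rule nn_integral_mono)
    fix x
    show "ennreal (\<bar>g x\<bar> powr q) * indicator (open_triangle x1 x2 x3) x \<le> ennreal (\<theta>^2) * ennreal (\<bar>?F x\<bar> powr q)"
    proof (cases "x \<in> open_triangle x1 x2 x3")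
      case True
      have "\<bar>g x\<bar> powr q = (\<theta>^2) powr q * \<bar>?F x\<bar> powr q" unfolding g[OF True] by (simp add: abs_mult powr_mult)
      also have "\<dots> \<le> \<theta>^2 * \<bar>?F x\<bar> powr q" using \<theta>q by (intro mult_right_mono) auto
      finally have "ennreal (\<bar>g x\<bar> powr q) \<le> ennreal (\<theta>^2 * \<bar>?F x\<bar> powr q)" by (rule ennreal_leI)
      then show ?thesis using True by (simp add: ennreal_mult)
    qed simp
  qed
  also have "\<dots> = ennreal (\<theta>^2) * (\<integral>\<^sup>+x. ennreal (\<bar>?F x\<bar> powr q) \<partial>lborel)" by (rule nn_integral_cmult) measurable
  also have "\<dots> \<le> (\<integral>\<^sup>+x. ennreal (\<bar>v x\<bar> powr q) \<partial>lborel)" by (rule nn_integral_mollify_power_le[OF \<delta> \<theta>(1) v q])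
  finally show ?thesis .
qed

lemma bounded_open_triangle: "bounded (open_triangle a b c)"
  unfolding open_triangle_def by (rule bounded_subset[OF compact_imp_bounded[OF compact_triangle] interior_subset])

lemma open_triangle_nonempty:
  assumes "det2 (b - a) (c - a) \<noteq> 0" shows "open_triangle a b c \<noteq> {}"
proof
  assume "open_triangle a b c = {}"
  moreover obtain k where "0 < k" "emeasure lborel (open_triangle a b c) = ennreal k" using emeasure_open_triangle[OF assms] by blast
  ultimately show False by simp
qed

text \<open>
  The approximations are \<open>v\<close> contracted towards an interior point \<open>z\<close>
  and mollified at a scale proportional to \<open>1 - \<theta>\<close>. Then at every point of
  the closed triangle the kernel is a test function, so the derivatives of the approximations
  are, up to powers of \<open>\<theta>\<close>, mollified weak derivatives; those of second
  order inherit the \<open>L\<^sup>q\<close> and sup bounds of the weak derivatives.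
\<close>

lemma smooth_approximation_exists:
  assumes det: "det2 (b - a) (c - a) \<noteq> 0"
    and v: "integrable lborel v" "integrable lborel v1" "integrable lborel v2" "integrable lborel v11" "integrable lborel v12" "integrable lborel v22"
    and W: "\<And>\<delta> y. 0 < \<delta> \<Longrightarrow> cbox (y - vec \<delta>) (y + vec \<delta>) \<subseteq> open_triangle a b c \<Longrightarrow>
      mollify \<delta> 1 0 v y = - mollify \<delta> 0 0 v1 y \<and> mollify \<delta> 0 1 v y = - mollify \<delta> 0 0 v2 y \<and>
      mollify \<delta> 2 0 v y = mollify \<delta> 0 0 v11 y \<and> mollify \<delta> 1 1 v y = mollify \<delta> 0 0 v12 y \<and> mollify \<delta> 0 2 v y = mollify \<delta> 0 0 v22 y"
  obtains f f1 f2 f11 f12 f22 where "smooth_approximation a b c f f1 f2 f11 f12 f22 v v1 v2 v11 v12 v22"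
    "\<And>q n. 1 \<le> q \<Longrightarrow> triangle_integral a b c (\<lambda>x. \<bar>f11 n x\<bar> powr q) \<le> (\<integral>\<^sup>+x. ennreal (\<bar>v11 x\<bar> powr q) \<partial>lborel)"
    "\<And>q n. 1 \<le> q \<Longrightarrow> triangle_integral a b c (\<lambda>x. \<bar>f12 n x\<bar> powr q) \<le> (\<integral>\<^sup>+x. ennreal (\<bar>v12 x\<bar> powr q) \<partial>lborel)"
    "\<And>q n. 1 \<le> q \<Longrightarrow> triangle_integral a b c (\<lambda>x. \<bar>f22 n x\<bar> powr q) \<le> (\<integral>\<^sup>+x. ennreal (\<bar>v22 x\<bar> powr q) \<partial>lborel)"
    "\<And>n x B. x \<in> convex hull {a, b, c} \<Longrightarrow> AE z in lborel. \<bar>v11 z\<bar> \<le> B \<Longrightarrow> \<bar>f11 n x\<bar> \<le> B"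
    "\<And>n x B. x \<in> convex hull {a, b, c} \<Longrightarrow> AE z in lborel. \<bar>v12 z\<bar> \<le> B \<Longrightarrow> \<bar>f12 n x\<bar> \<le> B"
    "\<And>n x B. x \<in> convex hull {a, b, c} \<Longrightarrow> AE z in lborel. \<bar>v22 z\<bar> \<le> B \<Longrightarrow> \<bar>f22 n x\<bar> \<le> B"
proof -
  let ?K = "open_triangle a b c"
  have "open ?K" by (simp add: open_triangle_def)
  then obtain z r where r: "0 < r" "cbox (z - vec r) (z + vec r) \<subseteq> ?K"
    using cbox_inside_open open_triangle_nonempty[OF det] by metis
  \<comment> \<open>starting at 1 / 2 keeps \<theta> away from 0\<close>
  define h where "h n = 1 / real (Suc (Suc n))" for n
  have h: "0 < h n" "h n \<le> 1/2" for n by (auto simp: h_def field_simps)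
  have h0: "h \<longlonglongrightarrow> 0" unfolding h_def by (rule LIMSEQ_Suc[OF LIMSEQ_Suc[OF lim_1_over_n]])
  define \<theta> where "\<theta> n = 1 - h n" for n
  define \<delta> where "\<delta> n = r * (1 - \<theta> n)" for n
  define s where "s n = (1 - \<theta> n) *\<^sub>R z" for n
  have \<delta>0: "0 < \<delta> n" for n using r h by (simp add: \<delta>_def \<theta>_def)
  have \<theta>: "1/2 \<le> \<theta> n" "\<theta> n \<le> 1" "0 < \<theta> n" "\<theta> n < 1" for n using h[of n] by (auto simp: \<theta>_def)
  have \<theta>1: "\<theta> \<longlonglongrightarrow> 1" using tendsto_diff[OF tendsto_const h0, of 1] by (simp add: \<theta>_def[abs_def])
  have \<delta>l: "\<delta> \<longlonglongrightarrow> 0" using tendsto_mult_right_zero[OF h0, of r] by (simp add: \<delta>_def[abs_def] \<theta>_def)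
  have sl: "s \<longlonglongrightarrow> 0" using tendsto_scaleR[OF h0 tendsto_const, of z] by (simp add: s_def[abs_def] \<theta>_def)
  define y where "y n x = s n + \<theta> n *\<^sub>R x" for n x
  have sub: "cbox (y n x - vec (\<delta> n)) (y n x + vec (\<delta> n)) \<subseteq> ?K" if "x \<in> convex hull {a, b, c}" for x n
    unfolding y_def s_def \<delta>_def open_triangle_def
    by (rule shrink_into_interior[OF convex_convex_hull])
       (use r that \<theta>(3,4)[of n] in \<open>auto simp: open_triangle_def less_imp_le intro: subsetD[OF closure_subset]\<close>)
  define f where "f n x = mollify (\<delta> n) 0 0 v (s n + \<theta> n *\<^sub>R x)" for n x
  define f1 where "f1 n x = - \<theta> n * mollify (\<delta> n) 1 0 v (s n + \<theta> n *\<^sub>R x)" for n x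
  define f2 where "f2 n x = - \<theta> n * mollify (\<delta> n) 0 1 v (s n + \<theta> n *\<^sub>R x)" for n x
  define f11 where "f11 n x = (\<theta> n)^2 * mollify (\<delta> n) 2 0 v (s n + \<theta> n *\<^sub>R x)" for n x
  define f12 where "f12 n x = (\<theta> n)^2 * mollify (\<delta> n) 1 1 v (s n + \<theta> n *\<^sub>R x)" for n x
  define f22 where "f22 n x = (\<theta> n)^2 * mollify (\<delta> n) 0 2 v (s n + \<theta> n *\<^sub>R x)" for n x
  have eq: "f n x = 1 * mollify (\<delta> n) 0 0 v (s n + \<theta> n *\<^sub>R x)"
    "f1 n x = \<theta> n * mollify (\<delta> n) 0 0 v1 (s n + \<theta> n *\<^sub>R x)" "f2 n x = \<theta> n * mollify (\<delta> n) 0 0 v2 (s n + \<theta> n *\<^sub>R x)"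
    "f11 n x = (\<theta> n)^2 * mollify (\<delta> n) 0 0 v11 (s n + \<theta> n *\<^sub>R x)" "f12 n x = (\<theta> n)^2 * mollify (\<delta> n) 0 0 v12 (s n + \<theta> n *\<^sub>R x)"
    "f22 n x = (\<theta> n)^2 * mollify (\<delta> n) 0 0 v22 (s n + \<theta> n *\<^sub>R x)" if "x \<in> convex hull {a, b, c}" for n x
    using W[OF \<delta>0 sub[OF that, unfolded y_def]] by (simp_all add: f_def f1_def f2_def f11_def f12_def f22_def)
  have K: "x \<in> ?K \<Longrightarrow> x \<in> convex hull {a, b, c}" for x using interior_subset unfolding open_triangle_def by blast
  have \<theta>sq: "(\<lambda>n. (\<theta> n)^2) \<longlonglongrightarrow> 1" "0 \<le> (\<theta> n)^2" "(\<theta> n)^2 \<le> 1" for n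
    using tendsto_power[OF \<theta>1, of 2] \<theta>[of n] by (auto simp: power_le_one)
  have \<theta>0: "0 \<le> \<theta> n" for n using \<theta>(3)[of n] by simp
  note tend = scaled_mollify_tendsto[OF _ bounded_open_triangle sl \<theta>1 \<delta>l \<delta>0 \<theta>(1)]
  note t0 = tend[OF v(1) tendsto_const zero_le_one order_refl eq(1)[OF K]]
  note t1 = tend[OF v(2) \<theta>1 \<theta>0 \<theta>(2) eq(2)[OF K]]
  note t2 = tend[OF v(3) \<theta>1 \<theta>0 \<theta>(2) eq(3)[OF K]]
  note t11 = tend[OF v(4) \<theta>sq eq(4)[OF K]]
  note t12 = tend[OF v(5) \<theta>sq eq(5)[OF K]]
  note t22 = tend[OF v(6) \<theta>sq eq(6)[OF K]]
  have approx: "smooth_approximation a b c f f1 f2 f11 f12 f22 v v1 v2 v11 v12 v22"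
  proof
    show "C2_plane (f n) (f1 n) (f2 n) (f11 n) (f12 n) (f22 n)" for n
      unfolding f_def[abs_def] f1_def[abs_def] f2_def[abs_def] f11_def[abs_def] f12_def[abs_def] f22_def[abs_def]
      by (rule mollify_C2_plane[OF \<delta>0 v(1)])
    show "(\<lambda>n. triangle_integral a b c (\<lambda>x. \<bar>f n x - v x\<bar>)) \<longlonglongrightarrow> 0"
      "(\<lambda>n. triangle_integral a b c (\<lambda>x. \<bar>f1 n x - v1 x\<bar>)) \<longlonglongrightarrow> 0"
      "(\<lambda>n. triangle_integral a b c (\<lambda>x. \<bar>f2 n x - v2 x\<bar>)) \<longlonglongrightarrow> 0"
      "(\<lambda>n. triangle_integral a b c (\<lambda>x. \<bar>f11 n x - v11 x\<bar>)) \<longlonglongrightarrow> 0"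
      "(\<lambda>n. triangle_integral a b c (\<lambda>x. \<bar>f12 n x - v12 x\<bar>)) \<longlonglongrightarrow> 0"
      "(\<lambda>n. triangle_integral a b c (\<lambda>x. \<bar>f22 n x - v22 x\<bar>)) \<longlonglongrightarrow> 0"
      by (rule t0(1) t1(1) t2(1) t11(1) t12(1) t22(1); assumption)+
    show "triangle_integral a b c (\<lambda>x. \<bar>f n x - v x\<bar>) < \<infinity>"
      "triangle_integral a b c (\<lambda>x. \<bar>f1 n x - v1 x\<bar>) < \<infinity>"
      "triangle_integral a b c (\<lambda>x. \<bar>f2 n x - v2 x\<bar>) < \<infinity>" for n
      by (rule t0(2) t1(2) t2(2); assumption)+
  qed (use det v in auto)
  have sup: "\<bar>(\<theta> n)^2 * mollify (\<delta> n) 0 0 u (s n + \<theta> n *\<^sub>R x)\<bar> \<le> B"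
    if u: "integrable lborel u" "AE z in lborel. \<bar>u z\<bar> \<le> B" for u B n x
  proof -
    have "\<bar>(\<theta> n)^2 * mollify (\<delta> n) 0 0 u (s n + \<theta> n *\<^sub>R x)\<bar> \<le> 1 * \<bar>mollify (\<delta> n) 0 0 u (s n + \<theta> n *\<^sub>R x)\<bar>"
      unfolding abs_mult using \<theta>sq(2,3)[of n] by (intro mult_right_mono) auto
    then show ?thesis using mollify_le_sup[OF \<delta>0 u, of n "s n + \<theta> n *\<^sub>R x"] by simp
  qed
  show thesis
  proof (rule that[OF approx])
    fix q :: real and n assume q: "1 \<le> q"
    note p = scaled_mollify_power_le[OF _ \<delta>0 \<theta>(3,2) q]
    show "triangle_integral a b c (\<lambda>x. \<bar>f11 n x\<bar> powr q) \<le> (\<integral>\<^sup>+x. ennreal (\<bar>v11 x\<bar> powr q) \<partial>lborel)"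
      "triangle_integral a b c (\<lambda>x. \<bar>f12 n x\<bar> powr q) \<le> (\<integral>\<^sup>+x. ennreal (\<bar>v12 x\<bar> powr q) \<partial>lborel)"
      "triangle_integral a b c (\<lambda>x. \<bar>f22 n x\<bar> powr q) \<le> (\<integral>\<^sup>+x. ennreal (\<bar>v22 x\<bar> powr q) \<partial>lborel)"
      by (rule p[OF v(4) eq(4)[OF K]] p[OF v(5) eq(5)[OF K]] p[OF v(6) eq(6)[OF K]]; assumption)+
  next
    fix n x B assume x: "x \<in> convex hull {a, b, c}"
    show "\<bar>f11 n x\<bar> \<le> B" if "AE z in lborel. \<bar>v11 z\<bar> \<le> B" unfolding eq(4)[OF x] by (rule sup[OF v(4) that])
    show "\<bar>f12 n x\<bar> \<le> B" if "AE z in lborel. \<bar>v12 z\<bar> \<le> B" unfolding eq(5)[OF x] by (rule sup[OF v(5) that])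
    show "\<bar>f22 n x\<bar> \<le> B" if "AE z in lborel. \<bar>v22 z\<bar> \<le> B" unfolding eq(6)[OF x] by (rule sup[OF v(6) that])
  qed
qed

section \<open>Norms and the continuous representative\<close>

lemma AE_lebesgue_on_iff:
  "\<Omega> \<in> sets borel \<Longrightarrow> (AE x in lebesgue_on \<Omega>. P x) \<longleftrightarrow> (AE x in lebesgue. x \<in> \<Omega> \<longrightarrow> P x)"
  by (subst AE_restrict_space_iff) auto

lemma measurable_lebesgue_on_AE:
  fixes f g :: "real^2 \<Rightarrow> real"
  assumes \<Omega>: "\<Omega> \<in> sets borel" and g: "g \<in> borel_measurable borel" and ae: "AE x in lebesgue. x \<in> \<Omega> \<longrightarrow> f x = g x"
  shows "f \<in> borel_measurable (lebesgue_on \<Omega>)"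
proof -
  have 1: "(\<lambda>x. indicator \<Omega> x *\<^sub>R g x) \<in> borel_measurable lebesgue"
    using g \<Omega> by (intro measurable_completion) simp
  have "(\<lambda>x. indicator \<Omega> x *\<^sub>R f x) \<in> borel_measurable lebesgue"
  proof (rule borel_measurable_AE[OF 1])
    show "AE x in lebesgue. indicator \<Omega> x *\<^sub>R g x = indicator \<Omega> x *\<^sub>R f x"
      using ae by eventually_elim (auto split: split_indicator)
  qed
  then show ?thesis using \<Omega> by (subst borel_measurable_restrict_space_iff) auto
qed

lemma Lp_norm_finite_eq:
  assumes p: "p \<noteq> \<infinity>" and g: "g \<in> borel_measurable borel"
    and ae: "AE x in lebesgue. x \<in> open_triangle a b c \<longrightarrow> f x = g x"
  shows "Lp_norm p (open_triangle a b c) f = (enn2real (triangle_integral a b c (\<lambda>x. \<bar>g x\<bar> powr enn2real p))) powr (1 / enn2real p)"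
proof -
  let ?K = "open_triangle a b c"
  have m: "f \<in> borel_measurable (lebesgue_on ?K)" by (rule measurable_lebesgue_on_AE[OF open_triangle_sets g ae])
  have gm [measurable]: "g \<in> borel_measurable borel" by (rule g)
  have "(\<integral>\<^sup>+x. ennreal (\<bar>f x\<bar> powr enn2real p) \<partial>lebesgue_on ?K) = (\<integral>\<^sup>+x. ennreal (\<bar>f x\<bar> powr enn2real p) * indicator ?K x \<partial>lebesgue)"
    by (rule nn_integral_restrict_space) simp
  also have "\<dots> = (\<integral>\<^sup>+x. ennreal (\<bar>g x\<bar> powr enn2real p) * indicator ?K x \<partial>lebesgue)"
  proof (rule nn_integral_cong_AE)
    show "AE x in lebesgue. ennreal (\<bar>f x\<bar> powr enn2real p) * indicator ?K x = ennreal (\<bar>g x\<bar> powr enn2real p) * indicator ?K x"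
      using ae by eventually_elim (auto split: split_indicator)
  qed
  also have "\<dots> = triangle_integral a b c (\<lambda>x. \<bar>g x\<bar> powr enn2real p)"
    unfolding triangle_integral_def by (rule nn_integral_completion)
  finally have "(\<integral>x. \<bar>f x\<bar> powr enn2real p \<partial>lebesgue_on ?K) = enn2real (triangle_integral a b c (\<lambda>x. \<bar>g x\<bar> powr enn2real p))"
    using m by (subst integral_eq_nn_integral) auto
  then show ?thesis using p by (simp add: Lp_norm_def)
qed

lemma Lp_norm_finite_le:
  assumes p: "p \<noteq> \<infinity>" "1 \<le> enn2real p" and g: "g \<in> borel_measurable borel"
    and ae: "AE x in lebesgue. x \<in> open_triangle a b c \<longrightarrow> f x = g x"
    and le: "triangle_integral a b c (\<lambda>x. \<bar>g x\<bar> powr enn2real p) \<le> ennreal (k powr enn2real p)" and k: "0 \<le> k"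
  shows "0 \<le> Lp_norm p (open_triangle a b c) f" "Lp_norm p (open_triangle a b c) f \<le> k"
proof -
  let ?q = "enn2real p"
  have "enn2real (triangle_integral a b c (\<lambda>x. \<bar>g x\<bar> powr ?q)) \<le> k powr ?q"
    using enn2real_mono[OF le] by simp
  then have "(enn2real (triangle_integral a b c (\<lambda>x. \<bar>g x\<bar> powr ?q))) powr (1 / ?q) \<le> (k powr ?q) powr (1 / ?q)"
    using p by (intro powr_mono2) auto
  also have "\<dots> = k" using p k by (simp add: powr_powr)
  finally show "Lp_norm p (open_triangle a b c) f \<le> k" unfolding Lp_norm_finite_eq[OF p(1) g ae] .
  show "0 \<le> Lp_norm p (open_triangle a b c) f" unfolding Lp_norm_finite_eq[OF p(1) g ae] by simp
qed

lemma Lp_norm_finite_power: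
  assumes p: "p \<noteq> \<infinity>" "1 \<le> enn2real p" and g: "g \<in> borel_measurable borel"
    and ae: "AE x in lebesgue. x \<in> open_triangle a b c \<longrightarrow> f x = g x"
    and f: "mem_Lp p (open_triangle a b c) f"
  shows "triangle_integral a b c (\<lambda>x. \<bar>g x\<bar> powr enn2real p) = ennreal (Lp_norm p (open_triangle a b c) f powr enn2real p)"
proof -
  let ?q = "enn2real p"
  let ?K = "open_triangle a b c"
  have "integrable (lebesgue_on ?K) (\<lambda>x. \<bar>f x\<bar> powr ?q)" using f p by (simp add: mem_Lp_def)
  then have "(\<integral>\<^sup>+x. ennreal (\<bar>f x\<bar> powr ?q) \<partial>lebesgue_on ?K) < \<infinity>" by (simp add: integrable_iff_bounded)
  also have "(\<integral>\<^sup>+x. ennreal (\<bar>f x\<bar> powr ?q) \<partial>lebesgue_on ?K) = (\<integral>\<^sup>+x. ennreal (\<bar>f x\<bar> powr ?q) * indicator ?K x \<partial>lebesgue)"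
    by (rule nn_integral_restrict_space) simp
  also have "\<dots> = (\<integral>\<^sup>+x. ennreal (\<bar>g x\<bar> powr ?q) * indicator ?K x \<partial>lebesgue)"
  proof (rule nn_integral_cong_AE)
    show "AE x in lebesgue. ennreal (\<bar>f x\<bar> powr ?q) * indicator ?K x = ennreal (\<bar>g x\<bar> powr ?q) * indicator ?K x"
      using ae by eventually_elim (auto split: split_indicator)
  qed
  also have "\<dots> = triangle_integral a b c (\<lambda>x. \<bar>g x\<bar> powr ?q)"
    unfolding triangle_integral_def by (rule nn_integral_completion)
  finally have fin: "triangle_integral a b c (\<lambda>x. \<bar>g x\<bar> powr ?q) < \<infinity>" .
  then show ?thesis unfolding Lp_norm_finite_eq[OF p(1) g ae] using p by (simp add: powr_powr)
qed

lemma ae_filter_open_triangle_nontrivial: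
  assumes det: "det2 (b - a) (c - a) \<noteq> 0"
  shows "\<not> (AE x in lebesgue_on (open_triangle a b c). False)"
proof
  assume "AE x in lebesgue_on (open_triangle a b c). False"
  then have "AE x in lebesgue. x \<notin> open_triangle a b c" by (simp add: AE_lebesgue_on_iff[OF open_triangle_sets])
  then have "negligible (open_triangle a b c)"
    using AE_lebesgue_negligible[of "\<lambda>x. x \<notin> open_triangle a b c"] by simp
  then show False using open_not_negligible open_triangle_nonempty[OF det] by (auto simp: open_triangle_def)
qed

text \<open>
  The essential supremum is an extended real. It is finite because of the upper bound and
  because the triangle has positive measure, so its conversion to a real number is faithful.
\<close>

lemma Lp_norm_infinity_le:
  assumes det: "det2 (b - a) (c - a) \<noteq> 0" and g: "g \<in> borel_measurable borel"
    and ae: "AE x in lebesgue. x \<in> open_triangle a b c \<longrightarrow> f x = g x"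
    and le: "AE x in lborel. x \<in> open_triangle a b c \<longrightarrow> \<bar>g x\<bar> \<le> k"
  shows "0 \<le> Lp_norm \<infinity> (open_triangle a b c) f" "Lp_norm \<infinity> (open_triangle a b c) f \<le> k"
    "AE x in lebesgue. x \<in> open_triangle a b c \<longrightarrow> \<bar>f x\<bar> \<le> Lp_norm \<infinity> (open_triangle a b c) f"
proof -
  let ?K = "open_triangle a b c"
  let ?E = "esssup (lebesgue_on ?K) (\<lambda>x. ereal \<bar>f x\<bar>)"
  have m: "f \<in> borel_measurable (lebesgue_on ?K)" by (rule measurable_lebesgue_on_AE[OF open_triangle_sets g ae])
  have "AE x in lebesgue. x \<in> ?K \<longrightarrow> \<bar>f x\<bar> \<le> k"
    using ae AE_completion[OF le] by eventually_elim auto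
  then have "AE x in lebesgue_on ?K. ereal \<bar>f x\<bar> \<le> ereal k" by (simp add: AE_lebesgue_on_iff[OF open_triangle_sets])
  then have up: "?E \<le> ereal k" using m by (intro esssup_I) auto
  have aeE: "AE x in lebesgue_on ?K. ereal \<bar>f x\<bar> \<le> ?E" by (rule esssup_AE)
  have low: "0 \<le> ?E"
  proof (rule ccontr)
    assume "\<not> 0 \<le> ?E"
    from aeE have "AE x in lebesgue_on ?K. False"
    proof eventually_elim
      case (elim x)
      have "(0::ereal) \<le> ereal \<bar>f x\<bar>" by simp
      then have "0 \<le> ?E" using elim by (rule order_trans)
      then show False using \<open>\<not> 0 \<le> ?E\<close> by blast
    qed
    then show False using ae_filter_open_triangle_nontrivial[OF det] by blast
  qed
  obtain e where e: "?E = ereal e" using up low by (cases ?E) auto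
  have N: "Lp_norm \<infinity> ?K f = e" by (simp add: Lp_norm_def e)
  show "0 \<le> Lp_norm \<infinity> ?K f" "Lp_norm \<infinity> ?K f \<le> k" unfolding N using up low e by simp_all
  show "AE x in lebesgue. x \<in> ?K \<longrightarrow> \<bar>f x\<bar> \<le> Lp_norm \<infinity> ?K f"
    using aeE unfolding e N by (simp add: AE_lebesgue_on_iff[OF open_triangle_sets])
qed

text \<open>
  On a set of finite measure \<open>L\<^sup>p\<close> is contained in \<open>L\<^sup>1\<close>,
  as \<open>\<bar>f\<bar> \<le> 1 + \<bar>f\<bar>\<^sup>p\<close>.
\<close>

lemma mem_Lp_integrable:
  assumes p: "1 \<le> p" and \<Omega>: "bounded \<Omega>" "\<Omega> \<in> sets borel" and f: "mem_Lp p \<Omega> f"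
  shows "integrable (lebesgue_on \<Omega>) (f :: real^2 \<Rightarrow> real)"
proof -
  have "\<Omega> \<in> lmeasurable" using \<Omega> by (simp add: bounded_set_imp_lmeasurable)
  then interpret finite_measure "lebesgue_on \<Omega>" by (rule finite_measure_lebesgue_on)
  have m: "f \<in> borel_measurable (lebesgue_on \<Omega>)" using f by (simp add: mem_Lp_def)
  show ?thesis
  proof (cases "p = \<infinity>")
    case True
    then obtain C where "AE x in lebesgue_on \<Omega>. \<bar>f x\<bar> \<le> C" using f by (auto simp: mem_Lp_def)
    then show ?thesis using m by (intro integrable_const_bound[of _ C]) auto
  next
    case False
    let ?q = "enn2real p"
    have q: "1 \<le> ?q" using p False by (cases p) auto
    have "integrable (lebesgue_on \<Omega>) (\<lambda>x. 1 + \<bar>f x\<bar> powr ?q)"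
      using f False by (intro Bochner_Integration.integrable_add) (auto simp: mem_Lp_def)
    then show ?thesis
    proof (rule Bochner_Integration.integrable_bound[OF _ m], intro AE_I2)
      fix x
      show "norm (f x) \<le> norm (1 + \<bar>f x\<bar> powr ?q)"
      proof (cases "\<bar>f x\<bar> \<le> 1")
        case False
        then have "\<bar>f x\<bar> powr 1 \<le> \<bar>f x\<bar> powr ?q" using q by (intro powr_mono) auto
        then show ?thesis using False by simp
      qed (simp add: add_increasing2)
    qed
  qed
qed

lemma closure_open_triangle:
  assumes det: "det2 (b - a) (c - a) \<noteq> 0"
  shows "closure (open_triangle a b c) = convex hull {a, b, c}"
  using convex_closure_interior[of "convex hull {a, b, c}"] open_triangle_nonempty[OF det] compact_imp_closed[OF compact_triangle]
  by (simp add: open_triangle_def)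

text \<open>
  If the two functions differ at a point of the closure, they differ on a nonempty open subset
  of \<open>K\<close>, which has positive measure.
\<close>

lemma continuous_AE_eq_on_closure:
  fixes V V' :: "real^2 \<Rightarrow> real"
  assumes K: "open K" and c: "continuous_on (closure K) V" "continuous_on (closure K) V'"
    and ae: "AE x in lebesgue. x \<in> K \<longrightarrow> V x = V' x" and x: "x \<in> closure K"
  shows "V x = V' x"
proof (rule ccontr)
  assume ne: "V x \<noteq> V' x"
  have "continuous_on (closure K) (\<lambda>x. V x - V' x)" using c by (intro continuous_on_diff)
  then obtain d where d: "0 < d" "\<And>y. y \<in> closure K \<Longrightarrow> dist y x < d \<Longrightarrow> dist (V y - V' y) (V x - V' x) < \<bar>V x - V' x\<bar>"
    using x ne unfolding continuous_on_iff by (metis right_minus_eq zero_less_abs_iff)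
  obtain y where "y \<in> K" "dist y x < d" using x d(1) unfolding closure_approachable by blast
  then have "y \<in> K \<inter> ball x d" by (simp add: dist_commute)
  then have "K \<inter> ball x d \<noteq> {}" by blast
  moreover have "open (K \<inter> ball x d)" using K by blast
  ultimately have "\<not> negligible (K \<inter> ball x d)" using open_not_negligible by blast
  moreover have "negligible {x. \<not> (x \<in> K \<longrightarrow> V x = V' x)}" using ae by (rule AE_lebesgue_negligible)
  moreover have "K \<inter> ball x d \<subseteq> {x. \<not> (x \<in> K \<longrightarrow> V x = V' x)}"
  proof
    fix y assume y: "y \<in> K \<inter> ball x d"
    then have "dist (V y - V' y) (V x - V' x) < \<bar>V x - V' x\<bar>" using d(2)[of y] closure_subset[of K] by (auto simp: dist_commute)
    then have "V y \<noteq> V' y" by (auto simp: dist_real_def)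
    then show "y \<in> {x. \<not> (x \<in> K \<longrightarrow> V x = V' x)}" using y by simp
  qed
  ultimately show False using negligible_subset by blast
qed

lemma continuous_rep_eq:
  fixes V w :: "real^2 \<Rightarrow> real"
  assumes K: "open K" and c: "continuous_on (closure K) V" and ae: "AE x in lebesgue. x \<in> K \<longrightarrow> V x = w x" and x: "x \<in> closure K"
  shows "continuous_rep K w x = V x"
proof -
  have Kb: "K \<in> sets borel" using K by simp
  have "continuous_on (closure K) (continuous_rep K w) \<and> (AE x in lebesgue_on K. continuous_rep K w x = w x)"
    unfolding continuous_rep_def by (rule someI[of _ V]) (use c ae in \<open>simp add: AE_lebesgue_on_iff[OF Kb]\<close>)
  then have r: "continuous_on (closure K) (continuous_rep K w)" "AE x in lebesgue. x \<in> K \<longrightarrow> continuous_rep K w x = w x"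
    by (simp_all add: AE_lebesgue_on_iff[OF Kb])
  show ?thesis
  proof (rule continuous_AE_eq_on_closure[OF K r(1) c _ x])
    show "AE x in lebesgue. x \<in> K \<longrightarrow> continuous_rep K w x = V x" using r(2) ae by eventually_elim auto
  qed
qed

text \<open>
  The Hessian is at most four times the largest of its three entries.
\<close>

lemma hess_power_bound:
  assumes C2: "C2_plane u u1 u2 u11 u12 u22" and q: "1 \<le> q"
    and le: "triangle_integral a b c (\<lambda>x. \<bar>u11 x\<bar> powr q) \<le> ennreal A" "triangle_integral a b c (\<lambda>x. \<bar>u12 x\<bar> powr q) \<le> ennreal B"
      "triangle_integral a b c (\<lambda>x. \<bar>u22 x\<bar> powr q) \<le> ennreal C" and nn: "0 \<le> A" "0 \<le> B" "0 \<le> C"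
  shows "triangle_integral a b c (\<lambda>x. hess u11 u12 u22 x powr q) \<le> ennreal (4 powr q * (A + B + C))"
proof -
  let ?T = "triangle_integral a b c"
  have m [measurable]: "u11 \<in> borel_measurable borel" "u12 \<in> borel_measurable borel" "u22 \<in> borel_measurable borel"
    using C2_continuous[OF C2] by (auto intro: borel_measurable_continuous_onI)
  have mp: "(\<lambda>x. \<bar>u11 x\<bar> powr q) \<in> borel_measurable borel" "(\<lambda>x. \<bar>u12 x\<bar> powr q) \<in> borel_measurable borel"
     "(\<lambda>x. \<bar>u22 x\<bar> powr q) \<in> borel_measurable borel"
    by measurable
  have pt: "hess u11 u12 u22 x powr q \<le> 4 powr q * (\<bar>u11 x\<bar> powr q + \<bar>u12 x\<bar> powr q + \<bar>u22 x\<bar> powr q)" for x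
  proof -
    define k where "k = max \<bar>u11 x\<bar> (max \<bar>u12 x\<bar> \<bar>u22 x\<bar>)"
    have k: "\<bar>u11 x\<bar> \<le> k" "\<bar>u12 x\<bar> \<le> k" "\<bar>u22 x\<bar> \<le> k" "0 \<le> k" by (auto simp: k_def le_max_iff_disj)
    have "hess u11 u12 u22 x powr q \<le> (4 * k) powr q"
      using k q hess_nonneg[OF C2] by (intro powr_mono2) (auto simp: hess_def[OF C2])
    also have "\<dots> = 4 powr q * k powr q" by (simp add: powr_mult)
    also have "k \<in> {\<bar>u11 x\<bar>, \<bar>u12 x\<bar>, \<bar>u22 x\<bar>}" by (auto simp: k_def max_def)
    then have "k powr q \<le> \<bar>u11 x\<bar> powr q + \<bar>u12 x\<bar> powr q + \<bar>u22 x\<bar> powr q" by auto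
    finally show ?thesis by simp
  qed
  have "?T (\<lambda>x. hess u11 u12 u22 x powr q) \<le> ?T (\<lambda>x. 4 powr q * (\<bar>u11 x\<bar> powr q + \<bar>u12 x\<bar> powr q + \<bar>u22 x\<bar> powr q))"
    by (intro triangle_integral_mono pt)
  also have "\<dots> = ennreal (4 powr q) * ?T (\<lambda>x. (\<bar>u11 x\<bar> powr q + \<bar>u12 x\<bar> powr q) + \<bar>u22 x\<bar> powr q)"
    by (rule triangle_integral_cmult) (auto intro!: borel_measurable_add mp)
  also have "?T (\<lambda>x. (\<bar>u11 x\<bar> powr q + \<bar>u12 x\<bar> powr q) + \<bar>u22 x\<bar> powr q)
     = ?T (\<lambda>x. \<bar>u11 x\<bar> powr q + \<bar>u12 x\<bar> powr q) + ?T (\<lambda>x. \<bar>u22 x\<bar> powr q)"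
    by (rule triangle_integral_add) (auto intro!: borel_measurable_add mp)
  also have "?T (\<lambda>x. \<bar>u11 x\<bar> powr q + \<bar>u12 x\<bar> powr q) = ?T (\<lambda>x. \<bar>u11 x\<bar> powr q) + ?T (\<lambda>x. \<bar>u12 x\<bar> powr q)"
    by (rule triangle_integral_add) (auto intro!: mp)
  also have "ennreal (4 powr q) * (?T (\<lambda>x. \<bar>u11 x\<bar> powr q) + ?T (\<lambda>x. \<bar>u12 x\<bar> powr q) + ?T (\<lambda>x. \<bar>u22 x\<bar> powr q))
     \<le> ennreal (4 powr q) * (ennreal A + ennreal B + ennreal C)"
    by (intro mult_left_mono add_mono le) simp
  also have "\<dots> = ennreal (4 powr q * (A + B + C))" using nn by (simp add: ennreal_mult)
  finally show ?thesis .
qed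

section \<open>The interpolation error\<close>

lemma interpolant_eq:
  assumes det: "det2 (b - a) (c - a) \<noteq> 0"
    and V: "\<And>x. x \<in> {a, b, c} \<Longrightarrow> continuous_rep (open_triangle a b c) w x = V x"
  shows "interpolant a b c w = affine_interp a b c (V a) (V b) (V c)"
  unfolding interpolant_def
proof (rule the_equality)
  show "poly_degree_le_1 (affine_interp a b c (V a) (V b) (V c)) \<and>
     (\<forall>x\<in>{a, b, c}. affine_interp a b c (V a) (V b) (V c) x = continuous_rep (open_triangle a b c) w x)"
    using affine_interp_vertices[OF det, of "V a" "V b" "V c"] V by (simp add: poly_degree_affine_interp)
  fix q assume "poly_degree_le_1 q \<and> (\<forall>x\<in>{a, b, c}. q x = continuous_rep (open_triangle a b c) w x)"
  then show "q = affine_interp a b c (V a) (V b) (V c)"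
    using V by (intro affine_interp_unique[OF det]) auto
qed

lemma AE_of_representative:
  assumes "AE x in lebesgue. indicator K x * u x = (v x :: real)"
  shows "AE x in lebesgue. x \<in> K \<longrightarrow> u x = v x"
  using assms by eventually_elim (auto split: split_indicator_asm)

text \<open>
  The Hessians of the approximations are bounded in \<open>L\<^sup>p\<close> by \<open>4 *
  S\<close>, so the limit estimates give the constants \<open>4 * 1332 = 5328\<close> and
  \<open>4 * 144 = 576\<close>. For \<open>p = \<infinity>\<close> the constants \<open>4 *
  444\<close> and \<open>4 * 24\<close> are smaller.
\<close>

lemma interpolation_error_bounds:
  assumes det: "det2 (b - a) (c - a) \<noteq> 0" and p: "1 \<le> p" and w: "w \<in> sobolev 2 p (open_triangle a b c)"
  defines "K \<equiv> open_triangle a b c" and "R \<equiv> circumradius a b c" and "S \<equiv> seminorm2 p (open_triangle a b c) w"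
    and "e \<equiv> \<lambda>x. w x - interpolant a b c w x"
  shows "0 \<le> S" "0 \<le> Lp_norm p K e" "Lp_norm p K e \<le> 5328 * R^2 * S"
    "0 \<le> Lp_norm p K (weak_deriv K [i] e)" "Lp_norm p K (weak_deriv K [i] e) \<le> 576 * R * S"
proof -
  have Ko: "open K" and Kb: "bounded K" and Ks: "K \<in> sets borel"
    by (auto simp: K_def open_triangle_def bounded_open_triangle[unfolded open_triangle_def])
  have R0: "0 < R" unfolding R_def by (rule circumradius_sides(5)[OF det])
  have wp: "mem_Lp p K w" using w by (simp add: sobolev_def K_def)
  have ex: "\<exists>v. has_weak_deriv K \<alpha> w v \<and> mem_Lp p K v" if "length \<alpha> \<le> 2" for \<alpha>
    using w that by (simp add: sobolev_def K_def)
  obtain w1 where w1: "has_weak_deriv K [1] w w1" "mem_Lp p K w1" using ex[of "[1]"] by auto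
  obtain w2 where w2: "has_weak_deriv K [2] w w2" "mem_Lp p K w2" using ex[of "[2]"] by auto
  obtain w11 where w11: "has_weak_deriv K [1, 1] w w11" "mem_Lp p K w11" using ex[of "[1, 1]"] by auto
  obtain w12 where w12: "has_weak_deriv K [1, 2] w w12" "mem_Lp p K w12" using ex[of "[1, 2]"] by auto
  obtain w22 where w22: "has_weak_deriv K [2, 2] w w22" "mem_Lp p K w22" using ex[of "[2, 2]"] by auto
  note int = mem_Lp_integrable[OF p Kb Ks]
  obtain v where v: "v \<in> borel_measurable borel" "integrable lborel v" "\<And>x. x \<notin> K \<Longrightarrow> v x = 0"
    "AE x in lebesgue. indicator K x * w x = v x" "(\<lambda>x. indicator K x * w x) \<in> borel_measurable lebesgue"
    by (rule borel_representative_integrable[OF Ks int[OF wp]]) blast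
  obtain v1 where v1: "v1 \<in> borel_measurable borel" "integrable lborel v1" "\<And>x. x \<notin> K \<Longrightarrow> v1 x = 0"
    "AE x in lebesgue. indicator K x * w1 x = v1 x" "(\<lambda>x. indicator K x * w1 x) \<in> borel_measurable lebesgue"
    by (rule borel_representative_integrable[OF Ks int[OF w1(2)]]) blast
  obtain v2 where v2: "v2 \<in> borel_measurable borel" "integrable lborel v2" "\<And>x. x \<notin> K \<Longrightarrow> v2 x = 0"
    "AE x in lebesgue. indicator K x * w2 x = v2 x" "(\<lambda>x. indicator K x * w2 x) \<in> borel_measurable lebesgue"
    by (rule borel_representative_integrable[OF Ks int[OF w2(2)]]) blast
  obtain v11 where v11: "v11 \<in> borel_measurable borel" "integrable lborel v11" "\<And>x. x \<notin> K \<Longrightarrow> v11 x = 0"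
    "AE x in lebesgue. indicator K x * w11 x = v11 x" "(\<lambda>x. indicator K x * w11 x) \<in> borel_measurable lebesgue"
    by (rule borel_representative_integrable[OF Ks int[OF w11(2)]]) blast
  obtain v12 where v12: "v12 \<in> borel_measurable borel" "integrable lborel v12" "\<And>x. x \<notin> K \<Longrightarrow> v12 x = 0"
    "AE x in lebesgue. indicator K x * w12 x = v12 x" "(\<lambda>x. indicator K x * w12 x) \<in> borel_measurable lebesgue"
    by (rule borel_representative_integrable[OF Ks int[OF w12(2)]]) blast
  obtain v22 where v22: "v22 \<in> borel_measurable borel" "integrable lborel v22" "\<And>x. x \<notin> K \<Longrightarrow> v22 x = 0"
    "AE x in lebesgue. indicator K x * w22 x = v22 x" "(\<lambda>x. indicator K x * w22 x) \<in> borel_measurable lebesgue"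
    by (rule borel_representative_integrable[OF Ks int[OF w22(2)]]) blast
  have W: "mollify \<delta> 1 0 v y = - mollify \<delta> 0 0 v1 y \<and> mollify \<delta> 0 1 v y = - mollify \<delta> 0 0 v2 y \<and>
      mollify \<delta> 2 0 v y = mollify \<delta> 0 0 v11 y \<and> mollify \<delta> 1 1 v y = mollify \<delta> 0 0 v12 y \<and> mollify \<delta> 0 2 v y = mollify \<delta> 0 0 v22 y"
    if \<delta>: "0 < \<delta>" and sub: "cbox (y - vec \<delta>) (y + vec \<delta>) \<subseteq> open_triangle a b c" for \<delta> y
    using mollify_weak_deriv[OF Ko w1(1) v(1,4,5) v1(1,4,5) \<delta> sub[folded K_def]]
      mollify_weak_deriv[OF Ko w2(1) v(1,4,5) v2(1,4,5) \<delta> sub[folded K_def]]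
      mollify_weak_deriv[OF Ko w11(1) v(1,4,5) v11(1,4,5) \<delta> sub[folded K_def]]
      mollify_weak_deriv[OF Ko w12(1) v(1,4,5) v12(1,4,5) \<delta> sub[folded K_def]]
      mollify_weak_deriv[OF Ko w22(1) v(1,4,5) v22(1,4,5) \<delta> sub[folded K_def]]
    by (simp add: numeral_2_eq_2)
  obtain f f1 f2 f11 f12 f22 where approx: "smooth_approximation a b c f f1 f2 f11 f12 f22 v v1 v2 v11 v12 v22"
    and fq: "\<And>q n. 1 \<le> q \<Longrightarrow> triangle_integral a b c (\<lambda>x. \<bar>f11 n x\<bar> powr q) \<le> (\<integral>\<^sup>+x. ennreal (\<bar>v11 x\<bar> powr q) \<partial>lborel)"
    "\<And>q n. 1 \<le> q \<Longrightarrow> triangle_integral a b c (\<lambda>x. \<bar>f12 n x\<bar> powr q) \<le> (\<integral>\<^sup>+x. ennreal (\<bar>v12 x\<bar> powr q) \<partial>lborel)"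
    "\<And>q n. 1 \<le> q \<Longrightarrow> triangle_integral a b c (\<lambda>x. \<bar>f22 n x\<bar> powr q) \<le> (\<integral>\<^sup>+x. ennreal (\<bar>v22 x\<bar> powr q) \<partial>lborel)"
    and fsup: "\<And>n x B. x \<in> convex hull {a, b, c} \<Longrightarrow> AE z in lborel. \<bar>v11 z\<bar> \<le> B \<Longrightarrow> \<bar>f11 n x\<bar> \<le> B"
    "\<And>n x B. x \<in> convex hull {a, b, c} \<Longrightarrow> AE z in lborel. \<bar>v12 z\<bar> \<le> B \<Longrightarrow> \<bar>f12 n x\<bar> \<le> B"
    "\<And>n x B. x \<in> convex hull {a, b, c} \<Longrightarrow> AE z in lborel. \<bar>v22 z\<bar> \<le> B \<Longrightarrow> \<bar>f22 n x\<bar> \<le> B"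
    using smooth_approximation_exists[OF det v(2) v1(2) v2(2) v11(2) v12(2) v22(2) W] by blast
  interpret SA: smooth_approximation a b c f f1 f2 f11 f12 f22 v v1 v2 v11 v12 v22 by (rule approx)
  obtain V where V: "uniform_limit (convex hull {a, b, c}) f V sequentially" using SA.uniform_limit_exists by blast
  have clK: "closure K = convex hull {a, b, c}" unfolding K_def by (rule closure_open_triangle[OF det])
  have aeV: "AE x in lebesgue. x \<in> K \<longrightarrow> V x = w x"
    using AE_completion[OF SA.AE_limit_eq[OF V]] AE_of_representative[OF v(4)]
    by eventually_elim (auto simp: K_def)
  have rep: "continuous_rep K w x = V x" if "x \<in> {a, b, c}" for x
    by (rule continuous_rep_eq[OF Ko _ aeV])
       (use that SA.limit_continuous[OF V] in \<open>auto simp: clK intro: hull_inc\<close>)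
  have interp: "interpolant a b c w = affine_interp a b c (V a) (V b) (V c)"
    by (rule interpolant_eq[OF det]) (rule rep[unfolded K_def])
  define \<beta> where "\<beta> i = slope i a b c (V a) (V b) (V c)" for i
  have sl: "SA.interp_slope_lim V i = \<beta> i" for i by (simp add: SA.interp_slope_lim_def[OF V] \<beta>_def)
  have ai: "SA.interp_lim V = interpolant a b c w" by (simp add: SA.interp_lim_def[OF V] interp)
  have e_eq: "e = (\<lambda>x. w x - (intercept a b c (V a) (V b) (V c) + \<beta> 1 * x$1 + \<beta> 2 * x$2))"
    by (simp add: e_def interp affine_interp_def \<beta>_def fun_eq_iff)
  have ae0: "AE x in lebesgue. x \<in> open_triangle a b c \<longrightarrow> e x = v x - SA.interp_lim V x"
    using AE_of_representative[OF v(4)] by eventually_elim (auto simp: K_def e_def ai)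
  have wd: "AE x in lebesgue. x \<in> open_triangle a b c \<longrightarrow> weak_deriv K [j] e x = v' x - \<beta> j"
    if wj: "has_weak_deriv K [j] w wj" "mem_Lp p K wj" and v': "AE x in lebesgue. indicator K x * wj x = v' x" for j wj v'
  proof -
    have "has_weak_deriv K [j] e (\<lambda>x. wj x - \<beta> j)"
      unfolding e_eq by (rule has_weak_deriv_minus_affine[OF Ko Kb int[OF wp] int[OF wj(2)] wj(1)])
    from AE_weak_deriv[OF Ko this] have "AE x in lebesgue. x \<in> K \<longrightarrow> weak_deriv K [j] e x = wj x - \<beta> j"
      by (simp add: AE_lebesgue_on_iff[OF Ks])
    with AE_of_representative[OF v'] show ?thesis by eventually_elim (auto simp: K_def)
  qed
  note ae1 = wd[OF w1 v1(4)] and ae2 = wd[OF w2 v2(4)]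
  have aeW: "AE x in lebesgue. x \<in> open_triangle a b c \<longrightarrow> weak_deriv K \<alpha> w x = v' x"
    if w': "has_weak_deriv K \<alpha> w w'" and v': "AE x in lebesgue. indicator K x * w' x = v' x" for \<alpha> w' v'
    using AE_weak_deriv[OF Ko w', unfolded AE_lebesgue_on_iff[OF Ks]] AE_of_representative[OF v']
    by eventually_elim (auto simp: K_def)
  note ae11 = aeW[OF w11(1) v11(4)] and ae12 = aeW[OF w12(1) v12(4)] and ae22 = aeW[OF w22(1) v22(4)]
  have i12: "i = 1 \<or> i = 2" by (rule exhaust_2)
  have gm: "(\<lambda>x. v1 x - \<beta> 1) \<in> borel_measurable borel" "(\<lambda>x. v2 x - \<beta> 2) \<in> borel_measurable borel"
     "(\<lambda>x. v x - SA.interp_lim V x) \<in> borel_measurable borel"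
  proof -
    have "continuous_on UNIV (affine_interp a b c (V a) (V b) (V c))"
      unfolding affine_interp_def[abs_def] by (intro continuous_on_add continuous_on_mult continuous_on_const continuous_on_component continuous_on_id)
    then have "SA.interp_lim V \<in> borel_measurable borel" unfolding ai interp by (rule borel_measurable_continuous_onI)
    then show "(\<lambda>x. v x - SA.interp_lim V x) \<in> borel_measurable borel" using v(1) by (intro borel_measurable_diff)
  qed (use v1(1) v2(1) in \<open>auto intro!: borel_measurable_diff\<close>)
  define S11 S12 S22 where "S11 = Lp_norm p K (weak_deriv K [1, 1] w)" and "S12 = Lp_norm p K (weak_deriv K [1, 2] w)"
    and "S22 = Lp_norm p K (weak_deriv K [2, 2] w)"
  have "0 \<le> S \<and> 0 \<le> Lp_norm p K e \<and> Lp_norm p K e \<le> 5328 * R^2 * S \<and>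
    0 \<le> Lp_norm p K (weak_deriv K [i] e) \<and> Lp_norm p K (weak_deriv K [i] e) \<le> 576 * R * S"
  proof (cases "p = \<infinity>")
    case True
    have bound: "0 \<le> Lp_norm p K (weak_deriv K \<alpha> w)" "AE x in lborel. \<bar>v' x\<bar> \<le> Lp_norm p K (weak_deriv K \<alpha> w)"
      if w': "mem_Lp p K w'" and v': "v' \<in> borel_measurable borel" "AE x in lebesgue. indicator K x * w' x = v' x" "\<And>x. x \<notin> K \<Longrightarrow> v' x = 0"
        and ae: "AE x in lebesgue. x \<in> open_triangle a b c \<longrightarrow> weak_deriv K \<alpha> w x = v' x" for w' v' \<alpha>
    proof -
      obtain C where "AE x in lebesgue_on K. \<bar>w' x\<bar> \<le> C" using w' True by (auto simp: mem_Lp_def)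
      then have "AE x in lebesgue. x \<in> K \<longrightarrow> \<bar>w' x\<bar> \<le> C" by (simp add: AE_lebesgue_on_iff[OF Ks])
      with AE_of_representative[OF v'(2)] have "AE x in lebesgue. x \<in> open_triangle a b c \<longrightarrow> \<bar>v' x\<bar> \<le> C"
        by eventually_elim (auto simp: K_def)
      then have C: "AE x in lborel. x \<in> open_triangle a b c \<longrightarrow> \<bar>v' x\<bar> \<le> C" by (simp add: AE_completion_iff)
      note L = Lp_norm_infinity_le[OF det v'(1) ae C]
      show nn: "0 \<le> Lp_norm p K (weak_deriv K \<alpha> w)" using L(1) by (simp add: True K_def)
      have "AE x in lebesgue. \<bar>v' x\<bar> \<le> Lp_norm p K (weak_deriv K \<alpha> w)"
        using L(3) ae
      proof eventually_elim
        case (elim x)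
        then show ?case using v'(3)[of x] nn by (cases "x \<in> K") (auto simp: True K_def)
      qed
      then show "AE x in lborel. \<bar>v' x\<bar> \<le> Lp_norm p K (weak_deriv K \<alpha> w)" by (simp add: AE_completion_iff)
    qed
    note b11 = bound[OF w11(2) v11(1,4,3) ae11, folded S11_def] and b12 = bound[OF w12(2) v12(1,4,3) ae12, folded S12_def]
      and b22 = bound[OF w22(2) v22(1,4,3) ae22, folded S22_def]
    have S: "S = max S11 (max S22 S12)" by (simp add: S_def seminorm2_def True S11_def S12_def S22_def K_def)
    have S0: "0 \<le> S" using b11(1) by (simp add: S max.coboundedI1)
    have hess: "hess (f11 n) (f12 n) (f22 n) x \<le> 4 * S" if x: "x \<in> convex hull {a, b, c}" for n x
      unfolding hess_def[OF SA.C2[of n]] S using fsup(1)[OF x b11(2), of n] fsup(2)[OF x b12(2), of n] fsup(3)[OF x b22(2), of n] by linarith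
    note est = SA.limit_estimates_sup[OF V hess refl, folded R_def, unfolded sl]
    have "0 \<le> Lp_norm p K (weak_deriv K [i] e) \<and> Lp_norm p K (weak_deriv K [i] e) \<le> 24 * R * (4 * S)"
      using i12 Lp_norm_infinity_le(1,2)[OF det gm(1) ae1 est(1)] Lp_norm_infinity_le(1,2)[OF det gm(2) ae2 est(2)]
      by (auto simp: True K_def)
    moreover have "0 \<le> Lp_norm p K e \<and> Lp_norm p K e \<le> 444 * R^2 * (4 * S)"
      using Lp_norm_infinity_le(1,2)[OF det gm(3) ae0 est(3)] by (auto simp: True K_def)
    moreover have "24 * R * (4 * S) \<le> 576 * R * S" "444 * R^2 * (4 * S) \<le> 5328 * R^2 * S"
      using R0 S0 mult_nonneg_nonneg[of R S] mult_nonneg_nonneg[of "R^2" S] by (auto simp: mult.assoc)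
    ultimately show ?thesis using S0 by linarith
  next
    case False
    define q where "q = enn2real p"
    have q: "1 \<le> q" using p False unfolding q_def by (cases p) auto
    note q' = q[unfolded q_def]
    have nn: "(\<integral>\<^sup>+x. ennreal (\<bar>v' x\<bar> powr q) \<partial>lborel) = ennreal (Lp_norm p K (weak_deriv K \<alpha> w) powr q)"
      if w': "mem_Lp p K w'" and v': "v' \<in> borel_measurable borel" "AE x in lebesgue. indicator K x * w' x = v' x" "\<And>x. x \<notin> K \<Longrightarrow> v' x = 0"
        and ae: "AE x in lebesgue. x \<in> open_triangle a b c \<longrightarrow> weak_deriv K \<alpha> w x = v' x" for w' v' \<alpha>
    proof -
      have ae': "AE x in lebesgue. x \<in> open_triangle a b c \<longrightarrow> w' x = v' x"
        using AE_of_representative[OF v'(2)] by (simp add: K_def)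
      have "(\<integral>\<^sup>+x. ennreal (\<bar>v' x\<bar> powr q) \<partial>lborel) = triangle_integral a b c (\<lambda>x. \<bar>v' x\<bar> powr q)"
        unfolding triangle_integral_def using v'(3) q by (intro nn_integral_cong) (auto simp: K_def split: split_indicator)
      also have "\<dots> = ennreal (Lp_norm p K w' powr q)"
        unfolding q_def K_def by (rule Lp_norm_finite_power[OF False q' v'(1) ae' w'[unfolded K_def]])
      also have "Lp_norm p K w' = Lp_norm p K (weak_deriv K \<alpha> w)"
        unfolding K_def Lp_norm_finite_eq[OF False v'(1) ae'] Lp_norm_finite_eq[OF False v'(1) ae[unfolded K_def]] ..
      finally show ?thesis .
    qed
    note n11 = nn[OF w11(2) v11(1,4,3) ae11, folded S11_def] and n12 = nn[OF w12(2) v12(1,4,3) ae12, folded S12_def]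
      and n22 = nn[OF w22(2) v22(1,4,3) ae22, folded S22_def]
    define P where "P = S11 powr q + S22 powr q + 2 * S12 powr q"
    have P0: "0 \<le> P" by (simp add: P_def)
    have S: "S = P powr (1 / q)" using False by (simp add: S_def seminorm2_def S11_def S12_def S22_def K_def P_def q_def Let_def)
    have S0: "0 \<le> S" by (simp add: S)
    have Sq: "S powr q = P" using q P0 by (simp add: S powr_powr)
    have W: "triangle_integral a b c (\<lambda>x. hess (f11 n) (f12 n) (f22 n) x powr q) \<le> ennreal ((4 * S) powr q)" for n
    proof -
      have "triangle_integral a b c (\<lambda>x. hess (f11 n) (f12 n) (f22 n) x powr q) \<le> ennreal (4 powr q * (S11 powr q + S12 powr q + S22 powr q))"
        by (rule hess_power_bound[OF SA.C2 q]) (use fq[OF q, of n] n11 n12 n22 in auto)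
      also have "\<dots> \<le> ennreal (4 powr q * P)" by (intro ennreal_leI mult_left_mono) (auto simp: P_def)
      also have "4 powr q * P = (4 * S) powr q" by (simp add: powr_mult Sq)
      finally show ?thesis .
    qed
    note est = SA.limit_estimates_Lq[OF V q W refl, folded R_def, unfolded sl]
    have comb: "ennreal (k powr q) * ennreal ((4 * S) powr q) = ennreal ((k * (4 * S)) powr q)" for k
      by (simp add: powr_mult ennreal_mult)
    have nnk: "0 \<le> 144 * R * (4 * S)" "0 \<le> 1332 * R^2 * (4 * S)" using R0 S0 by auto
    have "0 \<le> Lp_norm p K (weak_deriv K [i] e) \<and> Lp_norm p K (weak_deriv K [i] e) \<le> 144 * R * (4 * S)"
      using i12 Lp_norm_finite_le[OF False q' gm(1) ae1 est(1)[unfolded comb, unfolded q_def] nnk(1)]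
        Lp_norm_finite_le[OF False q' gm(2) ae2 est(2)[unfolded comb, unfolded q_def] nnk(1)]
      by (auto simp: K_def)
    moreover have "0 \<le> Lp_norm p K e \<and> Lp_norm p K e \<le> 1332 * R^2 * (4 * S)"
      using Lp_norm_finite_le[OF False q' gm(3) ae0 est(3)[unfolded comb, unfolded q_def] nnk(2)] by (auto simp: K_def)
    ultimately show ?thesis using S0 by simp
  qed
  then show "0 \<le> S" "0 \<le> Lp_norm p K e" "Lp_norm p K e \<le> 5328 * R^2 * S"
    "0 \<le> Lp_norm p K (weak_deriv K [i] e)" "Lp_norm p K (weak_deriv K [i] e) \<le> 576 * R * S" by auto
qed

theorem theorem3:
  fixes p :: ennreal
  assumes "1 \<le> p"
  shows "\<exists>E1 E2 :: real. 0 \<le> E1 \<and> 0 \<le> E2 \<and>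
    (\<forall>x1 x2 x3 :: real^2. \<not> collinear {x1, x2, x3} \<longrightarrow>
      (let K = open_triangle x1 x2 x3;
           R = circumradius x1 x2 x3;
           q = enn2real p;
           M = (if p = \<infinity> then max E1 (E2 * R)
                else (E1 powr q + E2 powr q * R powr q) powr (1 / q))
       in \<forall>w \<in> sobolev 2 p K.
            norm1 p K (\<lambda>x. w x - interpolant x1 x2 x3 w x) \<le> M * R * seminorm2 p K w))"
proof -
  let ?M = "\<lambda>R q. if p = \<infinity> then max 1152 (5328 * R) else (1152 powr q + 5328 powr q * R powr q) powr (1 / q)"
  have main: "norm1 p (open_triangle x1 x2 x3) (\<lambda>x. w x - interpolant x1 x2 x3 w x) \<le>
      ?M (circumradius x1 x2 x3) (enn2real p) * circumradius x1 x2 x3 * seminorm2 p (open_triangle x1 x2 x3) w"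
    if nc: "\<not> collinear {x1, x2, x3}" and w': "w \<in> sobolev 2 p (open_triangle x1 x2 x3)" for x1 x2 x3 w
  proof -
    from nc have det: "det2 (x2 - x1) (x3 - x1) \<noteq> 0" by (simp add: collinear_iff_det2)
    define K where "K = open_triangle x1 x2 x3"
    define R where "R = circumradius x1 x2 x3"
    define q where "q = enn2real p"
    have R0: "0 < R" unfolding R_def by (rule circumradius_sides(5)[OF det])
    have w: "w \<in> sobolev 2 p K" using w' by (simp add: K_def)
    define e where "e = (\<lambda>x. w x - interpolant x1 x2 x3 w x)"
    define S where "S = seminorm2 p K w"
    note b = interpolation_error_bounds[OF det assms w[unfolded K_def], folded K_def R_def, folded S_def e_def]
    define N0 N1 N2 where "N0 = Lp_norm p K e" and "N1 = Lp_norm p K (weak_deriv K [1] e)" and "N2 = Lp_norm p K (weak_deriv K [2] e)"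
    have S0: "0 \<le> S" and N: "0 \<le> N0" "N0 \<le> 5328 * R^2 * S" "0 \<le> N1" "N1 \<le> 576 * R * S" "0 \<le> N2" "N2 \<le> 576 * R * S"
      using b(1-3) b(4,5)[of 1] b(4,5)[of 2] by (auto simp: N0_def N1_def N2_def)
    have RS: "0 \<le> R * S" using R0 S0 by simp
    have "norm1 p K e \<le> ?M R q * R * S"
    proof (cases "p = \<infinity>")
      case True
      have "norm1 p K e = max N0 (max N1 N2)" by (simp add: norm1_def seminorm1_def True N0_def N1_def N2_def)
      also have "\<dots> \<le> max 1152 (5328 * R) * (R * S)"
      proof -
        have "5328 * R * (R * S) \<le> max 1152 (5328 * R) * (R * S)" "1152 * (R * S) \<le> max 1152 (5328 * R) * (R * S)"
          using RS by (auto intro!: mult_right_mono)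
        moreover have "N0 \<le> 5328 * R * (R * S)" using N by (simp add: power2_eq_square mult.assoc)
        moreover have "N1 \<le> 1152 * (R * S)" "N2 \<le> 1152 * (R * S)" using N RS by (simp_all add: mult.assoc)
        ultimately show ?thesis by linarith
      qed
      finally show ?thesis using True by (simp add: mult.assoc)
    next
      case False
      have q: "1 \<le> q" using assms False unfolding q_def by (cases p) auto
      have semi: "seminorm1 p K e powr q = N1 powr q + N2 powr q"
        using q False N by (simp add: seminorm1_def Let_def q_def[symmetric] N1_def N2_def powr_powr)
      have "norm1 p K e = (N0 powr q + (N1 powr q + N2 powr q)) powr (1 / q)"
        using False semi by (simp add: norm1_def Let_def q_def[symmetric] N0_def)
      also have "\<dots> \<le> ((5328 * R * (R * S)) powr q + (1152 * (R * S)) powr q) powr (1 / q)"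
      proof (rule powr_mono2[OF _ _ add_mono])
        show "N0 powr q \<le> (5328 * R * (R * S)) powr q"
          using N q by (intro powr_mono2) (auto simp: power2_eq_square mult.assoc)
        have "N1 powr q \<le> (576 * (R * S)) powr q" "N2 powr q \<le> (576 * (R * S)) powr q"
          using N q by (auto intro!: powr_mono2 simp: mult.assoc)
        \<comment> \<open>both components of the gradient together: 2 * 576 = 1152\<close>
        then have "N1 powr q + N2 powr q \<le> 2 * (576 * (R * S)) powr q" by simp
        also have "\<dots> \<le> 2 powr q * (576 * (R * S)) powr q" using powr_mono[OF q, of 2] by (intro mult_right_mono) auto
        also have "\<dots> = (2 * (576 * (R * S))) powr q" by (simp only: powr_mult)
        finally show "N1 powr q + N2 powr q \<le> (1152 * (R * S)) powr q" by simp
      qed (use q in auto)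
      also have "(5328 * R * (R * S)) powr q + (1152 * (R * S)) powr q = (1152 powr q + 5328 powr q * R powr q) * (R * S) powr q"
        by (simp add: powr_mult algebra_simps)
      also have "\<dots> powr (1 / q) = (1152 powr q + 5328 powr q * R powr q) powr (1 / q) * (R * S)"
        using q R0 S0 by (simp add: powr_mult powr_powr)
      finally show ?thesis using False by (simp add: mult.assoc)
    qed
    then show ?thesis unfolding e_def S_def K_def R_def q_def .
  qed
  show ?thesis
    by (rule exI[of _ 1152], rule exI[of _ 5328]) (use main in \<open>simp only: Let_def, auto\<close>)
qed

end
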